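(* Let $g:\Omega\times[0,T]\times(\mathbb R^n)^6\to\mathbb R^n$ satisfy: (i) there is a constant $L$ such that, $\mathbb P$-a.s., for all $t\in[0,T]$ and all $p,q_1,q_2,\bar p,\bar q_1,\bar q_2,p',q_1',q_2',\bar p',\bar q_1',\bar q_2'\in\mathbb R^n$, $$\begin{aligned}&|g(t,p,q_1,q_2,\bar p,\bar q_1,\bar q_2)-g(t,p',q_1',q_2',\bar p',\bar q_1',\bar q_2')|\\&\le L\big(|p-p'|+|q_1-q_1'|+|q_2-q_2'|+|\bar p-\bar p'|+|\bar q_1-\bar q_1'|+|\bar q_2-\bar q_2'|\big);\end{aligned}$$ (ii) $g(\cdot,0,0,0,0,0,0)\in\mathcal L^2_{\mathcal F}(0,T;\mathbb R^n)$. Then for any $\zeta\in\mathcal L^2_{\mathcal F_T}(\Omega;\mathbb R^n)$ the backward stochastic differential equation with filtering $$\left\{\begin{aligned}dP&=g(t,P,Q_1,Q_2,\widehat P,\widehat Q_1,\widehat Q_2)dt+Q_1dW_1+Q_2dW_2,\\ P_T&=\zeta,\end{aligned}\right.$$ admits a unique solution $(P,Q_1,Q_2)\in\mathcal S^2_{\mathcal F}(0,T;\mathbb R^n)\times\mathcal L^2_{\mathcal F}(0,T;\mathbb R^n)\times\mathcal L^2_{\mathcal F}(0,T;\mathbb R^n)$.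
   Context: $T>0$ is fixed, $(\Omega,\mathcal F,\mathbb F,\mathbb P)$ is a complete filtered probability space carrying a standard $\mathbb R^2$-valued Wiener process $(W_1,W_2)$ on $[0,T]$, and $\mathbb F=\{\mathcal F_t\}$ is the natural filtration of $(W_1,W_2)$ augmented by all $\mathbb P$-null sets. $\mathcal F^{W_1}_t=\sigma\{W_{1s}:0\le s\le t\}$, and for a process $\beta$ we write $\widehat\beta_t=\mathbb E[\beta_t\,|\,\mathcal F^{W_1}_t]$; thus $\widehat P_t=\mathbb E[P_t|\mathcal F_t^{W_1}]$, $\widehat Q_{it}=\mathbb E[Q_{it}|\mathcal F^{W_1}_t]$, $i=1,2$. $\mathcal L^2_{\mathcal F_T}(\Omega;\mathbb R^n)$ is the set of square-integrable $\mathcal F_T$-measurable $\mathbb R^n$-valued random variables; $\mathcal L^2_{\mathcal F}(0,T;\mathbb R^n)$ is the set of $\mathbb F$-adapted $\mathbb R^n$-valued processes $u$ with $\mathbb E\int_0^T|u_t|^2dt<\infty$; $\mathcal S^2_{\mathcal F}(0,T;\mathbb R^n)$ is the set of continuous $\mathbb F$-adapted processes $u$ with $\mathbb E[\sup_{t\in[0,T]}|u_t|^2]<\infty$. The generator $g$ is assumed to have the usual measurability: $g(\cdot,p,q_1,q_2,\bar p,\bar q_1,\bar q_2)$ is a (progressively) measurable $\mathbb F$-adapted process for each fixed $(p,q_1,q_2,\bar p,\bar q_1,\bar q_2)$. *)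

theory Defs
  imports "HOL-Probability.Probability"
begin

text \<open>
  A process on [0,T] is a function of type \<open>real \<Rightarrow> 'w \<Rightarrow> 'b\<close>; its values at times outside
  [0,T] are irrelevant. A filtration is a family \<open>F :: real \<Rightarrow> 'w measure\<close>, of which only the
  \<sigma>-algebras \<open>sets (F t)\<close> matter.
\<close>

section \<open>Wiener process and filtrations\<close>

definition nat_filt :: "'w measure \<Rightarrow> (real \<Rightarrow> 'w \<Rightarrow> 'b::topological_space) \<Rightarrow> real \<Rightarrow> 'w measure" where
  "nat_filt M X t =
     sigma (space M) {X s -` B \<inter> space M | s B. s \<in> {0..t} \<and> B \<in> sets borel}"

definition aug_filt :: "'w measure \<Rightarrow> (real \<Rightarrow> 'w \<Rightarrow> 'b::topological_space) \<Rightarrow> real \<Rightarrow> 'w measure" where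
  "aug_filt M X t = sigma (space M) (sets (nat_filt M X t) \<union> null_sets M)"

text \<open>
  A standard Wiener process in the plane: the increments over [s,t] are independent of the past up
  to s and have the law N(0,t-s) \<open>\<otimes>\<close> N(0,t-s) (\<open>normal_density\<close> takes the standard deviation).
\<close>

definition wiener2 :: "'w measure \<Rightarrow> real \<Rightarrow> (real \<Rightarrow> 'w \<Rightarrow> real) \<Rightarrow> (real \<Rightarrow> 'w \<Rightarrow> real) \<Rightarrow> bool" where
  "wiener2 M T W1 W2 \<longleftrightarrow>
     (\<forall>t\<in>{0..T}. W1 t \<in> borel_measurable M \<and> W2 t \<in> borel_measurable M) \<and>
     (AE \<omega> in M. W1 0 \<omega> = 0 \<and> W2 0 \<omega> = 0) \<and>
     (AE \<omega> in M. continuous_on {0..T} (\<lambda>t. W1 t \<omega>) \<and> continuous_on {0..T} (\<lambda>t. W2 t \<omega>)) \<and>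
     (\<forall>s t. 0 \<le> s \<longrightarrow> s < t \<longrightarrow> t \<le> T \<longrightarrow>
        distr M (borel \<Otimes>\<^sub>M borel) (\<lambda>\<omega>. (W1 t \<omega> - W1 s \<omega>, W2 t \<omega> - W2 s \<omega>)) =
          density lborel (\<lambda>x. ennreal (normal_density 0 (sqrt (t - s)) x)) \<Otimes>\<^sub>M
          density lborel (\<lambda>x. ennreal (normal_density 0 (sqrt (t - s)) x)) \<and>
        prob_space.indep_set M
          (sets (nat_filt M (\<lambda>r \<omega>. (W1 r \<omega>, W2 r \<omega>)) s))
          {(\<lambda>\<omega>. (W1 t \<omega> - W1 s \<omega>, W2 t \<omega> - W2 s \<omega>)) -` B \<inter> space M | B. B \<in> sets borel})"

section \<open>Spaces of random variables and processes\<close>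

definition adapted :: "(real \<Rightarrow> 'w measure) \<Rightarrow> real \<Rightarrow> (real \<Rightarrow> 'w \<Rightarrow> 'b::topological_space) \<Rightarrow> bool" where
  "adapted F T u \<longleftrightarrow> (\<forall>t\<in>{0..T}. u t \<in> borel_measurable (F t))"

definition progressive :: "(real \<Rightarrow> 'w measure) \<Rightarrow> real \<Rightarrow> (real \<Rightarrow> 'w \<Rightarrow> 'b::topological_space) \<Rightarrow> bool" where
  "progressive F T u \<longleftrightarrow>
     (\<forall>t\<in>{0..T}. (\<lambda>(s, \<omega>). u s \<omega>) \<in> borel_measurable (restrict_space borel {0..t} \<Otimes>\<^sub>M F t))"

definition L2_var :: "'w measure \<Rightarrow> 'w measure \<Rightarrow> ('w \<Rightarrow> real ^ 'n) set" where
  "L2_var M G = {\<zeta>. \<zeta> \<in> borel_measurable G \<and> (\<integral>\<^sup>+\<omega>. ennreal ((norm (\<zeta> \<omega>))\<^sup>2) \<partial>M) < \<infinity>}"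

text \<open>
  Adaptedness of a merely square-integrable process is understood as progressive measurability
  (a jointly measurable adapted process has a progressive modification). For the continuous
  processes of \<open>S2_proc\<close> this follows from adaptedness.
\<close>

definition L2_proc :: "'w measure \<Rightarrow> (real \<Rightarrow> 'w measure) \<Rightarrow> real \<Rightarrow> (real \<Rightarrow> 'w \<Rightarrow> real ^ 'n) set" where
  "L2_proc M F T =
     {u. progressive F T u \<and>
         (\<integral>\<^sup>+\<omega>. (\<integral>\<^sup>+t\<in>{0..T}. ennreal ((norm (u t \<omega>))\<^sup>2) \<partial>lborel) \<partial>M) < \<infinity>}"

definition S2_proc :: "'w measure \<Rightarrow> (real \<Rightarrow> 'w measure) \<Rightarrow> real \<Rightarrow> (real \<Rightarrow> 'w \<Rightarrow> real ^ 'n) set" where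
  "S2_proc M F T =
     {u. adapted F T u \<and> (\<forall>\<omega>\<in>space M. continuous_on {0..T} (\<lambda>t. u t \<omega>)) \<and>
         (\<integral>\<^sup>+\<omega>. (SUP t\<in>{0..T}. ennreal ((norm (u t \<omega>))\<^sup>2)) \<partial>M) < \<infinity>}"

section \<open>Stochastic integral\<close>

text \<open>
  \<open>elementary_integral M F T W h I\<close>: h is the step process that equals \<open>\<xi> i\<close> on
  \<open>(\<tau> i, \<tau> (i+1)]\<close> for i < m, where \<open>\<xi> i\<close> is bounded and \<open>F (\<tau> i)\<close>-measurable, and
  I is its (elementary) stochastic integral process with respect to W.
\<close>

definition elementary_integral ::
  "'w measure \<Rightarrow> (real \<Rightarrow> 'w measure) \<Rightarrow> real \<Rightarrow> (real \<Rightarrow> 'w \<Rightarrow> real) \<Rightarrow>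
   (real \<Rightarrow> 'w \<Rightarrow> real ^ 'n) \<Rightarrow> (real \<Rightarrow> 'w \<Rightarrow> real ^ 'n) \<Rightarrow> bool" where
  "elementary_integral M F T W h I \<longleftrightarrow>
     (\<exists>(m::nat) (\<tau> :: nat \<Rightarrow> real) (\<xi> :: nat \<Rightarrow> 'w \<Rightarrow> real ^ 'n).
        0 \<le> \<tau> 0 \<and> \<tau> m \<le> T \<and> (\<forall>i<m. \<tau> i < \<tau> (Suc i)) \<and>
        (\<forall>i<m. \<xi> i \<in> borel_measurable (F (\<tau> i)) \<and> (\<exists>C. \<forall>\<omega>\<in>space M. norm (\<xi> i \<omega>) \<le> C)) \<and>
        h = (\<lambda>t \<omega>. \<Sum>i<m. indicator {\<tau> i<..\<tau> (Suc i)} t *\<^sub>R \<xi> i \<omega>) \<and>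
        I = (\<lambda>t \<omega>. \<Sum>i<m. (W (min t (\<tau> (Suc i))) \<omega> - W (min t (\<tau> i)) \<omega>) *\<^sub>R \<xi> i \<omega>))"

text \<open>
  \<open>ito_integral M F T W H X\<close>: X is a continuous version of the process
  \<open>t \<mapsto> \<integral>\<^sub>0\<^sup>t H dW\<close>, the \<open>L\<^sup>2\<close>-limit of the integrals of elementary processes approximating H in
  \<open>L\<^sup>2([0,T] \<times> \<Omega>)\<close>. By the Ito isometry X does not depend, up to indistinguishability, on the
  approximating sequence.
\<close>

definition ito_integral ::
  "'w measure \<Rightarrow> (real \<Rightarrow> 'w measure) \<Rightarrow> real \<Rightarrow> (real \<Rightarrow> 'w \<Rightarrow> real) \<Rightarrow>
   (real \<Rightarrow> 'w \<Rightarrow> real ^ 'n) \<Rightarrow> (real \<Rightarrow> 'w \<Rightarrow> real ^ 'n) \<Rightarrow> bool" where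
  "ito_integral M F T W H X \<longleftrightarrow>
     adapted F T X \<and> (\<forall>\<omega>\<in>space M. continuous_on {0..T} (\<lambda>t. X t \<omega>)) \<and>
     (\<exists>h I. (\<forall>k::nat. elementary_integral M F T W (h k) (I k)) \<and>
        ((\<lambda>k. \<integral>\<^sup>+\<omega>. (\<integral>\<^sup>+t\<in>{0..T}. ennreal ((norm (H t \<omega> - h k t \<omega>))\<^sup>2) \<partial>lborel) \<partial>M)
           \<longlonglongrightarrow> 0) \<and>
        (\<forall>t\<in>{0..T}. (\<lambda>k. \<integral>\<^sup>+\<omega>. ennreal ((norm (X t \<omega> - I k t \<omega>))\<^sup>2) \<partial>M) \<longlonglongrightarrow> 0))"

section \<open>Filtering\<close>

definition vec_cond_exp :: "'w measure \<Rightarrow> 'w measure \<Rightarrow> ('w \<Rightarrow> real ^ 'n) \<Rightarrow> 'w \<Rightarrow> real ^ 'n" where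
  "vec_cond_exp M G f = (\<lambda>\<omega>. \<chi> i. real_cond_exp M G (\<lambda>\<omega>'. f \<omega>' $ i) \<omega>)"

text \<open>
  Conditional expectations are defined only almost surely for each t, so a version that is jointly
  measurable in (t, \<omega>) has to be chosen before it can be integrated in t. Two such versions agree
  \<open>dt \<otimes> dP\<close>-almost everywhere. Only almost every t is considered because \<open>\<beta> t\<close> is integrable
  only for almost every t when \<open>\<beta>\<close> is square integrable over [0,T] \<open>\<times>\<close> \<open>\<Omega>\<close>.
\<close>

definition is_filtered_version ::
  "'w measure \<Rightarrow> real \<Rightarrow> (real \<Rightarrow> 'w \<Rightarrow> real) \<Rightarrow>
   (real \<Rightarrow> 'w \<Rightarrow> real ^ 'n) \<Rightarrow> (real \<Rightarrow> 'w \<Rightarrow> real ^ 'n) \<Rightarrow> bool" where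
  "is_filtered_version M T W1 \<beta> \<beta>h \<longleftrightarrow>
     (\<lambda>(t, \<omega>). \<beta>h t \<omega>) \<in> borel_measurable (restrict_space borel {0..T} \<Otimes>\<^sub>M M) \<and>
     (AE t in lborel. t \<in> {0..T} \<longrightarrow>
        (AE \<omega> in M. \<beta>h t \<omega> = vec_cond_exp M (nat_filt M W1 t) (\<beta> t) \<omega>))"

section \<open>The backward equation with filtering\<close>

abbreviation wiener_filt ::
  "'w measure \<Rightarrow> (real \<Rightarrow> 'w \<Rightarrow> real) \<Rightarrow> (real \<Rightarrow> 'w \<Rightarrow> real) \<Rightarrow> real \<Rightarrow> 'w measure" where
  "wiener_filt M W1 W2 \<equiv> aug_filt M (\<lambda>t \<omega>. (W1 t \<omega>, W2 t \<omega>))"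

definition bsde_filtering_solution ::
  "'w measure \<Rightarrow> real \<Rightarrow> (real \<Rightarrow> 'w \<Rightarrow> real) \<Rightarrow> (real \<Rightarrow> 'w \<Rightarrow> real) \<Rightarrow>
   ('w \<Rightarrow> real \<Rightarrow> real^'n \<Rightarrow> real^'n \<Rightarrow> real^'n \<Rightarrow> real^'n \<Rightarrow> real^'n \<Rightarrow> real^'n \<Rightarrow> real^'n) \<Rightarrow>
   ('w \<Rightarrow> real^'n) \<Rightarrow>
   (real \<Rightarrow> 'w \<Rightarrow> real^'n) \<Rightarrow> (real \<Rightarrow> 'w \<Rightarrow> real^'n) \<Rightarrow> (real \<Rightarrow> 'w \<Rightarrow> real^'n) \<Rightarrow> bool" where
  "bsde_filtering_solution M T W1 W2 g \<zeta> P Q1 Q2 \<longleftrightarrow>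
     P \<in> S2_proc M (wiener_filt M W1 W2) T \<and>
     Q1 \<in> L2_proc M (wiener_filt M W1 W2) T \<and>
     Q2 \<in> L2_proc M (wiener_filt M W1 W2) T \<and>
     (\<exists>Ph Q1h Q2h I1 I2.
        is_filtered_version M T W1 P Ph \<and>
        is_filtered_version M T W1 Q1 Q1h \<and>
        is_filtered_version M T W1 Q2 Q2h \<and>
        ito_integral M (wiener_filt M W1 W2) T W1 Q1 I1 \<and>
        ito_integral M (wiener_filt M W1 W2) T W2 Q2 I2 \<and>
        (AE \<omega> in M. set_integrable lborel {0..T}
           (\<lambda>s. g \<omega> s (P s \<omega>) (Q1 s \<omega>) (Q2 s \<omega>) (Ph s \<omega>) (Q1h s \<omega>) (Q2h s \<omega>))) \<and>
        (AE \<omega> in M. \<forall>t\<in>{0..T}.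
           P t \<omega> = P 0 \<omega>
             + (LINT s:{0..t}|lborel.
                  g \<omega> s (P s \<omega>) (Q1 s \<omega>) (Q2 s \<omega>) (Ph s \<omega>) (Q1h s \<omega>) (Q2h s \<omega>))
             + I1 t \<omega> + I2 t \<omega>) \<and>
        (AE \<omega> in M. P T \<omega> = \<zeta> \<omega>))"

text \<open>Uniqueness holds for P up to indistinguishability and for Q1, Q2 \<open>dt \<otimes> dP\<close>-almost everywhere.\<close>

definition indistinguishable ::
  "'w measure \<Rightarrow> real \<Rightarrow> (real \<Rightarrow> 'w \<Rightarrow> 'b) \<Rightarrow> (real \<Rightarrow> 'w \<Rightarrow> 'b) \<Rightarrow> bool" where
  "indistinguishable M T u v \<longleftrightarrow> (AE \<omega> in M. \<forall>t\<in>{0..T}. u t \<omega> = v t \<omega>)"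

definition ae_equal_proc ::
  "'w measure \<Rightarrow> real \<Rightarrow> (real \<Rightarrow> 'w \<Rightarrow> 'b) \<Rightarrow> (real \<Rightarrow> 'w \<Rightarrow> 'b) \<Rightarrow> bool" where
  "ae_equal_proc M T u v \<longleftrightarrow>
     (AE (t, \<omega>) in (restrict_space lborel {0..T} \<Otimes>\<^sub>M M). u t \<omega> = v t \<omega>)"

end

theory Submission
  imports Defs
begin

text \<open>
  The generator is frozen along a process f, and the frozen equation is solved by the martingale
  representation theorem; the solution of the original equation is the fixed point of the map that
  sends f to the generator along the solution (P, Q1, Q2) frozen at f and along its filtered versions.
  Ito's formula is not needed. For two frozen solutions with the same terminal value, the increment of
  the stochastic integrals over [t,T] is orthogonal to the difference of P at t, so
  \<open>\<parallel>\<Delta>P t\<parallel>\<^sup>2 + \<parallel>\<Delta>Q1\<parallel>\<^sup>2 + \<parallel>\<Delta>Q2\<parallel>\<^sup>2 \<le> \<parallel>\<integral>\<Delta>f\<parallel>\<^sup>2\<close>, all integrals being taken over [t,T]. Integration over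
  t against an exponential weight makes the map a contraction, since filtering does not increase
  norms in \<open>L\<^sup>2\<close>.

  Representation is proved first for products of smooth functions of Brownian increments, each factor
  by telescoping the heat semigroup along a fine partition, and extends to all square-integrable
  variables because the representable ones form a closed subspace. A jointly measurable filtered
  version is the conditional expectation on [0,T] \<open>\<times>\<close> \<open>\<Omega>\<close> given the \<open>\<sigma>\<close>-algebra generated by
  rectangles whose event precedes their time interval.
\<close>

section \<open>Square-integrable functions\<close>

text \<open>Filtered processes are controlled by the unfiltered ones only in square mean at a fixed
  time, so pathwise estimates are out of reach and drifts are compared in square mean throughout.
  Limits are taken pointwise, with \<open>lim\<close>, along sequences whose squared increments are
  of order \<open>4^-k\<close>; this keeps progressive measurability and explains why the
  contraction factor is made 1/4. In the representation, first-order expansion over a partition has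
  a small error only because the one-step errors are orthogonal. For filtering, the obstacle is that
  the conditioning sigma-algebra changes with time: each testing identity holds outside its own null
  set of times. Continuity of \<open>W1\<close> reduces the tests to countably many, given by
  rational times before \<open>t\<close>.\<close>

definition nn2 :: "'a measure \<Rightarrow> ('a \<Rightarrow> 'b::real_normed_vector) \<Rightarrow> ennreal" where
  "nn2 M f = (\<integral>\<^sup>+x. ennreal ((norm (f x))\<^sup>2) \<partial>M)"

text \<open>Squared norms live in \<open>ennreal\<close>, so estimates on \<open>nn2\<close> can be
  stated for measurable functions in general; \<open>sq_int\<close> supplies finiteness where
  Bochner integrals, and hence orthogonality, enter.\<close>

definition sq_int :: "'a measure \<Rightarrow> ('a \<Rightarrow> 'b::real_normed_vector) \<Rightarrow> bool" where
  "sq_int M f \<longleftrightarrow> f \<in> borel_measurable M \<and> nn2 M f < \<infinity>"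

lemma sq_int_measurable[measurable_dest]: "sq_int M f \<Longrightarrow> f \<in> borel_measurable M"
  by (simp add: sq_int_def)

lemma sq_int_finite: "sq_int M f \<Longrightarrow> nn2 M f < \<infinity>"
  by (simp add: sq_int_def)

lemma sq_intI: "f \<in> borel_measurable M \<Longrightarrow> nn2 M f < \<infinity> \<Longrightarrow> sq_int M f"
  by (simp add: sq_int_def)

lemma nn2_cong_AE: "AE x in M. f x = g x \<Longrightarrow> nn2 M f = nn2 M g"
  unfolding nn2_def by (rule nn_integral_cong_AE) auto

lemma nn2_cong: "(\<And>x. x \<in> space M \<Longrightarrow> f x = g x) \<Longrightarrow> nn2 M f = nn2 M g"
  unfolding nn2_def by (rule nn_integral_cong) auto

lemma nn2_mono_AE: "AE x in M. norm (f x) \<le> norm (g x) \<Longrightarrow> nn2 M f \<le> nn2 M g"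
  unfolding nn2_def by (rule nn_integral_mono_AE) (auto intro!: ennreal_leI power_mono)

lemma nn2_zero[simp]: "nn2 M (\<lambda>x. 0) = 0"
  by (simp add: nn2_def)

lemma nn2_minus_commute: "nn2 M (\<lambda>x. f x - g x) = nn2 M (\<lambda>x. g x - f x)"
  by (simp add: nn2_def norm_minus_commute)

lemma nn2_scale: "f \<in> borel_measurable M \<Longrightarrow> nn2 M (\<lambda>x. c *\<^sub>R f x) = ennreal (c\<^sup>2) * nn2 M f"
  unfolding nn2_def
  by (simp add: power_mult_distrib ennreal_mult nn_integral_cmult)

text \<open>Young's inequality for the mixed term. The free parameter matters: \<open>e = 1\<close>
  gives the usual factor 2, while \<open>e\<close> near 0 keeps the factor of the first summand near
  1, as limits of sharp inequalities require.\<close>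

lemma norm_add_power2_le:
  fixes a b :: "'b::real_normed_vector"
  assumes "e > 0"
  shows "(norm (a + b))\<^sup>2 \<le> (1 + e) * (norm a)\<^sup>2 + (1 + 1 / e) * (norm b)\<^sup>2"
proof -
  have "(norm (a + b))\<^sup>2 \<le> (norm a + norm b)\<^sup>2"
    by (intro power_mono norm_triangle_ineq) auto
  also have "\<dots> = (norm a)\<^sup>2 + 2 * norm a * norm b + (norm b)\<^sup>2"
    by (simp add: power2_sum)
  also have "2 * norm a * norm b \<le> e * (norm a)\<^sup>2 + (1 / e) * (norm b)\<^sup>2"
  proof -
    have "0 \<le> (sqrt e * norm a - norm b / sqrt e)\<^sup>2" by simp
    also have "\<dots> = e * (norm a)\<^sup>2 + (1 / e) * (norm b)\<^sup>2 - 2 * norm a * norm b"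
      using assms by (simp add: power2_diff power_mult_distrib power_divide)
    finally show ?thesis by simp
  qed
  finally show ?thesis by (simp add: algebra_simps)
qed

lemma nn2_add_eps:
  fixes f g :: "'a \<Rightarrow> 'b::{real_normed_vector, second_countable_topology}"
  assumes [measurable]: "f \<in> borel_measurable M" "g \<in> borel_measurable M" and "e > 0"
  shows "nn2 M (\<lambda>x. f x + g x) \<le> ennreal (1 + e) * nn2 M f + ennreal (1 + 1 / e) * nn2 M g"
proof -
  have "nn2 M (\<lambda>x. f x + g x)
      \<le> (\<integral>\<^sup>+x. ennreal (1 + e) * ennreal ((norm (f x))\<^sup>2) + ennreal (1 + 1 / e) * ennreal ((norm (g x))\<^sup>2) \<partial>M)"
    unfolding nn2_def
    using norm_add_power2_le[OF \<open>e > 0\<close>] \<open>e > 0\<close>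
    by (intro nn_integral_mono)
       (auto simp: ennreal_mult[symmetric] ennreal_plus[symmetric] simp del: ennreal_plus intro!: ennreal_leI)
  also have "\<dots> = ennreal (1 + e) * nn2 M f + ennreal (1 + 1 / e) * nn2 M g"
    unfolding nn2_def by (simp add: nn_integral_add nn_integral_cmult)
  finally show ?thesis .
qed

lemma nn2_add_le:
  fixes f g :: "'a \<Rightarrow> 'b::{real_normed_vector, second_countable_topology}"
  assumes "f \<in> borel_measurable M" "g \<in> borel_measurable M"
  shows "nn2 M (\<lambda>x. f x + g x) \<le> 2 * nn2 M f + 2 * nn2 M g"
  using nn2_add_eps[OF assms, of 1] by simp

lemma nn2_uminus[simp]: "nn2 M (\<lambda>x. - f x) = nn2 M f"
  by (simp add: nn2_def)

lemma nn2_triangle_le: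
  fixes f g h :: "'a \<Rightarrow> 'b::{real_normed_vector, second_countable_topology}"
  assumes [measurable]: "f \<in> borel_measurable M" "g \<in> borel_measurable M" "h \<in> borel_measurable M"
  shows "nn2 M (\<lambda>x. f x - h x) \<le> 2 * nn2 M (\<lambda>x. f x - g x) + 2 * nn2 M (\<lambda>x. g x - h x)"
  using nn2_add_le[of "\<lambda>x. f x - g x" M "\<lambda>x. g x - h x"] by simp

lemma sq_int_add:
  fixes f g :: "'a \<Rightarrow> 'b::{real_normed_vector, second_countable_topology}"
  assumes "sq_int M f" "sq_int M g"
  shows "sq_int M (\<lambda>x. f x + g x)"
proof (rule sq_intI)
  show "(\<lambda>x. f x + g x) \<in> borel_measurable M" using assms by measurable
  show "nn2 M (\<lambda>x. f x + g x) < \<infinity>"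
    using nn2_add_le[of f M g] assms
    by (auto simp: sq_int_def ennreal_mult_less_top intro!: le_less_trans[OF nn2_add_le])
qed

lemma sq_int_scale:
  fixes f :: "'a \<Rightarrow> 'b::{real_normed_vector, second_countable_topology}"
  shows "sq_int M f \<Longrightarrow> sq_int M (\<lambda>x. c *\<^sub>R f x)"
  by (auto simp: sq_int_def nn2_scale ennreal_mult_less_top)

lemma sq_int_uminus:
  fixes f :: "'a \<Rightarrow> 'b::{real_normed_vector, second_countable_topology}"
  shows "sq_int M f \<Longrightarrow> sq_int M (\<lambda>x. - f x)"
  using sq_int_scale[of M f "-1"] by simp

lemma sq_int_diff:
  fixes f g :: "'a \<Rightarrow> 'b::{real_normed_vector, second_countable_topology}"
  shows "sq_int M f \<Longrightarrow> sq_int M g \<Longrightarrow> sq_int M (\<lambda>x. f x - g x)"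
  using sq_int_add[of M f "\<lambda>x. - g x"] sq_int_uminus[of M g] by simp

lemma sq_int_zero[simp]: "sq_int M (\<lambda>x. 0)"
  by (simp add: sq_int_def)

lemma sq_int_sum:
  fixes f :: "'i \<Rightarrow> 'a \<Rightarrow> 'b::{real_normed_vector, second_countable_topology}"
  shows "(\<And>i. i \<in> I \<Longrightarrow> sq_int M (f i)) \<Longrightarrow> sq_int M (\<lambda>x. \<Sum>i\<in>I. f i x)"
  by (induction I rule: infinite_finite_induct) (auto intro: sq_int_add)

lemma sq_int_bound:
  fixes f :: "'a \<Rightarrow> 'b::real_normed_vector"
  assumes "sq_int M g" "f \<in> borel_measurable M" "AE x in M. norm (f x) \<le> norm (g x)"
  shows "sq_int M f"
  using assms nn2_mono_AE[OF assms(3)] by (auto simp: sq_int_def)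

lemma sq_int_integrable_power2:
  fixes f :: "'a \<Rightarrow> 'b::{real_normed_vector, second_countable_topology}"
  assumes "sq_int M f" shows "integrable M (\<lambda>x. (norm (f x))\<^sup>2)"
  using assms by (intro integrableI_nonneg) (auto simp: sq_int_def nn2_def)

lemma nn2_eq_integral:
  fixes f :: "'a \<Rightarrow> 'b::{real_normed_vector, second_countable_topology}"
  assumes "sq_int M f" shows "nn2 M f = ennreal (\<integral>x. (norm (f x))\<^sup>2 \<partial>M)"
  unfolding nn2_def using sq_int_integrable_power2[OF assms]
  by (rule nn_integral_eq_integral) simp

lemma sq_int_integrable_inner:
  fixes f g :: "'a \<Rightarrow> 'b::{real_inner, second_countable_topology}"
  assumes f: "sq_int M f" and g: "sq_int M g"
  shows "integrable M (\<lambda>x. f x \<bullet> g x)"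
proof (rule Bochner_Integration.integrable_bound)
  show "integrable M (\<lambda>x. (norm (f x))\<^sup>2 + (norm (g x))\<^sup>2)"
    using sq_int_integrable_power2[OF f] sq_int_integrable_power2[OF g] by simp
  show "(\<lambda>x. f x \<bullet> g x) \<in> borel_measurable M" using f g by measurable
  have "norm (a \<bullet> b) \<le> (norm a)\<^sup>2 + (norm b)\<^sup>2" for a b :: 'b
  proof -
    have "\<bar>a \<bullet> b\<bar> \<le> norm a * norm b" by (rule Cauchy_Schwarz_ineq2)
    also have "2 * (norm a * norm b) \<le> (norm a)\<^sup>2 + (norm b)\<^sup>2"
      using sum_squares_bound[of "norm a" "norm b"] by (simp add: mult.assoc)
    finally show ?thesis
      by (smt (verit) real_norm_def zero_le_power2)
  qed
  then show "AE x in M. norm (f x \<bullet> g x) \<le> norm ((norm (f x))\<^sup>2 + (norm (g x))\<^sup>2)" by simp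
qed

lemma (in finite_measure) sq_int_integrable:
  fixes f :: "'a \<Rightarrow> 'b::{banach, second_countable_topology}"
  assumes "sq_int M f" shows "integrable M f"
proof (rule Bochner_Integration.integrable_bound)
  show "integrable M (\<lambda>x. 1 + (norm (f x))\<^sup>2)"
    using sq_int_integrable_power2[OF assms] by simp
  show "f \<in> borel_measurable M" using assms by measurable
  have "a \<le> 1 + a\<^sup>2" if "a \<ge> 0" for a :: real
    using sum_squares_bound[of 1 a] that by (simp add: power2_eq_square)
  then show "AE x in M. norm (f x) \<le> norm (1 + (norm (f x))\<^sup>2)" by simp
qed

lemma (in finite_measure) sq_int_bounded:
  fixes f :: "'a \<Rightarrow> 'b::real_normed_vector"
  assumes "f \<in> borel_measurable M" "\<And>x. x \<in> space M \<Longrightarrow> norm (f x) \<le> C"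
  shows "sq_int M f"
proof (rule sq_intI)
  have "nn2 M f \<le> (\<integral>\<^sup>+x. ennreal (C\<^sup>2) \<partial>M)"
    unfolding nn2_def using assms(2) by (intro nn_integral_mono ennreal_leI power_mono) auto
  also have "\<dots> < \<infinity>" by (simp add: ennreal_mult_eq_top_iff less_top[symmetric])
  finally show "nn2 M f < \<infinity>" .
qed fact

lemma nn2_pythagoras:
  fixes f g :: "'a \<Rightarrow> 'b::{real_inner, second_countable_topology}"
  assumes f: "sq_int M f" and g: "sq_int M g" and o: "(\<integral>x. f x \<bullet> g x \<partial>M) = 0"
  shows "nn2 M (\<lambda>x. f x + g x) = nn2 M f + nn2 M g"
proof -
  note i = sq_int_integrable_power2[OF f] sq_int_integrable_power2[OF g] sq_int_integrable_inner[OF f g]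
  have "(norm (f x + g x))\<^sup>2 = (norm (f x))\<^sup>2 + 2 * (f x \<bullet> g x) + (norm (g x))\<^sup>2" for x
    by (simp add: power2_norm_eq_inner algebra_simps inner_commute)
  then have "(\<integral>x. (norm (f x + g x))\<^sup>2 \<partial>M) = (\<integral>x. (norm (f x))\<^sup>2 \<partial>M) + (\<integral>x. (norm (g x))\<^sup>2 \<partial>M)"
    using i o by simp
  then show ?thesis
    using nn2_eq_integral[OF f] nn2_eq_integral[OF g] nn2_eq_integral[OF sq_int_add[OF f g]]
    by (simp add: ennreal_plus[symmetric] del: ennreal_plus)
qed

text \<open>Both sides change by a small relative amount plus a null sequence, so an inequality
  between norms on two different spaces survives the limit with the same constants. It transfers the
  isometry from elementary to general integrands.\<close>

lemma nn2_limit_le: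
  fixes u :: "'a \<Rightarrow> 'b::{real_normed_vector, second_countable_topology}"
    and v :: "'c \<Rightarrow> 'd::{real_normed_vector, second_countable_topology}"
  assumes [measurable]: "u \<in> borel_measurable M" "\<And>k. uk k \<in> borel_measurable M"
    "v \<in> borel_measurable N" "\<And>k. vk k \<in> borel_measurable N"
    and u: "(\<lambda>k. nn2 M (\<lambda>x. u x - uk k x)) \<longlonglongrightarrow> 0"
    and v: "(\<lambda>k. nn2 N (\<lambda>x. v x - vk k x)) \<longlonglongrightarrow> 0"
    and le: "\<And>k. c + nn2 M (uk k) \<le> nn2 N (vk k)"
  shows "c + nn2 M u \<le> nn2 N v"
proof -
  \<comment> \<open>Each of the two approximations costs one factor \<open>1 + e\<close>;
    \<open>c\<close> is enlarged by such a factor as well, so that the hypothesis applies as it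
    stands.\<close>
  have *: "c + nn2 M u \<le> ennreal ((1 + e)\<^sup>2) * nn2 N v" if e: "e > 0" for e :: real
  proof -
    let ?R = "\<lambda>k. ennreal (1 + e) * (ennreal (1 + e) * nn2 N v + ennreal (1 + 1/e) * nn2 N (\<lambda>x. v x - vk k x))
       + ennreal (1 + 1/e) * nn2 M (\<lambda>x. u x - uk k x)"
    have "c + nn2 M u \<le> ?R k" for k
    proof -
      have "nn2 M u \<le> ennreal (1 + e) * nn2 M (uk k) + ennreal (1 + 1/e) * nn2 M (\<lambda>x. u x - uk k x)"
        using nn2_add_eps[of "uk k" M "\<lambda>x. u x - uk k x" e] e by simp
      moreover have "c \<le> ennreal (1 + e) * c"
        using mult_right_mono[of 1 "ennreal (1 + e)" c] e by simp
      ultimately have "c + nn2 M u \<le> ennreal (1 + e) * c + (ennreal (1 + e) * nn2 M (uk k) + ennreal (1 + 1/e) * nn2 M (\<lambda>x. u x - uk k x))"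
        by (intro add_mono)
      also have "\<dots> = ennreal (1 + e) * (c + nn2 M (uk k)) + ennreal (1 + 1/e) * nn2 M (\<lambda>x. u x - uk k x)"
        by (simp add: distrib_left add.assoc)
      also have "\<dots> \<le> ennreal (1 + e) * nn2 N (vk k) + ennreal (1 + 1/e) * nn2 M (\<lambda>x. u x - uk k x)"
        by (intro add_mono mult_left_mono le) auto
      also have "nn2 N (vk k) \<le> ennreal (1 + e) * nn2 N v + ennreal (1 + 1/e) * nn2 N (\<lambda>x. v x - vk k x)"
        using nn2_add_eps[of v N "\<lambda>x. vk k x - v x" e] e by (simp add: nn2_minus_commute[of N v])
      finally show ?thesis by (simp add: add_right_mono mult_left_mono)
    qed
    moreover have "?R \<longlonglongrightarrow> ennreal (1 + e) * (ennreal (1 + e) * nn2 N v + ennreal (1 + 1/e) * 0) + ennreal (1 + 1/e) * 0"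
      by (intro tendsto_add ennreal_tendsto_cmult tendsto_const u v) auto
    ultimately have "c + nn2 M u \<le> ennreal (1 + e) * (ennreal (1 + e) * nn2 N v + ennreal (1 + 1/e) * 0) + ennreal (1 + 1/e) * 0"
      by (intro tendsto_lowerbound[where f="?R" and F=sequentially]) auto
    then show ?thesis
      using e by (simp add: power2_eq_square ennreal_mult mult.assoc)
  qed
  show ?thesis
  \<comment> \<open>Letting \<open>e\<close> tend to 0 uses continuity of multiplication by a finite
    element of \<open>ennreal\<close>; an infinite right-hand side is trivial.\<close>
  proof (cases "nn2 N v = \<infinity>")
    case False
    have "((\<lambda>e. ennreal ((1 + e)\<^sup>2) * nn2 N v) \<longlongrightarrow> ennreal ((1 + 0)\<^sup>2) * nn2 N v) (at_right 0)"
      using False by (intro tendsto_mult_ennreal tendsto_const tendsto_ennrealI tendsto_intros) auto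
    then show ?thesis
      using * by (intro tendsto_lowerbound[where F="at_right (0::real)" and f="\<lambda>e. ennreal ((1 + e)\<^sup>2) * nn2 N v"])
        (auto simp: eventually_at_right_less eventually_at intro!: exI[of _ 1])
  qed simp
qed

section \<open>Rapidly convergent sequences in square mean\<close>

lemma sum_inverse_two_power_le: "(\<Sum>j\<in>{k..<m}. (1/2::real) ^ j) \<le> 2 / 2 ^ k"
proof (cases "k \<le> m")
  case True
  then have "(\<Sum>j\<in>{k..<m}. (1/2::real) ^ j) = 2 / 2^k - 2 / 2^m"
  proof (induction m rule: dec_induct)
    case (step n)
    then have "(\<Sum>j\<in>{k..<Suc n}. (1/2::real) ^ j) = (2 / 2^k - 2 / 2^n) + (1/2)^n" by simp
    then show ?case by (simp add: power_divide)
  qed simp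
  then show ?thesis by simp
qed simp

text \<open>Each increment is written as \<open>sqrt ((1/2)^j)\<close> times
  \<open>sqrt (2^j)\<close> times itself; Cauchy-Schwarz then separates a geometric tail from the
  weighted sum of squares.\<close>

lemma fast_increments_bound:
  fixes u :: "nat \<Rightarrow> 'b::real_normed_vector"
  assumes S: "\<And>n. (\<Sum>j<n. 2 ^ j * (norm (u (Suc j) - u j))\<^sup>2) \<le> S" and "k \<le> m"
  shows "(norm (u m - u k))\<^sup>2 \<le> 2 / 2 ^ k * S"
proof -
  have "norm (u m - u k) \<le> (\<Sum>j\<in>{k..<m}. norm (u (Suc j) - u j))"
    using norm_sum[of "\<lambda>j. u (Suc j) - u j" "{k..<m}"] sum_Suc_diff'[OF \<open>k \<le> m\<close>, of u] by simp
  then have "(norm (u m - u k))\<^sup>2 \<le> (\<Sum>j\<in>{k..<m}. sqrt ((1/2) ^ j) * (sqrt (2 ^ j) * norm (u (Suc j) - u j)))\<^sup>2"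
    by (intro power_mono) (auto simp: real_sqrt_mult[symmetric] mult.assoc[symmetric] power_mult_distrib[symmetric])
  also have "\<dots> \<le> (\<Sum>j\<in>{k..<m}. (sqrt ((1/2) ^ j))\<^sup>2) * (\<Sum>j\<in>{k..<m}. (sqrt (2 ^ j) * norm (u (Suc j) - u j))\<^sup>2)"
    by (rule Cauchy_Schwarz_ineq_sum)
  also have "\<dots> = (\<Sum>j\<in>{k..<m}. (1/2) ^ j) * (\<Sum>j\<in>{k..<m}. 2 ^ j * (norm (u (Suc j) - u j))\<^sup>2)"
    by (simp add: power_mult_distrib)
  also have "\<dots> \<le> 2 / 2 ^ k * S"
  proof (intro mult_mono sum_inverse_two_power_le)
    have "(\<Sum>j\<in>{k..<m}. 2 ^ j * (norm (u (Suc j) - u j))\<^sup>2) \<le> (\<Sum>j<m. 2 ^ j * (norm (u (Suc j) - u j))\<^sup>2)"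
      by (intro sum_mono2) auto
    with S[of m] show "(\<Sum>j\<in>{k..<m}. 2 ^ j * (norm (u (Suc j) - u j))\<^sup>2) \<le> S" by linarith
  qed (auto intro!: sum_nonneg)
  finally show ?thesis .
qed

lemma fast_increments_Cauchy:
  fixes u :: "nat \<Rightarrow> 'b::real_normed_vector"
  assumes S: "\<And>n. (\<Sum>j<n. 2 ^ j * (norm (u (Suc j) - u j))\<^sup>2) \<le> S"
  shows "Cauchy u"
proof (rule CauchyI')
  fix e :: real assume "e > 0"
  have "(\<lambda>k. 2 * S * (1/2) ^ k) \<longlonglongrightarrow> 2 * S * 0" by (intro tendsto_intros) auto
  then have "eventually (\<lambda>k. 2 * S * (1/2) ^ k < e\<^sup>2) sequentially"
    using \<open>e > 0\<close> by (intro order_tendstoD) auto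
  then obtain K where K: "\<And>k. k \<ge> K \<Longrightarrow> 2 * S * (1/2)^k < e\<^sup>2" by (auto simp: eventually_sequentially)
  have "dist (u k) (u m) < e" if "k \<ge> K" "k < m" for k m
  proof -
    have "(norm (u m - u k))\<^sup>2 < e\<^sup>2"
      using fast_increments_bound[OF S, of k m] K[OF that(1)] that by (simp add: power_divide)
    then show ?thesis
      using \<open>e > 0\<close> by (simp add: dist_norm norm_minus_commute power_less_imp_less_base)
  qed
  then show "\<exists>K. \<forall>m\<ge>K. \<forall>n>m. dist (u m) (u n) < e" by blast
qed

text \<open>Against bounds of order \<open>4^-j\<close> the weight \<open>2^j\<close> still leaves a
  geometric series, with sum \<open>2 * C\<close>; the weighted series is therefore finite almost
  everywhere.\<close>

lemma nn_integral_weighted_suminf_le: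
  fixes d :: "nat \<Rightarrow> 'a \<Rightarrow> ennreal"
  assumes [measurable]: "\<And>j. d j \<in> borel_measurable M"
    and C: "\<And>j. (\<integral>\<^sup>+x. d j x \<partial>M) \<le> ennreal (C / 4 ^ j)" and "C \<ge> 0"
  shows "(\<integral>\<^sup>+x. (\<Sum>j. 2 ^ j * d j x) \<partial>M) \<le> ennreal (2 * C)"
proof -
  have "(\<integral>\<^sup>+x. (\<Sum>j. 2 ^ j * d j x) \<partial>M) = (\<Sum>j. \<integral>\<^sup>+x. 2 ^ j * d j x \<partial>M)"
    by (rule nn_integral_suminf) auto
  also have "\<dots> = (\<Sum>j. 2 ^ j * \<integral>\<^sup>+x. d j x \<partial>M)"
    by (subst nn_integral_cmult) auto
  also have "\<dots> \<le> (\<Sum>j. ennreal (C * (1/2) ^ j))"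
  proof (rule suminf_le)
    fix j
    have "2 ^ j * (\<integral>\<^sup>+x. d j x \<partial>M) \<le> 2 ^ j * ennreal (C / 4 ^ j)" by (intro mult_left_mono C) auto
    also have "\<dots> = ennreal (2 ^ j * (C / 4 ^ j))"
      using \<open>C \<ge> 0\<close> ennreal_power[of 2 j] ennreal_mult[of "2 ^ j" "C / 4 ^ j"] by simp
    also have "2 ^ j * (C / 4 ^ j) = C * (1/2) ^ j"
    proof -
      have "(4::real) ^ j = 2 ^ j * 2 ^ j" by (simp add: power_mult_distrib[symmetric])
      then show ?thesis by (simp add: power_divide)
    qed
    finally show "2 ^ j * (\<integral>\<^sup>+x. d j x \<partial>M) \<le> ennreal (C * (1/2) ^ j)" .
  qed auto
  also have "\<dots> = ennreal (2 * C)"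
    using \<open>C \<ge> 0\<close> sums_mult[OF geometric_sums[of "1/2::real"], of C]
    by (intro suminf_ennreal_eq) (auto simp: mult.commute)
  finally show ?thesis .
qed

text \<open>Riesz-Fischer with a rate. The limit is the pointwise \<open>lim\<close>, so that finer
  measurability of the sequence, such as progressiveness, passes to it.\<close>

lemma fast_L2_convergence:
  fixes u :: "nat \<Rightarrow> 'a \<Rightarrow> 'b::{banach, second_countable_topology}"
  assumes [measurable]: "\<And>k. u k \<in> borel_measurable M"
    and C: "\<And>k. nn2 M (\<lambda>x. u (Suc k) x - u k x) \<le> ennreal (C / 4 ^ k)" and "C \<ge> 0"
  shows "AE x in M. (\<lambda>k. u k x) \<longlonglongrightarrow> lim (\<lambda>k. u k x)"
    and "nn2 M (\<lambda>x. lim (\<lambda>k. u k x) - u k x) \<le> ennreal (4 * C / 2 ^ k)"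
    and "(\<lambda>k. nn2 M (\<lambda>x. lim (\<lambda>k. u k x) - u k x)) \<longlonglongrightarrow> 0"
proof -
  \<comment> \<open>\<open>S\<close> dominates all weighted partial sums at a point; where it is
    finite, the sequence is Cauchy with an explicit rate.\<close>
  define S where "S x = (\<Sum>j. 2 ^ j * ennreal ((norm (u (Suc j) x - u j x))\<^sup>2))" for x
  have [measurable]: "S \<in> borel_measurable M" unfolding S_def by measurable
  have intS: "(\<integral>\<^sup>+x. S x \<partial>M) \<le> ennreal (2 * C)"
    unfolding S_def using C \<open>C \<ge> 0\<close>
    by (intro nn_integral_weighted_suminf_le) (auto simp: nn2_def)
  then have "(\<integral>\<^sup>+x. S x \<partial>M) \<noteq> \<infinity>" by (auto simp: top_unique)
  then have fin: "AE x in M. S x \<noteq> \<infinity>" by (intro nn_integral_noteq_infinite) auto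
  have ptw: "(\<lambda>k. u k x) \<longlonglongrightarrow> lim (\<lambda>k. u k x) \<and> (\<forall>k. ennreal ((norm (lim (\<lambda>k. u k x) - u k x))\<^sup>2) \<le> ennreal (2 / 2 ^ k) * S x)"
    if fx: "S x \<noteq> \<infinity>" for x
  proof -
    have b: "(\<Sum>j<n. 2 ^ j * (norm (u (Suc j) x - u j x))\<^sup>2) \<le> enn2real (S x)" for n
    proof -
      have "ennreal (\<Sum>j<n. 2 ^ j * (norm (u (Suc j) x - u j x))\<^sup>2)
         = (\<Sum>j<n. 2 ^ j * ennreal ((norm (u (Suc j) x - u j x))\<^sup>2))"
        by (subst sum_ennreal[symmetric]) (auto simp: ennreal_mult ennreal_power[symmetric])
      also have "\<dots> \<le> S x" unfolding S_def by (rule sum_le_suminf) auto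
      also have "S x = ennreal (enn2real (S x))" using fx by (simp add: less_top)
      finally show ?thesis by (subst (asm) ennreal_le_iff) auto
    qed
    have conv: "(\<lambda>k. u k x) \<longlonglongrightarrow> lim (\<lambda>k. u k x)"
      using fast_increments_Cauchy[OF b] by (simp add: Cauchy_convergent_iff convergent_LIMSEQ_iff)
    have "(norm (lim (\<lambda>k. u k x) - u k x))\<^sup>2 \<le> 2 / 2 ^ k * enn2real (S x)" for k
    proof (rule tendsto_upperbound)
      show "(\<lambda>m. (norm (u m x - u k x))\<^sup>2) \<longlonglongrightarrow> (norm (lim (\<lambda>k. u k x) - u k x))\<^sup>2"
        by (intro tendsto_intros conv)
      show "eventually (\<lambda>m. (norm (u m x - u k x))\<^sup>2 \<le> 2 / 2 ^ k * enn2real (S x)) sequentially"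
        using fast_increments_bound[OF b, of k] by (auto simp: eventually_sequentially)
    qed simp
    then have "ennreal ((norm (lim (\<lambda>k. u k x) - u k x))\<^sup>2) \<le> ennreal (2 / 2 ^ k * enn2real (S x))" for k
      by (intro ennreal_leI)
    also have "ennreal (2 / 2 ^ k * enn2real (S x)) = ennreal (2 / 2 ^ k) * S x" for k
      using fx ennreal_mult[of "2 / 2 ^ k" "enn2real (S x)"] by (simp add: less_top)
    finally show ?thesis using conv by auto
  qed
  show "AE x in M. (\<lambda>k. u k x) \<longlonglongrightarrow> lim (\<lambda>k. u k x)"
    using fin by eventually_elim (use ptw in auto)
  show *: "nn2 M (\<lambda>x. lim (\<lambda>k. u k x) - u k x) \<le> ennreal (4 * C / 2 ^ k)" for k
  proof -
    have "nn2 M (\<lambda>x. lim (\<lambda>k. u k x) - u k x) \<le> (\<integral>\<^sup>+x. ennreal (2 / 2 ^ k) * S x \<partial>M)"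
      unfolding nn2_def
    proof (rule nn_integral_mono_AE)
      show "AE x in M. ennreal ((norm (lim (\<lambda>k. u k x) - u k x))\<^sup>2) \<le> ennreal (2 / 2 ^ k) * S x"
        using fin by eventually_elim (use ptw in auto)
    qed
    also have "\<dots> = ennreal (2 / 2 ^ k) * (\<integral>\<^sup>+x. S x \<partial>M)" by (intro nn_integral_cmult) auto
    also have "\<dots> \<le> ennreal (2 / 2 ^ k) * ennreal (2 * C)" by (intro mult_left_mono intS) auto
    also have "\<dots> = ennreal (4 * C / 2 ^ k)" using \<open>C \<ge> 0\<close> by (simp add: ennreal_mult[symmetric])
    finally show ?thesis .
  qed
  have "(\<lambda>k. 4 * C * (1/2) ^ k) \<longlonglongrightarrow> 4 * C * 0" by (intro tendsto_intros) auto
  then have "(\<lambda>k. ennreal (4 * C / 2 ^ k)) \<longlonglongrightarrow> 0"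
    using tendsto_ennrealI[of _ 0] by (simp add: power_divide)
  then show "(\<lambda>k. nn2 M (\<lambda>x. lim (\<lambda>k. u k x) - u k x)) \<longlonglongrightarrow> 0"
    by (rule tendsto_sandwich[OF _ _ tendsto_const, rotated 2]) (use * in auto)
qed

section \<open>Filtrations and Gaussian increments\<close>

lemma space_nat_filt[simp]: "space (nat_filt M X t) = space M"
  unfolding nat_filt_def by (rule space_measure_of) auto

lemma sets_nat_filt:
  "sets (nat_filt M X t) = sigma_sets (space M) {X s -` B \<inter> space M | s B. s \<in> {0..t} \<and> B \<in> sets borel}"
  unfolding nat_filt_def by (rule sets_measure_of) auto

lemma nat_filt_mono: "s \<le> t \<Longrightarrow> sets (nat_filt M X s) \<subseteq> sets (nat_filt M X t)"
  unfolding sets_nat_filt by (rule sigma_sets_mono') force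

lemma nat_filt_measurable: "0 \<le> s \<Longrightarrow> s \<le> t \<Longrightarrow> X s \<in> borel_measurable (nat_filt M X t)"
  by (rule measurableI) (auto simp: sets_nat_filt)

lemma sets_nat_filt_le:
  assumes "\<And>s. s \<in> {0..t} \<Longrightarrow> X s \<in> borel_measurable N" "space N = space M"
  shows "sets (nat_filt M X t) \<subseteq> sets N"
  unfolding sets_nat_filt assms(2)[symmetric]
  using assms(1) by (intro sets.sigma_sets_subset) (auto intro!: measurable_sets)

lemma space_aug_filt[simp]: "space (aug_filt M X t) = space M"
  unfolding aug_filt_def
  using sets.sets_into_space[of _ "nat_filt M X t"] sets.sets_into_space[of _ M]
  by (intro space_measure_of) auto

lemma sets_aug_filt:
  "sets (aug_filt M X t) = sigma_sets (space M) (sets (nat_filt M X t) \<union> null_sets M)"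
  unfolding aug_filt_def
  using sets.sets_into_space[of _ "nat_filt M X t"] sets.sets_into_space[of _ M]
  by (intro sets_measure_of) auto

lemma aug_filt_mono: "s \<le> t \<Longrightarrow> sets (aug_filt M X s) \<subseteq> sets (aug_filt M X t)"
  unfolding sets_aug_filt using nat_filt_mono[of s t M X] by (intro sigma_sets_mono') auto

lemma nat_filt_le_aug_filt: "sets (nat_filt M X t) \<subseteq> sets (aug_filt M X t)"
  unfolding sets_aug_filt by auto

lemma null_sets_aug_filt: "N \<in> null_sets M \<Longrightarrow> N \<in> sets (aug_filt M X t)"
  unfolding sets_aug_filt by auto

lemma sets_aug_filt_le:
  "sets (nat_filt M X t) \<subseteq> sets M \<Longrightarrow> sets (aug_filt M X t) \<subseteq> sets M"
  unfolding sets_aug_filt by (intro sets.sigma_sets_subset) auto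

text \<open>The sets with this property form a sigma-algebra containing the natural filtration and
  the null sets. Independence and representability thereby pass from the natural to the augmented
  filtration.\<close>

lemma aug_filt_AE_eq_nat_filt:
  assumes "A \<in> sets (aug_filt M X t)"
  shows "\<exists>B\<in>sets (nat_filt M X t). AE \<omega> in M. \<omega> \<in> A \<longleftrightarrow> \<omega> \<in> B"
  using assms unfolding sets_aug_filt
proof (induction rule: sigma_sets.induct)
  case (Basic a)
  then show ?case
  proof
    assume "a \<in> null_sets M"
    then show ?thesis by (intro bexI[of _ "{}"]) (auto dest: AE_not_in)
  qed auto
next
  case Empty
  show ?case by (intro bexI[of _ "{}"]) auto
next
  case (Compl a)
  then obtain B where B: "B \<in> sets (nat_filt M X t)" "AE \<omega> in M. \<omega> \<in> a \<longleftrightarrow> \<omega> \<in> B" by auto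
  have "space M - B \<in> sets (nat_filt M X t)" using sets.compl_sets[OF B(1)] by simp
  then show ?case using B(2) by (intro bexI[of _ "space M - B"]) auto
next
  case (Union a)
  then obtain B where B: "\<And>i. B i \<in> sets (nat_filt M X t)" "\<And>i. AE \<omega> in M. \<omega> \<in> a i \<longleftrightarrow> \<omega> \<in> B i"
    by metis
  have "AE \<omega> in M. \<forall>i::nat. \<omega> \<in> a i \<longleftrightarrow> \<omega> \<in> B i" using B(2) by (simp add: AE_all_countable)
  then show ?case using B(1) by (intro bexI[of _ "\<Union>i. B i"]) (auto elim!: eventually_mono)
qed

section \<open>Moments of the centred Gaussian law in the plane\<close>

definition gauss :: "real \<Rightarrow> real measure" where
  "gauss d = density lborel (\<lambda>x. ennreal (normal_density 0 (sqrt d) x))"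

definition gauss2 :: "real \<Rightarrow> (real \<times> real) measure" where
  "gauss2 d = gauss d \<Otimes>\<^sub>M gauss d"

lemma sets_gauss[simp, measurable_cong]: "sets (gauss d) = sets borel"
  by (simp add: gauss_def)

lemma space_gauss[simp]: "space (gauss d) = UNIV"
  by (simp add: gauss_def)

lemma sets_gauss2[simp, measurable_cong]: "sets (gauss2 d) = sets (borel \<Otimes>\<^sub>M borel)"
  unfolding gauss2_def by (intro sets_pair_measure_cong) simp_all

lemma space_gauss2[simp]: "space (gauss2 d) = UNIV"
  by (simp add: gauss2_def space_pair_measure)

lemma prob_space_gauss: "d > 0 \<Longrightarrow> prob_space (gauss d)"
  unfolding gauss_def by (rule prob_space_normal_density) simp

lemma prob_space_gauss2: "d > 0 \<Longrightarrow> prob_space (gauss2 d)"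
proof -
  assume "d > 0"
  then interpret prob_space "gauss d" by (rule prob_space_gauss)
  interpret pair_prob_space "gauss d" "gauss d" ..
  show ?thesis unfolding gauss2_def by (rule prob_space_axioms)
qed

lemma gauss_moments:
  assumes "d > 0"
  shows "has_bochner_integral (gauss d) (\<lambda>x. x) 0"
    and "has_bochner_integral (gauss d) (\<lambda>x. x\<^sup>2) d"
    and "has_bochner_integral (gauss d) (\<lambda>x. x^4) (3 * d\<^sup>2)"
proof -
  have *: "has_bochner_integral (gauss d) f c"
    if "has_bochner_integral lborel (\<lambda>x. normal_density 0 (sqrt d) x * f x) c" "f \<in> borel_measurable borel" for f c
    unfolding gauss_def using that
    by (intro has_bochner_integral_density) (auto simp: assms less_imp_le)
  have s: "0 < sqrt d" using assms by simp
  show "has_bochner_integral (gauss d) (\<lambda>x. x) 0"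
    using normal_moment_odd[OF s, of 0 0] by (intro *) auto
  show "has_bochner_integral (gauss d) (\<lambda>x. x\<^sup>2) d"
    using normal_moment_even[OF s, of 0 1] assms by (intro *) (auto simp: fact_numeral field_simps power2_eq_square)
  show "has_bochner_integral (gauss d) (\<lambda>x. x^4) (3 * d\<^sup>2)"
    using normal_moment_even[OF s, of 0 2] assms
    by (intro *) (auto simp: fact_numeral field_simps power2_eq_square)
qed

lemma has_bochner_integral_gauss2_mult:
  assumes d: "d > 0" and f: "has_bochner_integral (gauss d) f a" and g: "has_bochner_integral (gauss d) g b"
  shows "has_bochner_integral (gauss2 d) (\<lambda>y. f (fst y) * g (snd y)) (a * b :: real)"
proof -
  interpret prob_space "gauss d" using d by (rule prob_space_gauss)
  interpret P: pair_sigma_finite "gauss d" "gauss d" ..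
  have fg: "integrable (gauss d) f" "integrable (gauss d) g" using f g by (auto simp: has_bochner_integral_iff)
  have m[measurable]: "f \<in> borel_measurable borel" "g \<in> borel_measurable borel"
    using borel_measurable_integrable[OF fg(1)] borel_measurable_integrable[OF fg(2)]
    by (simp_all cong: measurable_cong_sets)
  have i: "integrable (gauss d \<Otimes>\<^sub>M gauss d) (\<lambda>y. f (fst y) * g (snd y))"
  proof (rule P.Fubini_integrable)
    show "(\<lambda>y. f (fst y) * g (snd y)) \<in> borel_measurable (gauss d \<Otimes>\<^sub>M gauss d)" by measurable
    show "integrable (gauss d) (\<lambda>x. \<integral>y. norm (f (fst (x, y)) * g (snd (x, y))) \<partial>gauss d)"
      using fg by (simp add: abs_mult)
    show "AE x in gauss d. integrable (gauss d) (\<lambda>y. f (fst (x, y)) * g (snd (x, y)))"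
      using fg by simp
  qed
  then have "integral\<^sup>L (gauss d \<Otimes>\<^sub>M gauss d) (\<lambda>y. f (fst y) * g (snd y)) = (\<integral>x. \<integral>y. f x * g y \<partial>gauss d \<partial>gauss d)"
    using P.integral_fst'[OF i] by simp
  also have "\<dots> = a * b" using f g by (simp add: has_bochner_integral_iff)
  finally show ?thesis using i unfolding gauss2_def by (simp add: has_bochner_integral_iff)
qed

text \<open>The second moments give the isometry. The fourth moment, \<open>3 + 2 + 3\<close> times
  \<open>d^2\<close>, bounds the squared second-order Taylor remainder of a heat step.\<close>

lemma gauss2_moments:
  assumes d: "d > 0"
  shows "has_bochner_integral (gauss2 d) (\<lambda>y. fst y) 0"
    and "has_bochner_integral (gauss2 d) (\<lambda>y. snd y) 0"
    and "has_bochner_integral (gauss2 d) (\<lambda>y. (fst y)\<^sup>2) d"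
    and "has_bochner_integral (gauss2 d) (\<lambda>y. (snd y)\<^sup>2) d"
    and "has_bochner_integral (gauss2 d) (\<lambda>y. fst y * snd y) 0"
    and "has_bochner_integral (gauss2 d) (\<lambda>y. (norm y)^2) (2 * d)"
    and "has_bochner_integral (gauss2 d) (\<lambda>y. (norm y)^4) (8 * d\<^sup>2)"
proof -
  interpret prob_space "gauss d" using d by (rule prob_space_gauss)
  have 1: "has_bochner_integral (gauss d) (\<lambda>x. 1::real) 1"
    using prob_space by (simp add: has_bochner_integral_iff)
  note m = has_bochner_integral_gauss2_mult[OF d]
  note g = gauss_moments[OF d]
  show "has_bochner_integral (gauss2 d) (\<lambda>y. fst y) 0" using m[OF g(1) 1] by simp
  show "has_bochner_integral (gauss2 d) (\<lambda>y. snd y) 0" using m[OF 1 g(1)] by simp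
  show a: "has_bochner_integral (gauss2 d) (\<lambda>y. (fst y)\<^sup>2) d" using m[OF g(2) 1] by simp
  show b: "has_bochner_integral (gauss2 d) (\<lambda>y. (snd y)\<^sup>2) d" using m[OF 1 g(2)] by simp
  show "has_bochner_integral (gauss2 d) (\<lambda>y. fst y * snd y) 0" using m[OF g(1) g(1)] by simp
  show "has_bochner_integral (gauss2 d) (\<lambda>y. (norm y)^2) (2 * d)"
    using has_bochner_integral_add[OF a b] by (simp add: norm_prod_def)
  have "has_bochner_integral (gauss2 d) (\<lambda>y. fst y ^ 4 * 1 + (2 * ((fst y)\<^sup>2 * (snd y)\<^sup>2) + 1 * (snd y) ^ 4))
    (3 * d\<^sup>2 * 1 + (2 * (d * d) + 1 * (3 * d\<^sup>2)))"
    by (intro has_bochner_integral_add m[OF g(3) 1] m[OF 1 g(3)] has_bochner_integral_mult_right m[OF g(2) g(2)])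
  also have "(\<lambda>y. fst y ^ 4 * 1 + (2 * ((fst y)\<^sup>2 * (snd y)\<^sup>2) + 1 * (snd y) ^ 4)) = (\<lambda>y::real\<times>real. (norm y) ^ 4)"
  proof
    fix y :: "real \<times> real"
    have "(norm y) ^ 4 = ((norm y)\<^sup>2)\<^sup>2" by (simp add: power_mult[symmetric])
    then show "fst y ^ 4 * 1 + (2 * ((fst y)\<^sup>2 * (snd y)\<^sup>2) + 1 * (snd y) ^ 4) = (norm y) ^ 4"
      by (simp add: norm_prod_def power2_eq_square algebra_simps power4_eq_xxxx)
  qed
  finally show "has_bochner_integral (gauss2 d) (\<lambda>y. (norm y)^4) (8 * d\<^sup>2)"
    by (simp add: power2_eq_square)
qed

section \<open>Independent Gaussian increments over the augmented filtration\<close>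

locale wiener_pair = prob_space M + complete_measure M for M :: "'w measure" +
  fixes T :: real and W1 W2 :: "real \<Rightarrow> 'w \<Rightarrow> real"
  assumes T_pos: "T > 0" and wiener: "wiener2 M T W1 W2"
begin

abbreviation Fl :: "real \<Rightarrow> 'w measure" where "Fl \<equiv> wiener_filt M W1 W2"

definition dW :: "real \<Rightarrow> real \<Rightarrow> 'w \<Rightarrow> real \<times> real" where
  "dW s t \<omega> = (W1 t \<omega> - W1 s \<omega>, W2 t \<omega> - W2 s \<omega>)"

lemma W_measurable: "0 \<le> t \<Longrightarrow> t \<le> T \<Longrightarrow> W1 t \<in> borel_measurable M" "0 \<le> t \<Longrightarrow> t \<le> T \<Longrightarrow> W2 t \<in> borel_measurable M"
  using wiener unfolding wiener2_def by auto

lemma AE_W_continuous: "AE \<omega> in M. continuous_on {0..T} (\<lambda>t. W1 t \<omega>) \<and> continuous_on {0..T} (\<lambda>t. W2 t \<omega>)"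
  using wiener unfolding wiener2_def by auto

lemma AE_W_zero: "AE \<omega> in M. W1 0 \<omega> = 0 \<and> W2 0 \<omega> = 0"
  using wiener unfolding wiener2_def by auto

lemma sets_Fl_le: "t \<le> T \<Longrightarrow> sets (Fl t) \<subseteq> sets M"
  using W_measurable by (intro sets_aug_filt_le sets_nat_filt_le) auto

lemma subalgebra_Fl: "t \<le> T \<Longrightarrow> subalgebra M (Fl t)"
  using sets_Fl_le by (simp add: subalgebra_def)

lemma Fl_mono: "s \<le> t \<Longrightarrow> sets (Fl s) \<subseteq> sets (Fl t)"
  by (rule aug_filt_mono)

lemma subalgebra_Fl_mono: "s \<le> t \<Longrightarrow> subalgebra (Fl t) (Fl s)"
  using Fl_mono by (simp add: subalgebra_def)

lemma measurable_Fl_M: "f \<in> measurable (Fl t) N \<Longrightarrow> t \<le> T \<Longrightarrow> f \<in> measurable M N"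
  using measurable_from_subalg[OF subalgebra_Fl] by blast

lemma measurable_Fl_mono: "f \<in> measurable (Fl s) N \<Longrightarrow> s \<le> t \<Longrightarrow> f \<in> measurable (Fl t) N"
  using measurable_from_subalg[OF subalgebra_Fl_mono] by blast

lemma W_pair_measurable_Fl:
  assumes "0 \<le> s" "s \<le> t" shows "(\<lambda>\<omega>. (W1 s \<omega>, W2 s \<omega>)) \<in> borel_measurable (Fl t)"
  using nat_filt_measurable[OF assms, of "\<lambda>t \<omega>. (W1 t \<omega>, W2 t \<omega>)" M] nat_filt_le_aug_filt
  by (force simp: measurable_def)

lemma W_measurable_Fl:
  assumes "0 \<le> s" "s \<le> t"
  shows "W1 s \<in> borel_measurable (Fl t)" "W2 s \<in> borel_measurable (Fl t)"
proof -
  note [measurable] = W_pair_measurable_Fl[OF assms]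
  have "(\<lambda>\<omega>. fst (W1 s \<omega>, W2 s \<omega>)) \<in> borel_measurable (Fl t)"
    "(\<lambda>\<omega>. snd (W1 s \<omega>, W2 s \<omega>)) \<in> borel_measurable (Fl t)"
    using measurable_compose[OF W_pair_measurable_Fl[OF assms], of fst borel]
      measurable_compose[OF W_pair_measurable_Fl[OF assms], of snd borel] by (simp_all add: borel_prod[symmetric])
  then show "W1 s \<in> borel_measurable (Fl t)" "W2 s \<in> borel_measurable (Fl t)" by simp_all
qed

lemma sets_nat_filt_W1_le: "sets (nat_filt M W1 t) \<subseteq> sets (Fl t)"
  using W_measurable_Fl by (intro sets_nat_filt_le) auto

lemma dW_measurable_Fl:
  assumes "0 \<le> s" "s \<le> r" "0 \<le> t" "t \<le> r"
  shows "dW s t \<in> measurable (Fl r) (borel \<Otimes>\<^sub>M borel)"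
  using W_measurable_Fl[OF assms(1,2)] W_measurable_Fl[OF assms(3,4)]
  unfolding dW_def by measurable

lemma distr_dW:
  "0 \<le> s \<Longrightarrow> s < t \<Longrightarrow> t \<le> T \<Longrightarrow> distr M (borel \<Otimes>\<^sub>M borel) (dW s t) = gauss2 (t - s)"
  using wiener unfolding wiener2_def dW_def gauss2_def gauss_def by auto

text \<open>The Wiener property speaks of the natural filtration only; \<open>A\<close> is replaced
  by a natural event that differs from it by a null set.\<close>

lemma indep_Fl_dW:
  assumes st: "0 \<le> s" "s < t" "t \<le> T" and A: "A \<in> sets (Fl s)" and B: "B \<in> sets (borel \<Otimes>\<^sub>M borel)"
  shows "prob (A \<inter> (dW s t -` B \<inter> space M)) = prob A * prob (dW s t -` B \<inter> space M)"
proof -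
  obtain A' where A': "A' \<in> sets (nat_filt M (\<lambda>t \<omega>. (W1 t \<omega>, W2 t \<omega>)) s)" and AE: "AE \<omega> in M. \<omega> \<in> A \<longleftrightarrow> \<omega> \<in> A'"
    using aug_filt_AE_eq_nat_filt[OF A] by blast
  have m: "A \<in> sets M" "A' \<in> sets M"
    using A A' sets_Fl_le[of s] nat_filt_le_aug_filt[of M "\<lambda>t \<omega>. (W1 t \<omega>, W2 t \<omega>)" s] st by auto
  have [measurable]: "dW s t -` B \<inter> space M \<in> sets M"
    using measurable_sets[OF measurable_Fl_M[OF dW_measurable_Fl[of s t t]], of B] st B by simp
  have "indep_set (sets (nat_filt M (\<lambda>t \<omega>. (W1 t \<omega>, W2 t \<omega>)) s)) {dW s t -` B \<inter> space M | B. B \<in> sets borel}"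
    using wiener st unfolding wiener2_def dW_def by auto
  moreover have "B \<in> sets borel" using B by (metis borel_prod)
  ultimately have "prob (A' \<inter> (dW s t -` B \<inter> space M)) = prob A' * prob (dW s t -` B \<inter> space M)"
    using indep_setD[OF _ A', of _ "dW s t -` B \<inter> space M"] by blast
  moreover have "prob A = prob A'" using AE m by (rule measure_eq_AE)
  moreover have "prob (A \<inter> (dW s t -` B \<inter> space M)) = prob (A' \<inter> (dW s t -` B \<inter> space M))"
    using AE m by (intro measure_eq_AE) auto
  ultimately show ?thesis by simp
qed

text \<open>Independence gives the product formula on rectangles, and these determine the product
  measure.\<close>

lemma distr_pair_dW:
  assumes st: "0 \<le> s" "s < t" "t \<le> T" and U: "U \<in> measurable (Fl s) S"
  shows "distr M (S \<Otimes>\<^sub>M (borel \<Otimes>\<^sub>M borel)) (\<lambda>\<omega>. (U \<omega>, dW s t \<omega>)) = distr M S U \<Otimes>\<^sub>M gauss2 (t - s)"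
proof -
  have UM[measurable]: "U \<in> measurable M S" using measurable_Fl_M[OF U] st by simp
  have DM[measurable]: "dW s t \<in> measurable M (borel \<Otimes>\<^sub>M borel)"
    using measurable_Fl_M[OF dW_measurable_Fl[of s t t]] st by simp
  interpret X: prob_space "distr M S U" by (rule prob_space_distr) fact
  interpret Y: prob_space "gauss2 (t - s)" using st by (intro prob_space_gauss2) simp
  show ?thesis
  proof (rule pair_measure_eqI[symmetric])
    fix A B assume "A \<in> sets (distr M S U)" and "B \<in> sets (gauss2 (t - s))"
    then have A: "A \<in> sets S" and B: "B \<in> sets (borel \<Otimes>\<^sub>M borel)" by auto
    have "emeasure (distr M (S \<Otimes>\<^sub>M (borel \<Otimes>\<^sub>M borel)) (\<lambda>\<omega>. (U \<omega>, dW s t \<omega>))) (A \<times> B)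
        = emeasure M ((U -` A \<inter> space M) \<inter> (dW s t -` B \<inter> space M))"
      using A B by (subst emeasure_distr) (auto intro!: arg_cong[where f="emeasure M"])
    also have "\<dots> = emeasure M (U -` A \<inter> space M) * emeasure M (dW s t -` B \<inter> space M)"
      using indep_Fl_dW[OF st measurable_sets[OF U A], of B] B
      by (simp add: emeasure_eq_measure ennreal_mult)
    also have "\<dots> = emeasure (distr M S U) A * emeasure (gauss2 (t - s)) B"
      using A B by (simp add: distr_dW[OF st, symmetric] emeasure_distr)
    finally show "emeasure (distr M S U) A * emeasure (gauss2 (t - s)) B =
      emeasure (distr M (S \<Otimes>\<^sub>M (borel \<Otimes>\<^sub>M borel)) (\<lambda>\<omega>. (U \<omega>, dW s t \<omega>))) (A \<times> B)" by simp
  qed (unfold_locales, auto cong: sets_pair_measure_cong)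
qed

text \<open>The past \<open>U\<close> is held constant while the independent increment is integrated
  out. This takes the place of conditioning on \<open>Fl s\<close>.\<close>

lemma nn_integral_freeze:
  assumes st: "0 \<le> s" "s < t" "t \<le> T" and U: "U \<in> measurable (Fl s) S"
    and f[measurable]: "f \<in> borel_measurable (S \<Otimes>\<^sub>M (borel \<Otimes>\<^sub>M borel))"
  shows "(\<integral>\<^sup>+\<omega>. f (U \<omega>, dW s t \<omega>) \<partial>M) = (\<integral>\<^sup>+\<omega>. \<integral>\<^sup>+y. f (U \<omega>, y) \<partial>gauss2 (t - s) \<partial>M)"
proof -
  have UM[measurable]: "U \<in> measurable M S" using measurable_Fl_M[OF U] st by simp
  have DM[measurable]: "dW s t \<in> measurable M (borel \<Otimes>\<^sub>M borel)"
    using measurable_Fl_M[OF dW_measurable_Fl[of s t t]] st by simp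
  interpret Y: prob_space "gauss2 (t - s)" using st by (intro prob_space_gauss2) simp
  have "(\<integral>\<^sup>+\<omega>. f (U \<omega>, dW s t \<omega>) \<partial>M) = (\<integral>\<^sup>+x. f x \<partial>(distr M S U \<Otimes>\<^sub>M gauss2 (t - s)))"
    unfolding distr_pair_dW[OF st U, symmetric] by (subst nn_integral_distr) auto
  also have "\<dots> = (\<integral>\<^sup>+x. \<integral>\<^sup>+y. f (x, y) \<partial>gauss2 (t - s) \<partial>distr M S U)"
    by (rule Y.nn_integral_fst[symmetric]) simp
  also have "\<dots> = (\<integral>\<^sup>+\<omega>. \<integral>\<^sup>+y. f (U \<omega>, y) \<partial>gauss2 (t - s) \<partial>M)"
    by (rule nn_integral_distr) auto
  finally show ?thesis .
qed

lemma integral_freeze: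
  fixes f :: "'s \<times> real \<times> real \<Rightarrow> 'b::{banach, second_countable_topology}"
  assumes st: "0 \<le> s" "s < t" "t \<le> T" and U: "U \<in> measurable (Fl s) S"
    and f[measurable]: "f \<in> borel_measurable (S \<Otimes>\<^sub>M (borel \<Otimes>\<^sub>M borel))"
    and i: "integrable M (\<lambda>\<omega>. f (U \<omega>, dW s t \<omega>))"
  shows "(\<integral>\<omega>. f (U \<omega>, dW s t \<omega>) \<partial>M) = (\<integral>\<omega>. (\<integral>y. f (U \<omega>, y) \<partial>gauss2 (t - s)) \<partial>M)"
proof -
  have UM[measurable]: "U \<in> measurable M S" using measurable_Fl_M[OF U] st by simp
  have DM[measurable]: "dW s t \<in> measurable M (borel \<Otimes>\<^sub>M borel)"
    using measurable_Fl_M[OF dW_measurable_Fl[of s t t]] st by simp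
  interpret X: prob_space "distr M S U" by (rule prob_space_distr) fact
  interpret Y: prob_space "gauss2 (t - s)" using st by (intro prob_space_gauss2) simp
  interpret P: pair_sigma_finite "distr M S U" "gauss2 (t - s)" ..
  have i': "integrable (distr M S U \<Otimes>\<^sub>M gauss2 (t - s)) f"
    using i unfolding distr_pair_dW[OF st U, symmetric] by (subst integrable_distr_eq) auto
  have "(\<integral>\<omega>. f (U \<omega>, dW s t \<omega>) \<partial>M) = (\<integral>x. f x \<partial>(distr M S U \<Otimes>\<^sub>M gauss2 (t - s)))"
    unfolding distr_pair_dW[OF st U, symmetric] by (subst integral_distr) auto
  also have "\<dots> = (\<integral>x. \<integral>y. f (x, y) \<partial>gauss2 (t - s) \<partial>distr M S U)"
    by (rule P.integral_fst'[OF i', symmetric])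
  also have "\<dots> = (\<integral>\<omega>. \<integral>y. f (U \<omega>, y) \<partial>gauss2 (t - s) \<partial>M)"
    by (rule integral_distr) auto
  finally show ?thesis .
qed

text \<open>With the coefficients frozen at \<open>(a, b)\<close> only the pure second moments
  survive, because the two coordinates of the increment are uncorrelated. This is the isometry for
  one cell, for both integrators at once.\<close>

lemma nn2_increment:
  fixes x y :: "'w \<Rightarrow> 'b::euclidean_space"
  assumes st: "0 \<le> s" "s < t" "t \<le> T" and x[measurable]: "x \<in> borel_measurable (Fl s)" and y[measurable]: "y \<in> borel_measurable (Fl s)"
  shows "nn2 M (\<lambda>\<omega>. (W1 t \<omega> - W1 s \<omega>) *\<^sub>R x \<omega> + (W2 t \<omega> - W2 s \<omega>) *\<^sub>R y \<omega>) =
    ennreal (t - s) * (nn2 M x + nn2 M y)"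
proof -
  have [measurable]: "x \<in> borel_measurable M" "y \<in> borel_measurable M"
    using measurable_Fl_M[OF x] measurable_Fl_M[OF y] st by auto
  define f :: "('b \<times> 'b) \<times> real \<times> real \<Rightarrow> ennreal" where
    "f = (\<lambda>(u, w). ennreal ((norm (fst w *\<^sub>R fst u + snd w *\<^sub>R snd u))\<^sup>2))"
  have [measurable]: "f \<in> borel_measurable ((borel \<Otimes>\<^sub>M borel) \<Otimes>\<^sub>M (borel \<Otimes>\<^sub>M borel))"
    unfolding f_def by measurable
  have inner: "(\<integral>\<^sup>+w. f ((a, b), w) \<partial>gauss2 (t - s)) = ennreal (t - s) * (ennreal ((norm a)\<^sup>2) + ennreal ((norm b)\<^sup>2))" for a b
  proof -
    have d: "t - s > 0" using st by simp
    note m = gauss2_moments[OF d]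
    have "has_bochner_integral (gauss2 (t - s)) (\<lambda>w. (fst w)\<^sup>2 * (a \<bullet> a) + ((fst w * snd w) * (2 * (a \<bullet> b)) + (snd w)\<^sup>2 * (b \<bullet> b)))
      ((t - s) * (a \<bullet> a) + (0 * (2 * (a \<bullet> b)) + (t - s) * (b \<bullet> b)))"
      by (intro has_bochner_integral_add has_bochner_integral_mult_left m)
    also have "(\<lambda>w. (fst w)\<^sup>2 * (a \<bullet> a) + ((fst w * snd w) * (2 * (a \<bullet> b)) + (snd w)\<^sup>2 * (b \<bullet> b)))
      = (\<lambda>w. (norm (fst w *\<^sub>R a + snd w *\<^sub>R b))\<^sup>2)"
      by (simp only: power2_norm_eq_inner)
        (simp add: algebra_simps inner_add_left inner_add_right inner_commute power2_eq_square fun_eq_iff)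
    finally have h: "has_bochner_integral (gauss2 (t - s)) (\<lambda>w. (norm (fst w *\<^sub>R a + snd w *\<^sub>R b))\<^sup>2)
      ((t - s) * ((norm a)\<^sup>2 + (norm b)\<^sup>2))"
      by (simp add: power2_norm_eq_inner distrib_left)
    have "(\<integral>\<^sup>+w. f ((a, b), w) \<partial>gauss2 (t - s)) = ennreal ((t - s) * ((norm a)\<^sup>2 + (norm b)\<^sup>2))"
      unfolding f_def using h by (simp add: nn_integral_eq_integral has_bochner_integral_iff)
    also have "\<dots> = ennreal (t - s) * (ennreal ((norm a)\<^sup>2) + ennreal ((norm b)\<^sup>2))"
      using d by (simp add: ennreal_mult)
    finally show ?thesis .
  qed
  have "nn2 M (\<lambda>\<omega>. (W1 t \<omega> - W1 s \<omega>) *\<^sub>R x \<omega> + (W2 t \<omega> - W2 s \<omega>) *\<^sub>R y \<omega>) = (\<integral>\<^sup>+\<omega>. f ((x \<omega>, y \<omega>), dW s t \<omega>) \<partial>M)"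
    by (simp add: nn2_def f_def dW_def)
  also have "\<dots> = (\<integral>\<^sup>+\<omega>. \<integral>\<^sup>+w. f ((x \<omega>, y \<omega>), w) \<partial>gauss2 (t - s) \<partial>M)"
    by (rule nn_integral_freeze[OF st, of "\<lambda>\<omega>. (x \<omega>, y \<omega>)" "borel \<Otimes>\<^sub>M borel"]) auto
  also have "\<dots> = ennreal (t - s) * (nn2 M x + nn2 M y)"
    unfolding inner nn2_def by (simp add: nn_integral_cmult nn_integral_add)
  finally show ?thesis .
qed

lemma sq_int_increment:
  fixes x y :: "'w \<Rightarrow> 'b::euclidean_space"
  assumes st: "0 \<le> s" "s < t" "t \<le> T" and "x \<in> borel_measurable (Fl s)" "y \<in> borel_measurable (Fl s)"
    and "sq_int M x" "sq_int M y"
  shows "sq_int M (\<lambda>\<omega>. (W1 t \<omega> - W1 s \<omega>) *\<^sub>R x \<omega> + (W2 t \<omega> - W2 s \<omega>) *\<^sub>R y \<omega>)"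
proof (rule sq_intI)
  have [measurable]: "W1 s \<in> borel_measurable M" "W1 t \<in> borel_measurable M" "W2 s \<in> borel_measurable M"
      "W2 t \<in> borel_measurable M" "x \<in> borel_measurable M" "y \<in> borel_measurable M"
    using W_measurable st assms(6,7) by (auto simp: sq_int_def)
  show "(\<lambda>\<omega>. (W1 t \<omega> - W1 s \<omega>) *\<^sub>R x \<omega> + (W2 t \<omega> - W2 s \<omega>) *\<^sub>R y \<omega>) \<in> borel_measurable M"
    by measurable
  show "nn2 M (\<lambda>\<omega>. (W1 t \<omega> - W1 s \<omega>) *\<^sub>R x \<omega> + (W2 t \<omega> - W2 s \<omega>) *\<^sub>R y \<omega>) < \<infinity>"
    unfolding nn2_increment[OF assms(1-5)] using assms(6,7) by (simp add: sq_int_def ennreal_mult_less_top)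
qed

text \<open>The increment with frozen coefficients is centred: the martingale property, in the form
  of orthogonality to the square-integrable past.\<close>

lemma integral_inner_increment:
  fixes x y z :: "'w \<Rightarrow> 'b::euclidean_space"
  assumes st: "0 \<le> s" "s < t" "t \<le> T" and m: "x \<in> borel_measurable (Fl s)" "y \<in> borel_measurable (Fl s)" "z \<in> borel_measurable (Fl s)"
    and sq: "sq_int M x" "sq_int M y" "sq_int M z"
  shows "(\<integral>\<omega>. z \<omega> \<bullet> ((W1 t \<omega> - W1 s \<omega>) *\<^sub>R x \<omega> + (W2 t \<omega> - W2 s \<omega>) *\<^sub>R y \<omega>) \<partial>M) = 0"
proof -
  note [measurable] = m
  define f :: "('b \<times> 'b \<times> 'b) \<times> real \<times> real \<Rightarrow> real" where
    "f = (\<lambda>(u, w). snd (snd u) \<bullet> (fst w *\<^sub>R fst u + snd w *\<^sub>R fst (snd u)))"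
  have [measurable]: "f \<in> borel_measurable ((borel \<Otimes>\<^sub>M (borel \<Otimes>\<^sub>M borel)) \<Otimes>\<^sub>M (borel \<Otimes>\<^sub>M borel))"
    unfolding f_def by measurable
  have "(\<integral>\<omega>. z \<omega> \<bullet> ((W1 t \<omega> - W1 s \<omega>) *\<^sub>R x \<omega> + (W2 t \<omega> - W2 s \<omega>) *\<^sub>R y \<omega>) \<partial>M) =
      (\<integral>\<omega>. f ((x \<omega>, y \<omega>, z \<omega>), dW s t \<omega>) \<partial>M)"
    by (simp add: f_def dW_def)
  also have "\<dots> = (\<integral>\<omega>. (\<integral>w. f ((x \<omega>, y \<omega>, z \<omega>), w) \<partial>gauss2 (t - s)) \<partial>M)"
  proof (rule integral_freeze[OF st, of "\<lambda>\<omega>. (x \<omega>, y \<omega>, z \<omega>)" "borel \<Otimes>\<^sub>M (borel \<Otimes>\<^sub>M borel)"])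
    show "integrable M (\<lambda>\<omega>. f ((x \<omega>, y \<omega>, z \<omega>), dW s t \<omega>))"
      using sq_int_integrable_inner[OF sq(3) sq_int_increment[OF st m(1,2) sq(1,2)]] by (simp add: f_def dW_def)
  qed auto
  also have "(\<lambda>\<omega>. (\<integral>w. f ((x \<omega>, y \<omega>, z \<omega>), w) \<partial>gauss2 (t - s))) = (\<lambda>\<omega>. 0)"
  proof
    fix \<omega>
    have d: "t - s > 0" using st by simp
    have "has_bochner_integral (gauss2 (t - s)) (\<lambda>w. fst w * (z \<omega> \<bullet> x \<omega>) + snd w * (z \<omega> \<bullet> y \<omega>)) (0 * (z \<omega> \<bullet> x \<omega>) + 0 * (z \<omega> \<bullet> y \<omega>))"
      by (intro has_bochner_integral_add has_bochner_integral_mult_left gauss2_moments[OF d])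
    then show "(\<integral>w. f ((x \<omega>, y \<omega>, z \<omega>), w) \<partial>gauss2 (t - s)) = 0"
      by (simp add: f_def inner_add_right has_bochner_integral_iff)
  qed
  finally show ?thesis by simp
qed

end

section \<open>Orthogonal increments and Doob's maximal inequality\<close>

primrec rmax :: "(nat \<Rightarrow> real) \<Rightarrow> nat \<Rightarrow> real" where
  "rmax s 0 = s 0"
| "rmax s (Suc n) = max (rmax s n) (s (Suc n))"

lemma rmax_ge: "i \<le> n \<Longrightarrow> s i \<le> rmax s n"
  by (induction n) (auto simp: le_Suc_eq)

lemma rmax_le_sum: "(\<And>i. 0 \<le> s i) \<Longrightarrow> rmax s n \<le> (\<Sum>i\<le>n. s i)"
proof (induction n)
  case (Suc n)
  moreover have "0 \<le> (\<Sum>i\<le>n. s i)" using Suc.prems by (intro sum_nonneg) auto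
  ultimately show ?case by (auto simp: max_def intro: order_trans add_increasing add_increasing2)
qed simp

lemma rmax_nonneg: "(\<And>i. 0 \<le> s i) \<Longrightarrow> 0 \<le> rmax s n"
  using rmax_ge[of 0 n s] order_trans by blast

text \<open>A deterministic form of Doob's inequality. The sum is a discrete stochastic integral of
  the running maximum; once its mean is known to be nonnegative, taking expectations leaves the two
  outer terms.\<close>

lemma doob_pathwise:
  assumes "\<And>i. 0 \<le> s i"
  shows "(rmax s n)\<^sup>2 + 4 * (\<Sum>i<n. rmax s i * (s (Suc i) - s i)) \<le> 4 * (s n)\<^sup>2"
proof -
  have "(rmax s n)\<^sup>2 + 2 * (\<Sum>i<n. rmax s i * (s (Suc i) - s i)) \<le> 2 * rmax s n * s n"
  proof (induction n)
    case (Suc n)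
    let ?m = "rmax s n" and ?s' = "s (Suc n)"
    \<comment> \<open>When a new maximum is attained, the two sides differ by the square of
      \<open>?s' - ?m\<close>; otherwise they are equal.\<close>
    have "(max ?m ?s')\<^sup>2 - ?m\<^sup>2 + 2 * ?m * ?s' \<le> 2 * max ?m ?s' * ?s'"
    proof (cases "?s' \<le> ?m")
      case False
      have "0 \<le> (?s' - ?m)\<^sup>2" by simp
      then have "?s'\<^sup>2 - ?m\<^sup>2 + 2 * ?m * ?s' \<le> 2 * ?s' * ?s'" by (simp add: power2_eq_square algebra_simps)
      then show ?thesis using False by (simp add: max_def)
    qed (simp add: max_def)
    then show ?case using Suc by (simp add: algebra_simps)
  qed (use assms in \<open>simp add: power2_eq_square\<close>)
  moreover have "2 * rmax s n * s n \<le> (rmax s n)\<^sup>2 / 2 + 2 * (s n)\<^sup>2"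
  proof -
    have "0 \<le> (rmax s n - 2 * s n)\<^sup>2 / 2" by simp
    then show ?thesis by (simp add: power2_eq_square algebra_simps)
  qed
  ultimately show ?thesis by linarith
qed

text \<open>\<open>sgn x\<close> is a subgradient of the norm at \<open>x\<close>.\<close>

lemma inner_sgn_diff_le: "sgn x \<bullet> (y - x) \<le> norm y - norm (x :: 'a::real_inner)"
proof -
  have "sgn x \<bullet> y \<le> norm (sgn x) * norm y" by (rule norm_cauchy_schwarz)
  also have "\<dots> \<le> norm y" by (simp add: norm_sgn)
  finally have "sgn x \<bullet> y \<le> norm y" .
  moreover have "sgn x \<bullet> x = norm x"
    by (cases "x = 0") (simp_all add: sgn_div_norm power2_norm_eq_inner[symmetric] power2_eq_square)
  ultimately show ?thesis by (simp add: inner_diff_right)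
qed

text \<open>Martingale differences without conditional expectations: each difference is orthogonal
  to all square-integrable functions of its past. The bound \<open>m\<close> on the indices suits
  finite partitions.\<close>

locale orthogonal_increments = prob_space M for M :: "'w measure" +
  fixes G :: "nat \<Rightarrow> 'w measure" and D :: "nat \<Rightarrow> 'w \<Rightarrow> 'b::euclidean_space" and m :: nat
  assumes sub: "\<And>i j. i \<le> j \<Longrightarrow> j \<le> m \<Longrightarrow> subalgebra (G j) (G i)"
    and D_meas: "\<And>i. i < m \<Longrightarrow> D i \<in> borel_measurable (G (Suc i))"
    and D_sq: "\<And>i. i < m \<Longrightarrow> sq_int M (D i)"
    and orth: "\<And>i Z. i < m \<Longrightarrow> Z \<in> borel_measurable (G i) \<Longrightarrow> sq_int M Z \<Longrightarrow> (\<integral>\<omega>. Z \<omega> \<bullet> D i \<omega> \<partial>M) = 0"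
begin

text \<open>Each new difference is orthogonal to everything accumulated before it, including the
  initial term \<open>Y\<close>, so Pythagoras applies one step at a time.\<close>

lemma sum_D:
  assumes "p \<le> n" "n \<le> m" and Y: "Y \<in> borel_measurable (G p)" "sq_int M Y"
  shows "(\<lambda>\<omega>. Y \<omega> + (\<Sum>i\<in>{p..<n}. D i \<omega>)) \<in> borel_measurable (G n)"
    and "sq_int M (\<lambda>\<omega>. Y \<omega> + (\<Sum>i\<in>{p..<n}. D i \<omega>))"
    and "nn2 M (\<lambda>\<omega>. Y \<omega> + (\<Sum>i\<in>{p..<n}. D i \<omega>)) = nn2 M Y + (\<Sum>i\<in>{p..<n}. nn2 M (D i))"
proof -
  have meas: "(\<lambda>\<omega>. Y \<omega> + (\<Sum>i\<in>{p..<n}. D i \<omega>)) \<in> borel_measurable (G n)" if "p \<le> n" "n \<le> m" for n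
  proof -
    have "Y \<in> borel_measurable (G n)" using measurable_from_subalg[OF sub[OF that] Y(1)] .
    moreover have "D i \<in> borel_measurable (G n)" if i: "i \<in> {p..<n}" for i
      using measurable_from_subalg[OF sub[of "Suc i" n] D_meas[of i]] i \<open>n \<le> m\<close> by auto
    ultimately show ?thesis by (intro borel_measurable_add borel_measurable_sum)
  qed
  have sq: "sq_int M (\<lambda>\<omega>. Y \<omega> + (\<Sum>i\<in>{p..<n}. D i \<omega>))" if "n \<le> m" for n
    using that by (intro sq_int_add sq_int_sum D_sq Y(2)) auto
  show "(\<lambda>\<omega>. Y \<omega> + (\<Sum>i\<in>{p..<n}. D i \<omega>)) \<in> borel_measurable (G n)" "sq_int M (\<lambda>\<omega>. Y \<omega> + (\<Sum>i\<in>{p..<n}. D i \<omega>))"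
    using assms by (auto intro: meas sq)
  show "nn2 M (\<lambda>\<omega>. Y \<omega> + (\<Sum>i\<in>{p..<n}. D i \<omega>)) = nn2 M Y + (\<Sum>i\<in>{p..<n}. nn2 M (D i))"
    using \<open>p \<le> n\<close> \<open>n \<le> m\<close>
  proof (induction n rule: dec_induct)
    case (step n)
    have "nn2 M (\<lambda>\<omega>. (Y \<omega> + (\<Sum>i\<in>{p..<n}. D i \<omega>)) + D n \<omega>)
      = nn2 M (\<lambda>\<omega>. Y \<omega> + (\<Sum>i\<in>{p..<n}. D i \<omega>)) + nn2 M (D n)"
      using step by (intro nn2_pythagoras sq D_sq orth meas) auto
    then show ?case using step by (simp add: add.assoc)
  qed simp
qed

lemma doob:
  "(\<integral>\<^sup>+\<omega>. ennreal ((rmax (\<lambda>n. norm (\<Sum>i<n. D i \<omega>)) m)\<^sup>2) \<partial>M) \<le> 4 * nn2 M (\<lambda>\<omega>. \<Sum>i<m. D i \<omega>)"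
proof -
  define X where "X n \<omega> = (\<Sum>i<n. D i \<omega>)" for n \<omega>
  define R where "R n \<omega> = rmax (\<lambda>n. norm (X n \<omega>)) n" for n \<omega>
  have X0: "X n = (\<lambda>\<omega>. 0 + (\<Sum>i\<in>{0..<n}. D i \<omega>))" for n by (auto simp: X_def atLeast0LessThan)
  have X_meas: "X n \<in> borel_measurable (G n)" and X_sq: "sq_int M (X n)" if "n \<le> m" for n
    unfolding X0 using that by (intro sum_D; simp)+
  have R_meas: "R n \<in> borel_measurable (G k)" if "n \<le> k" "k \<le> m" for n k
    using that
  proof (induction n)
    case 0
    have "X 0 \<in> borel_measurable (G k)" using measurable_from_subalg[OF sub X_meas, of 0 k] 0 by auto
    then show ?case by (simp add: R_def)
  next
    case (Suc n)
    have [measurable]: "X (Suc n) \<in> borel_measurable (G k)"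
      using measurable_from_subalg[OF sub X_meas, of "Suc n" k] Suc.prems by auto
    have [measurable]: "R n \<in> borel_measurable (G k)" using Suc by auto
    have "R (Suc n) = (\<lambda>\<omega>. max (R n \<omega>) (norm (X (Suc n) \<omega>)))" by (simp add: R_def fun_eq_iff)
    then show ?case by simp
  qed
  have R_M: "R n \<in> borel_measurable M" if "n \<le> m" for n
    using that
  proof (induction n)
    case 0
    then show ?case using X_sq[of 0] by (auto simp: R_def sq_int_def intro!: borel_measurable_norm)
  next
    case (Suc n)
    have [measurable]: "X (Suc n) \<in> borel_measurable M" "R n \<in> borel_measurable M"
      using Suc X_sq[of "Suc n"] by (auto simp: sq_int_def)
    have "R (Suc n) = (\<lambda>\<omega>. max (R n \<omega>) (norm (X (Suc n) \<omega>)))" by (simp add: R_def fun_eq_iff)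
    then show ?case by simp
  qed
  have R_nonneg: "0 \<le> R n \<omega>" for n \<omega> unfolding R_def by (rule rmax_nonneg) simp
  have R_sq: "sq_int M (R n)" if "n \<le> m" for n
  proof (rule sq_int_bound)
    show "sq_int M (\<lambda>\<omega>. \<Sum>j\<le>n. norm (X j \<omega>))"
    proof (rule sq_int_sum)
      fix j assume "j \<in> {..n}"
      then show "sq_int M (\<lambda>\<omega>. norm (X j \<omega>))" using X_sq[of j] that
        by (auto simp: sq_int_def nn2_def)
    qed
    show "AE \<omega> in M. norm (R n \<omega>) \<le> norm (\<Sum>j\<le>n. norm (X j \<omega>))"
      using R_nonneg rmax_le_sum[of "\<lambda>n. norm (X n _)" n] by (auto simp: R_def intro!: AE_I2 order_trans[OF _ abs_ge_self])
  qed (rule R_M[OF that])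
  \<comment> \<open>The adapted integrand for the pathwise inequality: by the subgradient property,
    \<open>Z i\<close> paired with \<open>D i\<close> is at most the running maximum times the
    increment of the norm, and by orthogonality its mean is zero.\<close>
  define Z where "Z n \<omega> = R n \<omega> *\<^sub>R sgn (X n \<omega>)" for n \<omega>
  have Z_meas: "Z n \<in> borel_measurable (G n)" if "n \<le> m" for n
    using R_meas[of n n] X_meas[of n] that unfolding Z_def by (auto simp: sgn_div_norm)
  have Z_sq: "sq_int M (Z n)" if "n \<le> m" for n
  proof (rule sq_int_bound[OF R_sq[OF that]])
    have [measurable]: "X n \<in> borel_measurable M" "R n \<in> borel_measurable M"
      using that X_sq[of n] R_M by (auto simp: sq_int_def)
    show "Z n \<in> borel_measurable M" unfolding Z_def sgn_div_norm by measurable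
    show "AE \<omega> in M. norm (Z n \<omega>) \<le> norm (R n \<omega>)" by (simp add: Z_def norm_sgn)
  qed
  have "(R m \<omega>)\<^sup>2 + 4 * (\<Sum>i<m. Z i \<omega> \<bullet> D i \<omega>) \<le> 4 * (norm (X m \<omega>))\<^sup>2" for \<omega>
  proof -
    have "Z i \<omega> \<bullet> D i \<omega> \<le> R i \<omega> * (norm (X (Suc i) \<omega>) - norm (X i \<omega>))" for i
    proof -
      have "sgn (X i \<omega>) \<bullet> D i \<omega> \<le> norm (X (Suc i) \<omega>) - norm (X i \<omega>)"
        using inner_sgn_diff_le[of "X i \<omega>" "X (Suc i) \<omega>"] by (simp add: X_def)
      then show ?thesis unfolding Z_def using R_nonneg by (simp add: mult_left_mono)
    qed
    then have "(\<Sum>i<m. Z i \<omega> \<bullet> D i \<omega>) \<le> (\<Sum>i<m. R i \<omega> * (norm (X (Suc i) \<omega>) - norm (X i \<omega>)))"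
      by (rule sum_mono)
    with doob_pathwise[of "\<lambda>n. norm (X n \<omega>)" m] show ?thesis by (simp add: R_def)
  qed
  moreover have i: "integrable M (\<lambda>\<omega>. Z i \<omega> \<bullet> D i \<omega>)" if "i < m" for i
    using that by (intro sq_int_integrable_inner Z_sq D_sq) auto
  moreover have R2: "integrable M (\<lambda>\<omega>. (R m \<omega>)\<^sup>2)" using sq_int_integrable_power2[OF R_sq[of m]] by simp
  moreover have "integrable M (\<lambda>\<omega>. (R m \<omega>)\<^sup>2 + 4 * (\<Sum>i<m. Z i \<omega> \<bullet> D i \<omega>))"
    by (intro Bochner_Integration.integrable_add integrable_mult_right Bochner_Integration.integrable_sum i R2) auto
  ultimately have "(\<integral>\<omega>. (R m \<omega>)\<^sup>2 + 4 * (\<Sum>i<m. Z i \<omega> \<bullet> D i \<omega>) \<partial>M) \<le> (\<integral>\<omega>. 4 * (norm (X m \<omega>))\<^sup>2 \<partial>M)"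
    using sq_int_integrable_power2[OF X_sq[of m]] by (intro integral_mono) auto
  also have "(\<integral>\<omega>. (R m \<omega>)\<^sup>2 + 4 * (\<Sum>i<m. Z i \<omega> \<bullet> D i \<omega>) \<partial>M) = (\<integral>\<omega>. (R m \<omega>)\<^sup>2 \<partial>M)"
  proof -
    have "integrable M (\<lambda>\<omega>. \<Sum>i<m. Z i \<omega> \<bullet> D i \<omega>)" by (intro Bochner_Integration.integrable_sum i) auto
    moreover have "(\<integral>\<omega>. (\<Sum>i<m. Z i \<omega> \<bullet> D i \<omega>) \<partial>M) = (\<Sum>i<m. \<integral>\<omega>. Z i \<omega> \<bullet> D i \<omega> \<partial>M)"
      by (intro Bochner_Integration.integral_sum i) auto
    moreover have "\<dots> = 0" using orth Z_meas Z_sq by (intro sum.neutral) auto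
    ultimately show ?thesis using R2 by simp
  qed
  finally have "ennreal (\<integral>\<omega>. (R m \<omega>)\<^sup>2 \<partial>M) \<le> ennreal (4 * (\<integral>\<omega>. (norm (X m \<omega>))\<^sup>2 \<partial>M))"
    by (intro ennreal_leI) simp
  then show ?thesis
    using nn2_eq_integral[OF X_sq[of m]] nn2_eq_integral[OF R_sq[of m]]
    by (simp add: ennreal_mult nn2_def R_def X_def)
qed

end

section \<open>Partitions and elementary integrals\<close>

text \<open>Unlike the times in \<open>elementary_integral\<close>, a partition covers all of [0,T],
  so that several step processes can be written over the same one.\<close>

definition part :: "real \<Rightarrow> nat \<Rightarrow> (nat \<Rightarrow> real) \<Rightarrow> bool" where
  "part T m \<tau> \<longleftrightarrow> \<tau> 0 = 0 \<and> \<tau> m = T \<and> (\<forall>i<m. \<tau> i < \<tau> (Suc i))"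

lemma incr_less:
  fixes \<tau> :: "nat \<Rightarrow> real"
  assumes "\<forall>i<m. \<tau> i < \<tau> (Suc i)" "i < j" "j \<le> m" shows "\<tau> i < \<tau> j"
  using assms(2,3)
proof (induction j)
  case (Suc j)
  then show ?case using assms(1) by (cases "i = j") (auto intro: order.strict_trans)
qed simp

lemma incr_le:
  fixes \<tau> :: "nat \<Rightarrow> real"
  assumes "\<forall>i<m. \<tau> i < \<tau> (Suc i)" "i \<le> j" "j \<le> m" shows "\<tau> i \<le> \<tau> j"
  using incr_less[OF assms(1), of i j] assms by (cases "i = j") auto

lemma part_less: "part T m \<tau> \<Longrightarrow> i < j \<Longrightarrow> j \<le> m \<Longrightarrow> \<tau> i < \<tau> j"
  unfolding part_def using incr_less by blast

lemma part_le: "part T m \<tau> \<Longrightarrow> i \<le> j \<Longrightarrow> j \<le> m \<Longrightarrow> \<tau> i \<le> \<tau> j"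
  unfolding part_def using incr_le by blast

lemma part_range: "part T m \<tau> \<Longrightarrow> i \<le> m \<Longrightarrow> 0 \<le> \<tau> i \<and> \<tau> i \<le> T"
  using part_le[of T m \<tau> 0 i] part_le[of T m \<tau> i m] by (auto simp: part_def)

text \<open>The partition lists \<open>S\<close> with both end points adjoined, sorted; distinctness
  makes the list strictly increasing.\<close>

lemma part_exists:
  assumes "finite S" "S \<subseteq> {0..T}" "T > 0"
  shows "\<exists>m \<tau>. part T m \<tau> \<and> S \<subseteq> \<tau> ` {..m}"
proof -
  define A where "A = insert 0 (insert T S)"
  define xs where "xs = sorted_list_of_set A"
  have A: "finite A" "A \<subseteq> {0..T}" "0 \<in> A" "T \<in> A" using assms by (auto simp: A_def)
  then have xs: "set xs = A" "sorted xs" "distinct xs" "xs \<noteq> []"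
    by (auto simp: xs_def sorted_list_of_set_eq_Nil_iff)
  let ?m = "length xs - 1"
  have len: "0 < length xs" using xs by simp
  have strict: "xs ! i < xs ! j" if "i < j" "j < length xs" for i j
    using sorted_wrt_nth_less[of "(<)" xs i j] xs that by (simp add: strict_sorted_iff)
  have in_A: "xs ! i \<in> A" if "i < length xs" for i using that xs(1) nth_mem by blast
  obtain i where i: "i < length xs" "xs ! i = 0" using A(3) xs(1) by (metis in_set_conv_nth)
  obtain k where k: "k < length xs" "xs ! k = T" using A(4) xs(1) by (metis in_set_conv_nth)
  have "xs ! 0 = 0"
    using strict[of 0 i] in_A[OF len] i A(2) by (cases "i = 0") force+
  moreover have "xs ! ?m = T"
    using strict[of k ?m] in_A[of ?m] k A(2) len by (cases "k = ?m") force+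
  moreover have "\<forall>i<?m. xs ! i < xs ! Suc i" using strict by simp
  moreover have "S \<subseteq> (!) xs ` {..?m}"
  proof
    fix s assume "s \<in> S"
    then have "s \<in> set xs" using xs(1) by (simp add: A_def)
    then obtain i where "i < length xs" "xs ! i = s" by (metis in_set_conv_nth)
    then show "s \<in> (!) xs ` {..?m}" by (intro image_eqI[of _ _ i]) auto
  qed
  ultimately show ?thesis unfolding part_def by (intro exI[of _ ?m] exI[of _ "(!) xs"]) auto
qed

text \<open>A coarse increment is a 0-1 combination of fine ones. Summing over every
  \<open>j < m\<close> with a weight, not over a range of indices, lets coarse and fine sums be
  interchanged later.\<close>

lemma part_telescope:
  fixes \<phi> :: "real \<Rightarrow> 'b::real_vector"
  assumes P: "part T m \<tau>" and pq: "p \<le> q" "q \<le> m"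
  shows "\<phi> (\<tau> q) - \<phi> (\<tau> p) =
    (\<Sum>j<m. of_bool (\<tau> p \<le> \<tau> j \<and> \<tau> (Suc j) \<le> \<tau> q) *\<^sub>R (\<phi> (\<tau> (Suc j)) - \<phi> (\<tau> j)))"
proof -
  have "(\<tau> p \<le> \<tau> j \<and> \<tau> (Suc j) \<le> \<tau> q) \<longleftrightarrow> j \<in> {p..<q}" if "j < m" for j
  proof
    assume "\<tau> p \<le> \<tau> j \<and> \<tau> (Suc j) \<le> \<tau> q"
    moreover have "\<not> j < p" if "\<tau> p \<le> \<tau> j" using part_less[OF P, of j p] that pq by auto
    moreover have "\<not> q < Suc j" if "\<tau> (Suc j) \<le> \<tau> q"
      using part_less[OF P, of q "Suc j"] that \<open>j < m\<close> by auto
    ultimately show "j \<in> {p..<q}" by auto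
  next
    assume "j \<in> {p..<q}"
    then show "\<tau> p \<le> \<tau> j \<and> \<tau> (Suc j) \<le> \<tau> q"
      using part_le[OF P, of p j] part_le[OF P, of "Suc j" q] pq by auto
  qed
  then have "(\<Sum>j<m. of_bool (\<tau> p \<le> \<tau> j \<and> \<tau> (Suc j) \<le> \<tau> q) *\<^sub>R (\<phi> (\<tau> (Suc j)) - \<phi> (\<tau> j)))
     = (\<Sum>j<m. if j \<in> {p..<q} then \<phi> (\<tau> (Suc j)) - \<phi> (\<tau> j) else 0)"
    by (intro sum.cong) auto
  also have "\<dots> = (\<Sum>j\<in>{..<m} \<inter> {p..<q}. \<phi> (\<tau> (Suc j)) - \<phi> (\<tau> j))"
    by (rule sum.inter_restrict[symmetric]) simp
  also have "{..<m} \<inter> {p..<q} = {p..<q}" using pq by auto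
  also have "(\<Sum>j\<in>{p..<q}. \<phi> (\<tau> (Suc j)) - \<phi> (\<tau> j)) = \<phi> (\<tau> q) - \<phi> (\<tau> p)"
    using sum_Suc_diff'[OF pq(1), of "\<lambda>j. \<phi> (\<tau> j)"] by simp
  finally show ?thesis by simp
qed

section \<open>Step processes over a common partition\<close>

definition el_proc :: "nat \<Rightarrow> (nat \<Rightarrow> real) \<Rightarrow> (nat \<Rightarrow> 'w \<Rightarrow> 'b::real_vector) \<Rightarrow> real \<Rightarrow> 'w \<Rightarrow> 'b" where
  "el_proc m \<tau> \<xi> = (\<lambda>t \<omega>. \<Sum>i<m. indicator {\<tau> i<..\<tau> (Suc i)} t *\<^sub>R \<xi> i \<omega>)"

definition el_int :: "(real \<Rightarrow> 'w \<Rightarrow> real) \<Rightarrow> nat \<Rightarrow> (nat \<Rightarrow> real) \<Rightarrow> (nat \<Rightarrow> 'w \<Rightarrow> 'b::real_vector) \<Rightarrow> real \<Rightarrow> 'w \<Rightarrow> 'b" where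
  "el_int W m \<tau> \<xi> = (\<lambda>t \<omega>. \<Sum>i<m. (W (min t (\<tau> (Suc i))) \<omega> - W (min t (\<tau> i)) \<omega>) *\<^sub>R \<xi> i \<omega>)"

definition el_coef :: "'w measure \<Rightarrow> (real \<Rightarrow> 'w measure) \<Rightarrow> nat \<Rightarrow> (nat \<Rightarrow> real) \<Rightarrow> (nat \<Rightarrow> 'w \<Rightarrow> 'b::real_normed_vector) \<Rightarrow> bool" where
  "el_coef M F m \<tau> \<xi> \<longleftrightarrow> (\<forall>i<m. \<xi> i \<in> borel_measurable (F (\<tau> i)) \<and> (\<exists>C. \<forall>\<omega>\<in>space M. norm (\<xi> i \<omega>) \<le> C))"

lemma elementary_integral_part:
  "part T m \<tau> \<Longrightarrow> el_coef M F m \<tau> \<xi> \<Longrightarrow> elementary_integral M F T W (el_proc m \<tau> \<xi>) (el_int W m \<tau> \<xi>)"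
  unfolding elementary_integral_def el_coef_def part_def el_proc_def el_int_def
  by (intro exI[of _ m] exI[of _ \<tau>] exI[of _ \<xi>]) auto

lemma el_int_part:
  assumes P: "part T m \<tau>" and "p \<le> m"
  shows "el_int W m \<tau> \<xi> (\<tau> p) = (\<lambda>\<omega>. \<Sum>i<p. (W (\<tau> (Suc i)) \<omega> - W (\<tau> i) \<omega>) *\<^sub>R \<xi> i \<omega>)"
proof
  fix \<omega>
  have "(W (min (\<tau> p) (\<tau> (Suc i))) \<omega> - W (min (\<tau> p) (\<tau> i)) \<omega>) *\<^sub>R \<xi> i \<omega>
     = (if i \<in> {..<p} then (W (\<tau> (Suc i)) \<omega> - W (\<tau> i) \<omega>) *\<^sub>R \<xi> i \<omega> else 0)" if "i < m" for i
    using part_le[OF P, of "Suc i" p] part_le[OF P, of i p] part_le[OF P, of p i] part_le[OF P, of p "Suc i"] that \<open>p \<le> m\<close>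
    by (auto simp: min_def)
  then have "el_int W m \<tau> \<xi> (\<tau> p) \<omega> = (\<Sum>i<m. if i \<in> {..<p} then (W (\<tau> (Suc i)) \<omega> - W (\<tau> i) \<omega>) *\<^sub>R \<xi> i \<omega> else 0)"
    unfolding el_int_def by (intro sum.cong) auto
  also have "\<dots> = (\<Sum>i\<in>{..<m} \<inter> {..<p}. (W (\<tau> (Suc i)) \<omega> - W (\<tau> i) \<omega>) *\<^sub>R \<xi> i \<omega>)"
    by (rule sum.inter_restrict[symmetric]) simp
  also have "{..<m} \<inter> {..<p} = {..<p}" using \<open>p \<le> m\<close> by auto
  finally show "el_int W m \<tau> \<xi> (\<tau> p) \<omega> = (\<Sum>i<p. (W (\<tau> (Suc i)) \<omega> - W (\<tau> i) \<omega>) *\<^sub>R \<xi> i \<omega>)" .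
qed

text \<open>\<open>S\<close> collects the break points of \<open>h\<close>; over any partition
  through them, the process and its integral are recovered with coefficients repeated on the finer
  cells. Quantifying over all such partitions lets several processes share one.\<close>

lemma elementary_refine:
  fixes h :: "real \<Rightarrow> 'w \<Rightarrow> real^'n"
  assumes E: "elementary_integral M F T W h I" and T: "T > 0"
    and F: "\<And>s t. s \<le> t \<Longrightarrow> subalgebra (F t) (F s)"
  shows "\<exists>S. finite S \<and> S \<subseteq> {0..T} \<and> (\<forall>m \<tau>. part T m \<tau> \<longrightarrow> S \<subseteq> \<tau> ` {..m} \<longrightarrow>
    (\<exists>\<xi>. el_coef M F m \<tau> \<xi> \<and> h = el_proc m \<tau> \<xi> \<and> I = el_int W m \<tau> \<xi>))"
proof -
  from E obtain m0 \<tau>0 and \<xi>0 :: "nat \<Rightarrow> 'w \<Rightarrow> real^'n" where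
    e: "0 \<le> \<tau>0 0" "\<tau>0 m0 \<le> T" "\<forall>i<m0. \<tau>0 i < \<tau>0 (Suc i)" "el_coef M F m0 \<tau>0 \<xi>0"
    "h = el_proc m0 \<tau>0 \<xi>0" "I = el_int W m0 \<tau>0 \<xi>0"
    unfolding elementary_integral_def el_coef_def el_proc_def el_int_def by auto
  define S where "S = \<tau>0 ` {..m0}"
  have "S \<subseteq> {0..T}"
    using e(1,2) incr_le[OF e(3), of 0] incr_le[OF e(3), of _ m0] by (force simp: S_def)
  moreover have "\<exists>\<xi>. el_coef M F m \<tau> \<xi> \<and> h = el_proc m \<tau> \<xi> \<and> I = el_int W m \<tau> \<xi>"
    if P: "part T m \<tau>" and S: "S \<subseteq> \<tau> ` {..m}" for m \<tau>
  proof -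
    define b where "b i j = (of_bool (\<tau>0 i \<le> \<tau> j \<and> \<tau> (Suc j) \<le> \<tau>0 (Suc i)) :: real)" for i j
    define \<xi> where "\<xi> j \<omega> = (\<Sum>i<m0. b i j *\<^sub>R \<xi>0 i \<omega>)" for j \<omega>
    have tel: "\<phi> (\<tau>0 (Suc i)) - \<phi> (\<tau>0 i) = (\<Sum>j<m. b i j * (\<phi> (\<tau> (Suc j)) - \<phi> (\<tau> j)))"
      if "i < m0" for i and \<phi> :: "real \<Rightarrow> real"
    proof -
      have "\<tau>0 i \<in> \<tau> ` {..m}" "\<tau>0 (Suc i) \<in> \<tau> ` {..m}" using S that by (auto simp: S_def)
      then obtain p q where pq: "p \<le> m" "q \<le> m" "\<tau>0 i = \<tau> p" "\<tau>0 (Suc i) = \<tau> q" by auto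
      moreover have "p \<le> q"
        using part_le[OF P, of q p] pq e(3) that by (metis nat_le_linear not_less)
      ultimately show ?thesis
        using part_telescope[OF P, of p q \<phi>] by (simp add: b_def)
    qed
    \<comment> \<open>The process and its integral are both sums of increments of a function of
      time: the truth value of \<open>t \<le> s\<close>, as a function of \<open>s\<close>, gives
      the process at \<open>t\<close>, up to sign conventions that agree on both sides, and
      \<open>W (min t s) \<omega>\<close> gives the integral.\<close>
    have tel2: "(\<Sum>i<m0. (\<phi> (\<tau>0 (Suc i)) - \<phi> (\<tau>0 i)) *\<^sub>R \<xi>0 i \<omega>) = (\<Sum>j<m. (\<phi> (\<tau> (Suc j)) - \<phi> (\<tau> j)) *\<^sub>R \<xi> j \<omega>)"
      for \<phi> :: "real \<Rightarrow> real" and \<omega>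
    proof -
      have "(\<Sum>i<m0. (\<phi> (\<tau>0 (Suc i)) - \<phi> (\<tau>0 i)) *\<^sub>R \<xi>0 i \<omega>)
        = (\<Sum>i<m0. \<Sum>j<m. (b i j * (\<phi> (\<tau> (Suc j)) - \<phi> (\<tau> j))) *\<^sub>R \<xi>0 i \<omega>)"
        by (intro sum.cong refl) (simp add: tel scaleR_sum_left)
      also have "\<dots> = (\<Sum>j<m. \<Sum>i<m0. (b i j * (\<phi> (\<tau> (Suc j)) - \<phi> (\<tau> j))) *\<^sub>R \<xi>0 i \<omega>)"
        by (rule sum.swap)
      also have "\<dots> = (\<Sum>j<m. (\<phi> (\<tau> (Suc j)) - \<phi> (\<tau> j)) *\<^sub>R \<xi> j \<omega>)"
        by (simp add: \<xi>_def scaleR_sum_right mult.commute)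
      finally show ?thesis .
    qed
    have ind: "indicator {a<..c} t = (of_bool (t \<le> c) - of_bool (t \<le> a) :: real)" if "a < c" for a c t :: real
      using that by (auto simp: indicator_def)
    have "el_coef M F m \<tau> \<xi>"
      unfolding el_coef_def
    proof (intro allI impI conjI)
      fix j assume j: "j < m"
      show "\<xi> j \<in> borel_measurable (F (\<tau> j))"
        unfolding \<xi>_def
      proof (rule borel_measurable_sum)
        fix i assume "i \<in> {..<m0}"
        then have "\<xi>0 i \<in> borel_measurable (F (\<tau>0 i))" using e(4) by (auto simp: el_coef_def)
        then show "(\<lambda>\<omega>. b i j *\<^sub>R \<xi>0 i \<omega>) \<in> borel_measurable (F (\<tau> j))"
        \<comment> \<open>A coarse cell that starts after the fine one does not contain it; its
          coefficient, possibly not yet measurable, enters with weight 0.\<close>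
        proof (cases "\<tau>0 i \<le> \<tau> j")
          case True
          show ?thesis
            using measurable_from_subalg[OF F[OF True] \<open>\<xi>0 i \<in> borel_measurable (F (\<tau>0 i))\<close>] by simp
        qed (simp add: b_def)
      qed
      obtain C where C: "\<And>i \<omega>. i < m0 \<Longrightarrow> \<omega> \<in> space M \<Longrightarrow> norm (\<xi>0 i \<omega>) \<le> C i"
        using e(4) unfolding el_coef_def by metis
      have "norm (\<xi> j \<omega>) \<le> (\<Sum>i<m0. C i)" if "\<omega> \<in> space M" for \<omega>
        unfolding \<xi>_def
      proof (rule sum_norm_le)
        fix i assume "i \<in> {..<m0}"
        then have "norm (\<xi>0 i \<omega>) \<le> C i" using C that by simp
        moreover from this have "0 \<le> C i" by (rule order_trans[rotated]) simp
        ultimately show "norm (b i j *\<^sub>R \<xi>0 i \<omega>) \<le> C i" by (auto simp: b_def)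
      qed
      then show "\<exists>C. \<forall>\<omega>\<in>space M. norm (\<xi> j \<omega>) \<le> C" by blast
    qed
    moreover have "h = el_proc m \<tau> \<xi>"
    proof (intro ext)
      fix t \<omega>
      have "h t \<omega> = (\<Sum>i<m0. (of_bool (t \<le> \<tau>0 (Suc i)) - of_bool (t \<le> \<tau>0 i)) *\<^sub>R \<xi>0 i \<omega>)"
        unfolding e(5) el_proc_def using e(3) ind by (intro sum.cong) auto
      also have "\<dots> = (\<Sum>j<m. (of_bool (t \<le> \<tau> (Suc j)) - of_bool (t \<le> \<tau> j)) *\<^sub>R \<xi> j \<omega>)"
        by (rule tel2)
      also have "\<dots> = el_proc m \<tau> \<xi> t \<omega>"
        unfolding el_proc_def using P ind by (intro sum.cong) (auto simp: part_def)
      finally show "h t \<omega> = el_proc m \<tau> \<xi> t \<omega>" .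
    qed
    moreover have "I = el_int W m \<tau> \<xi>"
    proof (intro ext)
      fix t \<omega>
      show "I t \<omega> = el_int W m \<tau> \<xi> t \<omega>"
        unfolding e(6) el_int_def by (rule tel2[of "\<lambda>s. W (min t s) \<omega>"])
    qed
    ultimately show ?thesis by blast
  qed
  ultimately show ?thesis by (intro exI[of _ S]) (auto simp: S_def)
qed

text \<open>The break points do not depend on the integrator, so \<open>W\<close> and
  \<open>W'\<close> may differ. The set \<open>S\<close> forces further times into the
  partition.\<close>

lemma elementary_common_partition:
  fixes h :: "real \<Rightarrow> 'w \<Rightarrow> real^'n" and h' :: "real \<Rightarrow> 'w \<Rightarrow> real^'n"
  assumes E: "elementary_integral M F T W h I" and E': "elementary_integral M F T W' h' I'" and T: "T > 0"
    and F: "\<And>s t. s \<le> t \<Longrightarrow> subalgebra (F t) (F s)" and S: "finite S" "S \<subseteq> {0..T}"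
  obtains m \<tau> \<xi> \<xi>' where "part T m \<tau>" "S \<subseteq> \<tau> ` {..m}" "el_coef M F m \<tau> \<xi>" "el_coef M F m \<tau> \<xi>'"
    "h = el_proc m \<tau> \<xi>" "I = el_int W m \<tau> \<xi>" "h' = el_proc m \<tau> \<xi>'" "I' = el_int W' m \<tau> \<xi>'"
proof -
  obtain S1 where S1: "finite S1" "S1 \<subseteq> {0..T}" "\<And>m \<tau>. part T m \<tau> \<Longrightarrow> S1 \<subseteq> \<tau> ` {..m} \<Longrightarrow>
    \<exists>\<xi>. el_coef M F m \<tau> \<xi> \<and> h = el_proc m \<tau> \<xi> \<and> I = el_int W m \<tau> \<xi>"
    using elementary_refine[OF E T F] by blast
  obtain S2 where S2: "finite S2" "S2 \<subseteq> {0..T}" "\<And>m \<tau>. part T m \<tau> \<Longrightarrow> S2 \<subseteq> \<tau> ` {..m} \<Longrightarrow>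
    \<exists>\<xi>. el_coef M F m \<tau> \<xi> \<and> h' = el_proc m \<tau> \<xi> \<and> I' = el_int W' m \<tau> \<xi>"
    using elementary_refine[OF E' T F] by blast
  obtain m \<tau> where P: "part T m \<tau>" "S \<union> S1 \<union> S2 \<subseteq> \<tau> ` {..m}"
    using part_exists[of "S \<union> S1 \<union> S2" T] S S1(1,2) S2(1,2) T by auto
  from S1(3)[OF P(1)] S2(3)[OF P(1)] P(2) obtain \<xi> \<xi>' where
    "el_coef M F m \<tau> \<xi> \<and> h = el_proc m \<tau> \<xi> \<and> I = el_int W m \<tau> \<xi>"
    "el_coef M F m \<tau> \<xi>' \<and> h' = el_proc m \<tau> \<xi>' \<and> I' = el_int W' m \<tau> \<xi>'" by auto
  with P show thesis by (intro that[of m \<tau> \<xi> \<xi>']) auto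
qed

lemma el_coef_lincomb:
  fixes \<xi> :: "nat \<Rightarrow> 'w \<Rightarrow> real^'n"
  assumes "el_coef M F m \<tau> \<xi>" "el_coef M F m \<tau> (\<xi>' :: nat \<Rightarrow> 'w \<Rightarrow> real^'n)"
  shows "el_coef M F m \<tau> (\<lambda>i \<omega>. a *\<^sub>R \<xi> i \<omega> + b *\<^sub>R \<xi>' i \<omega>)"
  unfolding el_coef_def
proof (intro allI impI conjI)
  fix i assume i: "i < m"
  show "(\<lambda>\<omega>. a *\<^sub>R \<xi> i \<omega> + b *\<^sub>R \<xi>' i \<omega>) \<in> borel_measurable (F (\<tau> i))"
    using assms i unfolding el_coef_def by (auto intro!: borel_measurable_add borel_measurable_scaleR)
  obtain C C' where "\<And>\<omega>. \<omega> \<in> space M \<Longrightarrow> norm (\<xi> i \<omega>) \<le> C" "\<And>\<omega>. \<omega> \<in> space M \<Longrightarrow> norm (\<xi>' i \<omega>) \<le> C'"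
    using assms i unfolding el_coef_def by metis
  then have "norm (a *\<^sub>R \<xi> i \<omega> + b *\<^sub>R \<xi>' i \<omega>) \<le> \<bar>a\<bar> * C + \<bar>b\<bar> * C'" if "\<omega> \<in> space M" for \<omega>
    using that by (intro norm_triangle_le add_mono) (auto intro!: mult_left_mono)
  then show "\<exists>C. \<forall>\<omega>\<in>space M. norm (a *\<^sub>R \<xi> i \<omega> + b *\<^sub>R \<xi>' i \<omega>) \<le> C" by blast
qed

lemma elementary_lincomb:
  fixes h :: "real \<Rightarrow> 'w \<Rightarrow> real^'n" and h' :: "real \<Rightarrow> 'w \<Rightarrow> real^'n"
  assumes E: "elementary_integral M F T W h I" and E': "elementary_integral M F T W h' I'" and T: "T > 0"
    and F: "\<And>s t. s \<le> t \<Longrightarrow> subalgebra (F t) (F s)"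
  shows "elementary_integral M F T W (\<lambda>t \<omega>. a *\<^sub>R h t \<omega> + b *\<^sub>R h' t \<omega>) (\<lambda>t \<omega>. a *\<^sub>R I t \<omega> + b *\<^sub>R I' t \<omega>)"
proof -
  obtain m \<tau> \<xi> \<xi>' where P: "part T m \<tau>" "el_coef M F m \<tau> \<xi>" "el_coef M F m \<tau> \<xi>'"
    "h = el_proc m \<tau> \<xi>" "I = el_int W m \<tau> \<xi>" "h' = el_proc m \<tau> \<xi>'" "I' = el_int W m \<tau> \<xi>'"
    using elementary_common_partition[OF E E' T F, of "{}"] by (metis empty_subsetI finite.emptyI)
  let ?\<xi> = "\<lambda>i \<omega>. a *\<^sub>R \<xi> i \<omega> + b *\<^sub>R \<xi>' i \<omega>"
  have "(\<lambda>t \<omega>. a *\<^sub>R h t \<omega> + b *\<^sub>R h' t \<omega>) = el_proc m \<tau> ?\<xi>" "(\<lambda>t \<omega>. a *\<^sub>R I t \<omega> + b *\<^sub>R I' t \<omega>) = el_int W m \<tau> ?\<xi>"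
    by (simp_all only: P el_proc_def el_int_def scaleR_sum_right sum.distrib[symmetric] scaleR_add_right scaleR_left_commute)
  then show ?thesis
    using elementary_integral_part[OF P(1) el_coef_lincomb[OF P(2,3)]] by simp
qed

lemma elementary_zero:
  "T > 0 \<Longrightarrow> elementary_integral M F T W (\<lambda>t \<omega>. 0 :: real^'n) (\<lambda>t \<omega>. 0)"
  unfolding elementary_integral_def by (intro exI[of _ 0] exI[of _ "\<lambda>i. 0"]) auto

section \<open>Ito isometry and limits of elementary integrals\<close>

definition proc_norm :: "'w measure \<Rightarrow> real \<Rightarrow> real \<Rightarrow> (real \<Rightarrow> 'w \<Rightarrow> 'b::real_normed_vector) \<Rightarrow> ennreal" where
  "proc_norm M a b h = (\<integral>\<^sup>+\<omega>. (\<integral>\<^sup>+t\<in>{a..b}. ennreal ((norm (h t \<omega>))\<^sup>2) \<partial>lborel) \<partial>M)"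

lemma norm_sum_disjoint_indicator:
  fixes x :: "'i \<Rightarrow> 'b::real_normed_vector"
  assumes "finite I" "disjoint_family_on A I"
  shows "(norm (\<Sum>i\<in>I. indicator (A i) t *\<^sub>R x i))\<^sup>2 = (\<Sum>i\<in>I. indicator (A i) t * (norm (x i))\<^sup>2)"
proof (cases "\<exists>i\<in>I. t \<in> A i")
  case True
  then obtain i where i: "i \<in> I" "t \<in> A i" by auto
  then have o: "t \<notin> A j" if "j \<in> I - {i}" for j
    using assms(2) that unfolding disjoint_family_on_def by blast
  have "(\<Sum>j\<in>I. indicator (A j) t *\<^sub>R x j) = indicator (A i) t *\<^sub>R x i + (\<Sum>j\<in>I - {i}. indicator (A j) t *\<^sub>R x j)"
    using assms(1) i(1) by (rule sum.remove)
  moreover have "(\<Sum>j\<in>I - {i}. indicator (A j) t *\<^sub>R x j) = 0" using o by (intro sum.neutral) auto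
  moreover have "(\<Sum>j\<in>I. indicator (A j) t * (norm (x j))\<^sup>2) = indicator (A i) t * (norm (x i))\<^sup>2 + (\<Sum>j\<in>I - {i}. indicator (A j) t * (norm (x j))\<^sup>2)"
    using assms(1) i(1) by (rule sum.remove)
  moreover have "(\<Sum>j\<in>I - {i}. indicator (A j) t * (norm (x j))\<^sup>2) = 0" using o by (intro sum.neutral) auto
  ultimately show ?thesis using i by simp
next
  case False
  then show ?thesis by (simp add: sum.neutral)
qed

lemma part_disjoint:
  assumes P: "part T m \<tau>" shows "disjoint_family_on (\<lambda>i. {\<tau> i<..\<tau> (Suc i)}) {..<m}"
  unfolding disjoint_family_on_def
proof (intro ballI impI)
  fix i j assume ij: "i \<in> {..<m}" "j \<in> {..<m}" "i \<noteq> j"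
  then consider "Suc i \<le> j" | "Suc j \<le> i" by linarith
  then show "{\<tau> i<..\<tau> (Suc i)} \<inter> {\<tau> j<..\<tau> (Suc j)} = {}"
    using part_le[OF P, of "Suc i" j] part_le[OF P, of "Suc j" i] ij by cases auto
qed

text \<open>On disjoint cells the squared norm of the sum is the sum of the squared norms. The lower
  end of the interval is a partition point, so each cell lies on one side of it.\<close>

lemma proc_norm_el_proc:
  fixes \<xi> :: "nat \<Rightarrow> 'w \<Rightarrow> 'b::euclidean_space"
  assumes P: "part T m \<tau>" and "p \<le> m" and \<xi>: "\<And>i. i < m \<Longrightarrow> \<xi> i \<in> borel_measurable M"
  shows "proc_norm M (\<tau> p) T (el_proc m \<tau> \<xi>) = (\<Sum>i\<in>{p..<m}. ennreal (\<tau> (Suc i) - \<tau> i) * nn2 M (\<xi> i))"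
proof -
  let ?A = "\<lambda>i. {\<tau> i<..\<tau> (Suc i)}"
  have inner: "(\<integral>\<^sup>+t\<in>{\<tau> p..T}. ennreal ((norm (el_proc m \<tau> \<xi> t \<omega>))\<^sup>2) \<partial>lborel)
     = (\<Sum>i\<in>{p..<m}. ennreal (\<tau> (Suc i) - \<tau> i) * ennreal ((norm (\<xi> i \<omega>))\<^sup>2))" for \<omega>
  proof -
    have "ennreal ((norm (el_proc m \<tau> \<xi> t \<omega>))\<^sup>2) * indicator {\<tau> p..T} t
       = (\<Sum>i<m. ennreal ((norm (\<xi> i \<omega>))\<^sup>2) * indicator (?A i \<inter> {\<tau> p..T}) t)" for t
    proof -
      have "(norm (el_proc m \<tau> \<xi> t \<omega>))\<^sup>2 = (\<Sum>i<m. indicator (?A i) t * (norm (\<xi> i \<omega>))\<^sup>2)"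
        unfolding el_proc_def by (intro norm_sum_disjoint_indicator part_disjoint[OF P]) simp
      then have "ennreal ((norm (el_proc m \<tau> \<xi> t \<omega>))\<^sup>2) = (\<Sum>i<m. ennreal (indicator (?A i) t * (norm (\<xi> i \<omega>))\<^sup>2))"
        by (subst sum_ennreal) simp_all
      also have "\<dots> = (\<Sum>i<m. ennreal ((norm (\<xi> i \<omega>))\<^sup>2) * indicator (?A i) t)"
        by (intro sum.cong refl) (auto simp: indicator_def)
      finally show ?thesis
        by (simp only: sum_distrib_right indicator_inter_arith mult.assoc)
    qed
    then have "(\<integral>\<^sup>+t\<in>{\<tau> p..T}. ennreal ((norm (el_proc m \<tau> \<xi> t \<omega>))\<^sup>2) \<partial>lborel)
      = (\<integral>\<^sup>+t. (\<Sum>i<m. ennreal ((norm (\<xi> i \<omega>))\<^sup>2) * indicator (?A i \<inter> {\<tau> p..T}) t) \<partial>lborel)"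
      by (simp only:)
    also have "\<dots> = (\<Sum>i<m. \<integral>\<^sup>+t. ennreal ((norm (\<xi> i \<omega>))\<^sup>2) * indicator (?A i \<inter> {\<tau> p..T}) t \<partial>lborel)"
      by (rule nn_integral_sum) simp
    also have "\<dots> = (\<Sum>i<m. ennreal ((norm (\<xi> i \<omega>))\<^sup>2) * emeasure lborel (?A i \<inter> {\<tau> p..T}))"
      by (intro sum.cong refl nn_integral_cmult_indicator) simp
    also have "\<dots> = (\<Sum>i<m. if i \<in> {p..<m} then ennreal (\<tau> (Suc i) - \<tau> i) * ennreal ((norm (\<xi> i \<omega>))\<^sup>2) else 0)"
    proof (intro sum.cong refl)
      fix i assume "i \<in> {..<m}"
      then have i: "i < m" by simp
      have T: "\<tau> m = T" using P by (simp add: part_def)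
      show "ennreal ((norm (\<xi> i \<omega>))\<^sup>2) * emeasure lborel (?A i \<inter> {\<tau> p..T})
        = (if i \<in> {p..<m} then ennreal (\<tau> (Suc i) - \<tau> i) * ennreal ((norm (\<xi> i \<omega>))\<^sup>2) else 0)"
      proof (cases "p \<le> i")
        case True
        then have "?A i \<inter> {\<tau> p..T} = ?A i"
          using part_le[OF P, of p i] part_le[OF P, of "Suc i" m] i T by auto
        then show ?thesis using True i part_le[OF P, of i "Suc i"] by (simp add: mult.commute)
      next
        case False
        \<comment> \<open>An earlier cell meets the interval in at most its left end point, a null
          set.\<close>
        then have "?A i \<inter> {\<tau> p..T} \<subseteq> {\<tau> p}"
          using part_le[OF P, of "Suc i" p] \<open>p \<le> m\<close> by auto
        then have "emeasure lborel (?A i \<inter> {\<tau> p..T}) \<le> emeasure lborel {\<tau> p}"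
          by (intro emeasure_mono) auto
        then show ?thesis using False by simp
      qed
    qed
    also have "\<dots> = (\<Sum>i\<in>{..<m} \<inter> {p..<m}. ennreal (\<tau> (Suc i) - \<tau> i) * ennreal ((norm (\<xi> i \<omega>))\<^sup>2))"
      by (rule sum.inter_restrict[symmetric]) simp
    also have "{..<m} \<inter> {p..<m} = {p..<m}" by auto
    finally show ?thesis .
  qed
  have "proc_norm M (\<tau> p) T (el_proc m \<tau> \<xi>) = (\<integral>\<^sup>+\<omega>. (\<Sum>i\<in>{p..<m}. ennreal (\<tau> (Suc i) - \<tau> i) * ennreal ((norm (\<xi> i \<omega>))\<^sup>2)) \<partial>M)"
    unfolding proc_norm_def inner ..
  also have "\<dots> = (\<Sum>i\<in>{p..<m}. \<integral>\<^sup>+\<omega>. ennreal (\<tau> (Suc i) - \<tau> i) * ennreal ((norm (\<xi> i \<omega>))\<^sup>2) \<partial>M)"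
    using \<xi> by (intro nn_integral_sum) (auto intro!: borel_measurable_times)
  also have "\<dots> = (\<Sum>i\<in>{p..<m}. ennreal (\<tau> (Suc i) - \<tau> i) * nn2 M (\<xi> i))"
  proof (intro sum.cong refl)
    fix i assume "i \<in> {p..<m}"
    then have [measurable]: "\<xi> i \<in> borel_measurable M" using \<xi> by simp
    show "(\<integral>\<^sup>+\<omega>. ennreal (\<tau> (Suc i) - \<tau> i) * ennreal ((norm (\<xi> i \<omega>))\<^sup>2) \<partial>M) = ennreal (\<tau> (Suc i) - \<tau> i) * nn2 M (\<xi> i)"
      unfolding nn2_def by (intro nn_integral_cmult) measurable
  qed
  finally show ?thesis .
qed

text \<open>Sublevel sets of a continuous function are closed, so a bound on a dense set extends.
  Suprema over [0,T] can thereby be controlled by countable, hence measurable, ones.\<close>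

lemma continuous_le_dense:
  fixes f :: "real \<Rightarrow> real"
  assumes "continuous_on {0..T} f" "{0..T} \<subseteq> closure D" "D \<subseteq> {0..T}"
    and le: "\<And>t. t \<in> D \<Longrightarrow> ennreal (f t) \<le> c" and t: "t \<in> {0..T}" "0 \<le> f t"
  shows "ennreal (f t) \<le> c"
proof (cases c)
  case (real r)
  have "closed ({0..T} \<inter> f -` {..r})"
    using assms(1) by (intro continuous_closed_preimage) auto
  moreover have "D \<subseteq> {0..T} \<inter> f -` {..r}"
    using le assms(3) real by (auto dest!: le simp: ennreal_le_iff)
  ultimately have "closure D \<subseteq> {0..T} \<inter> f -` {..r}" by (rule closure_minimal[rotated])
  then show ?thesis using t assms(2) real by (auto intro!: ennreal_leI)
qed simp

section \<open>Isometry, maximal inequality and limits for sums of the two integrals\<close>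

context wiener_pair
begin

lemma sub_Fl: "s \<le> t \<Longrightarrow> subalgebra (Fl t) (Fl s)"
  by (rule subalgebra_Fl_mono)

lemma common_partition:
  fixes h :: "real \<Rightarrow> 'w \<Rightarrow> real^'n" and h' :: "real \<Rightarrow> 'w \<Rightarrow> real^'n"
  assumes E: "elementary_integral M Fl T W h I" and E': "elementary_integral M Fl T W' h' I'"
    and S: "finite S" "S \<subseteq> {0..T}"
  obtains m \<tau> \<xi> \<xi>' where "part T m \<tau>" "S \<subseteq> \<tau> ` {..m}" "el_coef M Fl m \<tau> \<xi>" "el_coef M Fl m \<tau> \<xi>'"
    "h = el_proc m \<tau> \<xi>" "I = el_int W m \<tau> \<xi>" "h' = el_proc m \<tau> \<xi>'" "I' = el_int W' m \<tau> \<xi>'"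
  by (rule elementary_common_partition[OF E E' T_pos sub_Fl S]) (assumption, rule that, assumption+)

lemma elementary_diff:
  fixes h :: "real \<Rightarrow> 'w \<Rightarrow> real^'n" and h' :: "real \<Rightarrow> 'w \<Rightarrow> real^'n"
  assumes "elementary_integral M Fl T W h I" "elementary_integral M Fl T W h' I'"
  shows "elementary_integral M Fl T W (\<lambda>t \<omega>. h t \<omega> - h' t \<omega>) (\<lambda>t \<omega>. I t \<omega> - I' t \<omega>)"
  using elementary_lincomb[OF assms T_pos, of 1 "-1"] sub_Fl by simp

lemma el_coef_measurable:
  assumes P: "part T m \<tau>" and c: "el_coef M Fl m \<tau> \<xi>" and "i < m"
  shows "\<xi> i \<in> borel_measurable (Fl (\<tau> i))" "\<xi> i \<in> borel_measurable M" "sq_int M (\<xi> i)"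
proof -
  show 1: "\<xi> i \<in> borel_measurable (Fl (\<tau> i))" using c \<open>i < m\<close> by (simp add: el_coef_def)
  show 2: "\<xi> i \<in> borel_measurable M"
    using measurable_Fl_M[OF 1] part_range[OF P, of i] \<open>i < m\<close> by simp
  show "sq_int M (\<xi> i)" using c \<open>i < m\<close> 2 unfolding el_coef_def by (metis sq_int_bounded)
qed

text \<open>The two integrators are merged into one difference sequence, so that the isometry and
  Doob's inequality treat the sum of the two integrals directly.\<close>

lemma orthogonal_increments_part:
  fixes \<xi> \<xi>' :: "nat \<Rightarrow> 'w \<Rightarrow> real^'n"
  assumes P: "part T m \<tau>" and c: "el_coef M Fl m \<tau> \<xi>" "el_coef M Fl m \<tau> \<xi>'"
  shows "orthogonal_increments M (\<lambda>i. Fl (\<tau> i))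
    (\<lambda>i \<omega>. (W1 (\<tau> (Suc i)) \<omega> - W1 (\<tau> i) \<omega>) *\<^sub>R \<xi> i \<omega> + (W2 (\<tau> (Suc i)) \<omega> - W2 (\<tau> i) \<omega>) *\<^sub>R \<xi>' i \<omega>) m"
proof unfold_locales
  fix i j assume "i \<le> j" "j \<le> m"
  then show "subalgebra (Fl (\<tau> j)) (Fl (\<tau> i))" by (intro sub_Fl part_le[OF P])
next
  fix i assume i: "i < m"
  have r: "0 \<le> \<tau> i" "\<tau> i < \<tau> (Suc i)" "\<tau> (Suc i) \<le> T" using part_range[OF P] part_less[OF P] i by auto
  note m = el_coef_measurable[OF P c(1) i] el_coef_measurable[OF P c(2) i]
  have [measurable]: "\<xi> i \<in> borel_measurable (Fl (\<tau> (Suc i)))" "\<xi>' i \<in> borel_measurable (Fl (\<tau> (Suc i)))"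
    using measurable_Fl_mono[OF m(1)] measurable_Fl_mono[OF m(4)] r by auto
  have [measurable]: "W1 (\<tau> i) \<in> borel_measurable (Fl (\<tau> (Suc i)))" "W2 (\<tau> i) \<in> borel_measurable (Fl (\<tau> (Suc i)))"
    "W1 (\<tau> (Suc i)) \<in> borel_measurable (Fl (\<tau> (Suc i)))" "W2 (\<tau> (Suc i)) \<in> borel_measurable (Fl (\<tau> (Suc i)))"
    using W_measurable_Fl r by auto
  show "(\<lambda>\<omega>. (W1 (\<tau> (Suc i)) \<omega> - W1 (\<tau> i) \<omega>) *\<^sub>R \<xi> i \<omega> + (W2 (\<tau> (Suc i)) \<omega> - W2 (\<tau> i) \<omega>) *\<^sub>R \<xi>' i \<omega>)
    \<in> borel_measurable (Fl (\<tau> (Suc i)))" by measurable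
  show "sq_int M (\<lambda>\<omega>. (W1 (\<tau> (Suc i)) \<omega> - W1 (\<tau> i) \<omega>) *\<^sub>R \<xi> i \<omega> + (W2 (\<tau> (Suc i)) \<omega> - W2 (\<tau> i) \<omega>) *\<^sub>R \<xi>' i \<omega>)"
    by (rule sq_int_increment[OF r m(1,4,3,6)])
  fix Z :: "'w \<Rightarrow> real^'n" assume "Z \<in> borel_measurable (Fl (\<tau> i))" "sq_int M Z"
  then show "(\<integral>\<omega>. Z \<omega> \<bullet> ((W1 (\<tau> (Suc i)) \<omega> - W1 (\<tau> i) \<omega>) *\<^sub>R \<xi> i \<omega> + (W2 (\<tau> (Suc i)) \<omega> - W2 (\<tau> i) \<omega>) *\<^sub>R \<xi>' i \<omega>) \<partial>M) = 0"
    by (intro integral_inner_increment[OF r m(1,4) _ m(3,6)])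
qed

lemma el_int_sum_part:
  assumes P: "part T m \<tau>" and "p \<le> m"
  shows "el_int W1 m \<tau> \<xi> (\<tau> p) \<omega> + el_int W2 m \<tau> \<xi>' (\<tau> p) \<omega>
    = (\<Sum>i<p. (W1 (\<tau> (Suc i)) \<omega> - W1 (\<tau> i) \<omega>) *\<^sub>R \<xi> i \<omega> + (W2 (\<tau> (Suc i)) \<omega> - W2 (\<tau> i) \<omega>) *\<^sub>R \<xi>' i \<omega>)"
  unfolding el_int_part[OF assms] by (simp add: sum.distrib)

text \<open>The term \<open>Y\<close> from the past stays inside the norm: with \<open>Y\<close> the
  difference of two solutions at time \<open>t\<close>, this is the identity behind the backward
  estimate.\<close>

lemma elementary_isometry:
  fixes h1 h2 :: "real \<Rightarrow> 'w \<Rightarrow> real^'n"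
  assumes E1: "elementary_integral M Fl T W1 h1 I1" and E2: "elementary_integral M Fl T W2 h2 I2"
    and t: "0 \<le> t" "t \<le> T" and Y: "Y \<in> borel_measurable (Fl t)" "sq_int M Y"
  shows "nn2 M (\<lambda>\<omega>. Y \<omega> + ((I1 T \<omega> - I1 t \<omega>) + (I2 T \<omega> - I2 t \<omega>))) = nn2 M Y + (proc_norm M t T h1 + proc_norm M t T h2)"
proof -
  \<comment> \<open>The partition is forced through \<open>t\<close>, so that the increments after
    \<open>t\<close> run over whole cells.\<close>
  obtain m \<tau> \<xi> \<xi>' where P: "part T m \<tau>" "{t} \<subseteq> \<tau> ` {..m}" and c: "el_coef M Fl m \<tau> \<xi>" "el_coef M Fl m \<tau> \<xi>'"
    and e: "h1 = el_proc m \<tau> \<xi>" "I1 = el_int W1 m \<tau> \<xi>" "h2 = el_proc m \<tau> \<xi>'" "I2 = el_int W2 m \<tau> \<xi>'"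
    by (rule common_partition[OF E1 E2, of "{t}"]) (simp, simp add: t, rule that, assumption+)
  obtain p where p: "p \<le> m" "t = \<tau> p" using P(2) by auto
  have T: "T = \<tau> m" using P(1) by (simp add: part_def)
  let ?D = "\<lambda>i \<omega>. (W1 (\<tau> (Suc i)) \<omega> - W1 (\<tau> i) \<omega>) *\<^sub>R \<xi> i \<omega> + (W2 (\<tau> (Suc i)) \<omega> - W2 (\<tau> i) \<omega>) *\<^sub>R \<xi>' i \<omega>"
  interpret orthogonal_increments M "\<lambda>i. Fl (\<tau> i)" ?D m
    by (rule orthogonal_increments_part[OF P(1) c])
  have "(I1 T \<omega> - I1 t \<omega>) + (I2 T \<omega> - I2 t \<omega>) = (\<Sum>i\<in>{p..<m}. ?D i \<omega>)" for \<omega>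
  proof -
    have "(I1 T \<omega> - I1 t \<omega>) + (I2 T \<omega> - I2 t \<omega>) = (I1 T \<omega> + I2 T \<omega>) - (I1 t \<omega> + I2 t \<omega>)" by simp
    also have "\<dots> = (\<Sum>i<m. ?D i \<omega>) - (\<Sum>i<p. ?D i \<omega>)"
      unfolding e T p(2) by (simp only: el_int_sum_part[OF P(1) order_refl] el_int_sum_part[OF P(1) p(1)])
    also have "\<dots> = (\<Sum>i\<in>{p..<m}. ?D i \<omega>)"
      using sum_diff_nat_ivl[of 0 p m "\<lambda>i. ?D i \<omega>"] p(1) by (simp add: atLeast0LessThan)
    finally show ?thesis .
  qed
  then have "nn2 M (\<lambda>\<omega>. Y \<omega> + ((I1 T \<omega> - I1 t \<omega>) + (I2 T \<omega> - I2 t \<omega>))) = nn2 M (\<lambda>\<omega>. Y \<omega> + (\<Sum>i\<in>{p..<m}. ?D i \<omega>))"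
    by simp
  also have "\<dots> = nn2 M Y + (\<Sum>i\<in>{p..<m}. nn2 M (?D i))"
    using p Y by (intro sum_D(3)) auto
  also have "(\<Sum>i\<in>{p..<m}. nn2 M (?D i)) = (\<Sum>i\<in>{p..<m}. ennreal (\<tau> (Suc i) - \<tau> i) * (nn2 M (\<xi> i) + nn2 M (\<xi>' i)))"
    using part_range[OF P(1)] part_less[OF P(1)] el_coef_measurable(1)[OF P(1)] c
    by (intro sum.cong refl nn2_increment) auto
  also have "\<dots> = proc_norm M t T h1 + proc_norm M t T h2"
    unfolding e p(2) using el_coef_measurable(2)[OF P(1) c(1)] el_coef_measurable(2)[OF P(1) c(2)]
    by (simp add: proc_norm_el_proc[OF P(1) p(1)] distrib_left sum.distrib)
  finally show ?thesis .
qed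

lemma elementary_at:
  fixes h1 h2 :: "real \<Rightarrow> 'w \<Rightarrow> real^'n"
  assumes E1: "elementary_integral M Fl T W1 h1 I1" and E2: "elementary_integral M Fl T W2 h2 I2"
    and t: "0 \<le> t" "t \<le> T"
  shows "(\<lambda>\<omega>. I1 t \<omega> + I2 t \<omega>) \<in> borel_measurable (Fl t)" "sq_int M (\<lambda>\<omega>. I1 t \<omega> + I2 t \<omega>)"
    "I1 0 \<omega> + I2 0 \<omega> = 0"
proof -
  obtain m \<tau> \<xi> \<xi>' where P: "part T m \<tau>" "{t} \<subseteq> \<tau> ` {..m}" and c: "el_coef M Fl m \<tau> \<xi>" "el_coef M Fl m \<tau> \<xi>'"
    and e: "h1 = el_proc m \<tau> \<xi>" "I1 = el_int W1 m \<tau> \<xi>" "h2 = el_proc m \<tau> \<xi>'" "I2 = el_int W2 m \<tau> \<xi>'"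
    by (rule common_partition[OF E1 E2, of "{t}"]) (simp, simp add: t, rule that, assumption+)
  obtain p where p: "p \<le> m" "t = \<tau> p" using P(2) by auto
  let ?D = "\<lambda>i \<omega>. (W1 (\<tau> (Suc i)) \<omega> - W1 (\<tau> i) \<omega>) *\<^sub>R \<xi> i \<omega> + (W2 (\<tau> (Suc i)) \<omega> - W2 (\<tau> i) \<omega>) *\<^sub>R \<xi>' i \<omega>"
  interpret orthogonal_increments M "\<lambda>i. Fl (\<tau> i)" ?D m
    by (rule orthogonal_increments_part[OF P(1) c])
  have "I1 t \<omega> + I2 t \<omega> = 0 + (\<Sum>i\<in>{0..<p}. ?D i \<omega>)" for \<omega>
    unfolding e p(2) by (simp only: el_int_sum_part[OF P(1) p(1)] atLeast0LessThan add_0)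
  then have 1: "(\<lambda>\<omega>. I1 t \<omega> + I2 t \<omega>) = (\<lambda>\<omega>. 0 + (\<Sum>i\<in>{0..<p}. ?D i \<omega>))" by (simp only:)
  show "(\<lambda>\<omega>. I1 t \<omega> + I2 t \<omega>) \<in> borel_measurable (Fl t)" "sq_int M (\<lambda>\<omega>. I1 t \<omega> + I2 t \<omega>)"
    unfolding 1 unfolding p(2) using sum_D(1)[of 0 p "\<lambda>\<omega>. 0"] sum_D(2)[of 0 p "\<lambda>\<omega>. 0"] p(1) by auto
  have "\<tau> 0 = 0" using P(1) by (simp add: part_def)
  then show "I1 0 \<omega> + I2 0 \<omega> = 0"
    using el_int_sum_part[OF P(1), of 0 \<xi> \<omega> \<xi>'] by (simp add: e)
qed

text \<open>All times of \<open>J\<close> are made partition points; the supremum is then at most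
  the running maximum of the discrete martingale.\<close>

lemma elementary_doob_finite:
  fixes h1 h2 :: "real \<Rightarrow> 'w \<Rightarrow> real^'n"
  assumes E1: "elementary_integral M Fl T W1 h1 I1" and E2: "elementary_integral M Fl T W2 h2 I2"
    and J: "finite J" "J \<subseteq> {0..T}"
  shows "(\<integral>\<^sup>+\<omega>. (SUP t\<in>J. ennreal ((norm (I1 t \<omega> + I2 t \<omega>))\<^sup>2)) \<partial>M) \<le> 4 * (proc_norm M 0 T h1 + proc_norm M 0 T h2)"
proof -
  obtain m \<tau> \<xi> \<xi>' where P: "part T m \<tau>" "J \<subseteq> \<tau> ` {..m}" and c: "el_coef M Fl m \<tau> \<xi>" "el_coef M Fl m \<tau> \<xi>'"
    and e: "h1 = el_proc m \<tau> \<xi>" "I1 = el_int W1 m \<tau> \<xi>" "h2 = el_proc m \<tau> \<xi>'" "I2 = el_int W2 m \<tau> \<xi>'"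
    by (rule common_partition[OF E1 E2 J]) (rule that, assumption+)
  have T: "T = \<tau> m" using P(1) by (simp add: part_def)
  let ?D = "\<lambda>i \<omega>. (W1 (\<tau> (Suc i)) \<omega> - W1 (\<tau> i) \<omega>) *\<^sub>R \<xi> i \<omega> + (W2 (\<tau> (Suc i)) \<omega> - W2 (\<tau> i) \<omega>) *\<^sub>R \<xi>' i \<omega>"
  interpret orthogonal_increments M "\<lambda>i. Fl (\<tau> i)" ?D m
    by (rule orthogonal_increments_part[OF P(1) c])
  have "(\<integral>\<^sup>+\<omega>. (SUP t\<in>J. ennreal ((norm (I1 t \<omega> + I2 t \<omega>))\<^sup>2)) \<partial>M)
    \<le> (\<integral>\<^sup>+\<omega>. ennreal ((rmax (\<lambda>n. norm (\<Sum>i<n. ?D i \<omega>)) m)\<^sup>2) \<partial>M)"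
  proof (intro nn_integral_mono SUP_least)
    fix \<omega> t assume "t \<in> J"
    then obtain p where p: "p \<le> m" "t = \<tau> p" using P(2) by auto
    have "norm (I1 t \<omega> + I2 t \<omega>) \<le> rmax (\<lambda>n. norm (\<Sum>i<n. ?D i \<omega>)) m"
      unfolding e p(2) el_int_sum_part[OF P(1) p(1)] using p(1) by (rule rmax_ge)
    then show "ennreal ((norm (I1 t \<omega> + I2 t \<omega>))\<^sup>2) \<le> ennreal ((rmax (\<lambda>n. norm (\<Sum>i<n. ?D i \<omega>)) m)\<^sup>2)"
      by (intro ennreal_leI power_mono) auto
  qed
  also have "\<dots> \<le> 4 * nn2 M (\<lambda>\<omega>. \<Sum>i<m. ?D i \<omega>)" by (rule doob)
  also have "(\<lambda>\<omega>. \<Sum>i<m. ?D i \<omega>) = (\<lambda>\<omega>. 0 + ((I1 T \<omega> - I1 0 \<omega>) + (I2 T \<omega> - I2 0 \<omega>)))"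
  proof
    fix \<omega>
    have "I1 T \<omega> + I2 T \<omega> = (\<Sum>i<m. ?D i \<omega>)" unfolding e T by (simp only: el_int_sum_part[OF P(1) order_refl])
    then show "(\<Sum>i<m. ?D i \<omega>) = 0 + ((I1 T \<omega> - I1 0 \<omega>) + (I2 T \<omega> - I2 0 \<omega>))"
      using elementary_at(3)[OF E1 E2, of T \<omega>] T_pos by (simp add: algebra_simps)
  qed
  also have "nn2 M \<dots> = nn2 M (\<lambda>\<omega>. 0 :: real^'n) + (proc_norm M 0 T h1 + proc_norm M 0 T h2)"
    using T_pos by (intro elementary_isometry[OF E1 E2]) auto
  finally show ?thesis by simp
qed

text \<open>Monotone convergence along the finite initial segments of \<open>q\<close>.\<close>

lemma elementary_doob:
  fixes h1 h2 :: "real \<Rightarrow> 'w \<Rightarrow> real^'n" and q :: "nat \<Rightarrow> real"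
  assumes E1: "elementary_integral M Fl T W1 h1 I1" and E2: "elementary_integral M Fl T W2 h2 I2"
    and q: "\<And>n. q n \<in> {0..T}"
  shows "(\<integral>\<^sup>+\<omega>. (SUP n. ennreal ((norm (I1 (q n) \<omega> + I2 (q n) \<omega>))\<^sup>2)) \<partial>M) \<le> 4 * (proc_norm M 0 T h1 + proc_norm M 0 T h2)"
proof -
  let ?f = "\<lambda>n \<omega>. ennreal ((norm (I1 (q n) \<omega> + I2 (q n) \<omega>))\<^sup>2)"
  have [measurable]: "?f n \<in> borel_measurable M" for n
    using sq_int_measurable[OF elementary_at(2)[OF E1 E2, of "q n"]] q[of n] by auto
  have "(SUP n. ?f n \<omega>) = (SUP n. SUP k\<in>{..n}. ?f k \<omega>)" for \<omega>
  proof (intro antisym SUP_least)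
    show "?f n \<omega> \<le> (SUP n. SUP k\<in>{..n}. ?f k \<omega>)" for n
      by (rule SUP_upper2[of n]) (auto intro: SUP_upper)
    show "?f k \<omega> \<le> (SUP n. ?f n \<omega>)" for k by (rule SUP_upper) simp
  qed
  then have "(\<integral>\<^sup>+\<omega>. (SUP n. ?f n \<omega>) \<partial>M) = (\<integral>\<^sup>+\<omega>. (SUP n. SUP k\<in>{..n}. ?f k \<omega>) \<partial>M)" by simp
  also have "\<dots> = (SUP n. \<integral>\<^sup>+\<omega>. (SUP k\<in>{..n}. ?f k \<omega>) \<partial>M)"
    by (intro nn_integral_monotone_convergence_SUP) (auto simp: incseq_def le_fun_def intro!: SUP_subset_mono)
  also have "\<dots> \<le> 4 * (proc_norm M 0 T h1 + proc_norm M 0 T h2)"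
  proof (rule SUP_least)
    fix n
    have "(\<integral>\<^sup>+\<omega>. (SUP t\<in>q ` {..n}. ennreal ((norm (I1 t \<omega> + I2 t \<omega>))\<^sup>2)) \<partial>M) \<le> 4 * (proc_norm M 0 T h1 + proc_norm M 0 T h2)"
      using q by (intro elementary_doob_finite[OF E1 E2]) auto
    then show "(\<integral>\<^sup>+\<omega>. (SUP k\<in>{..n}. ?f k \<omega>) \<partial>M) \<le> 4 * (proc_norm M 0 T h1 + proc_norm M 0 T h2)"
      by (simp add: image_image)
  qed
  finally show ?thesis .
qed

lemma elementary_continuous:
  fixes h1 h2 :: "real \<Rightarrow> 'w \<Rightarrow> real^'n"
  assumes E1: "elementary_integral M Fl T W1 h1 I1" and E2: "elementary_integral M Fl T W2 h2 I2"
  shows "AE \<omega> in M. continuous_on {0..T} (\<lambda>t. I1 t \<omega> + I2 t \<omega>)"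
proof -
  obtain m \<tau> \<xi> \<xi>' where P: "part T m \<tau>" and e: "I1 = el_int W1 m \<tau> \<xi>" "I2 = el_int W2 m \<tau> \<xi>'"
    by (rule common_partition[OF E1 E2, of "{}"]) (simp, simp, rule that, assumption+)
  have *: "continuous_on {0..T} (\<lambda>t. el_int W m \<tau> \<xi> t \<omega>)" if c: "continuous_on {0..T} (\<lambda>t. W t \<omega>)"
    for W and \<xi> :: "nat \<Rightarrow> 'w \<Rightarrow> real^'n" and \<omega>
  proof -
    have "continuous_on {0..T} (\<lambda>t. W (min t (\<tau> i)) \<omega>)" if "i \<le> m" for i
    proof (rule continuous_on_compose2[OF c])
      show "continuous_on {0..T} (\<lambda>t. min t (\<tau> i))" by (intro continuous_intros)
      show "(\<lambda>t. min t (\<tau> i)) ` {0..T} \<subseteq> {0..T}" using part_range[OF P that] by (auto simp: min_def)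
    qed
    then show ?thesis unfolding el_int_def by (intro continuous_intros) auto
  qed
  show ?thesis using AE_W_continuous unfolding e by eventually_elim (auto intro!: continuous_on_add *)
qed

text \<open>Increments summable in the supremum norm give uniform convergence of almost every path,
  hence a continuous limit. The suprema run over a dense sequence, which keeps them
  measurable.\<close>

lemma limit_process:
  fixes J :: "nat \<Rightarrow> real \<Rightarrow> 'w \<Rightarrow> real^'n" and q :: "nat \<Rightarrow> real"
  assumes J[measurable]: "\<And>k t. 0 \<le> t \<Longrightarrow> t \<le> T \<Longrightarrow> J k t \<in> borel_measurable (Fl t)"
    and cont: "\<And>k. AE \<omega> in M. continuous_on {0..T} (\<lambda>t. J k t \<omega>)"
    and q: "\<And>n. q n \<in> {0..T}" "{0..T} \<subseteq> closure (range q)"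
    and C: "\<And>k. (\<integral>\<^sup>+\<omega>. (SUP n. ennreal ((norm (J (Suc k) (q n) \<omega> - J k (q n) \<omega>))\<^sup>2)) \<partial>M) \<le> ennreal (C / 4 ^ k)" "C \<ge> 0"
    and J0: "(\<integral>\<^sup>+\<omega>. (SUP n. ennreal ((norm (J 0 (q n) \<omega>))\<^sup>2)) \<partial>M) < \<infinity>"
  shows "\<exists>X. X \<in> S2_proc M Fl T \<and> (\<forall>t\<in>{0..T}. (\<lambda>k. nn2 M (\<lambda>\<omega>. X t \<omega> - J k t \<omega>)) \<longlonglongrightarrow> 0)"
proof -
  have JM[measurable]: "J k t \<in> borel_measurable M" if "t \<in> {0..T}" for k t
    using measurable_Fl_M[OF J[of t k]] that by auto
  have Jq[measurable]: "J k (q n) \<in> borel_measurable M" for k n using q(1) by (intro JM) auto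
  define V where "V k \<omega> = (SUP n. ennreal ((norm (J (Suc k) (q n) \<omega> - J k (q n) \<omega>))\<^sup>2))" for k \<omega>
  define V0 where "V0 \<omega> = (SUP n. ennreal ((norm (J 0 (q n) \<omega>))\<^sup>2))" for \<omega>
  have [measurable]: "V k \<in> borel_measurable M" for k unfolding V_def by measurable
  have [measurable]: "V0 \<in> borel_measurable M" unfolding V0_def by measurable
  define S where "S \<omega> = (\<Sum>k. 2 ^ k * V k \<omega>)" for \<omega>
  have [measurable]: "S \<in> borel_measurable M" unfolding S_def by measurable
  have intS: "(\<integral>\<^sup>+\<omega>. S \<omega> \<partial>M) \<le> ennreal (2 * C)"
    unfolding S_def using C by (intro nn_integral_weighted_suminf_le) (auto simp: V_def)
  then have "(\<integral>\<^sup>+\<omega>. S \<omega> \<partial>M) \<noteq> \<infinity>" by (auto simp: top_unique)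
  then have fin: "AE \<omega> in M. S \<omega> \<noteq> \<infinity>" by (intro nn_integral_noteq_infinite) auto
  have "AE \<omega> in M. S \<omega> \<noteq> \<infinity> \<and> (\<forall>k. continuous_on {0..T} (\<lambda>t. J k t \<omega>))"
    using fin cont by (auto simp: AE_all_countable)
  then obtain N where N: "N \<in> null_sets M" "{\<omega>\<in>space M. \<not> (S \<omega> \<noteq> \<infinity> \<and> (\<forall>k. continuous_on {0..T} (\<lambda>t. J k t \<omega>)))} \<subseteq> N"
    unfolding eventually_ae_filter by auto
  \<comment> \<open>On the null set \<open>N\<close> the limit is replaced by 0, since
    \<open>S2_proc\<close> asks for continuity of every path; \<open>N\<close> belongs to each
    \<open>Fl t\<close>, so adaptedness is kept.\<close>
  define X where "X t \<omega> = (if \<omega> \<in> N then 0 else lim (\<lambda>k. J k t \<omega>))" for t \<omega>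
  have good: "S \<omega> \<noteq> \<infinity>" "continuous_on {0..T} (\<lambda>t. J k t \<omega>)" if "\<omega> \<in> space M" "\<omega> \<notin> N" for \<omega> k
    using N(2) that by auto
  have le_V: "ennreal ((norm (J (Suc k) t \<omega> - J k t \<omega>))\<^sup>2) \<le> V k \<omega>" and le_V0: "ennreal ((norm (J 0 t \<omega>))\<^sup>2) \<le> V0 \<omega>"
    if w: "\<omega> \<in> space M" "\<omega> \<notin> N" and t: "t \<in> {0..T}" for \<omega> k t
  proof -
    note c = good(2)[OF w]
    show "ennreal ((norm (J (Suc k) t \<omega> - J k t \<omega>))\<^sup>2) \<le> V k \<omega>"
    proof (rule continuous_le_dense[OF _ q(2) _ _ t])
      show "continuous_on {0..T} (\<lambda>t. (norm (J (Suc k) t \<omega> - J k t \<omega>))\<^sup>2)" using c by (intro continuous_intros) auto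
      show "ennreal ((norm (J (Suc k) t \<omega> - J k t \<omega>))\<^sup>2) \<le> V k \<omega>" if "t \<in> range q" for t
        using that unfolding V_def by (auto intro: SUP_upper2)
    qed (use q in auto)
    show "ennreal ((norm (J 0 t \<omega>))\<^sup>2) \<le> V0 \<omega>"
    proof (rule continuous_le_dense[OF _ q(2) _ _ t])
      show "continuous_on {0..T} (\<lambda>t. (norm (J 0 t \<omega>))\<^sup>2)" using c by (intro continuous_intros) auto
      show "ennreal ((norm (J 0 t \<omega>))\<^sup>2) \<le> V0 \<omega>" if "t \<in> range q" for t
        using that unfolding V0_def by (auto intro: SUP_upper2)
    qed (use q in auto)
  qed
  have bS: "(\<Sum>j<n. 2 ^ j * (norm (J (Suc j) t \<omega> - J j t \<omega>))\<^sup>2) \<le> enn2real (S \<omega>)"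
    if w: "\<omega> \<in> space M" "\<omega> \<notin> N" and t: "t \<in> {0..T}" for \<omega> n t
  proof -
    have "ennreal (\<Sum>j<n. 2 ^ j * (norm (J (Suc j) t \<omega> - J j t \<omega>))\<^sup>2)
       = (\<Sum>j<n. 2 ^ j * ennreal ((norm (J (Suc j) t \<omega> - J j t \<omega>))\<^sup>2))"
      by (subst sum_ennreal[symmetric]) (auto simp: ennreal_mult ennreal_power[symmetric])
    also have "\<dots> \<le> (\<Sum>j<n. 2 ^ j * V j \<omega>)" by (intro sum_mono mult_left_mono le_V[OF w t]) auto
    also have "\<dots> \<le> S \<omega>" unfolding S_def by (rule sum_le_suminf) auto
    also have "S \<omega> = ennreal (enn2real (S \<omega>))" using good(1)[OF w] by (simp add: less_top)
    finally show ?thesis by (subst (asm) ennreal_le_iff) auto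
  qed
  have conv: "(\<lambda>k. J k t \<omega>) \<longlonglongrightarrow> X t \<omega>" if w: "\<omega> \<in> space M" "\<omega> \<notin> N" and t: "t \<in> {0..T}" for \<omega> t
    using fast_increments_Cauchy[OF bS[OF w t]] w by (simp add: X_def Cauchy_convergent_iff convergent_LIMSEQ_iff)
  have rate: "(norm (X t \<omega> - J k t \<omega>))\<^sup>2 \<le> 2 / 2 ^ k * enn2real (S \<omega>)"
    if w: "\<omega> \<in> space M" "\<omega> \<notin> N" and t: "t \<in> {0..T}" for \<omega> t k
  proof (rule tendsto_upperbound)
    show "(\<lambda>m. (norm (J m t \<omega> - J k t \<omega>))\<^sup>2) \<longlonglongrightarrow> (norm (X t \<omega> - J k t \<omega>))\<^sup>2"
      by (intro tendsto_intros conv[OF w t])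
    show "eventually (\<lambda>m. (norm (J m t \<omega> - J k t \<omega>))\<^sup>2 \<le> 2 / 2 ^ k * enn2real (S \<omega>)) sequentially"
      using fast_increments_bound[OF bS[OF w t], of k] by (auto simp: eventually_sequentially)
  qed simp
  have X_cont: "continuous_on {0..T} (\<lambda>t. X t \<omega>)" if w: "\<omega> \<in> space M" for \<omega>
  proof (cases "\<omega> \<in> N")
    case False
    show ?thesis
    proof (rule uniform_limit_theorem)
      show "\<forall>\<^sub>F k in sequentially. continuous_on {0..T} (\<lambda>t. J k t \<omega>)" using good[OF w False] by simp
      show "uniform_limit {0..T} (\<lambda>k t. J k t \<omega>) (\<lambda>t. X t \<omega>) sequentially"
      proof (rule uniform_limitI)
        fix e :: real assume "e > 0"
        have "(\<lambda>k. 2 * enn2real (S \<omega>) * (1/2) ^ k) \<longlonglongrightarrow> 2 * enn2real (S \<omega>) * 0" by (intro tendsto_intros) auto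
        then have "eventually (\<lambda>k. 2 * enn2real (S \<omega>) * (1/2) ^ k < e\<^sup>2) sequentially"
          using \<open>e > 0\<close> by (intro order_tendstoD) auto
        then show "\<forall>\<^sub>F k in sequentially. \<forall>t\<in>{0..T}. dist (J k t \<omega>) (X t \<omega>) < e"
        proof (eventually_elim, intro ballI)
          fix k t assume k: "2 * enn2real (S \<omega>) * (1/2) ^ k < e\<^sup>2" and t: "t \<in> {0..T}"
          have "(norm (X t \<omega> - J k t \<omega>))\<^sup>2 < e\<^sup>2" using rate[OF w False t, of k] k by (simp add: power_divide)
          then show "dist (J k t \<omega>) (X t \<omega>) < e"
            using \<open>e > 0\<close> by (simp add: dist_norm norm_minus_commute power_less_imp_less_base)
        qed
      qed
    qed simp
  qed (simp add: X_def)
  have X_adapted: "X t \<in> borel_measurable (Fl t)" if t: "t \<in> {0..T}" for t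
  proof -
    have [measurable]: "N \<in> sets (Fl t)" using N(1) by (rule null_sets_aug_filt)
    have [measurable]: "J k t \<in> borel_measurable (Fl t)" for k using t by (intro J) auto
    show ?thesis unfolding X_def by measurable
  qed
  have AEN: "AE \<omega> in M. \<omega> \<notin> N" using N(1) by (rule AE_not_in)
  have "(\<integral>\<^sup>+\<omega>. (SUP t\<in>{0..T}. ennreal ((norm (X t \<omega>))\<^sup>2)) \<partial>M) \<le> (\<integral>\<^sup>+\<omega>. 4 * S \<omega> + 2 * V0 \<omega> \<partial>M)"
  proof (rule nn_integral_mono_AE)
    show "AE \<omega> in M. (SUP t\<in>{0..T}. ennreal ((norm (X t \<omega>))\<^sup>2)) \<le> 4 * S \<omega> + 2 * V0 \<omega>"
      using AEN AE_space
    proof (eventually_elim, intro SUP_least)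
      \<comment> \<open>\<open>X\<close> is compared with \<open>J 0\<close>: the squared distance,
        at most \<open>2 * S\<close>, and the square of \<open>J 0\<close>, at most
        \<open>V0\<close>, are both doubled.\<close>
      fix \<omega> t assume w: "\<omega> \<notin> N" "\<omega> \<in> space M" and t: "t \<in> {0..T}"
      have "(norm (X t \<omega>))\<^sup>2 \<le> 2 * (norm (X t \<omega> - J 0 t \<omega>))\<^sup>2 + 2 * (norm (J 0 t \<omega>))\<^sup>2"
        using norm_add_power2_le[of 1 "X t \<omega> - J 0 t \<omega>" "J 0 t \<omega>"] by simp
      also have "\<dots> \<le> 4 * enn2real (S \<omega>) + 2 * (norm (J 0 t \<omega>))\<^sup>2" using rate[OF w(2,1) t, of 0] by simp
      finally have "ennreal ((norm (X t \<omega>))\<^sup>2) \<le> ennreal (4 * enn2real (S \<omega>) + 2 * (norm (J 0 t \<omega>))\<^sup>2)"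
        by (rule ennreal_leI)
      also have "\<dots> = 4 * S \<omega> + 2 * ennreal ((norm (J 0 t \<omega>))\<^sup>2)"
        using good(1)[OF w(2,1)] by (simp add: ennreal_mult less_top)
      also have "\<dots> \<le> 4 * S \<omega> + 2 * V0 \<omega>" by (intro add_mono mult_left_mono le_V0[OF w(2,1) t]) auto
      finally show "ennreal ((norm (X t \<omega>))\<^sup>2) \<le> 4 * S \<omega> + 2 * V0 \<omega>" .
    qed
  qed
  also have "\<dots> = 4 * (\<integral>\<^sup>+\<omega>. S \<omega> \<partial>M) + 2 * (\<integral>\<^sup>+\<omega>. V0 \<omega> \<partial>M)"
    by (simp add: nn_integral_add nn_integral_cmult)
  also have "\<dots> < \<infinity>" using intS J0 unfolding V0_def
    by (auto simp: ennreal_mult_eq_top_iff top_unique less_top[symmetric])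
  finally have "X \<in> S2_proc M Fl T" using X_adapted X_cont by (auto simp: S2_proc_def adapted_def)
  moreover have "(\<lambda>k. nn2 M (\<lambda>\<omega>. X t \<omega> - J k t \<omega>)) \<longlonglongrightarrow> 0" if t: "t \<in> {0..T}" for t
  proof -
    have "nn2 M (\<lambda>\<omega>. J (Suc k) t \<omega> - J k t \<omega>) \<le> ennreal (C / 4 ^ k)" for k
    proof -
      have "nn2 M (\<lambda>\<omega>. J (Suc k) t \<omega> - J k t \<omega>) \<le> (\<integral>\<^sup>+\<omega>. V k \<omega> \<partial>M)"
        unfolding nn2_def
      proof (rule nn_integral_mono_AE)
        show "AE \<omega> in M. ennreal ((norm (J (Suc k) t \<omega> - J k t \<omega>))\<^sup>2) \<le> V k \<omega>"
          using AEN AE_space by eventually_elim (intro le_V t)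
      qed
      also have "\<dots> \<le> ennreal (C / 4 ^ k)" using C(1)[of k] by (simp add: V_def)
      finally show ?thesis .
    qed
    then have "(\<lambda>k. nn2 M (\<lambda>\<omega>. lim (\<lambda>k. J k t \<omega>) - J k t \<omega>)) \<longlonglongrightarrow> 0"
      using t C(2) by (intro fast_L2_convergence(3)) auto
    also have "(\<lambda>k. nn2 M (\<lambda>\<omega>. lim (\<lambda>k. J k t \<omega>) - J k t \<omega>)) = (\<lambda>k. nn2 M (\<lambda>\<omega>. X t \<omega> - J k t \<omega>))"
      using AEN by (intro ext nn2_cong_AE) (auto simp: X_def)
    finally show ?thesis .
  qed
  ultimately show ?thesis by blast
qed

lemma dense_sequence: obtains q :: "nat \<Rightarrow> real" where "\<And>n. q n \<in> {0..T}" "{0..T} \<subseteq> closure (range q)"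
proof -
  obtain D :: "real set" where D: "countable D" "D \<subseteq> {0..T}" "{0..T} \<subseteq> closure D"
    using separable[of "{0..T}"] by metis
  then have "D \<noteq> {}" using T_pos by auto
  then have "range (from_nat_into D) = D" using D(1) by (rule range_from_nat_into)
  then show thesis using D from_nat_into[OF \<open>D \<noteq> {}\<close>] by (intro that[of "from_nat_into D"]) (auto simp del: atLeastAtMost_iff)
qed

text \<open>Doob's inequality turns closeness of integrands into closeness of paths; its factor 4 is
  absorbed into the constant. A single integral is the case where the other integrand is
  zero.\<close>

lemma ito_exists_pair:
  fixes h1 h2 :: "nat \<Rightarrow> real \<Rightarrow> 'w \<Rightarrow> real^'n"
  assumes E1: "\<And>k. elementary_integral M Fl T W1 (h1 k) (I1 k)" and E2: "\<And>k. elementary_integral M Fl T W2 (h2 k) (I2 k)"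
    and C: "\<And>k. proc_norm M 0 T (\<lambda>t \<omega>. h1 (Suc k) t \<omega> - h1 k t \<omega>) + proc_norm M 0 T (\<lambda>t \<omega>. h2 (Suc k) t \<omega> - h2 k t \<omega>)
      \<le> ennreal (C / 4 ^ k)" "C \<ge> 0"
  shows "\<exists>X. X \<in> S2_proc M Fl T \<and> (\<forall>t\<in>{0..T}. (\<lambda>k. nn2 M (\<lambda>\<omega>. X t \<omega> - (I1 k t \<omega> + I2 k t \<omega>))) \<longlonglongrightarrow> 0)"
proof -
  obtain q :: "nat \<Rightarrow> real" where q: "\<And>n. q n \<in> {0..T}" "{0..T} \<subseteq> closure (range q)" using dense_sequence by blast
  show ?thesis
  proof (rule limit_process[OF _ _ q, where C = "4 * C"])
    fix k
    note d1 = elementary_diff[OF E1[of "Suc k"] E1[of k]] and d2 = elementary_diff[OF E2[of "Suc k"] E2[of k]]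
    have "(\<integral>\<^sup>+\<omega>. (SUP n. ennreal ((norm (I1 (Suc k) (q n) \<omega> + I2 (Suc k) (q n) \<omega> - (I1 k (q n) \<omega> + I2 k (q n) \<omega>)))\<^sup>2)) \<partial>M)
      \<le> 4 * (proc_norm M 0 T (\<lambda>t \<omega>. h1 (Suc k) t \<omega> - h1 k t \<omega>) + proc_norm M 0 T (\<lambda>t \<omega>. h2 (Suc k) t \<omega> - h2 k t \<omega>))"
      using elementary_doob[OF d1 d2 q(1)] by (simp add: algebra_simps)
    also have "\<dots> \<le> 4 * ennreal (C / 4 ^ k)" by (intro mult_left_mono C) auto
    also have "\<dots> = ennreal (4 * C / 4 ^ k)" using C(2) ennreal_mult[of 4 "C / 4 ^ k"] by simp
    finally show "(\<integral>\<^sup>+\<omega>. (SUP n. ennreal ((norm (I1 (Suc k) (q n) \<omega> + I2 (Suc k) (q n) \<omega> - (I1 k (q n) \<omega> + I2 k (q n) \<omega>)))\<^sup>2)) \<partial>M)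
      \<le> ennreal (4 * C / 4 ^ k)" .
  next
    \<comment> \<open>The isometry from time 0 expresses the norm of the integrands by that of the
      square-integrable end value, which gives finiteness.\<close>
    have "proc_norm M 0 T (h1 0) + proc_norm M 0 T (h2 0) = nn2 M (\<lambda>\<omega>. 0 + ((I1 0 T \<omega> - I1 0 0 \<omega>) + (I2 0 T \<omega> - I2 0 0 \<omega>)))"
      using elementary_isometry[OF E1[of 0] E2[of 0], of 0 "\<lambda>\<omega>. 0"] T_pos by simp
    also have "(\<lambda>\<omega>. 0 + ((I1 0 T \<omega> - I1 0 0 \<omega>) + (I2 0 T \<omega> - I2 0 0 \<omega>))) = (\<lambda>\<omega>. I1 0 T \<omega> + I2 0 T \<omega>)"
      using elementary_at(3)[OF E1 E2, where t=T] T_pos by (auto simp: algebra_simps fun_eq_iff)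
    also have "nn2 M \<dots> < \<infinity>"
      using elementary_at(2)[OF E1 E2, where t=T] T_pos by (auto simp: sq_int_def)
    finally have "4 * (proc_norm M 0 T (h1 0) + proc_norm M 0 T (h2 0)) < \<infinity>" by (simp add: ennreal_mult_less_top)
    then show "(\<integral>\<^sup>+\<omega>. (SUP n. ennreal ((norm (I1 0 (q n) \<omega> + I2 0 (q n) \<omega>))\<^sup>2)) \<partial>M) < \<infinity>"
      using elementary_doob[OF E1[of 0] E2[of 0] q(1)] by (rule le_less_trans[rotated])
  qed (use C elementary_at(1)[OF E1 E2] elementary_continuous[OF E1 E2] in auto)
qed

end

section \<open>Martingale representation\<close>

text \<open>A function with gradient \<open>D\<close> and a second-order Taylor bound, all constants
  merged into \<open>C\<close>. Stated as inequalities, this passes through products and Gaussian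
  averages by elementary estimates.\<close>

definition smooth_fun :: "('a::euclidean_space \<Rightarrow> real) \<Rightarrow> ('a \<Rightarrow> 'a) \<Rightarrow> real \<Rightarrow> bool" where
  "smooth_fun \<phi> D C \<longleftrightarrow> \<phi> \<in> borel_measurable borel \<and> D \<in> borel_measurable borel \<and>
     (\<forall>x. \<bar>\<phi> x\<bar> \<le> C \<and> norm (D x) \<le> C) \<and>
     (\<forall>x h. \<bar>\<phi> (x + h) - \<phi> x\<bar> \<le> C * norm h) \<and>
     (\<forall>x h. \<bar>\<phi> (x + h) - \<phi> x - D x \<bullet> h\<bar> \<le> C * (norm h)\<^sup>2)"

lemma smooth_funD:
  assumes "smooth_fun \<phi> D C"
  shows "\<phi> \<in> borel_measurable borel" "D \<in> borel_measurable borel" "\<bar>\<phi> x\<bar> \<le> C" "norm (D x) \<le> C"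
    "\<bar>\<phi> (x + h) - \<phi> x\<bar> \<le> C * norm h" "\<bar>\<phi> (x + h) - \<phi> x - D x \<bullet> h\<bar> \<le> C * (norm h)\<^sup>2" "0 \<le> C"
  using assms unfolding smooth_fun_def by (auto intro: order_trans[OF abs_ge_zero])

lemma smooth_fun_const: "smooth_fun (\<lambda>x. c) (\<lambda>x. 0) \<bar>c\<bar>"
  by (auto simp: smooth_fun_def)

text \<open>The remainder of the product splits into three terms, each at most \<open>C * B\<close>
  times the squared step; hence the factor 3.\<close>

lemma smooth_fun_mult:
  assumes f: "smooth_fun \<phi> D C" and g: "smooth_fun \<psi> E B"
  shows "smooth_fun (\<lambda>x. \<phi> x * \<psi> x) (\<lambda>x. \<phi> x *\<^sub>R E x + \<psi> x *\<^sub>R D x) (3 * (C * B))"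
  unfolding smooth_fun_def
proof (intro conjI allI)
  note [measurable] = smooth_funD(1,2)[OF f] smooth_funD(1,2)[OF g]
  note f' = smooth_funD(3-)[OF f] and g' = smooth_funD(3-)[OF g]
  have CB: "0 \<le> C * B" using f' g' by simp
  show "(\<lambda>x. \<phi> x * \<psi> x) \<in> borel_measurable borel" by measurable
  show "(\<lambda>x. \<phi> x *\<^sub>R E x + \<psi> x *\<^sub>R D x) \<in> borel_measurable borel" by measurable
  fix x h
  have "\<bar>\<phi> x * \<psi> x\<bar> \<le> C * B" unfolding abs_mult using f' g' by (intro mult_mono) auto
  then show "\<bar>\<phi> x * \<psi> x\<bar> \<le> 3 * (C * B)" using CB by linarith
  have "norm (\<phi> x *\<^sub>R E x) \<le> C * B" using f' g' by (auto intro!: mult_mono)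
  moreover have "norm (\<psi> x *\<^sub>R D x) \<le> B * C" using f' g' by (auto intro!: mult_mono)
  ultimately show "norm (\<phi> x *\<^sub>R E x + \<psi> x *\<^sub>R D x) \<le> 3 * (C * B)"
    using CB norm_triangle_ineq[of "\<phi> x *\<^sub>R E x" "\<psi> x *\<^sub>R D x"] by (simp add: mult.commute)
  let ?p = "\<phi> (x + h) - \<phi> x" and ?q = "\<psi> (x + h) - \<psi> x"
  have "\<bar>\<phi> (x + h) * ?q\<bar> \<le> C * (B * norm h)" unfolding abs_mult using f' g' by (intro mult_mono) auto
  moreover have "\<bar>\<psi> x * ?p\<bar> \<le> B * (C * norm h)" unfolding abs_mult using f' g' by (intro mult_mono) auto
  moreover have "\<phi> (x + h) * \<psi> (x + h) - \<phi> x * \<psi> x = \<phi> (x + h) * ?q + \<psi> x * ?p" by (simp add: algebra_simps)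
  ultimately have "\<bar>\<phi> (x + h) * \<psi> (x + h) - \<phi> x * \<psi> x\<bar> \<le> 2 * (C * B * norm h)"
    using abs_triangle_ineq[of "\<phi> (x + h) * ?q" "\<psi> x * ?p"] by (simp add: algebra_simps)
  moreover have "0 \<le> C * B * norm h" using CB by simp
  ultimately show "\<bar>\<phi> (x + h) * \<psi> (x + h) - \<phi> x * \<psi> x\<bar> \<le> 3 * (C * B) * norm h" by linarith
  have "\<bar>?p * ?q\<bar> \<le> (C * norm h) * (B * norm h)"
    unfolding abs_mult using f' g' by (intro mult_mono) (auto simp: f'(5))
  moreover have "\<bar>\<phi> x * (?q - E x \<bullet> h)\<bar> \<le> C * (B * (norm h)\<^sup>2)"
    unfolding abs_mult using f' g' by (intro mult_mono) auto
  moreover have "\<bar>\<psi> x * (?p - D x \<bullet> h)\<bar> \<le> B * (C * (norm h)\<^sup>2)"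
    unfolding abs_mult using f' g' by (intro mult_mono) auto
  moreover have "\<phi> (x + h) * \<psi> (x + h) - \<phi> x * \<psi> x - (\<phi> x *\<^sub>R E x + \<psi> x *\<^sub>R D x) \<bullet> h =
    ?p * ?q + \<phi> x * (?q - E x \<bullet> h) + \<psi> x * (?p - D x \<bullet> h)"
    by (simp add: algebra_simps inner_add_left)
  ultimately show "\<bar>\<phi> (x + h) * \<psi> (x + h) - \<phi> x * \<psi> x - (\<phi> x *\<^sub>R E x + \<psi> x *\<^sub>R D x) \<bullet> h\<bar> \<le> 3 * (C * B) * (norm h)\<^sup>2"
    by (simp add: power2_eq_square algebra_simps abs_le_iff)
qed

text \<open>The heat semigroup. Variance 0 is treated apart, since the Gaussian density degenerates
  there.\<close>

definition heat :: "real \<Rightarrow> (real \<times> real \<Rightarrow> 'b::{banach, second_countable_topology}) \<Rightarrow> real \<times> real \<Rightarrow> 'b" where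
  "heat d \<phi> x = (if d = 0 then \<phi> x else \<integral>y. \<phi> (x + y) \<partial>gauss2 d)"

lemma gauss2_measurable: "f \<in> borel_measurable borel \<Longrightarrow> f \<in> borel_measurable (gauss2 d)"
  by (simp add: measurable_cong_sets[of "gauss2 d" "borel \<Otimes>\<^sub>M borel"] borel_prod)

text \<open>Every bound holds for all translates of \<open>\<phi>\<close> and is averaged by a
  probability measure, so the constant does not grow. A constant uniform in time is what allows
  arbitrarily fine partitions.\<close>

lemma smooth_fun_heat:
  assumes f: "smooth_fun \<phi> D C" and "d \<ge> 0"
  shows "smooth_fun (heat d \<phi>) (heat d D) C"
proof (cases "d = 0")
  case True
  then have "heat d \<phi> = \<phi>" "heat d D = D" by (auto simp: heat_def)
  then show ?thesis using f by simp
next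
  case False
  then interpret prob_space "gauss2 d" using \<open>d \<ge> 0\<close> by (intro prob_space_gauss2) simp
  note f' = smooth_funD(3-)[OF f]
  note [measurable] = smooth_funD(1,2)[OF f]
  have i: "integrable (gauss2 d) (\<lambda>y. \<phi> (x + y))" "integrable (gauss2 d) (\<lambda>y. D (x + y))" for x
    by (rule integrable_const_bound[where B=C]; simp add: f' gauss2_measurable)+
  have v: "heat d \<phi> x = (\<integral>y. \<phi> (x + y) \<partial>gauss2 d)" "heat d D x = (\<integral>y. D (x + y) \<partial>gauss2 d)" for x
    using False by (auto simp: heat_def)
  have b: "norm (\<integral>y. f y \<partial>gauss2 d) \<le> B" if "integrable (gauss2 d) f" "\<And>y. norm (f y) \<le> B"
    for f :: "real \<times> real \<Rightarrow> 'z::{banach, second_countable_topology}" and B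
  proof -
    have "norm (\<integral>y. f y \<partial>gauss2 d) \<le> (\<integral>y. norm (f y) \<partial>gauss2 d)" by (rule integral_norm_bound)
    also have "\<dots> \<le> (\<integral>y. B \<partial>gauss2 d)" using that by (intro integral_mono) auto
    also have "\<dots> = B" using prob_space by simp
    finally show ?thesis .
  qed
  show ?thesis
    unfolding smooth_fun_def
  proof (intro conjI allI)
    have m: "(\<lambda>(x, y). \<phi> (x + y)) \<in> borel_measurable (borel \<Otimes>\<^sub>M gauss2 d)"
      "(\<lambda>(x, y). D (x + y)) \<in> borel_measurable (borel \<Otimes>\<^sub>M gauss2 d)"
    proof -
      have "(\<lambda>x::(real \<times> real) \<times> (real \<times> real). fst x + snd x) \<in> borel_measurable (borel \<Otimes>\<^sub>M borel)" by measurable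
      then have "(\<lambda>x::(real \<times> real) \<times> (real \<times> real). fst x + snd x) \<in> borel_measurable (borel \<Otimes>\<^sub>M gauss2 d)"
        by (subst measurable_cong_sets[OF sets_pair_measure_cong[OF refl]]) (auto simp: borel_prod)
      from measurable_compose[OF this smooth_funD(1)[OF f]] measurable_compose[OF this smooth_funD(2)[OF f]]
      show "(\<lambda>(x, y). \<phi> (x + y)) \<in> borel_measurable (borel \<Otimes>\<^sub>M gauss2 d)"
        "(\<lambda>(x, y). D (x + y)) \<in> borel_measurable (borel \<Otimes>\<^sub>M gauss2 d)"
        by (simp_all add: case_prod_unfold)
    qed
    show "heat d \<phi> \<in> borel_measurable borel" "heat d D \<in> borel_measurable borel"
      using borel_measurable_lebesgue_integral[OF m(1)] borel_measurable_lebesgue_integral[OF m(2)]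
      by (simp_all add: v[abs_def])
    fix x h
    show "\<bar>heat d \<phi> x\<bar> \<le> C" "norm (heat d D x) \<le> C"
      unfolding v using b[OF i(1)[of x], of C] b[OF i(2)[of x], of C] by (simp_all add: f')
    have "heat d \<phi> (x + h) - heat d \<phi> x = (\<integral>y. \<phi> ((x + y) + h) - \<phi> (x + y) \<partial>gauss2 d)"
      unfolding v using i[of x] i[of "x + h"] by (simp add: algebra_simps)
    moreover have "integrable (gauss2 d) (\<lambda>y. \<phi> ((x + y) + h) - \<phi> (x + y))"
      using i[of x] i[of "x + h"] by (simp add: algebra_simps)
    then have "norm (\<integral>y. \<phi> ((x + y) + h) - \<phi> (x + y) \<partial>gauss2 d) \<le> C * norm h" by (rule b) (simp add: f')
    ultimately show "\<bar>heat d \<phi> (x + h) - heat d \<phi> x\<bar> \<le> C * norm h" by simp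
    have "heat d \<phi> (x + h) - heat d \<phi> x - heat d D x \<bullet> h
      = (\<integral>y. \<phi> ((x + y) + h) - \<phi> (x + y) - D (x + y) \<bullet> h \<partial>gauss2 d)"
      unfolding v using i[of x] i[of "x + h"] by (simp add: algebra_simps)
    moreover have "integrable (gauss2 d) (\<lambda>y. \<phi> ((x + y) + h) - \<phi> (x + y) - D (x + y) \<bullet> h)"
      using i[of x] i[of "x + h"] by (auto simp: algebra_simps)
    ultimately show "\<bar>heat d \<phi> (x + h) - heat d \<phi> x - heat d D x \<bullet> h\<bar> \<le> C * (norm h)\<^sup>2"
      using b[of "\<lambda>y. \<phi> ((x + y) + h) - \<phi> (x + y) - D (x + y) \<bullet> h" "C * (norm h)\<^sup>2"] f'(4) by simp
  qed
qed

section \<open>Smooth approximation of half planes\<close>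

lemma arctan_taylor:
  fixes x h :: real
  shows "\<bar>arctan (x + h) - arctan x\<bar> \<le> \<bar>h\<bar>" "\<bar>arctan (x + h) - arctan x - h / (1 + x\<^sup>2)\<bar> \<le> h\<^sup>2"
proof -
  have 1: "1 / (1 + x\<^sup>2) \<le> 1" for x :: real using zero_le_power2[of x] by (simp add: divide_le_eq_1 add_pos_nonneg)
  show "\<bar>arctan (x + h) - arctan x\<bar> \<le> \<bar>h\<bar>"
    using field_differentiable_bound[of UNIV arctan "\<lambda>x. inverse (1 + x\<^sup>2)" 1 "x + h" x] 1 DERIV_arctan
    by (auto simp: inverse_eq_divide)
  \<comment> \<open>The derivative of arctan is 1-Lipschitz, since
    \<open>2 * \<bar>x\<bar> \<le> (1 + x^2)^2\<close>.\<close>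
  have lip: "\<bar>inverse (1 + y\<^sup>2) - inverse (1 + x\<^sup>2)\<bar> \<le> \<bar>y - x\<bar>" for y :: real
  proof -
    have d: "((\<lambda>x. inverse (1 + x\<^sup>2)) has_field_derivative (- (2 * x) / (1 + x\<^sup>2)\<^sup>2)) (at x within UNIV)" for x :: real
    proof -
      have "1 + x\<^sup>2 > 0" by (intro add_pos_nonneg) auto
      then have "1 + x\<^sup>2 \<noteq> 0" by linarith
      then show ?thesis
        by (auto intro!: derivative_eq_intros simp del: power_inverse inverse_eq_iff_eq simp: divide_inverse power2_eq_square)
    qed
    have "norm (- (2 * x) / (1 + x\<^sup>2)\<^sup>2) \<le> 1" for x :: real
    proof -
      have "\<bar>2 * x\<bar> \<le> 1 + x\<^sup>2" using sum_squares_bound[of 1 "\<bar>x\<bar>"] by (simp add: abs_mult)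
      also have "\<dots> \<le> (1 + x\<^sup>2)\<^sup>2" by (rule self_le_power) simp_all
      finally show ?thesis by (simp add: abs_mult divide_le_eq_1)
    qed
    from field_differentiable_bound[OF convex_UNIV d this, of y x] show ?thesis by simp
  qed
  \<comment> \<open>The mean value estimate is applied to arctan minus its linear part at
    \<open>x\<close>; on this interval the derivative of that difference is at most
    \<open>\<bar>h\<bar>\<close> in absolute value.\<close>
  let ?S = "cball x \<bar>h\<bar>"
  have "norm ((arctan (x + h) - (x + h) * inverse (1 + x\<^sup>2)) - (arctan x - x * inverse (1 + x\<^sup>2))) \<le> \<bar>h\<bar> * norm ((x + h) - x)"
  proof (rule field_differentiable_bound[of ?S _ "\<lambda>y. inverse (1 + y\<^sup>2) - inverse (1 + x\<^sup>2)"])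
    show "((\<lambda>y. arctan y - y * inverse (1 + x\<^sup>2)) has_field_derivative inverse (1 + y\<^sup>2) - inverse (1 + x\<^sup>2)) (at y within ?S)" for y
      by (auto intro!: derivative_eq_intros)
    show "norm (inverse (1 + y\<^sup>2) - inverse (1 + x\<^sup>2)) \<le> \<bar>h\<bar>" if "y \<in> ?S" for y
      using lip[of y] that by (simp add: dist_real_def abs_minus_commute)
  qed (auto simp: dist_real_def)
  then show "\<bar>arctan (x + h) - arctan x - h / (1 + x\<^sup>2)\<bar> \<le> h\<^sup>2"
    by (simp add: algebra_simps divide_inverse power2_eq_square)
qed

text \<open>The shift by \<open>sqrt n\<close> makes the limit vanish on the boundary of the half plane \<open>{x. w \<bullet> x < c}\<close>.\<close>

definition half_approx :: "real \<times> real \<Rightarrow> real \<Rightarrow> nat \<Rightarrow> real \<times> real \<Rightarrow> real" where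
  "half_approx w c n x = 1/2 + arctan (n * (c - w \<bullet> x) - sqrt n) / pi"

lemma smooth_fun_half_approx:
  "\<exists>D C. smooth_fun (half_approx w c n) D C"
proof -
  let ?l = "\<lambda>x. n * (c - w \<bullet> x) - sqrt n"
  let ?D = "\<lambda>x. - (n / (pi * (1 + (?l x)\<^sup>2))) *\<^sub>R w"
  \<comment> \<open>The summands bound, in this order, the values, the gradient together with the
    first difference, and the second-order remainder.\<close>
  let ?C = "1 + n * norm w + (n * norm w)\<^sup>2"
  have pi1: "a / pi \<le> a" if "a \<ge> 0" for a :: real
    using that pi_gt3 by (simp add: divide_le_eq mult_le_cancel_left1)
  have "smooth_fun (half_approx w c n) ?D ?C"
    unfolding smooth_fun_def
  proof (intro conjI allI)
    show "half_approx w c n \<in> borel_measurable borel"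
      unfolding half_approx_def by (intro borel_measurable_continuous_onI continuous_intros) auto
    show "?D \<in> borel_measurable borel"
      by (intro borel_measurable_continuous_onI continuous_intros) (auto simp: add_nonneg_eq_0_iff)
    fix x h
    have nn: "0 \<le> n * norm w" "0 \<le> (n * norm w)\<^sup>2" by auto
    have "\<bar>arctan (?l x)\<bar> \<le> pi / 2" using arctan_bounded[of "?l x"] by auto
    then have "\<bar>arctan (?l x) / pi\<bar> \<le> 1/2" by (simp add: field_simps)
    then show "\<bar>half_approx w c n x\<bar> \<le> ?C" using nn unfolding half_approx_def by linarith
    have "n / (pi * (1 + (?l x)\<^sup>2)) \<le> n / 1"
      using pi_gt3 by (intro divide_left_mono) (auto intro!: mult_ge1_I add_nonneg_pos simp: mult_pos_pos add_pos_nonneg)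
    then have "norm (?D x) \<le> n * norm w"
      using mult_right_mono[of "n / (pi * (1 + (?l x)\<^sup>2))" n "norm w"] pi_gt_zero by (simp add: abs_of_nonneg)
    then show "norm (?D x) \<le> ?C" using nn by linarith
    have l: "?l (x + h) = ?l x + (- (n * (w \<bullet> h)))" by (simp add: inner_add_right algebra_simps)
    have wh: "\<bar>n * (w \<bullet> h)\<bar> \<le> n * norm w * norm h"
      using Cauchy_Schwarz_ineq2[of w h] by (simp add: abs_mult mult.assoc mult_left_mono)
    have e: "half_approx w c n (x + h) - half_approx w c n x = (arctan (?l (x + h)) - arctan (?l x)) / pi"
      by (simp add: half_approx_def diff_divide_distrib)
    have "\<bar>arctan (?l (x + h)) - arctan (?l x)\<bar> \<le> \<bar>n * (w \<bullet> h)\<bar>"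
      unfolding l using arctan_taylor(1)[of "?l x" "- (n * (w \<bullet> h))"] by simp
    then have "\<bar>half_approx w c n (x + h) - half_approx w c n x\<bar> \<le> n * norm w * norm h"
      unfolding e using wh pi1[of "\<bar>arctan (?l (x + h)) - arctan (?l x)\<bar>"] by simp
    also have "\<dots> \<le> ?C * norm h" using nn by (intro mult_right_mono) auto
    finally show "\<bar>half_approx w c n (x + h) - half_approx w c n x\<bar> \<le> ?C * norm h" .
    have "half_approx w c n (x + h) - half_approx w c n x - ?D x \<bullet> h
      = (arctan (?l (x + h)) - arctan (?l x) - (- (n * (w \<bullet> h))) / (1 + (?l x)\<^sup>2)) / pi"
      unfolding e by (simp add: diff_divide_distrib add_divide_distrib mult.commute)
    moreover have "\<bar>arctan (?l (x + h)) - arctan (?l x) - (- (n * (w \<bullet> h))) / (1 + (?l x)\<^sup>2)\<bar> \<le> (n * (w \<bullet> h))\<^sup>2"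
      unfolding l using arctan_taylor(2)[of "?l x" "- (n * (w \<bullet> h))"] by simp
    ultimately have "\<bar>half_approx w c n (x + h) - half_approx w c n x - ?D x \<bullet> h\<bar> \<le> (n * (w \<bullet> h))\<^sup>2"
      using pi1[of "\<bar>arctan (?l (x + h)) - arctan (?l x) - (- (n * (w \<bullet> h))) / (1 + (?l x)\<^sup>2)\<bar>"] by simp
    also have "\<dots> \<le> (n * norm w * norm h)\<^sup>2" using wh by (metis abs_ge_zero power2_abs power_mono)
    also have "\<dots> = (n * norm w)\<^sup>2 * (norm h)\<^sup>2" by (simp add: power_mult_distrib)
    also have "\<dots> \<le> ?C * (norm h)\<^sup>2" using nn by (intro mult_right_mono) auto
    finally show "\<bar>half_approx w c n (x + h) - half_approx w c n x - ?D x \<bullet> h\<bar> \<le> ?C * (norm h)\<^sup>2" .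
  qed
  then show ?thesis by blast
qed

lemma half_approx_bounds: "0 \<le> half_approx w c n x" "half_approx w c n x \<le> 1"
proof -
  have "\<bar>arctan (n * (c - w \<bullet> x) - sqrt n)\<bar> \<le> pi / 2"
    using arctan_bounded[of "n * (c - w \<bullet> x) - sqrt n"] by auto
  then have "\<bar>arctan (n * (c - w \<bullet> x) - sqrt n) / pi\<bar> \<le> 1/2" by (simp add: field_simps)
  then show "0 \<le> half_approx w c n x" "half_approx w c n x \<le> 1"
    unfolding half_approx_def by linarith+
qed

lemma half_approx_tendsto: "(\<lambda>n. half_approx w c n x) \<longlonglongrightarrow> indicator {x. w \<bullet> x < c} x"
proof -
  let ?y = "c - w \<bullet> x"
  have sq: "filterlim (\<lambda>n. sqrt (real n)) at_top sequentially"
    by (rule filterlim_compose[OF sqrt_at_top filterlim_real_sequentially])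
  show ?thesis
  proof (cases "?y > 0")
    case True
    have "filterlim (\<lambda>n. sqrt (real n) * ?y) at_top sequentially"
      using sq True by (intro filterlim_at_top_mult_tendsto_pos[OF tendsto_const _ sq])
    then have "filterlim (\<lambda>n. -1 + sqrt (real n) * ?y) at_top sequentially"
      by (intro filterlim_tendsto_add_at_top[OF tendsto_const])
    then have "filterlim (\<lambda>n. sqrt (real n) * (-1 + sqrt (real n) * ?y)) at_top sequentially"
      by (intro filterlim_at_top_mult_at_top sq)
    then have "filterlim (\<lambda>n. real n * ?y - sqrt n) at_top sequentially" by (simp add: algebra_simps)
    then have "(\<lambda>n. arctan (real n * ?y - sqrt n)) \<longlonglongrightarrow> pi / 2"
      by (rule filterlim_compose[OF tendsto_arctan_at_top])
    then have "(\<lambda>n. 1/2 + arctan (real n * ?y - sqrt n) / pi) \<longlonglongrightarrow> 1/2 + (pi / 2) / pi"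
      by (intro tendsto_intros) auto
    then show ?thesis using True by (simp add: half_approx_def)
  next
    case False
    have "filterlim (\<lambda>n. real n * ?y - sqrt n) at_bot sequentially"
    proof (rule filterlim_at_bot_mono)
      show "filterlim (\<lambda>n. - sqrt (real n)) at_bot sequentially"
        using sq by (simp add: filterlim_uminus_at_bot)
      show "\<forall>\<^sub>F n in sequentially. real n * ?y - sqrt n \<le> - sqrt n"
        using False by (intro always_eventually) (simp add: mult_nonneg_nonpos)
    qed
    then have "(\<lambda>n. arctan (real n * ?y - sqrt n)) \<longlonglongrightarrow> - (pi / 2)"
      by (rule filterlim_compose[OF tendsto_arctan_at_bot])
    then have "(\<lambda>n. 1/2 + arctan (real n * ?y - sqrt n) / pi) \<longlonglongrightarrow> 1/2 + (- (pi / 2)) / pi"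
      by (intro tendsto_intros) auto
    then show ?thesis using False by (simp add: half_approx_def)
  qed
qed

lemma smooth_fun_prod_indicator:
  "\<exists>\<phi> :: nat \<Rightarrow> real \<times> real \<Rightarrow> real. (\<forall>n. \<exists>D C. smooth_fun (\<phi> n) D C) \<and> (\<forall>n x. 0 \<le> \<phi> n x \<and> \<phi> n x \<le> 1) \<and>
     (\<forall>x. (\<lambda>n. \<phi> n x) \<longlonglongrightarrow> indicator {x. w \<bullet> x < c} x)"
  by (rule exI[of _ "\<lambda>n. half_approx w c n"])
    (auto simp: half_approx_bounds half_approx_tendsto smooth_fun_half_approx)

lemma nn2_dominated:
  fixes u :: "'a \<Rightarrow> 'b::{banach, second_countable_topology}"
  assumes [measurable]: "\<And>n. v n \<in> borel_measurable M" "u \<in> borel_measurable M" and g: "sq_int M g"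
    and b: "\<And>n. AE x in M. norm (u x - v n x) \<le> norm (g x)" and l: "AE x in M. (\<lambda>n. v n x) \<longlonglongrightarrow> u x"
  shows "(\<lambda>n. nn2 M (\<lambda>x. u x - v n x)) \<longlonglongrightarrow> 0"
proof -
  have "(\<lambda>n. \<integral>\<^sup>+x. ennreal ((norm (u x - v n x))\<^sup>2) \<partial>M) \<longlonglongrightarrow> (\<integral>\<^sup>+x. 0 \<partial>M)"
  proof (rule nn_integral_dominated_convergence[where w="\<lambda>x. ennreal ((norm (g x))\<^sup>2)"])
    show "(\<integral>\<^sup>+x. ennreal ((norm (g x))\<^sup>2) \<partial>M) < \<infinity>" using g by (simp add: sq_int_def nn2_def)
    show "(\<lambda>x. ennreal ((norm (g x))\<^sup>2)) \<in> borel_measurable M" using g by measurable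
    show "AE x in M. ennreal ((norm (u x - v n x))\<^sup>2) \<le> ennreal ((norm (g x))\<^sup>2)" for n
      using b[of n] by eventually_elim (auto intro!: ennreal_leI power_mono)
    show "AE x in M. (\<lambda>n. ennreal ((norm (u x - v n x))\<^sup>2)) \<longlonglongrightarrow> 0"
      using l
    proof eventually_elim
      case (elim x)
      then have "(\<lambda>n. (norm (u x - v n x))\<^sup>2) \<longlonglongrightarrow> (norm (u x - u x))\<^sup>2" by (intro tendsto_intros)
      from tendsto_ennrealI[OF this] show "(\<lambda>n. ennreal ((norm (u x - v n x))\<^sup>2)) \<longlonglongrightarrow> 0"
        by (simp only: diff_self norm_zero zero_power2 ennreal_0)
    qed
  qed measurable
  then show ?thesis by (simp add: nn2_def)
qed

lemma nn2_scaleR_const: "nn2 M (\<lambda>x. f x *\<^sub>R e) = ennreal ((norm e)\<^sup>2) * nn2 M f" if "f \<in> borel_measurable M" for f :: "'a \<Rightarrow> real"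
  using that by (simp add: nn2_def power_mult_distrib ennreal_mult nn_integral_cmult mult.commute)

section \<open>Heat semigroup along the Wiener path and representable variables\<close>

context wiener_pair
begin

definition Wp :: "real \<Rightarrow> 'w \<Rightarrow> real \<times> real" where "Wp t \<omega> = (W1 t \<omega>, W2 t \<omega>)"

lemma Wp_measurable: "0 \<le> s \<Longrightarrow> s \<le> t \<Longrightarrow> Wp s \<in> borel_measurable (Fl t)"
  using W_pair_measurable_Fl unfolding Wp_def[abs_def] .

lemma Wp_measurable_M: "0 \<le> s \<Longrightarrow> s \<le> T \<Longrightarrow> Wp s \<in> borel_measurable M"
  using measurable_Fl_M[OF Wp_measurable[of s s]] by simp

lemma Wp_dW: "Wp t \<omega> = Wp s \<omega> + dW s t \<omega>"
  by (simp add: Wp_def dW_def)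

lemma dW_measurable_M: "0 \<le> s \<Longrightarrow> s \<le> T \<Longrightarrow> 0 \<le> t \<Longrightarrow> t \<le> T \<Longrightarrow> dW s t \<in> borel_measurable M"
  using measurable_Fl_M[OF dW_measurable_Fl[of s T t]] by (simp add: borel_prod)

text \<open>The increment from \<open>s\<close> to \<open>b\<close> is split at \<open>t\<close>
  into two independent ones and the first is frozen; the semigroup law is thus read off the Wiener
  process instead of being computed by convolution of densities.\<close>

lemma heat_semigroup:
  fixes \<phi> :: "real \<times> real \<Rightarrow> real"
  assumes st: "0 \<le> s" "s < t" "t \<le> b" "b \<le> T" and f: "smooth_fun \<phi> D C"
  shows "heat (b - s) \<phi> x = (\<integral>y. heat (b - t) \<phi> (x + y) \<partial>gauss2 (t - s))"
proof (cases "t = b")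
  case False
  then have tb: "t < b" using st by simp
  note [measurable] = smooth_funD(1)[OF f]
  have [measurable]: "heat (b - t) \<phi> \<in> borel_measurable borel"
    using smooth_funD(1)[OF smooth_fun_heat[OF f]] st by simp
  have [measurable]: "dW s t \<in> borel_measurable M" "dW t b \<in> borel_measurable M" "dW s b \<in> borel_measurable M"
    using st tb by (auto intro!: dW_measurable_M)
  have "heat (b - s) \<phi> x = (\<integral>y. \<phi> (x + y) \<partial>distr M (borel \<Otimes>\<^sub>M borel) (dW s b))"
    using st by (simp add: heat_def distr_dW)
  also have "\<dots> = (\<integral>\<omega>. \<phi> (x + dW s b \<omega>) \<partial>M)"
    by (rule integral_distr) (simp_all add: borel_prod)
  also have "\<dots> = (\<integral>\<omega>. \<phi> ((x + dW s t \<omega>) + dW t b \<omega>) \<partial>M)"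
  proof -
    have "dW s b \<omega> = dW s t \<omega> + dW t b \<omega>" for \<omega> by (simp add: dW_def)
    then show ?thesis by (simp add: add.assoc)
  qed
  also have "\<dots> = (\<integral>\<omega>. (\<lambda>(u, y). \<phi> (x + u + y)) (dW s t \<omega>, dW t b \<omega>) \<partial>M)" by simp
  also have "\<dots> = (\<integral>\<omega>. (\<integral>y. (\<lambda>(u, y). \<phi> (x + u + y)) (dW s t \<omega>, y) \<partial>gauss2 (b - t)) \<partial>M)"
  proof (rule integral_freeze)
    show "dW s t \<in> measurable (Fl t) borel" using dW_measurable_Fl[of s t t] st by (simp add: borel_prod)
    have "(\<lambda>(u, y). \<phi> (x + u + y)) \<in> borel_measurable (borel \<Otimes>\<^sub>M borel)" by measurable
    then show "(\<lambda>(u, y). \<phi> (x + u + y)) \<in> borel_measurable (borel \<Otimes>\<^sub>M (borel \<Otimes>\<^sub>M borel))" by (simp add: borel_prod)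
    show "integrable M (\<lambda>\<omega>. case (dW s t \<omega>, dW t b \<omega>) of (u, y) \<Rightarrow> \<phi> (x + u + y))"
      by (rule integrable_const_bound[where B=C]) (simp_all add: smooth_funD(3)[OF f])
  qed (use st tb in auto)
  also have "\<dots> = (\<integral>\<omega>. heat (b - t) \<phi> (x + dW s t \<omega>) \<partial>M)"
    using tb by (simp add: heat_def)
  also have "\<dots> = (\<integral>y. heat (b - t) \<phi> (x + y) \<partial>distr M (borel \<Otimes>\<^sub>M borel) (dW s t))"
    by (rule integral_distr[symmetric]) (simp_all add: borel_prod)
  also have "\<dots> = (\<integral>y. heat (b - t) \<phi> (x + y) \<partial>gauss2 (t - s))"
    using st by (simp add: distr_dW)
  finally show ?thesis .
qed (use st in \<open>simp add: heat_def\<close>)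

text \<open>\<open>v\<close> at \<open>Wp s\<close> is the conditional mean of \<open>v'\<close> at
  \<open>Wp t\<close>, and the linear term uses the gradient of \<open>v'\<close>. The remainder is
  therefore centred given the past; by the Taylor bound it is quadratic in the increment up to a
  term of order \<open>t - s\<close>, so its squared norm has order
  \<open>(t - s)^2\<close>.\<close>

lemma heat_step:
  fixes v v' :: "real \<times> real \<Rightarrow> real"
  assumes st: "0 \<le> s" "s < t" "t \<le> T" and f: "smooth_fun v' D C" and v: "\<And>x. v x = (\<integral>y. v' (x + y) \<partial>gauss2 (t - s))"
    and v_meas: "v \<in> borel_measurable borel"
  defines "R \<equiv> \<lambda>\<omega>. v' (Wp t \<omega>) - v (Wp s \<omega>) - D (Wp s \<omega>) \<bullet> dW s t \<omega>"
  shows "R \<in> borel_measurable (Fl t)" "nn2 M R \<le> ennreal (24 * C\<^sup>2 * (t - s)\<^sup>2)"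
    "Z \<in> borel_measurable (Fl s) \<Longrightarrow> sq_int M Z \<Longrightarrow> (\<integral>\<omega>. Z \<omega> * R \<omega> \<partial>M) = 0"
proof -
  note [measurable] = smooth_funD(1,2)[OF f] v_meas
  have d: "t - s > 0" using st by simp
  interpret G: prob_space "gauss2 (t - s)" using d by (rule prob_space_gauss2)
  note mo = gauss2_moments[OF d]
  have "Wp t \<in> borel_measurable (Fl t)" "Wp s \<in> borel_measurable (Fl t)" "dW s t \<in> borel_measurable (Fl t)"
    using st dW_measurable_Fl[of s t t] by (auto intro!: Wp_measurable simp: borel_prod)
  note mFl = this
  show "R \<in> borel_measurable (Fl t)"
    unfolding R_def using mFl by measurable
  then have [measurable]: "R \<in> borel_measurable M" using measurable_Fl_M st by blast
  define f where "f u y = v' (u + y) - v u - D u \<bullet> y" for u y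
  have int_v': "integrable (gauss2 (t - s)) (\<lambda>y. v' (u + y))" for u
    by (rule G.integrable_const_bound[where B=C]) (simp_all add: smooth_funD(3)[OF f] gauss2_measurable)
  have lin: "has_bochner_integral (gauss2 (t - s)) (\<lambda>y. D u \<bullet> y) 0" for u
  proof -
    have "has_bochner_integral (gauss2 (t - s)) (\<lambda>y. fst (D u) * fst y + snd (D u) * snd y) (fst (D u) * 0 + snd (D u) * 0)"
      by (intro has_bochner_integral_add has_bochner_integral_mult_right mo)
    also have "(\<lambda>y. fst (D u) * fst y + snd (D u) * snd y) = (\<lambda>y. D u \<bullet> y)"
      by (simp add: inner_prod_def)
    finally show ?thesis by simp
  qed
  have f0: "(\<integral>y. f u y \<partial>gauss2 (t - s)) = 0" for u
    unfolding f_def using int_v'[of u] lin[of u] v[of u] G.prob_space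
    by (simp add: has_bochner_integral_iff)
  \<comment> \<open>The linear term has mean zero and may be subtracted under the integral; the
    Taylor bound is then averaged, \<open>2 * (t - s)\<close> being the mean of
    \<open>(norm y)^2\<close>.\<close>
  have diff: "\<bar>v u - v' u\<bar> \<le> C * (2 * (t - s))" for u
  proof -
    have i: "integrable (gauss2 (t - s)) (\<lambda>y. v' (u + y) - v' u - D u \<bullet> y)"
      using int_v'[of u] lin[of u] by (simp add: has_bochner_integral_iff)
    have "v u - v' u = (\<integral>y. v' (u + y) - v' u - D u \<bullet> y \<partial>gauss2 (t - s))"
      using int_v'[of u] lin[of u] v[of u] G.prob_space by (simp add: has_bochner_integral_iff)
    also have "\<bar>\<dots>\<bar> \<le> (\<integral>y. \<bar>v' (u + y) - v' u - D u \<bullet> y\<bar> \<partial>gauss2 (t - s))"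
      using integral_norm_bound[of "gauss2 (t - s)" "\<lambda>y. v' (u + y) - v' u - D u \<bullet> y"] by simp
    also have "\<dots> \<le> (\<integral>y. C * (norm y)\<^sup>2 \<partial>gauss2 (t - s))"
      using i mo(6) smooth_funD(6)[OF f] by (intro integral_mono) (simp_all add: has_bochner_integral_iff)
    also have "\<dots> = C * (2 * (t - s))" using mo(6) by (simp add: has_bochner_integral_iff)
    finally show ?thesis .
  qed
  have fb: "(f u y)\<^sup>2 \<le> 2 * C\<^sup>2 * norm y ^ 4 + 8 * C\<^sup>2 * (t - s)\<^sup>2" for u y
  proof -
    have "f u y = (v' (u + y) - v' u - D u \<bullet> y) - (v u - v' u)" by (simp add: f_def)
    then have "\<bar>f u y\<bar> \<le> C * (norm y)\<^sup>2 + C * (2 * (t - s))"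
      using smooth_funD(6)[OF f, of u y] diff[of u] by linarith
    then have "(f u y)\<^sup>2 \<le> (C * (norm y)\<^sup>2 + C * (2 * (t - s)))\<^sup>2"
      by (metis abs_ge_zero power2_abs power_mono)
    also have "\<dots> \<le> 2 * (C * (norm y)\<^sup>2)\<^sup>2 + 2 * (C * (2 * (t - s)))\<^sup>2"
      using norm_add_power2_le[of 1 "C * (norm y)\<^sup>2" "C * (2 * (t - s))"] by simp
    also have "\<dots> = 2 * C\<^sup>2 * norm y ^ 4 + 8 * C\<^sup>2 * (t - s)\<^sup>2"
      by (simp add: power_mult_distrib power_mult[symmetric]) (simp add: power2_eq_square algebra_simps)
    finally show ?thesis .
  qed
  have Rf: "R \<omega> = f (Wp s \<omega>) (dW s t \<omega>)" for \<omega> by (simp add: R_def f_def Wp_dW[of t \<omega> s])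
  have dWM[measurable]: "dW s t \<in> borel_measurable M" using st by (intro dW_measurable_M) auto
  \<comment> \<open>The fourth moment contributes \<open>2 * 8\<close> and the deterministic part 8,
    hence the constant 24.\<close>
  show R2: "nn2 M R \<le> ennreal (24 * C\<^sup>2 * (t - s)\<^sup>2)"
  proof -
    have "nn2 M R \<le> (\<integral>\<^sup>+\<omega>. ennreal (2 * C\<^sup>2 * norm (dW s t \<omega>) ^ 4 + 8 * C\<^sup>2 * (t - s)\<^sup>2) \<partial>M)"
      unfolding nn2_def using fb by (intro nn_integral_mono ennreal_leI) (simp add: Rf)
    also have "\<dots> = (\<integral>\<^sup>+y. ennreal (2 * C\<^sup>2 * norm y ^ 4 + 8 * C\<^sup>2 * (t - s)\<^sup>2) \<partial>distr M (borel \<Otimes>\<^sub>M borel) (dW s t))"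
      by (rule nn_integral_distr[symmetric]) (simp_all add: borel_prod)
    also have "\<dots> = (\<integral>\<^sup>+y. ennreal (2 * C\<^sup>2 * norm y ^ 4 + 8 * C\<^sup>2 * (t - s)\<^sup>2) \<partial>gauss2 (t - s))"
      using st by (simp add: distr_dW)
    also have "\<dots> = ennreal (2 * C\<^sup>2 * (8 * (t - s)\<^sup>2) + 8 * C\<^sup>2 * (t - s)\<^sup>2)"
    proof -
      have "has_bochner_integral (gauss2 (t - s)) (\<lambda>y. 8 * C\<^sup>2 * (t - s)\<^sup>2) (8 * C\<^sup>2 * (t - s)\<^sup>2)"
        using G.prob_space by (simp add: has_bochner_integral_iff)
      then have "has_bochner_integral (gauss2 (t - s)) (\<lambda>y. 2 * C\<^sup>2 * norm y ^ 4 + 8 * C\<^sup>2 * (t - s)\<^sup>2)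
        (2 * C\<^sup>2 * (8 * (t - s)\<^sup>2) + 8 * C\<^sup>2 * (t - s)\<^sup>2)"
        by (rule has_bochner_integral_add[rotated]) (intro has_bochner_integral_mult_right mo(7))
      then show ?thesis by (subst nn_integral_eq_integral) (auto simp: has_bochner_integral_iff)
    qed
    finally show ?thesis by (simp add: algebra_simps)
  qed
  show "(\<integral>\<omega>. Z \<omega> * R \<omega> \<partial>M) = 0" if Z: "Z \<in> borel_measurable (Fl s)" "sq_int M Z"
  proof -
    have "sq_int M R" using R2 by (auto simp: sq_int_def intro: le_less_trans)
    then have "integrable M (\<lambda>\<omega>. Z \<omega> * R \<omega>)" using sq_int_integrable_inner[OF Z(2)] by simp
    then have i: "integrable M (\<lambda>\<omega>. (\<lambda>((z, u), y). z * f u y) ((Z \<omega>, Wp s \<omega>), dW s t \<omega>))" by (simp add: Rf)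
    have "(\<integral>\<omega>. Z \<omega> * R \<omega> \<partial>M) = (\<integral>\<omega>. (\<lambda>((z, u), y). z * f u y) ((Z \<omega>, Wp s \<omega>), dW s t \<omega>) \<partial>M)"
      by (simp add: Rf)
    also have "\<dots> = (\<integral>\<omega>. (\<integral>y. (\<lambda>((z, u), y). z * f u y) ((Z \<omega>, Wp s \<omega>), y) \<partial>gauss2 (t - s)) \<partial>M)"
    proof (rule integral_freeze[OF st _ _ i])
      have [measurable]: "Wp s \<in> borel_measurable (Fl s)" using st by (intro Wp_measurable) auto
      show "(\<lambda>\<omega>. (Z \<omega>, Wp s \<omega>)) \<in> Fl s \<rightarrow>\<^sub>M (borel \<Otimes>\<^sub>M borel)" using Z by measurable
      have "(\<lambda>x. fst (fst x) * (v' (snd (fst x) + snd x) - v (snd (fst x)) - D (snd (fst x)) \<bullet> snd x)) \<in> borel_measurable ((borel \<Otimes>\<^sub>M borel) \<Otimes>\<^sub>M borel)"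
        by measurable
      also have "(\<lambda>x. fst (fst x) * (v' (snd (fst x) + snd x) - v (snd (fst x)) - D (snd (fst x)) \<bullet> snd x)) = (\<lambda>((z, u), y). z * f u y)"
        by (simp add: fun_eq_iff f_def)
      finally have "(\<lambda>((z, u), y). z * f u y) \<in> borel_measurable ((borel \<Otimes>\<^sub>M borel) \<Otimes>\<^sub>M borel)" .
      then show "(\<lambda>((z, u), y). z * f u y) \<in> borel_measurable ((borel \<Otimes>\<^sub>M borel) \<Otimes>\<^sub>M (borel \<Otimes>\<^sub>M borel))"
        by (simp add: borel_prod)
    qed
    also have "\<dots> = 0" by (simp add: f0)
    finally show ?thesis .
  qed
qed

text \<open>Representability is phrased as approximability by constants plus elementary integrals,
  so closedness under square-mean limits is a triangle inequality. Limiting integrands are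
  constructed only once, for the final variable.\<close>

definition rep :: "('w \<Rightarrow> real^'n) \<Rightarrow> bool" where
  "rep X \<longleftrightarrow> X \<in> borel_measurable M \<and> (\<forall>\<epsilon>>0. \<exists>c h1 I1 h2 I2. elementary_integral M Fl T W1 h1 I1 \<and>
     elementary_integral M Fl T W2 h2 I2 \<and> nn2 M (\<lambda>\<omega>. X \<omega> - (c + (I1 T \<omega> + I2 T \<omega>))) \<le> ennreal \<epsilon>)"

lemma rep_measurable: "rep X \<Longrightarrow> X \<in> borel_measurable M"
  by (simp add: rep_def)

lemma elementary_T_measurable:
  fixes h1 h2 :: "real \<Rightarrow> 'w \<Rightarrow> real^'n"
  assumes "elementary_integral M Fl T W1 h1 I1" "elementary_integral M Fl T W2 h2 I2"
  shows "(\<lambda>\<omega>. I1 T \<omega> + I2 T \<omega>) \<in> borel_measurable M"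
  using sq_int_measurable[OF elementary_at(2)[OF assms, of T]] T_pos by simp

lemma rep_approx:
  fixes X :: "'w \<Rightarrow> real^'n"
  assumes X: "X \<in> borel_measurable M" and a: "\<And>\<epsilon>. \<epsilon> > 0 \<Longrightarrow> \<exists>Y. rep Y \<and> nn2 M (\<lambda>\<omega>. X \<omega> - Y \<omega>) \<le> ennreal \<epsilon>"
  shows "rep X"
  unfolding rep_def
proof (intro conjI allI impI X)
  fix \<epsilon> :: real assume "\<epsilon> > 0"
  then have e: "\<epsilon> / 4 > 0" by simp
  from a[OF e] obtain Y where Y: "rep Y" "nn2 M (\<lambda>\<omega>. X \<omega> - Y \<omega>) \<le> ennreal (\<epsilon> / 4)" by auto
  from Y(1) e obtain c h1 I1 h2 I2 where E: "elementary_integral M Fl T W1 h1 I1" "elementary_integral M Fl T W2 h2 I2"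
    and n: "nn2 M (\<lambda>\<omega>. Y \<omega> - (c + (I1 T \<omega> + I2 T \<omega>))) \<le> ennreal (\<epsilon> / 4)" unfolding rep_def by meson
  note [measurable] = elementary_T_measurable[OF E] X rep_measurable[OF Y(1)]
  have "nn2 M (\<lambda>\<omega>. X \<omega> - (c + (I1 T \<omega> + I2 T \<omega>))) \<le> 2 * nn2 M (\<lambda>\<omega>. X \<omega> - Y \<omega>) + 2 * nn2 M (\<lambda>\<omega>. Y \<omega> - (c + (I1 T \<omega> + I2 T \<omega>)))"
    by (rule nn2_triangle_le) measurable
  also have "\<dots> \<le> 2 * ennreal (\<epsilon> / 4) + 2 * ennreal (\<epsilon> / 4)" by (intro add_mono mult_left_mono Y n) auto
  also have "\<dots> = ennreal (2 * (\<epsilon> / 4)) + ennreal (2 * (\<epsilon> / 4))" using \<open>\<epsilon> > 0\<close> ennreal_mult[of 2 "\<epsilon> / 4"] by simp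
  also have "\<dots> = ennreal \<epsilon>" using \<open>\<epsilon> > 0\<close> by (subst ennreal_plus[symmetric]) auto
  finally show "\<exists>c h1 I1 h2 I2. elementary_integral M Fl T W1 h1 I1 \<and>
     elementary_integral M Fl T W2 h2 I2 \<and> nn2 M (\<lambda>\<omega>. X \<omega> - (c + (I1 T \<omega> + I2 T \<omega>))) \<le> ennreal \<epsilon>" using E by blast
qed

lemma rep_tendsto:
  fixes X :: "'w \<Rightarrow> real^'n"
  assumes X: "X \<in> borel_measurable M" and Y: "\<And>n. rep (Y n)" and l: "(\<lambda>n. nn2 M (\<lambda>\<omega>. X \<omega> - Y n \<omega>)) \<longlonglongrightarrow> 0"
  shows "rep X"
proof (rule rep_approx[OF X])
  fix \<epsilon> :: real assume "\<epsilon> > 0"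
  then have "eventually (\<lambda>n. nn2 M (\<lambda>\<omega>. X \<omega> - Y n \<omega>) < ennreal \<epsilon>) sequentially"
    by (intro order_tendstoD(2)[OF l]) auto
  then obtain n where "nn2 M (\<lambda>\<omega>. X \<omega> - Y n \<omega>) < ennreal \<epsilon>" by (auto simp: eventually_sequentially)
  then show "\<exists>Y. rep Y \<and> nn2 M (\<lambda>\<omega>. X \<omega> - Y \<omega>) \<le> ennreal \<epsilon>" using Y[of n] by (auto intro: less_imp_le)
qed

lemma rep_cong_AE:
  fixes X :: "'w \<Rightarrow> real^'n"
  assumes "rep Y" "X \<in> borel_measurable M" "AE \<omega> in M. X \<omega> = Y \<omega>"
  shows "rep X"
proof (rule rep_tendsto[where Y="\<lambda>n. Y"])
  have "nn2 M (\<lambda>\<omega>. X \<omega> - Y \<omega>) = nn2 M (\<lambda>\<omega>. 0 :: real^'n)"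
    using assms(3) by (intro nn2_cong_AE) auto
  then show "(\<lambda>n. nn2 M (\<lambda>\<omega>. X \<omega> - Y \<omega>)) \<longlonglongrightarrow> 0" by simp
qed (use assms in auto)

lemma rep_elementary:
  fixes h1 h2 :: "real \<Rightarrow> 'w \<Rightarrow> real^'n"
  assumes E: "elementary_integral M Fl T W1 h1 I1" "elementary_integral M Fl T W2 h2 I2"
  shows "rep (\<lambda>\<omega>. c + (I1 T \<omega> + I2 T \<omega>))"
  unfolding rep_def
proof (intro conjI allI impI)
  note [measurable] = elementary_T_measurable[OF E]
  show "(\<lambda>\<omega>. c + (I1 T \<omega> + I2 T \<omega>)) \<in> borel_measurable M" by measurable
  fix \<epsilon> :: real
  have "nn2 M (\<lambda>\<omega>. (c + (I1 T \<omega> + I2 T \<omega>)) - (c + (I1 T \<omega> + I2 T \<omega>))) \<le> ennreal \<epsilon>" by simp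
  then show "\<exists>c' h1 I1' h2 I2'. elementary_integral M Fl T W1 h1 I1' \<and>
     elementary_integral M Fl T W2 h2 I2' \<and> nn2 M (\<lambda>\<omega>. (c + (I1 T \<omega> + I2 T \<omega>)) - (c' + (I1' T \<omega> + I2' T \<omega>))) \<le> ennreal \<epsilon>"
    using E by blast
qed

lemma rep_const: "rep (\<lambda>\<omega>. c :: real^'n)"
  using rep_elementary[OF elementary_zero[OF T_pos] elementary_zero[OF T_pos], of c] by simp

lemma rep_lincomb:
  fixes X Y :: "'w \<Rightarrow> real^'n"
  assumes X: "rep X" and Y: "rep Y"
  shows "rep (\<lambda>\<omega>. a *\<^sub>R X \<omega> + b *\<^sub>R Y \<omega>)"
proof (rule rep_approx)
  note [measurable] = rep_measurable[OF X] rep_measurable[OF Y]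
  show "(\<lambda>\<omega>. a *\<^sub>R X \<omega> + b *\<^sub>R Y \<omega>) \<in> borel_measurable M" by measurable
  fix \<epsilon> :: real assume e0: "\<epsilon> > 0"
  \<comment> \<open>Chosen so that the two errors, weighted by \<open>2 * a^2\<close> and
    \<open>2 * b^2\<close>, add up to at most \<open>\<epsilon>\<close>; the summand 1 keeps the
    denominator positive.\<close>
  define \<delta> where "\<delta> = \<epsilon> / (2 * a\<^sup>2 + 2 * b\<^sup>2 + 1)"
  have den: "2 * a\<^sup>2 + 2 * b\<^sup>2 + 1 > 0" by (intro add_nonneg_pos) auto
  have d: "\<delta> > 0" using e0 den by (simp add: \<delta>_def)
  from X d obtain c h1 I1 h2 I2 where E: "elementary_integral M Fl T W1 h1 I1" "elementary_integral M Fl T W2 h2 I2"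
    and n: "nn2 M (\<lambda>\<omega>. X \<omega> - (c + (I1 T \<omega> + I2 T \<omega>))) \<le> ennreal \<delta>" unfolding rep_def by meson
  from Y d obtain c' h1' I1' h2' I2' where E': "elementary_integral M Fl T W1 h1' I1'" "elementary_integral M Fl T W2 h2' I2'"
    and n': "nn2 M (\<lambda>\<omega>. Y \<omega> - (c' + (I1' T \<omega> + I2' T \<omega>))) \<le> ennreal \<delta>" unfolding rep_def by meson
  note [measurable] = elementary_T_measurable[OF E] elementary_T_measurable[OF E']
  define Z where "Z \<omega> = (a *\<^sub>R c + b *\<^sub>R c') + ((a *\<^sub>R I1 T \<omega> + b *\<^sub>R I1' T \<omega>) + (a *\<^sub>R I2 T \<omega> + b *\<^sub>R I2' T \<omega>))" for \<omega>
  have Z: "rep Z"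
    unfolding Z_def[abs_def]
    by (rule rep_elementary[OF elementary_lincomb[OF E(1) E'(1) T_pos sub_Fl] elementary_lincomb[OF E(2) E'(2) T_pos sub_Fl]])
  have "nn2 M (\<lambda>\<omega>. a *\<^sub>R X \<omega> + b *\<^sub>R Y \<omega> - Z \<omega>) =
    nn2 M (\<lambda>\<omega>. a *\<^sub>R (X \<omega> - (c + (I1 T \<omega> + I2 T \<omega>))) + b *\<^sub>R (Y \<omega> - (c' + (I1' T \<omega> + I2' T \<omega>))))"
    by (simp add: Z_def algebra_simps)
  also have "\<dots> \<le> 2 * nn2 M (\<lambda>\<omega>. a *\<^sub>R (X \<omega> - (c + (I1 T \<omega> + I2 T \<omega>)))) + 2 * nn2 M (\<lambda>\<omega>. b *\<^sub>R (Y \<omega> - (c' + (I1' T \<omega> + I2' T \<omega>))))"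
    by (rule nn2_add_le) measurable
  also have "\<dots> = 2 * (ennreal (a\<^sup>2) * nn2 M (\<lambda>\<omega>. X \<omega> - (c + (I1 T \<omega> + I2 T \<omega>)))) + 2 * (ennreal (b\<^sup>2) * nn2 M (\<lambda>\<omega>. Y \<omega> - (c' + (I1' T \<omega> + I2' T \<omega>))))"
    by (subst (1 2) nn2_scale) measurable
  also have "\<dots> \<le> 2 * (ennreal (a\<^sup>2) * ennreal \<delta>) + 2 * (ennreal (b\<^sup>2) * ennreal \<delta>)"
    by (intro add_mono mult_left_mono n n') auto
  also have "\<dots> = ennreal ((2 * a\<^sup>2 + 2 * b\<^sup>2) * \<delta>)"
  proof -
    have two: "2 * ennreal x = ennreal (2 * x)" if "x \<ge> 0" for x using that ennreal_mult[of 2 x] by simp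
    show ?thesis
      using d by (simp add: ennreal_mult[symmetric] two ennreal_plus[symmetric] distrib_right mult.assoc del: ennreal_plus)
  qed
  also have "\<dots> \<le> ennreal \<epsilon>"
  proof (rule ennreal_leI)
    have "(2 * a\<^sup>2 + 2 * b\<^sup>2) * \<delta> \<le> (2 * a\<^sup>2 + 2 * b\<^sup>2 + 1) * \<delta>" using d by (intro mult_right_mono) auto
    also have "\<dots> = \<epsilon>" using den by (simp add: \<delta>_def)
    finally show "(2 * a\<^sup>2 + 2 * b\<^sup>2) * \<delta> \<le> \<epsilon>" .
  qed
  finally show "\<exists>Y'. rep Y' \<and> nn2 M (\<lambda>\<omega>. a *\<^sub>R X \<omega> + b *\<^sub>R Y \<omega> - Y' \<omega>) \<le> ennreal \<epsilon>" using Z by blast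
qed

lemma rep_sum:
  fixes X :: "'i \<Rightarrow> 'w \<Rightarrow> real^'n"
  assumes "\<And>i. i \<in> I \<Longrightarrow> rep (X i)"
  shows "rep (\<lambda>\<omega>. \<Sum>i\<in>I. X i \<omega>)"
  using assms
proof (induction I rule: infinite_finite_induct)
  case (insert i I)
  then show ?case using rep_lincomb[of "X i" "\<lambda>\<omega>. \<Sum>i\<in>I. X i \<omega>" 1 1] by simp
qed (auto intro: rep_const)

text \<open>The last factor is moved from time \<open>b\<close> to time \<open>a\<close>. Over
  \<open>N\<close> equal steps the first-order terms form elementary integrals; the \<open>N\<close>
  remainders have squared norms of order \<open>1/N^2\<close> and are orthogonal, so their sum has
  squared norm of order \<open>1/N\<close>. The triangle inequality alone would leave an error of
  order 1.\<close>

lemma rep_step: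
  fixes X :: "'w \<Rightarrow> real" and e :: "real^'n"
  assumes ab: "0 \<le> a" "a < b" "b \<le> T" and X: "X \<in> borel_measurable (Fl a)" "\<And>\<omega>. \<omega> \<in> space M \<Longrightarrow> \<bar>X \<omega>\<bar> \<le> B"
    and f: "smooth_fun \<phi> D C" and r: "rep (\<lambda>\<omega>. (X \<omega> * heat (b - a) \<phi> (Wp a \<omega>)) *\<^sub>R e)"
  shows "rep (\<lambda>\<omega>. (X \<omega> * \<phi> (Wp b \<omega>)) *\<^sub>R e)"
proof (rule rep_approx)
  note [measurable] = smooth_funD(1)[OF f]
  have XM[measurable]: "X \<in> borel_measurable M" using measurable_Fl_M[OF X(1)] ab by simp
  have [measurable]: "Wp b \<in> borel_measurable M" using ab by (intro Wp_measurable_M) auto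
  show "(\<lambda>\<omega>. (X \<omega> * \<phi> (Wp b \<omega>)) *\<^sub>R e) \<in> borel_measurable M" by measurable
  fix \<epsilon> :: real assume "\<epsilon> > 0"
  \<comment> \<open>\<open>K / N\<close> bounds the total squared error computed at the end:
    \<open>N\<close> remainders, each over a step of length \<open>(b - a) / N\<close>.\<close>
  define K where "K = (norm e)\<^sup>2 * (B\<^sup>2 * (24 * C\<^sup>2 * (b - a)\<^sup>2))"
  have K0: "0 \<le> K" by (simp add: K_def)
  obtain N :: nat where N: "N > 0" "K / N \<le> \<epsilon>"
  proof -
    obtain N :: nat where "K / \<epsilon> < N" using reals_Archimedean2 by blast
    then have "K / Suc N \<le> \<epsilon>" using \<open>\<epsilon> > 0\<close> K0 by (simp add: field_simps)
    then show thesis using that[of "Suc N"] by simp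
  qed
  define \<delta> where "\<delta> = (b - a) / N"
  have \<delta>: "\<delta> > 0" using ab N by (simp add: \<delta>_def)
  define s where "s k = a + real k * \<delta>" for k :: nat
  have s0: "s 0 = a" and sN: "s N = b" using N by (auto simp: s_def \<delta>_def)
  have s_step: "s (Suc k) = s k + \<delta>" for k by (simp add: s_def algebra_simps)
  have s_less: "s k < s (Suc k)" for k using \<delta> by (simp add: s_step)
  have s_mono: "s j \<le> s k" if "j \<le> k" for j k using that \<delta> by (auto simp: s_def)
  have s_range: "a \<le> s k \<and> 0 \<le> s k \<and> s k \<le> b \<and> s k \<le> T" if "k \<le> N" for k
    using s_mono[of 0 k] s_mono[OF that] s0 sN ab by auto
  \<comment> \<open>The backward heat flow of \<open>\<phi>\<close> from time \<open>b\<close>: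
    \<open>v 0\<close> is the function in the hypothesis \<open>r\<close>, and \<open>v N\<close> is
    \<open>\<phi>\<close> itself.\<close>
  define v where "v k = heat (b - s k) \<phi>" for k
  define Dv where "Dv k = heat (b - s k) D" for k
  have sm: "smooth_fun (v k) (Dv k) C" if "k \<le> N" for k
    unfolding v_def Dv_def using s_range[OF that] by (intro smooth_fun_heat[OF f]) auto
  have tower: "v k x = (\<integral>y. v (Suc k) (x + y) \<partial>gauss2 (s (Suc k) - s k))" if "k < N" for k x
    unfolding v_def using s_range[of k] s_range[of "Suc k"] s_less[of k] that ab
    by (intro heat_semigroup[OF _ _ _ _ f]) auto
  define L where "L k \<omega> = Dv (Suc k) (Wp (s k) \<omega>) \<bullet> dW (s k) (s (Suc k)) \<omega>" for k \<omega>
  define R where "R k \<omega> = v (Suc k) (Wp (s (Suc k)) \<omega>) - v k (Wp (s k) \<omega>) - L k \<omega>" for k \<omega>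
  have R: "R k \<in> borel_measurable (Fl (s (Suc k)))" "nn2 M (R k) \<le> ennreal (24 * C\<^sup>2 * \<delta>\<^sup>2)"
    "\<And>Z. Z \<in> borel_measurable (Fl (s k)) \<Longrightarrow> sq_int M Z \<Longrightarrow> (\<integral>\<omega>. Z \<omega> * R k \<omega> \<partial>M) = 0" if k: "k < N" for k
  proof -
    have r': "0 \<le> s k" "s k < s (Suc k)" "s (Suc k) \<le> T" using s_range[of k] s_range[of "Suc k"] s_less[of k] k by auto
    have m: "v k \<in> borel_measurable borel" using smooth_funD(1)[OF sm[of k]] k by simp
    have sk: "smooth_fun (v (Suc k)) (Dv (Suc k)) C" using k by (intro sm) auto
    note hs = heat_step[OF r' sk tower[OF k] m]
    have RR: "R k = (\<lambda>\<omega>. v (Suc k) (Wp (s (Suc k)) \<omega>) - v k (Wp (s k) \<omega>) - Dv (Suc k) (Wp (s k) \<omega>) \<bullet> dW (s k) (s (Suc k)) \<omega>)"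
      by (simp add: R_def L_def fun_eq_iff)
    show "R k \<in> borel_measurable (Fl (s (Suc k)))" "nn2 M (R k) \<le> ennreal (24 * C\<^sup>2 * \<delta>\<^sup>2)"
      using hs(1,2) unfolding RR s_step by simp_all
    show "(\<integral>\<omega>. Z \<omega> * R k \<omega> \<partial>M) = 0" if "Z \<in> borel_measurable (Fl (s k))" "sq_int M Z" for Z
      using hs(3)[OF that] unfolding RR .
  qed
  have RM: "R k \<in> borel_measurable M" if "k < N" for k
    using measurable_Fl_M[OF R(1)[OF that]] s_range[of "Suc k"] that by simp
  have XFl: "X \<in> borel_measurable (Fl (s k))" if "k \<le> N" for k
    using measurable_Fl_mono[OF X(1)] s_range[OF that] by simp
  have XR: "nn2 M (\<lambda>\<omega>. X \<omega> * R k \<omega>) \<le> ennreal (B\<^sup>2 * (24 * C\<^sup>2 * \<delta>\<^sup>2))" if k: "k < N" for k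
  proof -
    have "nn2 M (\<lambda>\<omega>. X \<omega> * R k \<omega>) \<le> nn2 M (\<lambda>\<omega>. B *\<^sub>R R k \<omega>)"
    proof (rule nn2_mono_AE)
      show "AE \<omega> in M. norm (X \<omega> * R k \<omega>) \<le> norm (B *\<^sub>R R k \<omega>)"
        using AE_space
      proof eventually_elim
        case (elim \<omega>)
        then have "\<bar>X \<omega>\<bar> \<le> \<bar>B\<bar>" using X(2) by force
        then show ?case by (simp add: abs_mult mult_right_mono)
      qed
    qed
    also have "\<dots> = ennreal (B\<^sup>2) * nn2 M (R k)" by (rule nn2_scale[OF RM[OF k]])
    also have "\<dots> \<le> ennreal (B\<^sup>2) * ennreal (24 * C\<^sup>2 * \<delta>\<^sup>2)" by (intro mult_left_mono R(2)[OF k]) auto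
    also have "\<dots> = ennreal (B\<^sup>2 * (24 * C\<^sup>2 * \<delta>\<^sup>2))" by (simp add: ennreal_mult)
    finally show ?thesis .
  qed
  interpret orthogonal_increments M "\<lambda>k. Fl (s k)" "\<lambda>k \<omega>. X \<omega> * R k \<omega>" N
  proof unfold_locales
    show "subalgebra (Fl (s j)) (Fl (s i))" if "i \<le> j" for i j using s_mono[OF that] by (rule sub_Fl)
    fix k assume k: "k < N"
    have [measurable]: "X \<in> borel_measurable (Fl (s (Suc k)))" using XFl k by simp
    show "(\<lambda>\<omega>. X \<omega> * R k \<omega>) \<in> borel_measurable (Fl (s (Suc k)))" using R(1)[OF k] by measurable
    show "sq_int M (\<lambda>\<omega>. X \<omega> * R k \<omega>)"
      using XR[OF k] RM[OF k] by (auto simp: sq_int_def intro: le_less_trans)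
    fix Z :: "'w \<Rightarrow> real" assume Z: "Z \<in> borel_measurable (Fl (s k))" "sq_int M Z"
    have [measurable]: "X \<in> borel_measurable (Fl (s k))" using XFl k by simp
    \<comment> \<open>Boundedness of \<open>X\<close> lets it join the past factor \<open>Z\<close>
      without loss of square-integrability.\<close>
    have "sq_int M (\<lambda>\<omega>. Z \<omega> * X \<omega>)"
    proof (rule sq_int_bound[OF sq_int_scale[OF Z(2), of B]])
      show "(\<lambda>\<omega>. Z \<omega> * X \<omega>) \<in> borel_measurable M" using Z(2) by measurable
      show "AE \<omega> in M. norm (Z \<omega> * X \<omega>) \<le> norm (B *\<^sub>R Z \<omega>)"
        using AE_space
      proof eventually_elim
        case (elim \<omega>)
        then have "\<bar>X \<omega>\<bar> \<le> \<bar>B\<bar>" using X(2) by force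
        then show ?case by (simp add: abs_mult mult.commute[of "\<bar>Z \<omega>\<bar>"] mult_right_mono)
      qed
    qed
    moreover have "(\<lambda>\<omega>. Z \<omega> * X \<omega>) \<in> borel_measurable (Fl (s k))" using Z(1) by measurable
    ultimately have "(\<integral>\<omega>. (Z \<omega> * X \<omega>) * R k \<omega> \<partial>M) = 0" by (intro R(3)[OF k])
    then show "(\<integral>\<omega>. Z \<omega> \<bullet> (X \<omega> * R k \<omega>) \<partial>M) = 0" by (simp add: mult.assoc)
  qed
  \<comment> \<open>The components of the gradient, taken at the left end point of the cell and
    multiplied by the earlier factor \<open>X\<close>, are the integrands against \<open>W1\<close>
    and \<open>W2\<close>.\<close>
  define \<xi>1 where "\<xi>1 k \<omega> = (X \<omega> * fst (Dv (Suc k) (Wp (s k) \<omega>))) *\<^sub>R e" for k \<omega>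
  define \<xi>2 where "\<xi>2 k \<omega> = (X \<omega> * snd (Dv (Suc k) (Wp (s k) \<omega>))) *\<^sub>R e" for k \<omega>
  have coef: "el_coef M Fl N s \<xi>1" "el_coef M Fl N s \<xi>2"
  proof -
    have *: "el_coef M Fl N s (\<lambda>k \<omega>. (X \<omega> * p (Dv (Suc k) (Wp (s k) \<omega>))) *\<^sub>R e)"
      if p[measurable]: "p \<in> borel_measurable borel" and pn: "\<And>z. \<bar>p z\<bar> \<le> norm z" for p :: "real \<times> real \<Rightarrow> real"
      unfolding el_coef_def
    proof (intro allI impI conjI exI ballI)
      fix k assume k: "k < N"
      have [measurable]: "X \<in> borel_measurable (Fl (s k))" "Wp (s k) \<in> borel_measurable (Fl (s k))"
        using XFl k s_range[of k] by (auto intro!: Wp_measurable)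
      have [measurable]: "Dv (Suc k) \<in> borel_measurable borel" using smooth_funD(2)[OF sm[of "Suc k"]] k by simp
      show "(\<lambda>\<omega>. (X \<omega> * p (Dv (Suc k) (Wp (s k) \<omega>))) *\<^sub>R e) \<in> borel_measurable (Fl (s k))" by measurable
      fix \<omega> assume w: "\<omega> \<in> space M"
      have "\<bar>p (Dv (Suc k) (Wp (s k) \<omega>))\<bar> \<le> C"
        using pn[of "Dv (Suc k) (Wp (s k) \<omega>)"] smooth_funD(4)[OF sm[of "Suc k"], of "Wp (s k) \<omega>"] k by simp
      then show "norm ((X \<omega> * p (Dv (Suc k) (Wp (s k) \<omega>))) *\<^sub>R e) \<le> (B * C) * norm e"
        using X(2)[OF w] by (auto simp: abs_mult intro!: mult_right_mono mult_mono order_trans[OF abs_ge_zero X(2)[OF w]])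
    qed
    have "\<bar>fst z\<bar> \<le> norm z" "\<bar>snd z\<bar> \<le> norm z" for z :: "real \<times> real"
      using norm_fst_le[of "fst z" "snd z"] norm_snd_le[of "snd z" "fst z"] by auto
    moreover have "fst \<in> borel_measurable (borel :: (real \<times> real) measure)" "snd \<in> borel_measurable (borel :: (real \<times> real) measure)"
      by (simp_all add: borel_prod[symmetric])
    ultimately show "el_coef M Fl N s \<xi>1" "el_coef M Fl N s \<xi>2"
      unfolding \<xi>1_def[abs_def] \<xi>2_def[abs_def] by (intro *; simp)+
  qed
  \<comment> \<open>The cells cover only [a,b], which \<open>elementary_integral\<close> admits
    directly.\<close>
  have E: "elementary_integral M Fl T W (el_proc N s \<xi>) (el_int W N s \<xi>)" if "el_coef M Fl N s \<xi>" for W and \<xi> :: "nat \<Rightarrow> 'w \<Rightarrow> real^'n"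
    using that s_less s_range[of N] s0 ab unfolding elementary_integral_def el_coef_def el_proc_def el_int_def
    by (intro exI[of _ N] exI[of _ s] exI[of _ \<xi>]) auto
  note E1 = E[OF coef(1), of W1] and E2 = E[OF coef(2), of W2]
  have JT: "el_int W1 N s \<xi>1 T \<omega> + el_int W2 N s \<xi>2 T \<omega> = (\<Sum>k<N. (X \<omega> * L k \<omega>) *\<^sub>R e)" for \<omega>
  proof -
    have "el_int W1 N s \<xi>1 T \<omega> + el_int W2 N s \<xi>2 T \<omega>
       = (\<Sum>k<N. (W1 (s (Suc k)) \<omega> - W1 (s k) \<omega>) *\<^sub>R \<xi>1 k \<omega> + (W2 (s (Suc k)) \<omega> - W2 (s k) \<omega>) *\<^sub>R \<xi>2 k \<omega>)"
      unfolding el_int_def sum.distrib[symmetric]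
    proof (intro sum.cong refl)
      fix k assume "k \<in> {..<N}"
      then have "min T (s k) = s k" "min T (s (Suc k)) = s (Suc k)" using s_range[of k] s_range[of "Suc k"] by auto
      then show "(W1 (min T (s (Suc k))) \<omega> - W1 (min T (s k)) \<omega>) *\<^sub>R \<xi>1 k \<omega> + (W2 (min T (s (Suc k))) \<omega> - W2 (min T (s k)) \<omega>) *\<^sub>R \<xi>2 k \<omega>
        = (W1 (s (Suc k)) \<omega> - W1 (s k) \<omega>) *\<^sub>R \<xi>1 k \<omega> + (W2 (s (Suc k)) \<omega> - W2 (s k) \<omega>) *\<^sub>R \<xi>2 k \<omega>" by simp
    qed
    also have "\<dots> = (\<Sum>k<N. (X \<omega> * L k \<omega>) *\<^sub>R e)"
      by (intro sum.cong refl) (simp add: \<xi>1_def \<xi>2_def L_def dW_def inner_prod_def algebra_simps)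
    finally show ?thesis .
  qed
  define Y where "Y \<omega> = (X \<omega> * heat (b - a) \<phi> (Wp a \<omega>)) *\<^sub>R e + (0 + (el_int W1 N s \<xi>1 T \<omega> + el_int W2 N s \<xi>2 T \<omega>))" for \<omega>
  have "rep Y"
    unfolding Y_def[abs_def] using rep_lincomb[OF r rep_elementary[OF E1 E2, of 0], of 1 1] by simp
  moreover have "nn2 M (\<lambda>\<omega>. (X \<omega> * \<phi> (Wp b \<omega>)) *\<^sub>R e - Y \<omega>) \<le> ennreal \<epsilon>"
  proof -
    \<comment> \<open>Telescoping \<open>v k\<close> along the path and removing the first-order
      terms leaves exactly the remainders.\<close>
    have "(X \<omega> * \<phi> (Wp b \<omega>)) *\<^sub>R e - Y \<omega> = (\<Sum>k<N. X \<omega> * R k \<omega>) *\<^sub>R e" for \<omega>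
    proof -
      have "(\<Sum>k<N. R k \<omega> + L k \<omega>) = v N (Wp (s N) \<omega>) - v 0 (Wp (s 0) \<omega>)"
        unfolding R_def using sum_lessThan_telescope[of "\<lambda>k. v k (Wp (s k) \<omega>)" N] by simp
      then have "\<phi> (Wp b \<omega>) - heat (b - a) \<phi> (Wp a \<omega>) - (\<Sum>k<N. L k \<omega>) = (\<Sum>k<N. R k \<omega>)"
        by (simp add: v_def s0 sN heat_def[of 0] sum.distrib)
      then show ?thesis
        unfolding Y_def JT
        by (simp add: sum_distrib_left[symmetric] scaleR_sum_left[symmetric] scaleR_diff_left[symmetric] right_diff_distrib[symmetric]
              diff_diff_eq[symmetric])
    qed
    then have "nn2 M (\<lambda>\<omega>. (X \<omega> * \<phi> (Wp b \<omega>)) *\<^sub>R e - Y \<omega>) = nn2 M (\<lambda>\<omega>. (\<Sum>k<N. X \<omega> * R k \<omega>) *\<^sub>R e)" by simp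
    also have "\<dots> = ennreal ((norm e)\<^sup>2) * nn2 M (\<lambda>\<omega>. \<Sum>k<N. X \<omega> * R k \<omega>)"
      using RM by (intro nn2_scaleR_const borel_measurable_sum) auto
    also have "nn2 M (\<lambda>\<omega>. \<Sum>k<N. X \<omega> * R k \<omega>) = (\<Sum>k<N. nn2 M (\<lambda>\<omega>. X \<omega> * R k \<omega>))"
      using sum_D(3)[of 0 N "\<lambda>\<omega>. 0"] by (simp add: atLeast0LessThan)
    also have "\<dots> \<le> (\<Sum>k<N. ennreal (B\<^sup>2 * (24 * C\<^sup>2 * \<delta>\<^sup>2)))" by (intro sum_mono XR) auto
    also have "\<dots> = ennreal (N * (B\<^sup>2 * (24 * C\<^sup>2 * \<delta>\<^sup>2)))" by (simp add: ennreal_mult ennreal_of_nat_eq_real_of_nat)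
    finally have "nn2 M (\<lambda>\<omega>. (X \<omega> * \<phi> (Wp b \<omega>)) *\<^sub>R e - Y \<omega>) \<le> ennreal ((norm e)\<^sup>2) * ennreal (N * (B\<^sup>2 * (24 * C\<^sup>2 * \<delta>\<^sup>2)))"
      by (simp add: mult_left_mono)
    also have "\<dots> = ennreal ((norm e)\<^sup>2 * (N * (B\<^sup>2 * (24 * C\<^sup>2 * \<delta>\<^sup>2))))" by (simp add: ennreal_mult)
    also have "(norm e)\<^sup>2 * (N * (B\<^sup>2 * (24 * C\<^sup>2 * \<delta>\<^sup>2))) = K / N"
      using N by (simp add: K_def \<delta>_def power2_eq_square field_simps)
    also have "ennreal (K / N) \<le> ennreal \<epsilon>" using N by (intro ennreal_leI)
    finally show ?thesis .
  qed
  ultimately show "\<exists>Y. rep Y \<and> nn2 M (\<lambda>\<omega>. (X \<omega> * \<phi> (Wp b \<omega>)) *\<^sub>R e - Y \<omega>) \<le> ennreal \<epsilon>" by blast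
qed

text \<open>Induction on the number of times. The last factor is replaced by its heat average, a
  smooth function at the preceding time, and merged into the factor there; at time 0 the path is
  almost surely at the origin, so a constant is left.\<close>

lemma rep_prod:
  fixes e :: "real^'n"
  assumes P: "part T m \<tau>" and "k \<le> m" and f: "\<And>i. i \<le> k \<Longrightarrow> \<exists>D C. smooth_fun (\<phi> i) D C"
  shows "rep (\<lambda>\<omega>. (\<Prod>i<Suc k. \<phi> i (Wp (\<tau> i) \<omega>)) *\<^sub>R e)"
  using assms(2,3)
proof (induction k arbitrary: \<phi>)
  case 0
  obtain D C where f: "smooth_fun (\<phi> 0) D C" using 0 by blast
  have [measurable]: "\<phi> 0 \<in> borel_measurable borel" using smooth_funD(1)[OF f] .
  have \<tau>0: "\<tau> 0 = 0" using P by (simp add: part_def)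
  have [measurable]: "Wp 0 \<in> borel_measurable M" using T_pos by (intro Wp_measurable_M) auto
  have "AE \<omega> in M. \<phi> 0 (Wp 0 \<omega>) *\<^sub>R e = \<phi> 0 (0, 0) *\<^sub>R e"
    using AE_W_zero by eventually_elim (simp add: Wp_def)
  then have "rep (\<lambda>\<omega>. \<phi> 0 (Wp 0 \<omega>) *\<^sub>R e)"
    by (intro rep_cong_AE[OF rep_const]) measurable
  then show ?case by (simp add: \<tau>0)
next
  case (Suc k)
  obtain C where C: "\<And>i. i \<le> Suc k \<Longrightarrow> \<exists>D. smooth_fun (\<phi> i) D (C i)" using Suc.prems(2) by metis
  obtain D where f: "smooth_fun (\<phi> (Suc k)) D (C (Suc k))" using C by blast
  obtain D0 where f0: "smooth_fun (\<phi> k) D0 (C k)" using C[of k] by auto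
  have r: "0 \<le> \<tau> k" "\<tau> k < \<tau> (Suc k)" "\<tau> (Suc k) \<le> T"
    using part_range[OF P] part_less[OF P, of k "Suc k"] Suc.prems(1) by auto
  define X where "X \<omega> = (\<Prod>i<Suc k. \<phi> i (Wp (\<tau> i) \<omega>))" for \<omega>
  have "rep (\<lambda>\<omega>. (X \<omega> * \<phi> (Suc k) (Wp (\<tau> (Suc k)) \<omega>)) *\<^sub>R e)"
  proof (rule rep_step[OF r _ _ f, where B="\<Prod>i<Suc k. C i"])
    show "X \<in> borel_measurable (Fl (\<tau> k))"
      unfolding X_def[abs_def]
    proof (rule borel_measurable_prod)
      fix i assume "i \<in> {..<Suc k}"
      then have i: "i \<le> k" by simp
      have [measurable]: "\<phi> i \<in> borel_measurable borel" using C[of i] i smooth_funD(1) by (metis le_SucI)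
      have [measurable]: "Wp (\<tau> i) \<in> borel_measurable (Fl (\<tau> k))"
        using part_range[OF P, of i] part_le[OF P, of i k] i Suc.prems(1) by (intro Wp_measurable) auto
      show "(\<lambda>\<omega>. \<phi> i (Wp (\<tau> i) \<omega>)) \<in> borel_measurable (Fl (\<tau> k))" by measurable
    qed
    show "\<bar>X \<omega>\<bar> \<le> (\<Prod>i<Suc k. C i)" for \<omega>
      unfolding X_def abs_prod
    proof (rule prod_mono)
      fix i assume "i \<in> {..<Suc k}"
      then obtain D where "smooth_fun (\<phi> i) D (C i)" using C[of i] by auto
      then show "0 \<le> \<bar>\<phi> i (Wp (\<tau> i) \<omega>)\<bar> \<and> \<bar>\<phi> i (Wp (\<tau> i) \<omega>)\<bar> \<le> C i" using smooth_funD(3) by auto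
    qed
    define \<psi> where "\<psi> i = (if i = k then (\<lambda>x. \<phi> k x * heat (\<tau> (Suc k) - \<tau> k) (\<phi> (Suc k)) x) else \<phi> i)" for i
    have "rep (\<lambda>\<omega>. (\<Prod>i<Suc k. \<psi> i (Wp (\<tau> i) \<omega>)) *\<^sub>R e)"
    proof (rule Suc.IH)
      fix i assume i: "i \<le> k"
      show "\<exists>D C. smooth_fun (\<psi> i) D C"
      proof (cases "i = k")
        case True
        have "smooth_fun (heat (\<tau> (Suc k) - \<tau> k) (\<phi> (Suc k))) (heat (\<tau> (Suc k) - \<tau> k) D) (C (Suc k))"
          using r by (intro smooth_fun_heat[OF f]) auto
        from smooth_fun_mult[OF f0 this] show ?thesis using True by (auto simp: \<psi>_def)
      next
        case False
        then show ?thesis using Suc.prems(2)[of i] i by (simp add: \<psi>_def)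
      qed
    qed (use Suc.prems in simp)
    moreover have "(\<Prod>i<Suc k. \<psi> i (Wp (\<tau> i) \<omega>)) = X \<omega> * heat (\<tau> (Suc k) - \<tau> k) (\<phi> (Suc k)) (Wp (\<tau> k) \<omega>)" for \<omega>
    proof -
      have "(\<Prod>i<k. \<psi> i (Wp (\<tau> i) \<omega>)) = (\<Prod>i<k. \<phi> i (Wp (\<tau> i) \<omega>))" by (intro prod.cong) (auto simp: \<psi>_def)
      then show ?thesis by (simp add: X_def \<psi>_def mult.assoc)
    qed
    ultimately show "rep (\<lambda>\<omega>. (X \<omega> * heat (\<tau> (Suc k) - \<tau> k) (\<phi> (Suc k)) (Wp (\<tau> k) \<omega>)) *\<^sub>R e)" by simp
  qed
  then show ?case by (simp add: X_def mult.assoc)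
qed

end

text \<open>The class contains the half planes and is closed under intersection, which suffices for
  an intersection-stable generator; values in [0,1] provide domination.\<close>

definition smooth_limit :: "(real \<times> real) set \<Rightarrow> bool" where
  "smooth_limit Q \<longleftrightarrow> (\<exists>\<phi> :: nat \<Rightarrow> real \<times> real \<Rightarrow> real. (\<forall>n. \<exists>D C. smooth_fun (\<phi> n) D C) \<and>
     (\<forall>n x. 0 \<le> \<phi> n x \<and> \<phi> n x \<le> 1) \<and> (\<forall>x. (\<lambda>n. \<phi> n x) \<longlonglongrightarrow> indicator Q x))"

lemma smooth_limit_UNIV: "smooth_limit UNIV"
  unfolding smooth_limit_def using smooth_fun_const[of 1] by (intro exI[of _ "\<lambda>n x. 1"]) auto

lemma smooth_limit_halfspace: "smooth_limit {x. w \<bullet> x < c}"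
  unfolding smooth_limit_def by (rule smooth_fun_prod_indicator)

lemma smooth_limit_Int:
  assumes "smooth_limit Q" "smooth_limit Q'" shows "smooth_limit (Q \<inter> Q')"
proof -
  obtain \<phi> :: "nat \<Rightarrow> real \<times> real \<Rightarrow> real" where f: "\<And>n. \<exists>D C. smooth_fun (\<phi> n) D C"
    "\<And>n x. 0 \<le> \<phi> n x \<and> \<phi> n x \<le> 1" "\<And>x. (\<lambda>n. \<phi> n x) \<longlonglongrightarrow> indicator Q x"
    using assms(1) unfolding smooth_limit_def by metis
  obtain \<psi> :: "nat \<Rightarrow> real \<times> real \<Rightarrow> real" where g: "\<And>n. \<exists>D C. smooth_fun (\<psi> n) D C"
    "\<And>n x. 0 \<le> \<psi> n x \<and> \<psi> n x \<le> 1" "\<And>x. (\<lambda>n. \<psi> n x) \<longlonglongrightarrow> indicator Q' x"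
    using assms(2) unfolding smooth_limit_def by metis
  show ?thesis
    unfolding smooth_limit_def
  proof (intro exI[of _ "\<lambda>n x. \<phi> n x * \<psi> n x"] conjI allI)
    show "\<exists>D C. smooth_fun (\<lambda>x. \<phi> n x * \<psi> n x) D C" for n
      using f(1)[of n] g(1)[of n] smooth_fun_mult by blast
    show "0 \<le> \<phi> n x * \<psi> n x" "\<phi> n x * \<psi> n x \<le> 1" for n x
      using f(2)[of n x] g(2)[of n x] by (auto intro: mult_le_one)
    show "(\<lambda>n. \<phi> n x * \<psi> n x) \<longlonglongrightarrow> indicator (Q \<inter> Q') x" for x
      using tendsto_mult[OF f(3)[of x] g(3)[of x]] by (simp add: indicator_inter_arith)
  qed
qed

section \<open>From cylinder events to the terminal sigma-algebra\<close>

context wiener_pair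
begin

definition cylinder :: "real set \<Rightarrow> (real \<Rightarrow> (real \<times> real) set) \<Rightarrow> 'w set" where
  "cylinder J Q = {\<omega>\<in>space M. \<forall>t\<in>J. Wp t \<omega> \<in> Q t}"

definition cylinders :: "'w set set" where
  "cylinders = {cylinder J Q | J Q. finite J \<and> J \<subseteq> {0..T} \<and> (\<forall>t. smooth_limit (Q t))}"

lemma rep_cylinder:
  fixes e :: "real^'n"
  assumes "A \<in> cylinders" shows "rep (\<lambda>\<omega>. indicator A \<omega> *\<^sub>R e)"
proof -
  obtain J Q where A: "A = cylinder J Q" and J: "finite J" "J \<subseteq> {0..T}" and Q: "\<And>t. smooth_limit (Q t)"
    using assms unfolding cylinders_def by auto
  obtain m \<tau> where P: "part T m \<tau>" "J \<subseteq> \<tau> ` {..m}" using part_exists[OF J T_pos] by auto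
  \<comment> \<open>Partition points outside \<open>J\<close> carry no constraint.\<close>
  define Q' where "Q' i = (if \<tau> i \<in> J then Q (\<tau> i) else UNIV)" for i
  have "smooth_limit (Q' i)" for i using Q smooth_limit_UNIV by (simp add: Q'_def)
  then obtain \<phi> :: "nat \<Rightarrow> nat \<Rightarrow> real \<times> real \<Rightarrow> real" where f: "\<And>i n. \<exists>D C. smooth_fun (\<phi> i n) D C"
    "\<And>i n x. 0 \<le> \<phi> i n x \<and> \<phi> i n x \<le> 1" "\<And>i x. (\<lambda>n. \<phi> i n x) \<longlonglongrightarrow> indicator (Q' i) x"
    unfolding smooth_limit_def by metis
  define Y where "Y n \<omega> = (\<Prod>i<Suc m. \<phi> i n (Wp (\<tau> i) \<omega>)) *\<^sub>R e" for n \<omega>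
  have Y: "rep (Y n)" for n
    unfolding Y_def[abs_def] by (intro rep_prod[OF P(1)] f(1)) auto
  have lim: "(\<lambda>n. Y n \<omega>) \<longlonglongrightarrow> indicator A \<omega> *\<^sub>R e" if w: "\<omega> \<in> space M" for \<omega>
  proof -
    have "(\<lambda>n. (\<Prod>i<Suc m. \<phi> i n (Wp (\<tau> i) \<omega>))) \<longlonglongrightarrow> (\<Prod>i<Suc m. indicator (Q' i) (Wp (\<tau> i) \<omega>))"
      by (intro tendsto_prod f(3))
    also have "(\<Prod>i<Suc m. indicator (Q' i) (Wp (\<tau> i) \<omega>)) = (indicator A \<omega> :: real)"
    proof (cases "\<omega> \<in> A")
      case True
      then have "\<forall>i<Suc m. Wp (\<tau> i) \<omega> \<in> Q' i" unfolding A cylinder_def Q'_def by auto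
      then show ?thesis using True by (intro trans[OF prod.neutral]) auto
    next
      case False
      then obtain t where t: "t \<in> J" "Wp t \<omega> \<notin> Q t" unfolding A cylinder_def using w by auto
      then obtain i where i: "i \<le> m" "t = \<tau> i" using P(2) by auto
      then have "indicator (Q' i) (Wp (\<tau> i) \<omega>) = (0 :: real)" using t by (simp add: Q'_def)
      then show ?thesis using False i by (subst prod_zero) (auto intro!: bexI[of _ i])
    qed
    finally show ?thesis unfolding Y_def by (intro tendsto_intros)
  qed
  have YM[measurable]: "Y n \<in> borel_measurable M" for n using Y rep_measurable by blast
  have XM: "(\<lambda>\<omega>. indicator A \<omega> *\<^sub>R e) \<in> borel_measurable M"
    by (rule borel_measurable_LIMSEQ_metric[OF YM lim])
  show ?thesis
  proof (rule rep_tendsto[OF XM Y])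
    show "(\<lambda>n. nn2 M (\<lambda>\<omega>. indicator A \<omega> *\<^sub>R e - Y n \<omega>)) \<longlonglongrightarrow> 0"
    proof (rule nn2_dominated[OF YM XM, where g="\<lambda>\<omega>. 2 *\<^sub>R e"])
      show "sq_int M (\<lambda>\<omega>. 2 *\<^sub>R e)" by (rule sq_int_bounded[where C="norm (2 *\<^sub>R e)"]) auto
      show "AE \<omega> in M. norm (indicator A \<omega> *\<^sub>R e - Y n \<omega>) \<le> norm (2 *\<^sub>R e)" for n
      proof (rule AE_I2)
        fix \<omega>
        have p: "0 \<le> (\<Prod>i<Suc m. \<phi> i n (Wp (\<tau> i) \<omega>))" "(\<Prod>i<Suc m. \<phi> i n (Wp (\<tau> i) \<omega>)) \<le> 1"
          using f(2) by (intro prod_nonneg prod_le_1; simp)+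
        have "norm (indicator A \<omega> *\<^sub>R e - Y n \<omega>) = \<bar>indicator A \<omega> - (\<Prod>i<Suc m. \<phi> i n (Wp (\<tau> i) \<omega>))\<bar> * norm e"
          by (simp add: Y_def scaleR_diff_left[symmetric])
        also have "\<dots> \<le> 2 * norm e" using p by (intro mult_right_mono) (auto simp: indicator_def abs_le_iff)
        finally show "norm (indicator A \<omega> *\<^sub>R e - Y n \<omega>) \<le> norm (2 *\<^sub>R e)" by simp
      qed
      show "AE \<omega> in M. (\<lambda>n. Y n \<omega>) \<longlonglongrightarrow> indicator A \<omega> *\<^sub>R e" using lim by (intro AE_I2)
    qed
  qed
qed

lemma Int_stable_cylinders: "Int_stable cylinders"
proof (rule Int_stableI)
  fix A B assume "A \<in> cylinders" "B \<in> cylinders"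
  then obtain J Q J' Q' where A: "A = cylinder J Q" "finite J" "J \<subseteq> {0..T}" "\<And>t. smooth_limit (Q t)"
    and B: "B = cylinder J' Q'" "finite J'" "J' \<subseteq> {0..T}" "\<And>t. smooth_limit (Q' t)"
    unfolding cylinders_def by auto
  define R where "R t = (if t \<in> J then Q t else UNIV) \<inter> (if t \<in> J' then Q' t else UNIV)" for t
  have "A \<inter> B = cylinder (J \<union> J') R" unfolding A B cylinder_def R_def by auto
  moreover have "smooth_limit (R t)" for t
    unfolding R_def using A(4) B(4) smooth_limit_UNIV by (intro smooth_limit_Int) auto
  ultimately show "A \<inter> B \<in> cylinders" unfolding cylinders_def using A B by blast
qed

text \<open>Dynkin's argument: representability is stable under complements by linearity and under
  disjoint unions by closedness, and it holds on the intersection-stable cylinders.\<close>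

lemma rep_sigma_cylinders:
  fixes e :: "real^'n"
  assumes "A \<in> sigma_sets (space M) cylinders"
  shows "rep (\<lambda>\<omega>. indicator A \<omega> *\<^sub>R e)"
proof -
  have sub: "cylinders \<subseteq> Pow (space M)" unfolding cylinders_def cylinder_def by auto
  show ?thesis
    using Int_stable_cylinders sub assms
  proof (induction rule: sigma_sets_induct_disjoint)
    case (basic A) then show ?case by (rule rep_cylinder)
  next
    case empty then show ?case using rep_const[of 0] by simp
  next
    case (compl A)
    have "rep (\<lambda>\<omega>. 1 *\<^sub>R e + (-1) *\<^sub>R (indicator A \<omega> *\<^sub>R e))"
      by (rule rep_lincomb[OF rep_const compl(2)])
    moreover have "AE \<omega> in M. indicator (space M - A) \<omega> *\<^sub>R e = 1 *\<^sub>R e + (-1) *\<^sub>R (indicator A \<omega> *\<^sub>R e)"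
      by (rule AE_I2) (auto simp: indicator_def)
    moreover have "(\<lambda>\<omega>. indicator (space M - A) \<omega> *\<^sub>R e) \<in> borel_measurable M"
    proof (rule measurable_cong[THEN iffD1, rotated])
      show "(\<lambda>\<omega>. 1 *\<^sub>R e + (-1) *\<^sub>R (indicator A \<omega> *\<^sub>R e)) \<in> borel_measurable M"
        using rep_measurable[OF compl(2)] by measurable
    qed (auto simp: indicator_def)
    ultimately show ?case by (blast intro: rep_cong_AE)
  next
    case (union A)
    define Y where "Y n \<omega> = (\<Sum>i<n. indicator (A i) \<omega> *\<^sub>R e)" for n \<omega>
    have Y: "rep (Y n)" for n unfolding Y_def[abs_def] by (intro rep_sum union)
    have YM: "Y n \<in> borel_measurable M" for n using Y rep_measurable by blast
    have YI: "Y n \<omega> = indicator (\<Union>i<n. A i) \<omega> *\<^sub>R e" for n \<omega>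
    proof -
      have "disjoint_family_on A {..<n}" using union(1) by (auto simp: disjoint_family_on_def)
      then show ?thesis
        unfolding Y_def by (subst indicator_UN_disjoint) (auto simp: scaleR_sum_left)
    qed
    have lim: "(\<lambda>n. Y n \<omega>) \<longlonglongrightarrow> indicator (\<Union>i. A i) \<omega> *\<^sub>R e" for \<omega>
      unfolding YI by (intro tendsto_intros LIMSEQ_indicator_UN)
    have XM: "(\<lambda>\<omega>. indicator (\<Union>i. A i) \<omega> *\<^sub>R e) \<in> borel_measurable M"
      by (rule borel_measurable_LIMSEQ_metric[OF YM lim])
    show ?case
    proof (rule rep_tendsto[OF XM Y], rule nn2_dominated[where v=Y, OF YM XM, where g="\<lambda>\<omega>. e"])
      show "sq_int M (\<lambda>\<omega>. e)" by (rule sq_int_bounded[where C="norm e"]) auto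
      show "AE \<omega> in M. norm (indicator (\<Union>i. A i) \<omega> *\<^sub>R e - Y n \<omega>) \<le> norm e" for n
        unfolding YI by (rule AE_I2) (auto simp: indicator_def)
    qed (use lim in auto)
  qed
qed

text \<open>Half planes with normals (1,0) and (0,1) already make each coordinate of the path
  measurable.\<close>

lemma sets_nat_filt_le_cylinders:
  "sets (nat_filt M (\<lambda>t \<omega>. (W1 t \<omega>, W2 t \<omega>)) T) \<subseteq> sigma_sets (space M) cylinders"
proof -
  have sub: "cylinders \<subseteq> Pow (space M)" unfolding cylinders_def cylinder_def by auto
  let ?N = "sigma (space M) cylinders"
  have N: "space ?N = space M" "sets ?N = sigma_sets (space M) cylinders"
    using sub by (auto simp: space_measure_of sets_measure_of)
  have half: "{\<omega>\<in>space ?N. w \<bullet> Wp s \<omega> < c} \<in> sets ?N" if "s \<in> {0..T}" for s w c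
  proof -
    have "{\<omega>\<in>space ?N. w \<bullet> Wp s \<omega> < c} = cylinder {s} (\<lambda>t. {x. w \<bullet> x < c})"
      unfolding N by (auto simp: cylinder_def)
    moreover have "cylinder {s} (\<lambda>t. {x. w \<bullet> x < c}) \<in> cylinders"
      unfolding cylinders_def using that smooth_limit_halfspace by blast
    ultimately show ?thesis unfolding N by auto
  qed
  have "sets (nat_filt M (\<lambda>t \<omega>. (W1 t \<omega>, W2 t \<omega>)) T) \<subseteq> sets ?N"
  proof (rule sets_nat_filt_le)
    fix s assume s: "s \<in> {0..T}"
    have "W1 s \<in> borel_measurable ?N" "W2 s \<in> borel_measurable ?N"
      using half[OF s, of "(1, 0)"] half[OF s, of "(0, 1)"]
      by (auto simp: borel_measurable_iff_less Wp_def)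
    then show "(\<lambda>\<omega>. (W1 s \<omega>, W2 s \<omega>)) \<in> borel_measurable ?N" by measurable
  qed (rule N)
  then show ?thesis unfolding N .
qed

lemma rep_indicator:
  fixes e :: "real^'n"
  assumes "A \<in> sets (Fl T)" shows "rep (\<lambda>\<omega>. indicator A \<omega> *\<^sub>R e)"
proof -
  obtain B where B: "B \<in> sets (nat_filt M (\<lambda>t \<omega>. (W1 t \<omega>, W2 t \<omega>)) T)" "AE \<omega> in M. \<omega> \<in> A \<longleftrightarrow> \<omega> \<in> B"
    using aug_filt_AE_eq_nat_filt[OF assms] by blast
  have "rep (\<lambda>\<omega>. indicator B \<omega> *\<^sub>R e)"
    using B(1) sets_nat_filt_le_cylinders by (intro rep_sigma_cylinders) auto
  moreover have "A \<in> sets M" using assms sets_Fl_le[of T] by auto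
  then have "(\<lambda>\<omega>. indicator A \<omega> *\<^sub>R e) \<in> borel_measurable M" by measurable
  moreover have "AE \<omega> in M. indicator A \<omega> *\<^sub>R e = indicator B \<omega> *\<^sub>R e"
    using B(2) by eventually_elim (auto simp: indicator_def)
  ultimately show ?thesis by (rule rep_cong_AE)
qed

text \<open>Simple functions approximate \<open>X\<close> with norm at most twice that of
  \<open>X\<close>, so dominated convergence reduces the claim to indicators.\<close>

lemma rep_L2:
  fixes X :: "'w \<Rightarrow> real^'n"
  assumes X: "X \<in> borel_measurable (Fl T)" "sq_int M X"
  shows "rep X"
proof -
  obtain s where s: "\<And>i. simple_function (Fl T) (s i)" "\<And>x. x \<in> space (Fl T) \<Longrightarrow> (\<lambda>i. s i x) \<longlonglongrightarrow> X x"
    "\<And>i x. x \<in> space (Fl T) \<Longrightarrow> dist (s i x) 0 \<le> 2 * dist (X x) 0"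
    using borel_measurable_implies_sequence_metric[OF X(1), of 0] by blast
  have sM: "s i \<in> borel_measurable M" for i
    using measurable_Fl_M[OF borel_measurable_simple_function[OF s(1)]] by simp
  have rs: "rep (s i)" for i
  proof -
    have "rep (\<lambda>\<omega>. \<Sum>y\<in>s i ` space M. indicator (s i -` {y} \<inter> space M) \<omega> *\<^sub>R y)"
    proof (intro rep_sum rep_indicator)
      show "s i -` {y} \<inter> space M \<in> sets (Fl T)" for y
        using simple_functionD(2)[OF s(1), of i "{y}"] by simp
    qed
    moreover have "s i \<omega> = (\<Sum>y\<in>s i ` space M. indicator (s i -` {y} \<inter> space M) \<omega> *\<^sub>R y)" if "\<omega> \<in> space M" for \<omega>
      using simple_function_indicator_representation_banach[OF s(1), of \<omega> i] that by (simp only: space_aug_filt)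
    then have "AE \<omega> in M. s i \<omega> = (\<Sum>y\<in>s i ` space M. indicator (s i -` {y} \<inter> space M) \<omega> *\<^sub>R y)"
      by (rule AE_I2)
    ultimately show ?thesis by (rule rep_cong_AE[OF _ sM])
  qed
  have XM: "X \<in> borel_measurable M" using X(2) by measurable
  show ?thesis
  proof (rule rep_tendsto[OF XM rs nn2_dominated[OF sM XM sq_int_scale[OF X(2), of 3]]])
    show "AE \<omega> in M. norm (X \<omega> - s i \<omega>) \<le> norm (3 *\<^sub>R X \<omega>)" for i
    proof (rule AE_I2)
      fix \<omega> assume "\<omega> \<in> space M"
      then have "norm (s i \<omega>) \<le> 2 * norm (X \<omega>)" using s(3)[of \<omega> i] by simp
      then show "norm (X \<omega> - s i \<omega>) \<le> norm (3 *\<^sub>R X \<omega>)"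
        using norm_triangle_ineq4[of "X \<omega>" "s i \<omega>"] by simp
    qed
    show "AE \<omega> in M. (\<lambda>i. s i \<omega>) \<longlonglongrightarrow> X \<omega>" using s(2) by (intro AE_I2) simp
  qed
qed

end

section \<open>Progressive processes\<close>

lemma progressive_measurable:
  "progressive F T u \<Longrightarrow> 0 \<le> t \<Longrightarrow> t \<le> T \<Longrightarrow> (\<lambda>(s, \<omega>). u s \<omega>) \<in> borel_measurable (restrict_space borel {0..t} \<Otimes>\<^sub>M F t)"
  by (simp add: progressive_def)

lemma progressive_lim:
  fixes u :: "nat \<Rightarrow> real \<Rightarrow> 'w \<Rightarrow> 'b::{banach, second_countable_topology}"
  assumes "\<And>k. progressive F T (u k)"
  shows "progressive F T (\<lambda>t \<omega>. lim (\<lambda>k. u k t \<omega>))"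
  unfolding progressive_def
proof
  fix t assume t: "t \<in> {0..T}"
  have "(\<lambda>x. lim (\<lambda>k. (\<lambda>(s, \<omega>). u k s \<omega>) x)) \<in> borel_measurable (restrict_space borel {0..t} \<Otimes>\<^sub>M F t)"
    using assms t by (intro borel_measurable_lim_metric) (simp add: progressive_def)
  then show "(\<lambda>(s, \<omega>). lim (\<lambda>k. u k s \<omega>)) \<in> borel_measurable (restrict_space borel {0..t} \<Otimes>\<^sub>M F t)"
    by (simp add: case_prod_unfold)
qed

lemma progressive_diff:
  fixes u v :: "real \<Rightarrow> 'w \<Rightarrow> 'b::{second_countable_topology, real_normed_vector}"
  assumes "progressive F T u" "progressive F T v"
  shows "progressive F T (\<lambda>t \<omega>. u t \<omega> - v t \<omega>)"
  unfolding progressive_def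
proof
  fix t assume t: "t \<in> {0..T}"
  have "(\<lambda>x. (\<lambda>(s, \<omega>). u s \<omega>) x - (\<lambda>(s, \<omega>). v s \<omega>) x) \<in> borel_measurable (restrict_space borel {0..t} \<Otimes>\<^sub>M F t)"
    using assms t by (intro borel_measurable_diff) (simp_all add: progressive_def)
  then show "(\<lambda>(s, \<omega>). u s \<omega> - v s \<omega>) \<in> borel_measurable (restrict_space borel {0..t} \<Otimes>\<^sub>M F t)"
    by (simp add: case_prod_unfold)
qed

text \<open>Process norms become \<open>nn2\<close> on this product, so the convergence lemmas and
  conditional expectation apply to processes.\<close>

definition proc_space :: "real \<Rightarrow> 'w measure \<Rightarrow> (real \<times> 'w) measure" where
  "proc_space T M = restrict_space lborel {0..T} \<Otimes>\<^sub>M M"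

lemma sets_proc_space[measurable_cong]: "sets (proc_space T M) = sets (restrict_space borel {0..T} \<Otimes>\<^sub>M M)"
  unfolding proc_space_def by (intro sets_pair_measure_cong sets_restrict_space_cong) auto

lemma space_proc_space: "space (proc_space T M) = {0..T} \<times> space M"
  by (simp add: proc_space_def space_pair_measure space_restrict_space)

lemma measurable_pair_subalg:
  assumes "f \<in> borel_measurable (A \<Otimes>\<^sub>M F)" "subalgebra M F"
  shows "f \<in> borel_measurable (A \<Otimes>\<^sub>M M)"
proof (rule measurable_compose[OF _ assms(1), of "\<lambda>x. x", unfolded id_def])
  have "fst \<in> A \<Otimes>\<^sub>M M \<rightarrow>\<^sub>M A" by simp
  moreover have "snd \<in> A \<Otimes>\<^sub>M M \<rightarrow>\<^sub>M F"
    using measurable_snd[of A M] assms(2) unfolding subalgebra_def measurable_def by auto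
  ultimately have "(\<lambda>x. (fst x, snd x)) \<in> A \<Otimes>\<^sub>M M \<rightarrow>\<^sub>M A \<Otimes>\<^sub>M F"
    by (rule measurable_Pair)
  then show "(\<lambda>x. x) \<in> A \<Otimes>\<^sub>M M \<rightarrow>\<^sub>M A \<Otimes>\<^sub>M F" by (simp only: prod.collapse)
qed

section \<open>Processes as functions on the product of time and sample space\<close>

context wiener_pair
begin

abbreviation Tm :: "real measure" where "Tm \<equiv> restrict_space lborel {0..T}"

abbreviation joint :: "(real \<Rightarrow> 'w \<Rightarrow> 'b::topological_space) \<Rightarrow> bool" where
  "joint u \<equiv> (\<lambda>(s, \<omega>). u s \<omega>) \<in> borel_measurable (proc_space T M)"

lemma finite_lborel_restrict: "finite_measure Tm"
  using T_pos by (intro finite_measureI) (simp add: emeasure_restrict_space space_restrict_space)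

lemma progressive_joint:
  "progressive Fl T u \<Longrightarrow> joint u"
  using measurable_pair_subalg[OF progressive_measurable[of Fl T u T] subalgebra_Fl[of T]] T_pos
  by (simp add: measurable_cong_sets[OF sets_proc_space refl])

lemma nn2_proc_space:
  fixes u :: "real \<Rightarrow> 'w \<Rightarrow> 'b::{real_normed_vector, second_countable_topology}"
  assumes [measurable]: "joint u"
  shows "nn2 (proc_space T M) (\<lambda>(s, \<omega>). u s \<omega>) = proc_norm M 0 T u"
proof -
  interpret R: finite_measure Tm by (rule finite_lborel_restrict)
  interpret P: pair_sigma_finite Tm M ..
  have m: "(\<lambda>x. ennreal ((norm ((\<lambda>(s, \<omega>). u s \<omega>) x))\<^sup>2)) \<in> borel_measurable (proc_space T M)" by measurable
  have "nn2 (proc_space T M) (\<lambda>(s, \<omega>). u s \<omega>)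
      = (\<integral>\<^sup>+\<omega>. (\<integral>\<^sup>+s. ennreal ((norm (u s \<omega>))\<^sup>2) \<partial>Tm) \<partial>M)"
    using P.nn_integral_snd[OF m[unfolded proc_space_def]] unfolding nn2_def proc_space_def by simp
  also have "\<dots> = proc_norm M 0 T u"
    unfolding proc_norm_def by (simp add: nn_integral_restrict_space)
  finally show ?thesis .
qed

lemma L2_proc_iff: "u \<in> L2_proc M Fl T \<longleftrightarrow> progressive Fl T u \<and> proc_norm M 0 T u < \<infinity>"
  by (simp add: L2_proc_def proc_norm_def)

lemma proc_norm_nn2: "progressive Fl T u \<Longrightarrow> proc_norm M 0 T u = nn2 (proc_space T M) (\<lambda>(s, \<omega>). u s \<omega>)"
  for u :: "real \<Rightarrow> 'w \<Rightarrow> 'b::{real_normed_vector, second_countable_topology}"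
  by (simp add: nn2_proc_space progressive_joint)

lemma L2_proc_sq_int: "u \<in> L2_proc M Fl T \<Longrightarrow> sq_int (proc_space T M) (\<lambda>(s, \<omega>). u s \<omega>)"
  by (auto simp: L2_proc_iff sq_int_def progressive_joint proc_norm_nn2)

text \<open>The pointwise limit is progressive, being measurable on every [0,t]; convergence in norm
  is the rapid convergence lemma on \<open>proc_space\<close>.\<close>

lemma L2_proc_limit:
  fixes h :: "nat \<Rightarrow> real \<Rightarrow> 'w \<Rightarrow> real^'n"
  assumes h: "\<And>k. h k \<in> L2_proc M Fl T"
    and C: "\<And>k. proc_norm M 0 T (\<lambda>t \<omega>. h (Suc k) t \<omega> - h k t \<omega>) \<le> ennreal (C / 4 ^ k)" "C \<ge> 0"
  obtains H where "H \<in> L2_proc M Fl T" "(\<lambda>k. proc_norm M 0 T (\<lambda>t \<omega>. H t \<omega> - h k t \<omega>)) \<longlonglongrightarrow> 0"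
proof -
  define H where "H t \<omega> = lim (\<lambda>k. h k t \<omega>)" for t \<omega>
  have hp: "progressive Fl T (h k)" for k using h[of k] by (simp add: L2_proc_iff)
  have Hp: "progressive Fl T H" unfolding H_def[abs_def] by (rule progressive_lim[OF hp])
  let ?u = "\<lambda>k (s, \<omega>). h k s \<omega>"
  have m: "?u k \<in> borel_measurable (proc_space T M)" for k by (rule progressive_joint[OF hp])
  have d: "nn2 (proc_space T M) (\<lambda>x. ?u (Suc k) x - ?u k x) \<le> ennreal (C / 4 ^ k)" for k
    using C(1)[of k] proc_norm_nn2[OF progressive_diff[OF hp hp], of "Suc k" k] by (simp add: case_prod_unfold)
  have e: "nn2 (proc_space T M) (\<lambda>x. lim (\<lambda>k. ?u k x) - ?u k x) = proc_norm M 0 T (\<lambda>t \<omega>. H t \<omega> - h k t \<omega>)" for k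
    using proc_norm_nn2[OF progressive_diff[OF Hp hp], of k] by (simp add: case_prod_unfold H_def)
  have lim: "(\<lambda>k. proc_norm M 0 T (\<lambda>t \<omega>. H t \<omega> - h k t \<omega>)) \<longlonglongrightarrow> 0"
    using fast_L2_convergence(3)[of ?u, OF m d C(2)] unfolding e .
  have "sq_int (proc_space T M) (\<lambda>x. lim (\<lambda>k. ?u k x) - ?u 0 x)"
    using fast_L2_convergence(2)[of ?u, OF m d C(2), of 0] m by (auto simp: sq_int_def intro: le_less_trans)
  from sq_int_add[OF this L2_proc_sq_int[OF h[of 0]]]
  have "sq_int (proc_space T M) (\<lambda>(s, \<omega>). H s \<omega>)" by (simp add: case_prod_unfold H_def)
  then have "H \<in> L2_proc M Fl T" using Hp by (auto simp: L2_proc_iff sq_int_def proc_norm_nn2)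
  then show thesis using lim that by blast
qed

lemma elementary_L2_proc:
  fixes h :: "real \<Rightarrow> 'w \<Rightarrow> real^'n"
  assumes E: "elementary_integral M Fl T W h I"
  shows "h \<in> L2_proc M Fl T"
proof -
  obtain m \<tau> \<xi> where P: "part T m \<tau>" and c: "el_coef M Fl m \<tau> \<xi>" and e: "h = el_proc m \<tau> \<xi>"
    by (rule common_partition[OF E E, of "{}"]) (simp, simp, rule that, assumption+)
  have "progressive Fl T h"
    unfolding progressive_def
  proof
    fix t assume t: "t \<in> {0..T}"
    have "(\<lambda>x. \<Sum>i<m. indicator {\<tau> i<..\<tau> (Suc i)} (fst x) *\<^sub>R \<xi> i (snd x)) \<in> borel_measurable (restrict_space borel {0..t} \<Otimes>\<^sub>M Fl t)"
    proof (rule borel_measurable_sum)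
      fix i assume "i \<in> {..<m}"
      then have i: "i < m" by simp
      show "(\<lambda>x. indicator {\<tau> i<..\<tau> (Suc i)} (fst x) *\<^sub>R \<xi> i (snd x)) \<in> borel_measurable (restrict_space borel {0..t} \<Otimes>\<^sub>M Fl t)"
      \<comment> \<open>On [0,t] a cell that starts after \<open>t\<close> vanishes, so only
        coefficients already known at \<open>t\<close> contribute.\<close>
      proof (cases "\<tau> i \<le> t")
        case True
        have [measurable]: "\<xi> i \<in> borel_measurable (Fl t)"
          using measurable_Fl_mono[OF el_coef_measurable(1)[OF P c i] True] .
        have [measurable]: "fst \<in> restrict_space borel {0..t} \<Otimes>\<^sub>M Fl t \<rightarrow>\<^sub>M (borel :: real measure)"
          by (rule measurable_compose[OF measurable_fst]) (rule measurable_restrict_space1, simp)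
        show ?thesis by measurable
      next
        case False
        have "(\<lambda>x. 0 :: real^'n) \<in> borel_measurable (restrict_space borel {0..t} \<Otimes>\<^sub>M Fl t)" by simp
        then show ?thesis
          by (rule measurable_cong[THEN iffD1, rotated])
             (use False in \<open>auto simp: space_pair_measure space_restrict_space\<close>)
      qed
    qed
    then show "(\<lambda>(s, \<omega>). h s \<omega>) \<in> borel_measurable (restrict_space borel {0..t} \<Otimes>\<^sub>M Fl t)"
      by (simp add: e el_proc_def case_prod_unfold)
  qed
  moreover have "proc_norm M 0 T h < \<infinity>"
  proof -
    have "proc_norm M (\<tau> 0) T h = (\<Sum>i\<in>{0..<m}. ennreal (\<tau> (Suc i) - \<tau> i) * nn2 M (\<xi> i))"
      unfolding e using el_coef_measurable(2)[OF P c] by (intro proc_norm_el_proc[OF P]) auto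
    moreover have "\<dots> < \<infinity>"
      using el_coef_measurable(3)[OF P c] by (auto simp: sq_int_def ennreal_mult_less_top)
    ultimately show ?thesis using P by (simp add: part_def)
  qed
  ultimately show ?thesis by (simp add: L2_proc_iff)
qed

lemma S2_proc_at:
  fixes X :: "real \<Rightarrow> 'w \<Rightarrow> real^'n"
  assumes "X \<in> S2_proc M Fl T" "t \<in> {0..T}"
  shows "X t \<in> borel_measurable (Fl t)" "sq_int M (X t)"
proof -
  show m: "X t \<in> borel_measurable (Fl t)" using assms unfolding S2_proc_def adapted_def by blast
  have "t \<le> T" using assms(2) by simp
  have "nn2 M (X t) \<le> (\<integral>\<^sup>+\<omega>. (SUP t\<in>{0..T}. ennreal ((norm (X t \<omega>))\<^sup>2)) \<partial>M)"
    unfolding nn2_def by (intro nn_integral_mono SUP_upper assms(2))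
  also have "\<dots> < \<infinity>" using assms(1) by (simp add: S2_proc_def)
  finally show "sq_int M (X t)" using measurable_Fl_M[OF m \<open>t \<le> T\<close>] by (rule sq_intI[rotated])
qed

lemma ito_integral_iff:
  "ito_integral M F T W H X \<longleftrightarrow> adapted F T X \<and> (\<forall>\<omega>\<in>space M. continuous_on {0..T} (\<lambda>t. X t \<omega>)) \<and>
     (\<exists>h I. (\<forall>k::nat. elementary_integral M F T W (h k) (I k)) \<and>
        (\<lambda>k. proc_norm M 0 T (\<lambda>t \<omega>. H t \<omega> - h k t \<omega>)) \<longlonglongrightarrow> 0 \<and>
        (\<forall>t\<in>{0..T}. (\<lambda>k. nn2 M (\<lambda>\<omega>. X t \<omega> - I k t \<omega>)) \<longlonglongrightarrow> 0))"
  unfolding ito_integral_def proc_norm_def nn2_def ..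

text \<open>Approximants are taken at squared distance \<open>4^-k\<close>. By the isometry the
  constants and the two integrands are then Cauchy separately and at the same rate, so each has a
  limit of its own.\<close>

theorem martingale_representation:
  fixes \<zeta> :: "'w \<Rightarrow> real^'n"
  assumes z: "\<zeta> \<in> borel_measurable (Fl T)" "sq_int M \<zeta>"
  shows "\<exists>c Q1 Q2 X1 X2. Q1 \<in> L2_proc M Fl T \<and> Q2 \<in> L2_proc M Fl T \<and> X1 \<in> S2_proc M Fl T \<and> X2 \<in> S2_proc M Fl T \<and>
    ito_integral M Fl T W1 Q1 X1 \<and> ito_integral M Fl T W2 Q2 X2 \<and> (AE \<omega> in M. \<zeta> \<omega> = c + X1 T \<omega> + X2 T \<omega>)"
proof -
  define \<epsilon> :: "nat \<Rightarrow> real" where "\<epsilon> k = 1 / 4 ^ k" for k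
  have \<epsilon>: "\<epsilon> k > 0" "\<epsilon> (Suc k) \<le> \<epsilon> k" for k by (auto simp: \<epsilon>_def field_simps)
  have "\<forall>k. \<exists>c h1 I1 h2 I2. elementary_integral M Fl T W1 h1 I1 \<and>
     elementary_integral M Fl T W2 h2 I2 \<and> nn2 M (\<lambda>\<omega>. \<zeta> \<omega> - (c + (I1 T \<omega> + I2 T \<omega>))) \<le> ennreal (\<epsilon> k)"
    using rep_L2[OF z] \<epsilon>(1) unfolding rep_def by (intro allI) simp
  then obtain c h1 I1 h2 I2 where E1: "\<And>k. elementary_integral M Fl T W1 (h1 k) (I1 k)"
    and E2: "\<And>k. elementary_integral M Fl T W2 (h2 k) (I2 k)"
    and n: "\<And>k. nn2 M (\<lambda>\<omega>. \<zeta> \<omega> - (c k + (I1 k T \<omega> + I2 k T \<omega>))) \<le> ennreal (\<epsilon> k)"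
    unfolding choice_iff by blast
  have zM[measurable]: "\<zeta> \<in> borel_measurable M" using z(2) by measurable
  have [measurable]: "(\<lambda>\<omega>. I1 k T \<omega> + I2 k T \<omega>) \<in> borel_measurable M" for k by (rule elementary_T_measurable[OF E1 E2])
  \<comment> \<open>The constant difference plays the part of the past term in the isometry. Two
    errors of at most \<open>\<epsilon> k\<close>, each doubled, give the constant 4.\<close>
  have step: "nn2 M (\<lambda>\<omega>. c (Suc k) - c k) + (proc_norm M 0 T (\<lambda>t \<omega>. h1 (Suc k) t \<omega> - h1 k t \<omega>) + proc_norm M 0 T (\<lambda>t \<omega>. h2 (Suc k) t \<omega> - h2 k t \<omega>))
     \<le> ennreal (4 / 4 ^ k)" for k
  proof -
    note D1 = elementary_diff[OF E1[of "Suc k"] E1[of k]] and D2 = elementary_diff[OF E2[of "Suc k"] E2[of k]]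
    have "nn2 M (\<lambda>\<omega>. c (Suc k) - c k) + (proc_norm M 0 T (\<lambda>t \<omega>. h1 (Suc k) t \<omega> - h1 k t \<omega>) + proc_norm M 0 T (\<lambda>t \<omega>. h2 (Suc k) t \<omega> - h2 k t \<omega>))
      = nn2 M (\<lambda>\<omega>. (c (Suc k) - c k) + ((I1 (Suc k) T \<omega> - I1 k T \<omega> - (I1 (Suc k) 0 \<omega> - I1 k 0 \<omega>)) + (I2 (Suc k) T \<omega> - I2 k T \<omega> - (I2 (Suc k) 0 \<omega> - I2 k 0 \<omega>))))"
      using T_pos by (intro elementary_isometry[OF D1 D2, symmetric]) (auto intro: sq_int_bounded)
    also have "\<dots> = nn2 M (\<lambda>\<omega>. (c (Suc k) + (I1 (Suc k) T \<omega> + I2 (Suc k) T \<omega>)) - (c k + (I1 k T \<omega> + I2 k T \<omega>)))"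
    proof (rule nn2_cong)
      fix \<omega>
      have "I1 k 0 \<omega> + I2 k 0 \<omega> = 0" for k using elementary_at(3)[OF E1 E2, where t=T] T_pos by auto
      then have "I2 k 0 \<omega> = - I1 k 0 \<omega>" for k by (simp add: eq_neg_iff_add_eq_0 add.commute)
      then show "(c (Suc k) - c k) + ((I1 (Suc k) T \<omega> - I1 k T \<omega> - (I1 (Suc k) 0 \<omega> - I1 k 0 \<omega>)) + (I2 (Suc k) T \<omega> - I2 k T \<omega> - (I2 (Suc k) 0 \<omega> - I2 k 0 \<omega>)))
        = (c (Suc k) + (I1 (Suc k) T \<omega> + I2 (Suc k) T \<omega>)) - (c k + (I1 k T \<omega> + I2 k T \<omega>))"
        by (simp add: algebra_simps)
    qed
    also have "\<dots> \<le> 2 * nn2 M (\<lambda>\<omega>. (c (Suc k) + (I1 (Suc k) T \<omega> + I2 (Suc k) T \<omega>)) - \<zeta> \<omega>) + 2 * nn2 M (\<lambda>\<omega>. \<zeta> \<omega> - (c k + (I1 k T \<omega> + I2 k T \<omega>)))"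
      by (rule nn2_triangle_le) measurable
    also have "\<dots> \<le> 2 * ennreal (\<epsilon> k) + 2 * ennreal (\<epsilon> k)"
      using n[of k] n[of "Suc k"] ennreal_leI[OF \<epsilon>(2)[of k]]
      by (intro add_mono mult_left_mono) (auto simp: nn2_minus_commute[of M _ \<zeta>] intro: order_trans)
    also have "\<dots> = ennreal (4 / 4 ^ k)"
    proof -
      have two: "2 * ennreal x = ennreal (2 * x)" if "x \<ge> 0" for x using that ennreal_mult[of 2 x] by simp
      show ?thesis using \<epsilon>(1)[of k] by (simp add: two ennreal_plus[symmetric] \<epsilon>_def del: ennreal_plus)
    qed
    finally show ?thesis .
  qed
  have le3: "a \<le> a + (b + c)" "b \<le> a + (b + c)" "c \<le> a + (b + c)" for a b c :: ennreal
    by (auto intro: add_increasing add_increasing2)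
  have s1: "proc_norm M 0 T (\<lambda>t \<omega>. h1 (Suc k) t \<omega> - h1 k t \<omega>) \<le> ennreal (4 / 4 ^ k)" for k
    by (rule order_trans[OF le3(2) step])
  have s2: "proc_norm M 0 T (\<lambda>t \<omega>. h2 (Suc k) t \<omega> - h2 k t \<omega>) \<le> ennreal (4 / 4 ^ k)" for k
    by (rule order_trans[OF le3(3) step])
  have s0: "nn2 M (\<lambda>\<omega>. c (Suc k) - c k) \<le> ennreal (4 / 4 ^ k)" for k
    by (rule order_trans[OF le3(1) step])
  obtain Q1 where Q1: "Q1 \<in> L2_proc M Fl T" "(\<lambda>k. proc_norm M 0 T (\<lambda>t \<omega>. Q1 t \<omega> - h1 k t \<omega>)) \<longlonglongrightarrow> 0"
    using L2_proc_limit[OF elementary_L2_proc[OF E1] s1] by auto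
  obtain Q2 where Q2: "Q2 \<in> L2_proc M Fl T" "(\<lambda>k. proc_norm M 0 T (\<lambda>t \<omega>. Q2 t \<omega> - h2 k t \<omega>)) \<longlonglongrightarrow> 0"
    using L2_proc_limit[OF elementary_L2_proc[OF E2] s2] by auto
  \<comment> \<open>With the zero integral as partner, the paired existence result yields each of
    the two integrals separately.\<close>
  note Z = elementary_zero[OF T_pos]
  have z0: "proc_norm M 0 T (\<lambda>t \<omega>. 0 - 0 :: real^'n) = 0" by (simp add: proc_norm_def)
  have "\<exists>X. X \<in> S2_proc M Fl T \<and> (\<forall>t\<in>{0..T}. (\<lambda>k. nn2 M (\<lambda>\<omega>. X t \<omega> - (I1 k t \<omega> + 0))) \<longlonglongrightarrow> 0)"
    by (rule ito_exists_pair[OF E1 Z, where C=4]) (use s1 z0 in auto)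
  then obtain X1 where X1: "X1 \<in> S2_proc M Fl T" "\<And>t. t \<in> {0..T} \<Longrightarrow> (\<lambda>k. nn2 M (\<lambda>\<omega>. X1 t \<omega> - I1 k t \<omega>)) \<longlonglongrightarrow> 0"
    by auto
  have "\<exists>X. X \<in> S2_proc M Fl T \<and> (\<forall>t\<in>{0..T}. (\<lambda>k. nn2 M (\<lambda>\<omega>. X t \<omega> - (0 + I2 k t \<omega>))) \<longlonglongrightarrow> 0)"
    by (rule ito_exists_pair[OF Z E2, where C=4]) (use s2 z0 in auto)
  then obtain X2 where X2: "X2 \<in> S2_proc M Fl T" "\<And>t. t \<in> {0..T} \<Longrightarrow> (\<lambda>k. nn2 M (\<lambda>\<omega>. X2 t \<omega> - I2 k t \<omega>)) \<longlonglongrightarrow> 0"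
    by auto
  have ito1: "ito_integral M Fl T W1 Q1 X1"
    unfolding ito_integral_iff
    by (intro conjI exI[of _ h1] exI[of _ I1]) (use X1 Q1 E1 in \<open>auto simp: S2_proc_def\<close>)
  have ito2: "ito_integral M Fl T W2 Q2 X2"
    unfolding ito_integral_iff
    by (intro conjI exI[of _ h2] exI[of _ I2]) (use X2 Q2 E2 in \<open>auto simp: S2_proc_def\<close>)
  define c' where "c' = lim c"
  have c_lim: "(\<lambda>k. nn2 M (\<lambda>\<omega>. c' - c k)) \<longlonglongrightarrow> 0"
    unfolding c'_def by (rule fast_L2_convergence(3)[OF _ s0]) auto
  have TT: "T \<in> {0..T}" using T_pos by simp
  have [measurable]: "I1 k T \<in> borel_measurable M" "I2 k T \<in> borel_measurable M" for k
    using elementary_T_measurable[OF E1 Z] elementary_T_measurable[OF Z E2] by simp_all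
  have [measurable]: "X1 T \<in> borel_measurable M" "X2 T \<in> borel_measurable M"
    using S2_proc_at(2)[OF X1(1) TT] S2_proc_at(2)[OF X2(1) TT] by (simp_all add: sq_int_def)
  \<comment> \<open>For every \<open>k\<close> the distance is bounded by approximation errors, all
    of which tend to 0.\<close>
  have "nn2 M (\<lambda>\<omega>. \<zeta> \<omega> - (c' + X1 T \<omega> + X2 T \<omega>)) \<le> 0"
  proof (rule tendsto_lowerbound)
    show "(\<lambda>k. 2 * nn2 M (\<lambda>\<omega>. \<zeta> \<omega> - (c k + (I1 k T \<omega> + I2 k T \<omega>))) +
       2 * (2 * (2 * nn2 M (\<lambda>\<omega>. c' - c k) + 2 * nn2 M (\<lambda>\<omega>. X1 T \<omega> - I1 k T \<omega>)) + 2 * nn2 M (\<lambda>\<omega>. X2 T \<omega> - I2 k T \<omega>))) \<longlonglongrightarrow> 0"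
    proof -
      have "(\<lambda>k. ennreal (\<epsilon> k)) \<longlonglongrightarrow> 0"
        unfolding \<epsilon>_def by (subst ennreal_0[symmetric], intro tendsto_ennrealI) real_asymp
      then have "(\<lambda>k. nn2 M (\<lambda>\<omega>. \<zeta> \<omega> - (c k + (I1 k T \<omega> + I2 k T \<omega>)))) \<longlonglongrightarrow> 0"
        by (rule tendsto_sandwich[OF _ _ tendsto_const, rotated 2]) (use n in auto)
      then have "(\<lambda>k. 2 * nn2 M (\<lambda>\<omega>. \<zeta> \<omega> - (c k + (I1 k T \<omega> + I2 k T \<omega>))) +
       2 * (2 * (2 * nn2 M (\<lambda>\<omega>. c' - c k) + 2 * nn2 M (\<lambda>\<omega>. X1 T \<omega> - I1 k T \<omega>)) + 2 * nn2 M (\<lambda>\<omega>. X2 T \<omega> - I2 k T \<omega>)))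
       \<longlonglongrightarrow> 2 * 0 + 2 * (2 * (2 * 0 + 2 * 0) + 2 * 0)"
        by (intro tendsto_add ennreal_tendsto_cmult c_lim X1(2)[OF TT] X2(2)[OF TT]) auto
      then show ?thesis by simp
    qed
    show "\<forall>\<^sub>F k in sequentially. nn2 M (\<lambda>\<omega>. \<zeta> \<omega> - (c' + X1 T \<omega> + X2 T \<omega>)) \<le> 2 * nn2 M (\<lambda>\<omega>. \<zeta> \<omega> - (c k + (I1 k T \<omega> + I2 k T \<omega>))) +
       2 * (2 * (2 * nn2 M (\<lambda>\<omega>. c' - c k) + 2 * nn2 M (\<lambda>\<omega>. X1 T \<omega> - I1 k T \<omega>)) + 2 * nn2 M (\<lambda>\<omega>. X2 T \<omega> - I2 k T \<omega>))"
    proof (rule always_eventually, rule allI)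
      fix k
      have "nn2 M (\<lambda>\<omega>. \<zeta> \<omega> - (c' + X1 T \<omega> + X2 T \<omega>)) \<le> 2 * nn2 M (\<lambda>\<omega>. \<zeta> \<omega> - (c k + (I1 k T \<omega> + I2 k T \<omega>))) + 2 * nn2 M (\<lambda>\<omega>. (c k + (I1 k T \<omega> + I2 k T \<omega>)) - (c' + X1 T \<omega> + X2 T \<omega>))"
        by (rule nn2_triangle_le) measurable
      also have "nn2 M (\<lambda>\<omega>. (c k + (I1 k T \<omega> + I2 k T \<omega>)) - (c' + X1 T \<omega> + X2 T \<omega>)) = nn2 M (\<lambda>\<omega>. ((c' - c k) + (X1 T \<omega> - I1 k T \<omega>)) + (X2 T \<omega> - I2 k T \<omega>))"
        by (subst nn2_minus_commute) (simp add: algebra_simps)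
      also have "\<dots> \<le> 2 * nn2 M (\<lambda>\<omega>. (c' - c k) + (X1 T \<omega> - I1 k T \<omega>)) + 2 * nn2 M (\<lambda>\<omega>. X2 T \<omega> - I2 k T \<omega>)"
        by (rule nn2_add_le) measurable
      also have "nn2 M (\<lambda>\<omega>. (c' - c k) + (X1 T \<omega> - I1 k T \<omega>)) \<le> 2 * nn2 M (\<lambda>\<omega>. c' - c k) + 2 * nn2 M (\<lambda>\<omega>. X1 T \<omega> - I1 k T \<omega>)"
        by (rule nn2_add_le) measurable
      finally show "nn2 M (\<lambda>\<omega>. \<zeta> \<omega> - (c' + X1 T \<omega> + X2 T \<omega>)) \<le> 2 * nn2 M (\<lambda>\<omega>. \<zeta> \<omega> - (c k + (I1 k T \<omega> + I2 k T \<omega>))) +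
       2 * (2 * (2 * nn2 M (\<lambda>\<omega>. c' - c k) + 2 * nn2 M (\<lambda>\<omega>. X1 T \<omega> - I1 k T \<omega>)) + 2 * nn2 M (\<lambda>\<omega>. X2 T \<omega> - I2 k T \<omega>))"
        by (simp add: add_mono mult_left_mono)
    qed
  qed simp
  then have "(\<integral>\<^sup>+\<omega>. ennreal ((norm (\<zeta> \<omega> - (c' + X1 T \<omega> + X2 T \<omega>)))\<^sup>2) \<partial>M) = 0" by (simp add: nn2_def)
  then have "AE \<omega> in M. ennreal ((norm (\<zeta> \<omega> - (c' + X1 T \<omega> + X2 T \<omega>)))\<^sup>2) = 0"
    by (subst (asm) nn_integral_0_iff_AE) auto
  then have "AE \<omega> in M. \<zeta> \<omega> = c' + X1 T \<omega> + X2 T \<omega>" by eventually_elim (simp add: ennreal_eq_0_iff)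
  then show ?thesis using Q1(1) Q2(1) X1(1) X2(1) ito1 ito2 by blast
qed

end

section \<open>Filtered versions\<close>

context wiener_pair
begin

abbreviation G1 :: "real \<Rightarrow> 'w measure" where "G1 \<equiv> nat_filt M W1"

lemma G1_mono: "s \<le> t \<Longrightarrow> sets (G1 s) \<subseteq> sets (G1 t)"
  by (rule nat_filt_mono)

lemma sets_G1_le: "t \<le> T \<Longrightarrow> sets (G1 t) \<subseteq> sets M"
  using W_measurable by (intro sets_nat_filt_le) auto

lemma subalgebra_G1: "t \<le> T \<Longrightarrow> subalgebra M (G1 t)"
  using sets_G1_le by (simp add: subalgebra_def)

lemma cond_exp_G1: "t \<le> T \<Longrightarrow> finite_measure_subalgebra M (G1 t)"
  using subalgebra_G1 by unfold_locales

text \<open>An event known at time \<open>s\<close> is used only at times from \<open>s\<close> on.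
  The sections at \<open>t\<close> are then measurable for \<open>G1 t\<close>; this and
  progressiveness can be checked on the generating rectangles.\<close>

definition left_rects :: "(real \<times> 'w) set set" where
  "left_rects = {B \<times> A | B A s. 0 \<le> s \<and> s \<le> T \<and> B \<in> sets borel \<and> B \<subseteq> {s..T} \<and> A \<in> sets (G1 s)}"

definition left_sigma :: "(real \<times> 'w) measure" where
  "left_sigma = sigma ({0..T} \<times> space M) left_rects"

lemma left_rects_sub: "left_rects \<subseteq> Pow ({0..T} \<times> space M)"
proof -
  have "A \<subseteq> space M" if "A \<in> sets (G1 s)" for A s using sets.sets_into_space[OF that] by simp
  moreover have "B \<subseteq> {0..T}" if "B \<subseteq> {s..T}" "0 \<le> s" for B s using that by auto
  ultimately show ?thesis unfolding left_rects_def by (auto dest!: subsetD)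
qed

lemma space_left_sigma: "space left_sigma = {0..T} \<times> space M"
  and sets_left_sigma: "sets left_sigma = sigma_sets ({0..T} \<times> space M) left_rects"
  unfolding left_sigma_def using left_rects_sub by (simp_all add: space_measure_of sets_measure_of)

lemma subalgebra_left_sigma: "subalgebra (proc_space T M) left_sigma"
  unfolding subalgebra_def
proof
  show "space left_sigma = space (proc_space T M)" by (simp add: space_left_sigma space_proc_space)
  have "left_rects \<subseteq> sets (proc_space T M)"
  proof
    fix X assume "X \<in> left_rects"
    then obtain B A s where X: "X = B \<times> A" "0 \<le> s" "s \<le> T" "B \<in> sets borel" "B \<subseteq> {s..T}" "A \<in> sets (G1 s)"
      unfolding left_rects_def by blast
    have "B \<in> sets Tm"
      using X by (auto simp: sets_restrict_space_iff)
    moreover have "A \<in> sets M" using X sets_G1_le by auto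
    ultimately show "X \<in> sets (proc_space T M)" unfolding X proc_space_def by simp
  qed
  then have "sigma_sets (space (proc_space T M)) left_rects \<subseteq> sets (proc_space T M)"
    by (rule sets.sigma_sets_subset)
  then show "sets left_sigma \<subseteq> sets (proc_space T M)" by (simp add: sets_left_sigma space_proc_space)
qed

lemma left_sigma_section:
  assumes "b \<in> borel_measurable left_sigma" "t \<in> {0..T}"
  shows "(\<lambda>\<omega>. b (t, \<omega>)) \<in> borel_measurable (G1 t)"
proof (rule measurable_compose[OF _ assms(1)])
  show "(\<lambda>\<omega>. (t, \<omega>)) \<in> G1 t \<rightarrow>\<^sub>M left_sigma"
    unfolding left_sigma_def
  proof (rule measurable_measure_of[OF left_rects_sub])
    fix X assume "X \<in> left_rects"
    then obtain B A s where X: "X = B \<times> A" "0 \<le> s" "s \<le> T" "B \<in> sets borel" "B \<subseteq> {s..T}" "A \<in> sets (G1 s)"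
      unfolding left_rects_def by blast
    show "(\<lambda>\<omega>. (t, \<omega>)) -` X \<inter> space (G1 t) \<in> sets (G1 t)"
    proof (cases "t \<in> B")
      case True
      then have "s \<le> t" using X(5) by auto
      then have "A \<in> sets (G1 t)" using X(6) G1_mono by blast
      moreover have "(\<lambda>\<omega>. (t, \<omega>)) -` X \<inter> space (G1 t) = A" using True X sets.sets_into_space[OF X(6)] by auto
      ultimately show ?thesis by simp
    next
      case False
      then have "(\<lambda>\<omega>. (t, \<omega>)) -` X \<inter> space (G1 t) = {}" using X by auto
      then show ?thesis by simp
    qed
  qed (use assms in auto)
qed

lemma left_sigma_progressive:
  assumes "b \<in> borel_measurable left_sigma"
  shows "progressive Fl T (\<lambda>t \<omega>. b (t, \<omega>))"
  unfolding progressive_def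
proof
  fix t assume t: "t \<in> {0..T}"
  have "(\<lambda>x. b x) \<in> borel_measurable (restrict_space borel {0..t} \<Otimes>\<^sub>M Fl t)"
  proof (rule measurable_compose[OF _ assms, of "\<lambda>x. x", unfolded id_def])
    show "(\<lambda>x. x) \<in> restrict_space borel {0..t} \<Otimes>\<^sub>M Fl t \<rightarrow>\<^sub>M left_sigma"
      unfolding left_sigma_def
    proof (rule measurable_measure_of[OF left_rects_sub])
      show "(\<lambda>x. x) \<in> space (restrict_space borel {0..t} \<Otimes>\<^sub>M Fl t) \<rightarrow> {0..T} \<times> space M"
        using t by (auto simp: space_pair_measure space_restrict_space)
      fix X assume "X \<in> left_rects"
      then obtain B A s where X: "X = B \<times> A" "0 \<le> s" "s \<le> T" "B \<in> sets borel" "B \<subseteq> {s..T}" "A \<in> sets (G1 s)"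
        unfolding left_rects_def by blast
      have A: "A \<subseteq> space M" using sets.sets_into_space[OF X(6)] by simp
      have e: "(\<lambda>x. x) -` X \<inter> space (restrict_space borel {0..t} \<Otimes>\<^sub>M Fl t) = (B \<inter> {0..t}) \<times> A"
        using A unfolding X by (auto simp: space_pair_measure space_restrict_space)
      show "(\<lambda>x. x) -` X \<inter> space (restrict_space borel {0..t} \<Otimes>\<^sub>M Fl t) \<in> sets (restrict_space borel {0..t} \<Otimes>\<^sub>M Fl t)"
      proof (cases "s \<le> t")
        case True
        then have "A \<in> sets (Fl t)" using X(6) G1_mono[OF True] sets_nat_filt_W1_le[of t] by auto
        moreover have "B \<inter> {0..t} \<in> sets (restrict_space borel {0..t})"
          using X(4) by (auto simp: sets_restrict_space_iff)
        ultimately show ?thesis unfolding e by simp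
      next
        case False
        then have "B \<inter> {0..t} = {}" using X by auto
        then show ?thesis unfolding e by simp
      qed
    qed
  qed
  then show "(\<lambda>(s, \<omega>). b (s, \<omega>)) \<in> borel_measurable (restrict_space borel {0..t} \<Otimes>\<^sub>M Fl t)"
    by (simp add: case_prod_unfold)
qed

text \<open>Finite lists of pairs of rationals index these events, so tests valid for almost every
  time are valid simultaneously; concatenation of lists gives intersections.\<close>

definition rat_set :: "(rat \<times> rat) list \<Rightarrow> 'w set" where
  "rat_set l = {\<omega>\<in>space M. \<forall>(r, q)\<in>set l. W1 (of_rat r) \<omega> < of_rat q}"

definition rat_sets :: "real \<Rightarrow> 'w set set" where
  "rat_sets t = {rat_set l | l. \<forall>(r, q)\<in>set l. 0 \<le> (of_rat r :: real) \<and> of_rat r < t}"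

lemma rat_set_in_G1:
  assumes "\<forall>(r, q)\<in>set l. 0 \<le> (of_rat r :: real) \<and> of_rat r \<le> s"
  shows "rat_set l \<in> sets (G1 s)"
proof -
  have "rat_set l = space M \<inter> (\<Inter>x\<in>set l. {\<omega>\<in>space (G1 s). W1 (of_rat (fst x)) \<omega> < of_rat (snd x)})"
    unfolding rat_set_def by force
  moreover have "{\<omega>\<in>space (G1 s). W1 (of_rat (fst x)) \<omega> < of_rat (snd x)} \<in> sets (G1 s)" if "x \<in> set l" for x
  proof -
    have [measurable]: "W1 (of_rat (fst x)) \<in> borel_measurable (G1 s)"
      using assms that by (intro nat_filt_measurable) auto
    show ?thesis by measurable
  qed
  then have "space (G1 s) \<inter> (\<Inter>x\<in>set l. {\<omega>\<in>space (G1 s). W1 (of_rat (fst x)) \<omega> < of_rat (snd x)}) \<in> sets (G1 s)"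
    using sets.top[of "G1 s"] by (cases "set l = {}") (auto intro!: sets.Int sets.finite_INT)
  ultimately show ?thesis by simp
qed

lemma Int_stable_rat_sets: "Int_stable (rat_sets t)"
proof (rule Int_stableI)
  fix A B assume "A \<in> rat_sets t" "B \<in> rat_sets t"
  then obtain l l' where "A = rat_set l" "B = rat_set l'" "\<forall>(r, q)\<in>set l. 0 \<le> (of_rat r :: real) \<and> of_rat r < t"
    "\<forall>(r, q)\<in>set l'. 0 \<le> (of_rat r :: real) \<and> of_rat r < t" unfolding rat_sets_def by auto
  then show "A \<inter> B \<in> rat_sets t"
    unfolding rat_sets_def by (intro CollectI exI[of _ "l @ l'"]) (auto simp: rat_set_def)
qed

lemma rat_sets_sub: "rat_sets t \<subseteq> Pow (space M)"
  unfolding rat_sets_def rat_set_def by auto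

text \<open>By path continuity, the rational times before t already generate the filtration at t up to null sets.\<close>

lemma G1_AE_eq_rat:
  assumes t: "0 < t" "t \<le> T" and A: "A \<in> sets (G1 t)"
  shows "\<exists>B\<in>sigma_sets (space M) (rat_sets t). AE \<omega> in M. \<omega> \<in> A \<longleftrightarrow> \<omega> \<in> B"
proof -
  let ?H = "sigma (space M) (rat_sets t)"
  have H: "space ?H = space M" "sets ?H = sigma_sets (space M) (rat_sets t)"
    using rat_sets_sub by (auto simp: space_measure_of sets_measure_of)
  have rat_meas: "W1 (of_rat r) \<in> borel_measurable ?H" if r: "0 \<le> (of_rat r :: real)" "of_rat r < t" for r
  proof -
    have *: "{\<omega>\<in>space M. W1 (of_rat r) \<omega> < of_rat q} \<in> sets ?H" for q
    proof -
      have "{\<omega>\<in>space M. W1 (of_rat r) \<omega> < of_rat q} = rat_set [(r, q)]" by (simp add: rat_set_def)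
      moreover have "rat_set [(r, q)] \<in> rat_sets t" unfolding rat_sets_def using r by (intro CollectI exI[of _ "[(r, q)]"]) auto
      ultimately show ?thesis unfolding H by auto
    qed
    show ?thesis
      unfolding borel_measurable_iff_less H
    proof
      fix a :: real
      have "{\<omega>\<in>space M. W1 (of_rat r) \<omega> < a} = (\<Union>q\<in>{q. of_rat q < a}. {\<omega>\<in>space M. W1 (of_rat r) \<omega> < of_rat q})"
        by (auto intro: less_trans dest: of_rat_dense)
      also have "\<dots> \<in> sets ?H" using * by (intro sets.countable_UN') auto
      finally show "{\<omega>\<in>space M. W1 (of_rat r) \<omega> < a} \<in> sigma_sets (space M) (rat_sets t)" unfolding H .
    qed
  qed
  show ?thesis
    using A unfolding sets_nat_filt
  proof (induction rule: sigma_sets.induct)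
    case (Basic a)
    then obtain r C where a: "a = W1 r -` C \<inter> space M" "r \<in> {0..t}" "C \<in> sets borel" by auto
    have "\<exists>q. 0 \<le> (of_rat q :: real) \<and> of_rat q < t \<and> \<bar>of_rat q - r\<bar> < 1 / Suc n" for n :: nat
    proof (cases "r = 0")
      case True
      then show ?thesis using t by (intro exI[of _ 0]) auto
    next
      case False
      then have "max 0 (r - 1 / Suc n) < r" using a(2) by auto
      then obtain q where q: "max 0 (r - 1 / Suc n) < of_rat q" "of_rat q < r" using of_rat_dense by blast
      then show ?thesis using a(2) by (intro exI[of _ q]) auto
    qed
    then obtain q where q: "\<And>n. 0 \<le> (of_rat (q n) :: real)" "\<And>n. (of_rat (q n) :: real) < t" "\<And>n::nat. \<bar>of_rat (q n) - r\<bar> < 1 / Suc n"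
      by metis
    have qr: "(\<lambda>n. of_rat (q n)) \<longlonglongrightarrow> r"
    proof (rule LIMSEQ_norm_0[THEN LIM_zero_cancel])
      fix n show "norm (of_rat (q n) - r) < 1 / real (Suc n)" using q(3)[of n] by simp
    qed
    \<comment> \<open>The value at \<open>r\<close> is recovered along rational times strictly
      before \<open>t\<close>, even for \<open>r = t\<close>; path continuity makes it agree with
      \<open>W1 r\<close> almost surely.\<close>
    define V where "V \<omega> = lim (\<lambda>n. W1 (of_rat (q n)) \<omega>)" for \<omega>
    have V: "V \<in> borel_measurable ?H"
      unfolding V_def[abs_def] using rat_meas q by (intro borel_measurable_lim_metric) auto
    have "AE \<omega> in M. W1 r \<omega> = V \<omega>"
      using AE_W_continuous
    proof eventually_elim
      case (elim \<omega>)
      have "(\<lambda>n. W1 (of_rat (q n)) \<omega>) \<longlonglongrightarrow> W1 r \<omega>"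
      proof (rule continuous_on_tendsto_compose[OF _ qr])
        show "continuous_on {0..T} (\<lambda>t. W1 t \<omega>)" using elim by simp
        show "r \<in> {0..T}" using a(2) t by auto
        show "\<forall>\<^sub>F n in sequentially. of_rat (q n) \<in> {0..T}"
        proof (intro always_eventually allI)
          show "of_rat (q n) \<in> {0..T}" for n using q(1)[of n] q(2)[of n] t by simp
        qed
      qed
      then show "W1 r \<omega> = V \<omega>" unfolding V_def by (rule limI[symmetric])
    qed
    moreover have "V -` C \<inter> space M \<in> sigma_sets (space M) (rat_sets t)"
      using measurable_sets[OF V a(3)] unfolding H .
    ultimately show ?case using AE_space
      by (intro bexI[of _ "V -` C \<inter> space M"]) (auto simp: a elim!: eventually_mono AE_mp)
  next
    case Empty
    show ?case by (intro bexI[of _ "{}"]) (auto intro: sigma_sets.Empty)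
  next
    case (Compl a)
    then obtain B where B: "B \<in> sigma_sets (space M) (rat_sets t)" "AE \<omega> in M. \<omega> \<in> a \<longleftrightarrow> \<omega> \<in> B" by auto
    then show ?case by (intro bexI[of _ "space M - B"]) (auto intro: sigma_sets.Compl)
  next
    case (Union a)
    then obtain B where B: "\<And>i. B i \<in> sigma_sets (space M) (rat_sets t)" "\<And>i. AE \<omega> in M. \<omega> \<in> a i \<longleftrightarrow> \<omega> \<in> B i"
      by metis
    have "AE \<omega> in M. \<forall>i::nat. \<omega> \<in> a i \<longleftrightarrow> \<omega> \<in> B i" using B(2) by (simp add: AE_all_countable)
    then show ?case using B(1) by (intro bexI[of _ "\<Union>i. B i"]) (auto elim!: eventually_mono intro: sigma_sets.Union)
  qed
qed

lemma sigma_rat_sets_le: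
  assumes "t \<le> T" shows "sigma_sets (space M) (rat_sets t) \<subseteq> sets M"
proof (rule sets.sigma_sets_subset)
  show "rat_sets t \<subseteq> sets M"
  proof
    fix A assume "A \<in> rat_sets t"
    then obtain l where "A = rat_set l" "\<forall>(r, q)\<in>set l. 0 \<le> (of_rat r :: real) \<and> of_rat r < t" unfolding rat_sets_def by auto
    then have "A \<in> sets (G1 t)" by (auto intro!: rat_set_in_G1)
    then show "A \<in> sets M" using sets_G1_le[OF assms] by auto
  qed
qed

text \<open>The identity extends from the rational events to the sigma-algebra they generate by
  Dynkin's argument, and from there to \<open>G1 t\<close>, whose events are of that kind up to null
  sets.\<close>

lemma cond_exp_G1_rat:
  fixes f g :: "'w \<Rightarrow> real"
  assumes t: "0 < t" "t \<le> T" and fg: "integrable M f" "integrable M g" and g: "g \<in> borel_measurable (G1 t)"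
    and eq: "\<And>A. A \<in> rat_sets t \<Longrightarrow> (\<integral>\<omega>. indicator A \<omega> * (g \<omega> - f \<omega>) \<partial>M) = 0"
  shows "AE \<omega> in M. real_cond_exp M (G1 t) f \<omega> = g \<omega>"
proof -
  interpret C: finite_measure_subalgebra M "G1 t" by (rule cond_exp_G1[OF t(2)])
  define h where "h \<omega> = g \<omega> - f \<omega>" for \<omega>
  have h: "integrable M h" unfolding h_def[abs_def] using fg by simp
  have ih: "integrable M (\<lambda>\<omega>. indicator A \<omega> * h \<omega>)" if "A \<in> sets M" for A
    using integrable_mult_indicator[OF that h] by simp
  note sub = sigma_rat_sets_le[OF t(2)]
  have zero: "(\<integral>\<omega>. indicator B \<omega> * h \<omega> \<partial>M) = 0" if "B \<in> sigma_sets (space M) (rat_sets t)" for B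
    using Int_stable_rat_sets rat_sets_sub that
  proof (induction rule: sigma_sets_induct_disjoint)
    case (basic A) then show ?case using eq by (simp add: h_def)
  next
    case empty then show ?case by simp
  next
    case (compl A)
    have "space M \<in> rat_sets t" unfolding rat_sets_def by (intro CollectI exI[of _ "[]"]) (simp add: rat_set_def)
    then have "(\<integral>\<omega>. indicator (space M) \<omega> * h \<omega> \<partial>M) = 0" using eq by (simp add: h_def)
    moreover have "(\<integral>\<omega>. indicator (space M - A) \<omega> * h \<omega> \<partial>M) = (\<integral>\<omega>. indicator (space M) \<omega> * h \<omega> - indicator A \<omega> * h \<omega> \<partial>M)"
      by (rule Bochner_Integration.integral_cong) (auto simp: indicator_def)
    moreover have "A \<in> sets M" using compl(1) sub by auto
    ultimately show ?case using compl(2) ih[of A] ih[of "space M"] by simp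
  next
    case (union A)
    have A: "A i \<in> sets M" for i using union(2) sub by auto
    have "((\<lambda>n. \<integral>\<omega>. indicator (\<Union>i<n. A i) \<omega> * h \<omega> \<partial>M) \<longlonglongrightarrow> (\<integral>\<omega>. indicator (\<Union>i. A i) \<omega> * h \<omega> \<partial>M))"
    proof (rule integral_dominated_convergence[where w="\<lambda>\<omega>. norm (h \<omega>)"])
      show "AE \<omega> in M. (\<lambda>n. indicator (\<Union>i<n. A i) \<omega> * h \<omega>) \<longlonglongrightarrow> indicator (\<Union>i. A i) \<omega> * h \<omega>"
        by (intro AE_I2 tendsto_intros LIMSEQ_indicator_UN)
      show "AE \<omega> in M. norm (indicator (\<Union>i<n. A i) \<omega> * h \<omega>) \<le> norm (h \<omega>)" for n
        by (intro AE_I2) (auto simp: indicator_def)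
      have [measurable]: "h \<in> borel_measurable M" using h by simp
      note [measurable] = A
      show "(\<lambda>\<omega>. indicator (\<Union>i. A i) \<omega> * h \<omega>) \<in> borel_measurable M" by measurable
      show "(\<lambda>\<omega>. indicator (\<Union>i<n. A i) \<omega> * h \<omega>) \<in> borel_measurable M" for n by measurable
      show "integrable M (\<lambda>\<omega>. norm (h \<omega>))" using h by simp
    qed
    moreover have "(\<integral>\<omega>. indicator (\<Union>i<n. A i) \<omega> * h \<omega> \<partial>M) = 0" for n
    proof -
      have "disjoint_family_on A {..<n}" using union(1) by (auto simp: disjoint_family_on_def)
      then have "(\<integral>\<omega>. indicator (\<Union>i<n. A i) \<omega> * h \<omega> \<partial>M) = (\<integral>\<omega>. (\<Sum>i<n. indicator (A i) \<omega> * h \<omega>) \<partial>M)"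
        by (subst indicator_UN_disjoint) (auto simp: sum_distrib_right)
      also have "\<dots> = (\<Sum>i<n. \<integral>\<omega>. indicator (A i) \<omega> * h \<omega> \<partial>M)"
        using ih[OF A] by (intro Bochner_Integration.integral_sum) auto
      finally show ?thesis using union(3) by simp
    qed
    ultimately show ?case using LIMSEQ_unique[OF _ tendsto_const] by fastforce
  qed
  show ?thesis
  proof (rule C.real_cond_exp_charact)
    fix A assume A: "A \<in> sets (G1 t)"
    obtain B where B: "B \<in> sigma_sets (space M) (rat_sets t)" "AE \<omega> in M. \<omega> \<in> A \<longleftrightarrow> \<omega> \<in> B"
      using G1_AE_eq_rat[OF t A] by blast
    have AM: "A \<in> sets M" using A sets_G1_le[OF t(2)] by auto
    have BM: "B \<in> sets M" using B(1) sub by auto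
    have "(\<integral>\<omega>. indicator A \<omega> * h \<omega> \<partial>M) = (\<integral>\<omega>. indicator B \<omega> * h \<omega> \<partial>M)"
    proof (rule integral_cong_AE)
      show "AE \<omega> in M. indicator A \<omega> * h \<omega> = indicator B \<omega> * h \<omega>" using B(2) by eventually_elim (auto simp: indicator_def)
    qed (use ih[OF AM] ih[OF BM] in auto)
    also have "\<dots> = 0" by (rule zero[OF B(1)])
    finally have "(\<integral>\<omega>. indicator A \<omega> * g \<omega> - indicator A \<omega> * f \<omega> \<partial>M) = 0" by (simp add: h_def right_diff_distrib)
    then show "(\<integral>\<omega>\<in>A. f \<omega> \<partial>M) = (\<integral>\<omega>\<in>A. g \<omega> \<partial>M)"
      using integrable_mult_indicator[OF AM fg(1)] integrable_mult_indicator[OF AM fg(2)]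
      by (simp add: set_lebesgue_integral_def)
  qed (use fg g in auto)
qed

section \<open>Conditional expectation on the product space\<close>

lemma finite_proc_space: "finite_measure (proc_space T M)"
proof -
  interpret R: finite_measure Tm by (rule finite_lborel_restrict)
  have "finite_measure M" by unfold_locales
  then show ?thesis unfolding proc_space_def by (intro finite_measure_pair_measure R.finite_measure_axioms)
qed

lemma AE_proc_time: "(AE t in Tm. P t) \<longleftrightarrow> (AE t in lborel. t \<in> {0..T} \<longrightarrow> P t)"
  by (subst AE_restrict_space_iff) auto

text \<open>A single conditional expectation on the product is tested on rectangles. Each event
  gives an identity at almost every time; the rational events are countably many, so one null set of
  times serves for all of them.\<close>

lemma filtered_real:
  fixes f :: "real \<Rightarrow> 'w \<Rightarrow> real"
  assumes f: "integrable (proc_space T M) (\<lambda>(t, \<omega>). f t \<omega>)"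
  shows "\<exists>b. b \<in> borel_measurable left_sigma \<and> (AE t in lborel. t \<in> {0..T} \<longrightarrow>
    (AE \<omega> in M. b (t, \<omega>) = real_cond_exp M (G1 t) (f t) \<omega>))"
proof -
  let ?R = Tm
  interpret R: finite_measure ?R by (rule finite_lborel_restrict)
  interpret P: pair_sigma_finite ?R M ..
  interpret N: finite_measure "proc_space T M" by (rule finite_proc_space)
  interpret C: finite_measure_subalgebra "proc_space T M" left_sigma
    by unfold_locales (rule subalgebra_left_sigma)
  let ?f = "\<lambda>(t, \<omega>). f t \<omega>"
  define b where "b = real_cond_exp (proc_space T M) left_sigma ?f"
  have b_meas: "b \<in> borel_measurable left_sigma" unfolding b_def by (rule borel_measurable_cond_exp)
  have b_int: "integrable (proc_space T M) b" unfolding b_def by (rule C.real_cond_exp_int(1)[OF f])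
  define h where "h = (\<lambda>(t, \<omega>). b (t, \<omega>) - f t \<omega>)"
  have h: "integrable (?R \<Otimes>\<^sub>M M) h"
    using Bochner_Integration.integrable_diff[OF b_int f] unfolding h_def proc_space_def by (simp add: case_prod_unfold)
  \<comment> \<open>For a fixed event, \<open>\<phi>\<close> has zero integral over every measurable
    set of times, because the corresponding rectangle belongs to \<open>left_sigma\<close>.\<close>
  have key: "AE t in ?R. s \<le> t \<longrightarrow> (\<integral>\<omega>. indicator A \<omega> * h (t, \<omega>) \<partial>M) = 0"
    if s: "0 \<le> s" "s \<le> T" and A: "A \<in> sets (G1 s)" for s A
  proof -
    have AM[measurable]: "A \<in> sets M" using A sets_G1_le[OF s(2)] by auto
    have hB: "integrable (?R \<Otimes>\<^sub>M M) (\<lambda>x. indicator (B \<times> A) x * h x)" if "B \<in> sets ?R" for B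
      using integrable_mult_indicator[OF _ h, of "B \<times> A"] that by simp
    define \<phi> where "\<phi> t = indicator {s..T} t * (\<integral>\<omega>. indicator A \<omega> * h (t, \<omega>) \<partial>M)" for t
    have sR: "{s..T} \<in> sets ?R" using s by (auto simp: sets_restrict_space_iff)
    have \<phi>_eq: "(\<integral>\<omega>. indicator (B \<times> A) (t, \<omega>) * h (t, \<omega>) \<partial>M) = indicator B t * (\<integral>\<omega>. indicator A \<omega> * h (t, \<omega>) \<partial>M)" for t B
    proof -
      have "(\<integral>\<omega>. indicator (B \<times> A) (t, \<omega>) * h (t, \<omega>) \<partial>M) = (\<integral>\<omega>. indicator B t * (indicator A \<omega> * h (t, \<omega>)) \<partial>M)"
        by (intro Bochner_Integration.integral_cong) (auto simp: indicator_def)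
      then show ?thesis by simp
    qed
    have "AE t in ?R. \<phi> t = 0"
    proof (rule density_unique_real)
      show "integrable ?R \<phi>"
        using P.integrable_fst'[OF hB[OF sR]] unfolding \<phi>_def[abs_def] \<phi>_eq .
      show "integrable ?R (\<lambda>t. 0 :: real)" by simp
      fix B assume B: "B \<in> sets ?R"
      let ?B = "B \<inter> {s..T}"
      have BB: "?B \<in> sets ?R" using B sR by auto
      have "?B \<in> sets borel" using BB by (auto simp: sets_restrict_space_iff)
      then have rect: "?B \<times> A \<in> sets left_sigma"
        unfolding sets_left_sigma left_rects_def using s A by (intro sigma_sets.Basic) blast
      have "(\<integral>t\<in>B. \<phi> t \<partial>?R) = (\<integral>t. (\<integral>\<omega>. indicator (?B \<times> A) (t, \<omega>) * h (t, \<omega>) \<partial>M) \<partial>?R)"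
        unfolding \<phi>_eq \<phi>_def set_lebesgue_integral_def
        by (intro Bochner_Integration.integral_cong) (auto simp: indicator_def)
      also have "\<dots> = (\<integral>x. indicator (?B \<times> A) x * h x \<partial>(?R \<Otimes>\<^sub>M M))"
        using P.integral_fst'[OF hB[OF BB]] .
      also have "\<dots> = (\<integral>x. indicator (?B \<times> A) x * b x - indicator (?B \<times> A) x * ?f x \<partial>proc_space T M)"
        unfolding proc_space_def by (intro Bochner_Integration.integral_cong) (auto simp: h_def right_diff_distrib)
      also have "\<dots> = (\<integral>x\<in>?B \<times> A. b x \<partial>proc_space T M) - (\<integral>x\<in>?B \<times> A. ?f x \<partial>proc_space T M)"
      proof -
        have r: "?B \<times> A \<in> sets (proc_space T M)" using rect subalgebra_left_sigma by (auto simp: subalgebra_def)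
        show ?thesis
          using integrable_mult_indicator[OF r b_int] integrable_mult_indicator[OF r f]
          by (simp add: set_lebesgue_integral_def)
      qed
      also have "\<dots> = 0" using C.real_cond_exp_intA[OF f rect] unfolding b_def by simp
      finally show "(\<integral>t\<in>B. \<phi> t \<partial>?R) = (\<integral>t\<in>B. 0 \<partial>?R)" by simp
    qed
    then show ?thesis
      using AE_space by eventually_elim (auto simp: \<phi>_def space_restrict_space)
  qed
  have "AE t in ?R. \<forall>l. (\<forall>(r, q)\<in>set l. 0 \<le> (of_rat r :: real) \<and> of_rat r < t) \<longrightarrow> (\<integral>\<omega>. indicator (rat_set l) \<omega> * h (t, \<omega>) \<partial>M) = 0"
    unfolding AE_all_countable
  proof
    fix l :: "(rat \<times> rat) list"
    \<comment> \<open>The latest time in the list: \<open>rat_set l\<close> is known from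
      \<open>s\<close> on. The inserted 0 serves the empty list.\<close>
    define s where "s = Max (insert 0 ((\<lambda>x. of_rat (fst x) :: real) ` set l))"
    have s0: "0 \<le> s" unfolding s_def by (intro Max_ge) auto
    have sl: "of_rat (fst x) \<le> s" if "x \<in> set l" for x unfolding s_def using that by (intro Max_ge) auto
    show "AE t in ?R. (\<forall>(r, q)\<in>set l. 0 \<le> (of_rat r :: real) \<and> of_rat r < t) \<longrightarrow> (\<integral>\<omega>. indicator (rat_set l) \<omega> * h (t, \<omega>) \<partial>M) = 0"
    proof (cases "s \<le> T \<and> (\<forall>x\<in>set l. 0 \<le> (of_rat (fst x) :: real))")
      case True
      then have "rat_set l \<in> sets (G1 s)" using sl by (intro rat_set_in_G1) auto
      from key[OF s0 _ this] True have "AE t in ?R. s \<le> t \<longrightarrow> (\<integral>\<omega>. indicator (rat_set l) \<omega> * h (t, \<omega>) \<partial>M) = 0" by simp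
      then show ?thesis using AE_space
      proof eventually_elim
        case (elim t)
        show ?case
        proof
          assume "\<forall>(r, q)\<in>set l. 0 \<le> (of_rat r :: real) \<and> of_rat r < t"
          then have "s \<le> t" unfolding s_def using elim(2) by (subst Max_le_iff) (auto simp: space_restrict_space less_imp_le split: prod.splits)
          then show "(\<integral>\<omega>. indicator (rat_set l) \<omega> * h (t, \<omega>) \<partial>M) = 0" using elim(1) by simp
        qed
      qed
    next
      \<comment> \<open>Here no \<open>t\<close> in [0,T] satisfies the premise, so the implication
        is vacuous.\<close>
      case False
      show ?thesis using AE_space
      proof eventually_elim
        case (elim t)
        have "\<not> (\<forall>(r, q)\<in>set l. 0 \<le> (of_rat r :: real) \<and> of_rat r < t)"
        proof
          assume a: "\<forall>(r, q)\<in>set l. 0 \<le> (of_rat r :: real) \<and> of_rat r < t"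
          then have "s \<le> t" unfolding s_def using elim by (subst Max_le_iff) (auto simp: space_restrict_space less_imp_le split: prod.splits)
          then show False using False a elim by (auto simp: space_restrict_space split: prod.splits)
        qed
        then show ?case by blast
      qed
    qed
  qed
  moreover have "AE t in ?R. integrable M (\<lambda>\<omega>. ?f (t, \<omega>))"
    by (rule P.AE_integrable_fst'[OF f[unfolded proc_space_def]])
  moreover have "AE t in ?R. integrable M (\<lambda>\<omega>. b (t, \<omega>))"
    by (rule P.AE_integrable_fst'[OF b_int[unfolded proc_space_def]])
  \<comment> \<open>Time 0 is discarded as a null set, since no nonnegative rational time precedes
    it.\<close>
  moreover have "AE t in ?R. 0 < t"
  proof -
    have "AE t in lborel. t \<noteq> (0::real)" by (rule AE_lborel_singleton)
    then have "AE t in lborel. t \<in> {0..T} \<longrightarrow> 0 < t" by eventually_elim auto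
    then show ?thesis unfolding AE_proc_time .
  qed
  ultimately have "AE t in ?R. AE \<omega> in M. b (t, \<omega>) = real_cond_exp M (G1 t) (f t) \<omega>"
    using AE_space
  proof eventually_elim
    case (elim t)
    then have t: "t \<in> {0..T}" by (simp add: space_restrict_space)
    have "AE \<omega> in M. real_cond_exp M (G1 t) (f t) \<omega> = b (t, \<omega>)"
    proof (rule cond_exp_G1_rat)
      show "(\<lambda>\<omega>. b (t, \<omega>)) \<in> borel_measurable (G1 t)" by (rule left_sigma_section[OF b_meas t])
      fix A assume "A \<in> rat_sets t"
      then obtain l where "A = rat_set l" "\<forall>(r, q)\<in>set l. 0 \<le> (of_rat r :: real) \<and> of_rat r < t" unfolding rat_sets_def by auto
      then show "(\<integral>\<omega>. indicator A \<omega> * (b (t, \<omega>) - f t \<omega>) \<partial>M) = 0" using elim(1) by (simp add: h_def)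
    qed (use elim t in auto)
    then show ?case by eventually_elim simp
  qed
  then show ?thesis using b_meas unfolding AE_proc_time by blast
qed

end

section \<open>Vector-valued filtering as a contraction in square mean\<close>

lemma power2_norm_vec: "(norm (x :: real^'n))\<^sup>2 = (\<Sum>i\<in>UNIV. (x $ i)\<^sup>2)"
  by (simp add: norm_vec_def L2_set_def sum_nonneg)

lemma measurable_vec_nth[measurable (raw)]:
  fixes f :: "'a \<Rightarrow> real^'n"
  assumes "f \<in> borel_measurable M" shows "(\<lambda>x. f x $ i) \<in> borel_measurable M"
proof (rule measurable_compose[OF assms])
  show "(\<lambda>x::real^'n. x $ i) \<in> borel_measurable borel"
    by (intro borel_measurable_continuous_onI continuous_intros)
qed

lemma nn2_vec:
  fixes f :: "'a \<Rightarrow> real^'n"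
  assumes [measurable]: "f \<in> borel_measurable M"
  shows "nn2 M f = (\<Sum>i\<in>UNIV. nn2 M (\<lambda>x. f x $ i))"
proof -
  have "nn2 M f = (\<integral>\<^sup>+x. (\<Sum>i\<in>UNIV. ennreal ((f x $ i)\<^sup>2)) \<partial>M)"
    unfolding nn2_def power2_norm_vec by (simp add: sum_ennreal)
  also have "\<dots> = (\<Sum>i\<in>UNIV. \<integral>\<^sup>+x. ennreal ((f x $ i)\<^sup>2) \<partial>M)"
    by (intro nn_integral_sum) measurable
  finally show ?thesis by (simp add: nn2_def)
qed

lemma sq_int_vec_nth:
  fixes f :: "'a \<Rightarrow> real^'n"
  assumes "sq_int M f" shows "sq_int M (\<lambda>x. f x $ i)"
proof (rule sq_int_bound[OF assms])
  show "(\<lambda>x. f x $ i) \<in> borel_measurable M" using assms by measurable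
  show "AE x in M. norm (f x $ i) \<le> norm (f x)" by (simp add: component_le_norm_cart)
qed

text \<open>Jensen's inequality for the square, followed by preservation of the mean.\<close>

lemma (in finite_measure_subalgebra) nn2_real_cond_exp_le:
  fixes f :: "'a \<Rightarrow> real"
  assumes f: "sq_int M f"
  shows "nn2 M (real_cond_exp M F f) \<le> nn2 M f"
proof -
  have i: "integrable M f" "integrable M (\<lambda>x. (f x)\<^sup>2)"
    using sq_int_integrable[OF f] sq_int_integrable_power2[OF f] by simp_all
  have cvx: "convex_on UNIV (\<lambda>x::real. x\<^sup>2)" by (rule convex_power2)
  have "AE x in M. (real_cond_exp M F f x)\<^sup>2 \<le> real_cond_exp M F (\<lambda>x. (f x)\<^sup>2) x"
    by (rule real_cond_exp_jensens_inequality(2)[OF i(1), of UNIV]) (use i(2) cvx in auto)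
  then have "nn2 M (real_cond_exp M F f) \<le> (\<integral>\<^sup>+x. ennreal (real_cond_exp M F (\<lambda>x. (f x)\<^sup>2) x) \<partial>M)"
    unfolding nn2_def by (intro nn_integral_mono_AE) (auto intro!: ennreal_leI elim!: eventually_mono)
  also have "\<dots> = ennreal (\<integral>x. real_cond_exp M F (\<lambda>x. (f x)\<^sup>2) x \<partial>M)"
    by (rule nn_integral_eq_integral[OF real_cond_exp_int(1)[OF i(2)] real_cond_exp_pos]) (use i(2) in auto)
  also have "\<dots> = nn2 M f" using nn2_eq_integral[OF f] real_cond_exp_int(2)[OF i(2)] by simp
  finally show ?thesis .
qed

context wiener_pair
begin

lemma vec_cond_exp_measurable: "t \<le> T \<Longrightarrow> vec_cond_exp M (G1 t) f \<in> borel_measurable M"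
  for f :: "'w \<Rightarrow> real^'n"
proof -
  assume t: "t \<le> T"
  have e: "vec_cond_exp M (G1 t) f = (\<lambda>\<omega>. \<Sum>i\<in>UNIV. real_cond_exp M (G1 t) (\<lambda>\<omega>. f \<omega> $ i) \<omega> *\<^sub>R axis i 1)"
    by (simp add: vec_cond_exp_def fun_eq_iff vec_eq_iff axis_def if_distrib[of "(*) _"] cong: if_cong)
  show ?thesis unfolding e
    using measurable_from_subalg[OF subalgebra_G1[OF t] borel_measurable_cond_exp] by (intro borel_measurable_sum) auto
qed

lemma nn2_vec_cond_exp_le:
  fixes f :: "'w \<Rightarrow> real^'n"
  assumes t: "t \<le> T" and f: "sq_int M f"
  shows "nn2 M (vec_cond_exp M (G1 t) f) \<le> nn2 M f"
proof -
  interpret C: finite_measure_subalgebra M "G1 t" by (rule cond_exp_G1[OF t])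
  have "nn2 M (vec_cond_exp M (G1 t) f) = (\<Sum>i\<in>UNIV. nn2 M (real_cond_exp M (G1 t) (\<lambda>\<omega>. f \<omega> $ i)))"
    by (subst nn2_vec[OF vec_cond_exp_measurable[OF t]]) (simp add: vec_cond_exp_def)
  also have "\<dots> \<le> (\<Sum>i\<in>UNIV. nn2 M (\<lambda>\<omega>. f \<omega> $ i))"
    by (intro sum_mono C.nn2_real_cond_exp_le sq_int_vec_nth f)
  also have "\<dots> = nn2 M f" by (rule nn2_vec[OF sq_int_measurable[OF f], symmetric])
  finally show ?thesis .
qed

lemma vec_cond_exp_diff:
  fixes f g :: "'w \<Rightarrow> real^'n"
  assumes t: "t \<le> T" and f: "sq_int M f" and g: "sq_int M g"
  shows "AE \<omega> in M. vec_cond_exp M (G1 t) f \<omega> - vec_cond_exp M (G1 t) g \<omega> = vec_cond_exp M (G1 t) (\<lambda>\<omega>. f \<omega> - g \<omega>) \<omega>"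
proof -
  interpret C: finite_measure_subalgebra M "G1 t" by (rule cond_exp_G1[OF t])
  have "AE \<omega> in M. \<forall>i. real_cond_exp M (G1 t) (\<lambda>\<omega>. f \<omega> $ i - g \<omega> $ i) \<omega>
     = real_cond_exp M (G1 t) (\<lambda>\<omega>. f \<omega> $ i) \<omega> - real_cond_exp M (G1 t) (\<lambda>\<omega>. g \<omega> $ i) \<omega>"
    unfolding AE_all_countable
    using C.real_cond_exp_diff[OF sq_int_integrable[OF sq_int_vec_nth[OF f]] sq_int_integrable[OF sq_int_vec_nth[OF g]]] by blast
  then show ?thesis by eventually_elim (simp add: vec_cond_exp_def vec_eq_iff)
qed

lemma proc_section:
  assumes u: "joint u" and t: "t \<in> {0..T}"
  shows "u t \<in> borel_measurable M"
proof -
  have "(\<lambda>\<omega>. (t, \<omega>)) \<in> M \<rightarrow>\<^sub>M proc_space T M"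
    unfolding proc_space_def using t by (intro measurable_Pair1') (simp add: space_restrict_space)
  from measurable_compose[OF this u] show ?thesis by simp
qed

lemma nn2_time_measurable:
  fixes u :: "real \<Rightarrow> 'w \<Rightarrow> 'b::{real_normed_vector, second_countable_topology}"
  assumes [measurable]: "joint u"
  shows "(\<lambda>t. nn2 M (u t)) \<in> borel_measurable Tm"
proof -
  have "(\<lambda>x. ennreal ((norm ((\<lambda>(s, \<omega>). u s \<omega>) x))\<^sup>2)) \<in> borel_measurable (proc_space T M)" by measurable
  from borel_measurable_nn_integral_fst[OF this[unfolded proc_space_def]]
  show ?thesis by (simp add: nn2_def)
qed

lemma nn2_proc_time:
  fixes u :: "real \<Rightarrow> 'w \<Rightarrow> 'b::{real_normed_vector, second_countable_topology}"
  assumes [measurable]: "joint u"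
  shows "nn2 (proc_space T M) (\<lambda>(s, \<omega>). u s \<omega>) = (\<integral>\<^sup>+t. nn2 M (u t) \<partial>Tm)"
proof -
  have "(\<lambda>x. ennreal ((norm ((\<lambda>(s, \<omega>). u s \<omega>) x))\<^sup>2)) \<in> borel_measurable (proc_space T M)" by measurable
  from nn_integral_fst[OF this[unfolded proc_space_def]]
  show ?thesis by (simp add: nn2_def proc_space_def)
qed

lemma L2_proc_AE_sq_int:
  assumes u: "u \<in> L2_proc M Fl T"
  shows "AE t in Tm. sq_int M (u t)"
proof -
  have m: "joint u" using L2_proc_sq_int[OF u] by (simp add: sq_int_def)
  have "(\<integral>\<^sup>+t. nn2 M (u t) \<partial>Tm) \<noteq> \<infinity>"
    using sq_int_finite[OF L2_proc_sq_int[OF u]] unfolding nn2_proc_time[OF m, symmetric] by (metis less_irrefl)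
  from nn_integral_noteq_infinite[OF nn2_time_measurable[OF m] this]
  have "AE t in Tm. nn2 M (u t) \<noteq> \<infinity>" .
  then show ?thesis using AE_space
    by eventually_elim (use proc_section[OF m] in \<open>auto simp: sq_int_def space_restrict_space less_top\<close>)
qed

lemma is_filtered_version_iff:
  "is_filtered_version M T W1 u uh \<longleftrightarrow> joint uh \<and>
    (AE t in Tm. AE \<omega> in M. uh t \<omega> = vec_cond_exp M (G1 t) (u t) \<omega>)"
  unfolding is_filtered_version_def AE_proc_time by (simp add: measurable_cong_sets[OF sets_proc_space refl])

text \<open>The scalar construction is carried out componentwise. Measurability for
  \<open>left_sigma\<close> makes this version progressive, which keeps the generator along it in
  the space of progressive processes.\<close>

lemma filtered_version_exists:
  fixes u :: "real \<Rightarrow> 'w \<Rightarrow> real^'n"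
  assumes u: "u \<in> L2_proc M Fl T"
  shows "\<exists>uh. progressive Fl T uh \<and> is_filtered_version M T W1 u uh"
proof -
  interpret N: finite_measure "proc_space T M" by (rule finite_proc_space)
  have "\<forall>i. \<exists>b. b \<in> borel_measurable left_sigma \<and> (AE t in Tm.
    (AE \<omega> in M. b (t, \<omega>) = real_cond_exp M (G1 t) (\<lambda>\<omega>. u t \<omega> $ i) \<omega>))"
    unfolding AE_proc_time
    using N.sq_int_integrable[OF sq_int_vec_nth[OF L2_proc_sq_int[OF u]]]
    by (intro allI filtered_real) (simp add: case_prod_unfold)
  from choice[OF this] obtain b where b: "\<And>i. b i \<in> borel_measurable left_sigma"
    "\<And>i. AE t in Tm. AE \<omega> in M. b i (t, \<omega>) = real_cond_exp M (G1 t) (\<lambda>\<omega>. u t \<omega> $ i) \<omega>"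
    by blast
  define c where "c x = (\<Sum>i\<in>UNIV. b i x *\<^sub>R axis i (1::real))" for x
  have c: "c \<in> borel_measurable left_sigma" unfolding c_def[abs_def] using b(1) by (intro borel_measurable_sum) auto
  have c_nth: "c x $ i = b i x" for x i
    by (simp add: c_def axis_def if_distrib[of "(*) _"] cong: if_cong)
  define uh where "uh t \<omega> = c (t, \<omega>)" for t \<omega>
  have p: "progressive Fl T uh" unfolding uh_def[abs_def] by (rule left_sigma_progressive[OF c])
  have "AE t in Tm. \<forall>i. AE \<omega> in M. b i (t, \<omega>) = real_cond_exp M (G1 t) (\<lambda>\<omega>. u t \<omega> $ i) \<omega>"
    unfolding AE_all_countable using b(2) by blast
  then have "AE t in Tm. AE \<omega> in M. uh t \<omega> = vec_cond_exp M (G1 t) (u t) \<omega>"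
  proof eventually_elim
    case (elim t)
    then have "AE \<omega> in M. \<forall>i. b i (t, \<omega>) = real_cond_exp M (G1 t) (\<lambda>\<omega>. u t \<omega> $ i) \<omega>"
      unfolding AE_all_countable .
    then show ?case by eventually_elim (simp add: uh_def vec_eq_iff c_nth vec_cond_exp_def)
  qed
  then show ?thesis using p progressive_joint[OF p] unfolding is_filtered_version_iff by blast
qed

text \<open>At almost every time each filtered version equals the conditional expectation almost
  surely, so the bound holds for arbitrary choices of versions.\<close>

lemma filtered_contraction:
  fixes u v :: "real \<Rightarrow> 'w \<Rightarrow> real^'n"
  assumes u: "u \<in> L2_proc M Fl T" and v: "v \<in> L2_proc M Fl T"
    and uh: "is_filtered_version M T W1 u uh" and vh: "is_filtered_version M T W1 v vh"
  shows "AE t in Tm. nn2 M (\<lambda>\<omega>. uh t \<omega> - vh t \<omega>) \<le> nn2 M (\<lambda>\<omega>. u t \<omega> - v t \<omega>)"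
proof -
  have "AE t in Tm. AE \<omega> in M. uh t \<omega> = vec_cond_exp M (G1 t) (u t) \<omega>"
    "AE t in Tm. AE \<omega> in M. vh t \<omega> = vec_cond_exp M (G1 t) (v t) \<omega>"
    using uh vh by (auto simp: is_filtered_version_iff)
  then show ?thesis
    using L2_proc_AE_sq_int[OF u] L2_proc_AE_sq_int[OF v] AE_space
  proof eventually_elim
    case (elim t)
    then have t: "t \<le> T" by (simp add: space_restrict_space)
    from elim(1,2) vec_cond_exp_diff[OF t elim(3,4)]
    have "AE \<omega> in M. uh t \<omega> - vh t \<omega> = vec_cond_exp M (G1 t) (\<lambda>\<omega>. u t \<omega> - v t \<omega>) \<omega>"
      by eventually_elim simp
    then have "nn2 M (\<lambda>\<omega>. uh t \<omega> - vh t \<omega>) = nn2 M (vec_cond_exp M (G1 t) (\<lambda>\<omega>. u t \<omega> - v t \<omega>))"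
      by (rule nn2_cong_AE)
    also have "\<dots> \<le> nn2 M (\<lambda>\<omega>. u t \<omega> - v t \<omega>)" by (rule nn2_vec_cond_exp_le[OF t sq_int_diff[OF elim(3,4)]])
    finally show ?case .
  qed
qed

lemma zero_L2_proc: "(\<lambda>t \<omega>. 0 :: real^'n) \<in> L2_proc M Fl T"
  by (simp add: L2_proc_iff progressive_def proc_norm_def case_prod_unfold)

lemma filtered_zero: "is_filtered_version M T W1 (\<lambda>t \<omega>. 0 :: real^'n) (\<lambda>t \<omega>. 0)"
  unfolding is_filtered_version_iff
proof
  show "joint (\<lambda>t \<omega>. 0 :: real^'n)" by (simp add: case_prod_unfold)
  show "AE t in Tm. AE \<omega> in M. (0 :: real^'n) = vec_cond_exp M (G1 t) (\<lambda>\<omega>. 0) \<omega>"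
    using AE_space
  proof eventually_elim
    case (elim t)
    then have t: "t \<le> T" by (simp add: space_restrict_space)
    from vec_cond_exp_diff[OF t sq_int_zero sq_int_zero] show ?case by simp
  qed
qed

text \<open>The process is sampled on a grid and the mesh refined; continuity of paths gives the
  limit.\<close>

lemma S2_progressive:
  fixes X :: "real \<Rightarrow> 'w \<Rightarrow> real^'n"
  assumes X: "X \<in> S2_proc M Fl T"
  shows "progressive Fl T X"
  unfolding progressive_def
proof
  fix t assume t: "t \<in> {0..T}"
  let ?N = "restrict_space borel {0..t} \<Otimes>\<^sub>M Fl t"
  \<comment> \<open>Clipping to [0,t] keeps every sampling time observable at \<open>t\<close>,
    whatever integer the rounding produces.\<close>
  define Y where "Y k x = X (min t (max 0 (real_of_int \<lfloor>real (Suc k) * fst x\<rfloor> / real (Suc k)))) (snd x)" for k and x :: "real \<times> 'w"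
  have sp: "space ?N = {0..t} \<times> space M" by (simp add: space_pair_measure space_restrict_space)
  have [measurable]: "fst \<in> ?N \<rightarrow>\<^sub>M (borel :: real measure)"
    by (rule measurable_compose[OF measurable_fst]) (rule measurable_restrict_space1, simp)
  have Ym: "Y k \<in> borel_measurable ?N" for k
  proof -
    have "(\<lambda>x. (\<lambda>i x. X (min t (max 0 (real_of_int i / real (Suc k)))) (snd x)) \<lfloor>real (Suc k) * fst x\<rfloor> x) \<in> borel_measurable ?N"
    proof (rule measurable_compose_countable[where f="\<lambda>i x. X (min t (max 0 (real_of_int i / real (Suc k)))) (snd x)" and g="\<lambda>x. \<lfloor>real (Suc k) * fst x\<rfloor>"])
      fix i :: int
      let ?s = "min t (max 0 (real_of_int i / real (Suc k)))"
      have "X ?s \<in> borel_measurable (Fl ?s)" using t by (intro S2_proc_at(1)[OF X]) auto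
      then have [measurable]: "X ?s \<in> borel_measurable (Fl t)" by (rule measurable_Fl_mono) simp
      show "(\<lambda>x. X ?s (snd x)) \<in> borel_measurable ?N" by measurable
    qed measurable
    then show ?thesis by (simp add: Y_def[abs_def])
  qed
  show "(\<lambda>(s, \<omega>). X s \<omega>) \<in> borel_measurable ?N"
  proof (rule borel_measurable_LIMSEQ_metric[OF Ym])
    fix x assume x: "x \<in> space ?N"
    obtain s \<omega> where so: "x = (s, \<omega>)" "s \<in> {0..t}" "\<omega> \<in> space M" using x unfolding sp by auto
    have c: "continuous_on {0..T} (\<lambda>t. X t \<omega>)" using X so by (auto simp: S2_proc_def)
    have lim: "(\<lambda>k. min t (max 0 (real_of_int \<lfloor>real (Suc k) * s\<rfloor> / real (Suc k)))) \<longlonglongrightarrow> s"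
    proof -
      have "(\<lambda>k. real_of_int \<lfloor>real (Suc k) * s\<rfloor> / real (Suc k)) \<longlonglongrightarrow> s"
      proof (rule tendsto_sandwich)
        show "\<forall>\<^sub>F k in sequentially. s - 1 / real (Suc k) \<le> real_of_int \<lfloor>real (Suc k) * s\<rfloor> / real (Suc k)"
        proof (rule always_eventually, rule allI)
          fix k
          have "real (Suc k) * s - 1 \<le> real_of_int \<lfloor>real (Suc k) * s\<rfloor>" by linarith
          then have "(real (Suc k) * s - 1) / real (Suc k) \<le> real_of_int \<lfloor>real (Suc k) * s\<rfloor> / real (Suc k)"
            by (rule divide_right_mono) simp
          then show "s - 1 / real (Suc k) \<le> real_of_int \<lfloor>real (Suc k) * s\<rfloor> / real (Suc k)"
            by (simp add: diff_divide_distrib)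
        qed
        show "\<forall>\<^sub>F k in sequentially. real_of_int \<lfloor>real (Suc k) * s\<rfloor> / real (Suc k) \<le> s"
        proof (rule always_eventually, rule allI)
          fix k
          have "real_of_int \<lfloor>real (Suc k) * s\<rfloor> \<le> real (Suc k) * s" by linarith
          then have "real_of_int \<lfloor>real (Suc k) * s\<rfloor> / real (Suc k) \<le> (real (Suc k) * s) / real (Suc k)"
            by (rule divide_right_mono) simp
          then show "real_of_int \<lfloor>real (Suc k) * s\<rfloor> / real (Suc k) \<le> s" by simp
        qed
        have "(\<lambda>k. s - 1 / real (Suc k)) \<longlonglongrightarrow> s - 0" by (intro tendsto_intros lim_1_over_real_power LIMSEQ_Suc[OF lim_1_over_n])
        then show "(\<lambda>k. s - 1 / real (Suc k)) \<longlonglongrightarrow> s" by simp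
      qed simp
      then have "(\<lambda>k. min t (max 0 (real_of_int \<lfloor>real (Suc k) * s\<rfloor> / real (Suc k)))) \<longlonglongrightarrow> min t (max 0 s)"
        by (intro tendsto_min tendsto_max tendsto_const)
      moreover have "min t (max 0 s) = s" using so by auto
      ultimately show ?thesis by (simp only:)
    qed
    have "(\<lambda>k. X (min t (max 0 (real_of_int \<lfloor>real (Suc k) * s\<rfloor> / real (Suc k)))) \<omega>) \<longlonglongrightarrow> X s \<omega>"
    proof (rule continuous_on_tendsto_compose[OF c lim])
      show "\<forall>\<^sub>F k in sequentially. min t (max 0 (real_of_int \<lfloor>real (Suc k) * s\<rfloor> / real (Suc k))) \<in> {0..T}"
        by (rule always_eventually) (use t in \<open>auto intro: min.coboundedI1\<close>)
    qed (use so t in auto)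
    then show "(\<lambda>k. Y k x) \<longlonglongrightarrow> (case x of (s, \<omega>) \<Rightarrow> X s \<omega>)" by (simp add: Y_def so)
  qed
qed

lemma S2_L2_proc:
  fixes X :: "real \<Rightarrow> 'w \<Rightarrow> real^'n"
  assumes X: "X \<in> S2_proc M Fl T"
  shows "X \<in> L2_proc M Fl T"
proof -
  note p = S2_progressive[OF X]
  let ?S = "\<integral>\<^sup>+\<omega>. (SUP t\<in>{0..T}. ennreal ((norm (X t \<omega>))\<^sup>2)) \<partial>M"
  have "proc_norm M 0 T X = (\<integral>\<^sup>+t. nn2 M (X t) \<partial>Tm)"
    using nn2_proc_time[OF progressive_joint[OF p]] nn2_proc_space[OF progressive_joint[OF p]] by simp
  also have "\<dots> \<le> (\<integral>\<^sup>+t. ?S \<partial>Tm)"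
    unfolding nn2_def by (intro nn_integral_mono SUP_upper) (simp add: space_restrict_space)
  also have "\<dots> = ?S * ennreal T"
    using T_pos by (simp add: emeasure_restrict_space space_restrict_space)
  also have "\<dots> < \<infinity>" using X by (simp add: S2_proc_def ennreal_mult_less_top)
  finally show ?thesis using p by (simp add: L2_proc_iff)
qed

end

text \<open>\<open>u\<close> is approximated by the first point of a countable dense sequence within
  distance \<open>1/(m+1)\<close>. An argument with countably many values may be inserted
  measurably, and continuity in the second argument gives the limit.\<close>

lemma caratheodory_measurable:
  fixes g :: "'x \<Rightarrow> 'e::{metric_space, second_countable_topology} \<Rightarrow> 'f::{metric_space, second_countable_topology}"
  assumes g: "\<And>e. (\<lambda>x. g x e) \<in> borel_measurable N" and c: "\<And>x. x \<in> space N \<Longrightarrow> continuous_on UNIV (g x)"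
    and u[measurable]: "u \<in> borel_measurable N"
  shows "(\<lambda>x. g x (u x)) \<in> borel_measurable N"
proof -
  obtain D :: "'e set" where D: "countable D" "\<And>X. open X \<Longrightarrow> X \<noteq> {} \<Longrightarrow> \<exists>d\<in>D. d \<in> X"
    using countable_dense_setE by blast
  have "D \<noteq> {}" using D(2)[of UNIV] by auto
  define d where "d = from_nat_into D"
  have dd: "\<exists>j. dist (d j) e < 1 / real (Suc m)" for e :: 'e and m :: nat
  proof -
    obtain y where "y \<in> D" "y \<in> ball e (1 / real (Suc m))" using D(2)[of "ball e (1 / real (Suc m))"] by auto
    then show ?thesis using from_nat_into_surj[OF D(1)] by (metis d_def dist_commute mem_ball)
  qed
  define J where "J m x = (LEAST j. dist (d j) (u x) < 1 / real (Suc m))" for m x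
  have [measurable]: "J m \<in> measurable N (count_space UNIV)" for m
    unfolding J_def[abs_def] by measurable
  have J: "dist (d (J m x)) (u x) < 1 / real (Suc m)" for m x
    unfolding J_def using dd by (rule LeastI_ex)
  show ?thesis
  proof (rule borel_measurable_LIMSEQ_metric)
    show "(\<lambda>x. g x (d (J m x))) \<in> borel_measurable N" for m
      by (rule measurable_compose_countable[where f="\<lambda>j x. g x (d j)" and g="J m"]) (use g in auto)
    fix x assume x: "x \<in> space N"
    have "(\<lambda>m. d (J m x)) \<longlonglongrightarrow> u x"
    proof (rule metric_LIMSEQ_I)
      fix r :: real assume "r > 0"
      then obtain n where n: "1 / real (Suc n) < r" using nat_approx_posE by blast
      have "dist (d (J m x)) (u x) < r" if "m \<ge> n" for m
      proof -
        have "1 / real (Suc m) \<le> 1 / real (Suc n)" using that by (intro divide_left_mono) auto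
        then show ?thesis using J[of m x] n by linarith
      qed
      then show "\<exists>n. \<forall>m\<ge>n. dist (d (J m x)) (u x) < r" by blast
    qed
    then show "(\<lambda>m. g x (d (J m x))) \<longlonglongrightarrow> g x (u x)"
      by (intro continuous_on_tendsto_compose[OF c[OF x]]) auto
  qed
qed

section \<open>The equation with a given generator\<close>

lemma nn_integral_exp_Icc:
  fixes c :: real
  assumes "c \<noteq> 0" "a \<le> b"
  shows "(\<integral>\<^sup>+s\<in>{a..b}. ennreal (exp (c * (s - a))) \<partial>lborel) = ennreal ((exp (c * (b - a)) - 1) / c)"
proof -
  have "(\<integral>\<^sup>+s. ennreal (exp (c * (s - a))) * indicator {a..b} s \<partial>lborel) = exp (c * (b - a)) / c - exp (c * (a - a)) / c"
    using assms by (intro nn_integral_FTC_Icc) (auto intro!: derivative_eq_intros)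
  then show ?thesis using assms by (simp add: diff_divide_distrib)
qed

text \<open>Cauchy-Schwarz after splitting off the factor \<open>exp (-\<mu> * (s - a))\<close>,
  whose square integrates to at most \<open>1 / (2 * \<mu>)\<close>. This factor is the source of
  the contraction.\<close>

lemma norm_integral_weighted:
  fixes f :: "real \<Rightarrow> 'b::euclidean_space"
  assumes f: "set_borel_measurable lborel {a..b} f" and "\<mu> > 0"
  shows "ennreal ((norm (LINT s:{a..b}|lborel. f s))\<^sup>2)
    \<le> ennreal (1 / (2 * \<mu>)) * (\<integral>\<^sup>+s\<in>{a..b}. ennreal (exp (2 * \<mu> * (s - a)) * (norm (f s))\<^sup>2) \<partial>lborel)"
proof (cases "a \<le> b \<and> set_integrable lborel {a..b} f")
  case True
  define F where "F s = indicator {a..b} s *\<^sub>R f s" for s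
  have Fm[measurable]: "F \<in> borel_measurable lborel" using f unfolding set_borel_measurable_def F_def[abs_def] .
  have Fi: "integrable lborel F" using True unfolding set_integrable_def F_def[abs_def] by simp
  define u where "u s = ennreal (exp (- \<mu> * (s - a)) * indicator {a..b} s)" for s
  define v where "v s = ennreal (exp (\<mu> * (s - a)) * norm (F s))" for s
  have [measurable]: "u \<in> borel_measurable lborel" "v \<in> borel_measurable lborel" unfolding u_def[abs_def] v_def[abs_def] by measurable
  have "ennreal (norm (LINT s:{a..b}|lborel. f s)) \<le> (\<integral>\<^sup>+s. ennreal (norm (F s)) \<partial>lborel)"
    unfolding set_lebesgue_integral_def F_def[symmetric] by (rule integral_norm_bound_ennreal[OF Fi])
  also have "\<dots> = (\<integral>\<^sup>+s. u s * v s \<partial>lborel)"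
  proof (intro nn_integral_cong)
    fix s
    have "exp (- \<mu> * (s - a)) * exp (\<mu> * (s - a)) = (1::real)" by (simp add: exp_add[symmetric])
    then show "ennreal (norm (F s)) = u s * v s"
      unfolding u_def v_def by (subst ennreal_mult[symmetric]) (auto simp: F_def indicator_def mult.assoc[symmetric])
  qed
  finally have "(ennreal (norm (LINT s:{a..b}|lborel. f s)))\<^sup>2 \<le> (\<integral>\<^sup>+s. u s * v s \<partial>lborel)\<^sup>2" by (rule power_mono) simp
  also have "\<dots> \<le> (\<integral>\<^sup>+s. (u s)\<^sup>2 \<partial>lborel) * (\<integral>\<^sup>+s. (v s)\<^sup>2 \<partial>lborel)" by (rule Cauchy_Schwarz_nn_integral) auto
  also have "\<dots> \<le> ennreal (1 / (2 * \<mu>)) * (\<integral>\<^sup>+s\<in>{a..b}. ennreal (exp (2 * \<mu> * (s - a)) * (norm (f s))\<^sup>2) \<partial>lborel)"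
  proof (intro mult_mono)
    have "(\<integral>\<^sup>+s. (u s)\<^sup>2 \<partial>lborel) = (\<integral>\<^sup>+s\<in>{a..b}. ennreal (exp ((- 2 * \<mu>) * (s - a))) \<partial>lborel)"
    proof (intro nn_integral_cong)
      fix s
      have "(exp (- \<mu> * (s - a)))\<^sup>2 = exp ((- 2 * \<mu>) * (s - a))" by (simp add: exp_double[symmetric] algebra_simps)
      then show "(u s)\<^sup>2 = ennreal (exp ((- 2 * \<mu>) * (s - a))) * indicator {a..b} s"
        unfolding u_def by (auto simp: ennreal_power indicator_def)
    qed
    also have "\<dots> = ennreal ((exp (- 2 * \<mu> * (b - a)) - 1) / (- 2 * \<mu>))"
      using True \<open>\<mu> > 0\<close> by (intro nn_integral_exp_Icc) auto
    also have "\<dots> \<le> ennreal (1 / (2 * \<mu>))"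
      using \<open>\<mu> > 0\<close> by (intro ennreal_leI) (simp add: divide_simps)
    finally show "(\<integral>\<^sup>+s. (u s)\<^sup>2 \<partial>lborel) \<le> ennreal (1 / (2 * \<mu>))" .
    have "(v s)\<^sup>2 = ennreal (exp (2 * \<mu> * (s - a)) * (norm (f s))\<^sup>2) * indicator {a..b} s" for s
    proof -
      have "(exp (\<mu> * (s - a)))\<^sup>2 = exp (2 * \<mu> * (s - a))" by (simp add: exp_double[symmetric] algebra_simps)
      then show ?thesis unfolding v_def by (auto simp: ennreal_power power_mult_distrib F_def indicator_def)
    qed
    then show "(\<integral>\<^sup>+s. (v s)\<^sup>2 \<partial>lborel) \<le> (\<integral>\<^sup>+s\<in>{a..b}. ennreal (exp (2 * \<mu> * (s - a)) * (norm (f s))\<^sup>2) \<partial>lborel)" by simp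
  qed auto
  finally show ?thesis by (simp add: ennreal_power)
next
  \<comment> \<open>Without integrability the Bochner integral is 0 by convention; for
    \<open>a > b\<close> the interval is empty.\<close>
  case False
  then have "(LINT s:{a..b}|lborel. f s) = 0"
    by (auto simp: set_lebesgue_integral_def set_integrable_def not_integrable_integral_eq)
  then show ?thesis by simp
qed

text \<open>
  Integrating the inequality over t against the weight 4 mu exp (4 mu t) and adding it at t = 0
  produces the weight exp (4 mu s) on the left-hand side, since 1 + int_0^s 4 mu exp (4 mu t) dt = exp (4 mu s).
\<close>

lemma weighted_estimate:
  fixes a b \<phi> :: "real \<Rightarrow> ennreal"
  assumes T: "T > 0" and \<mu>: "\<mu> > 0"
  defines "R \<equiv> restrict_space lborel {0..T}"
  assumes [measurable]: "a \<in> borel_measurable R" "b \<in> borel_measurable R" "\<phi> \<in> borel_measurable R"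
    and ineq: "\<And>t. 0 \<le> t \<Longrightarrow> t \<le> T \<Longrightarrow> a t + (\<integral>\<^sup>+s. indicator {t..} s * b s \<partial>R)
      \<le> ennreal (1 / (2 * \<mu>)) * (\<integral>\<^sup>+s. indicator {t..} s * (ennreal (exp (2 * \<mu> * (s - t))) * \<phi> s) \<partial>R)"
  shows "ennreal (4 * \<mu>) * (\<integral>\<^sup>+t. ennreal (exp (4 * \<mu> * t)) * a t \<partial>R) + (\<integral>\<^sup>+s. ennreal (exp (4 * \<mu> * s)) * b s \<partial>R)
    \<le> ennreal (1 / \<mu>) * (\<integral>\<^sup>+s. ennreal (exp (4 * \<mu> * s)) * \<phi> s \<partial>R)"
proof -
  interpret R: finite_measure R
    unfolding R_def using T by (intro finite_measureI) (simp add: emeasure_restrict_space space_restrict_space)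
  interpret RR: pair_sigma_finite R R ..
  have [measurable]: "(\<lambda>x. x) \<in> R \<rightarrow>\<^sub>M (borel :: real measure)"
    unfolding R_def by (rule measurable_restrict_space1) simp
  have spR: "space R = {0..T}" by (simp add: R_def space_restrict_space)
  define I where "I t s = (indicator {t..} s :: ennreal)" for t s :: real
  have Im[measurable]: "(\<lambda>x. I (fst x) (snd x)) \<in> borel_measurable (R \<Otimes>\<^sub>M R)"
  proof -
    have [measurable]: "fst \<in> R \<Otimes>\<^sub>M R \<rightarrow>\<^sub>M (borel :: real measure)" "snd \<in> R \<Otimes>\<^sub>M R \<rightarrow>\<^sub>M (borel :: real measure)"
      by (rule measurable_compose[OF measurable_fst]; measurable) (rule measurable_compose[OF measurable_snd]; measurable)
    have "(\<lambda>x. if fst x \<le> snd x then 1 else 0 :: ennreal) \<in> borel_measurable (R \<Otimes>\<^sub>M R)" by measurable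
    then show ?thesis by (simp add: I_def indicator_def)
  qed
  define c where "c t = ennreal (4 * \<mu> * exp (4 * \<mu> * t))" for t
  have c[measurable]: "c \<in> borel_measurable R" unfolding c_def[abs_def] by measurable
  have expint: "(\<integral>\<^sup>+t. I t s * ennreal (k * exp (k * t)) \<partial>R) = ennreal (exp (k * s) - 1)" if "s \<in> {0..T}" "k > 0" for s k
  proof -
    have "(\<integral>\<^sup>+t. I t s * ennreal (k * exp (k * t)) \<partial>R) = (\<integral>\<^sup>+t. ennreal k * (ennreal (exp (k * (t - 0))) * indicator {0..s} t) \<partial>lborel)"
      unfolding R_def using that
      by (subst nn_integral_restrict_space) (auto simp: I_def indicator_def ennreal_mult intro!: nn_integral_cong)
    also have "\<dots> = ennreal k * ennreal ((exp (k * (s - 0)) - 1) / k)"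
      using that nn_integral_exp_Icc[of k 0 s] by (subst nn_integral_cmult) auto
    also have "\<dots> = ennreal (exp (k * s) - 1)" using that by (simp add: ennreal_mult[symmetric])
    finally show ?thesis .
  qed
  have L: "(\<integral>\<^sup>+t. c t * (\<integral>\<^sup>+s. I t s * b s \<partial>R) \<partial>R) + (\<integral>\<^sup>+s. b s \<partial>R) = (\<integral>\<^sup>+s. ennreal (exp (4 * \<mu> * s)) * b s \<partial>R)"
  proof -
    have m: "(\<lambda>(t, s). c t * (I t s * b s)) \<in> borel_measurable (R \<Otimes>\<^sub>M R)"
      unfolding case_prod_unfold by (intro borel_measurable_times_ennreal Im) measurable
    have "(\<integral>\<^sup>+t. c t * (\<integral>\<^sup>+s. I t s * b s \<partial>R) \<partial>R) = (\<integral>\<^sup>+t. \<integral>\<^sup>+s. c t * (I t s * b s) \<partial>R \<partial>R)"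
      by (intro nn_integral_cong nn_integral_cmult[symmetric]) (auto simp: I_def)
    also have "\<dots> = (\<integral>\<^sup>+s. \<integral>\<^sup>+t. c t * (I t s * b s) \<partial>R \<partial>R)"
      using RR.Fubini[of "\<lambda>(t, s). c t * (I t s * b s)"] m by simp
    also have "\<dots> = (\<integral>\<^sup>+s. ennreal (exp (4 * \<mu> * s) - 1) * b s \<partial>R)"
    proof (intro nn_integral_cong)
      fix s assume "s \<in> space R"
      then have s: "s \<in> {0..T}" by (simp add: spR)
      have [measurable]: "(\<lambda>t. I t s) \<in> borel_measurable R" unfolding I_def by (simp add: indicator_def)
      have "(\<integral>\<^sup>+t. c t * (I t s * b s) \<partial>R) = (\<integral>\<^sup>+t. (I t s * c t) * b s \<partial>R)" by (simp add: ac_simps)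
      also have "\<dots> = (\<integral>\<^sup>+t. I t s * c t \<partial>R) * b s" by (rule nn_integral_multc) measurable
      also have "(\<integral>\<^sup>+t. I t s * c t \<partial>R) = ennreal (exp (4 * \<mu> * s) - 1)"
        unfolding c_def using expint[OF s, of "4 * \<mu>"] \<mu> by simp
      finally show "(\<integral>\<^sup>+t. c t * (I t s * b s) \<partial>R) = ennreal (exp (4 * \<mu> * s) - 1) * b s" .
    qed
    finally have "(\<integral>\<^sup>+t. c t * (\<integral>\<^sup>+s. I t s * b s \<partial>R) \<partial>R) + (\<integral>\<^sup>+s. b s \<partial>R) = (\<integral>\<^sup>+s. ennreal (exp (4 * \<mu> * s) - 1) * b s + b s \<partial>R)"
      by (simp add: nn_integral_add)
    also have "\<dots> = (\<integral>\<^sup>+s. ennreal (exp (4 * \<mu> * s)) * b s \<partial>R)"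
    proof (intro nn_integral_cong)
      fix s assume "s \<in> space R"
      then have "1 \<le> exp (4 * \<mu> * s)" using \<mu> by (simp add: spR)
      then have "ennreal (exp (4 * \<mu> * s)) = ennreal (exp (4 * \<mu> * s) - 1) + ennreal 1"
        by (subst ennreal_plus[symmetric]) auto
      then show "ennreal (exp (4 * \<mu> * s) - 1) * b s + b s = ennreal (exp (4 * \<mu> * s)) * b s"
        by (simp add: distrib_right)
    qed
    finally show ?thesis .
  qed
  define E where "E t s = ennreal (exp (2 * \<mu> * (s - t))) * \<phi> s" for t s
  have Em: "(\<lambda>x. E (fst x) (snd x)) \<in> borel_measurable (R \<Otimes>\<^sub>M R)" unfolding E_def by measurable
  \<comment> \<open>After Fubini, \<open>c t\<close> times the exponential in \<open>E t s\<close>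
    is \<open>4 * \<mu> * exp (2 * \<mu> * t) * exp (2 * \<mu> * s)\<close>. Integration over
    \<open>t\<close> in [0,s] gives
    \<open>2 * (exp (2 * \<mu> * s) - 1) * exp (2 * \<mu> * s)\<close>; with the term from time 0
    added, this stays below \<open>2 * exp (4 * \<mu> * s)\<close>.\<close>
  have U: "(\<integral>\<^sup>+t. c t * (\<integral>\<^sup>+s. I t s * E t s \<partial>R) \<partial>R) + (\<integral>\<^sup>+s. E 0 s \<partial>R) \<le> 2 * (\<integral>\<^sup>+s. ennreal (exp (4 * \<mu> * s)) * \<phi> s \<partial>R)"
  proof -
    have m: "(\<lambda>(t, s). c t * (I t s * E t s)) \<in> borel_measurable (R \<Otimes>\<^sub>M R)"
      unfolding case_prod_unfold by (intro borel_measurable_times_ennreal Im Em) measurable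
    have E0[measurable]: "E t \<in> borel_measurable R" for t unfolding E_def[abs_def] by measurable
    have "(\<integral>\<^sup>+t. c t * (\<integral>\<^sup>+s. I t s * E t s \<partial>R) \<partial>R) = (\<integral>\<^sup>+t. \<integral>\<^sup>+s. c t * (I t s * E t s) \<partial>R \<partial>R)"
      by (intro nn_integral_cong nn_integral_cmult[symmetric]) (auto simp: I_def)
    also have "\<dots> = (\<integral>\<^sup>+s. \<integral>\<^sup>+t. c t * (I t s * E t s) \<partial>R \<partial>R)"
      using RR.Fubini[of "\<lambda>(t, s). c t * (I t s * E t s)"] m by simp
    also have "\<dots> = (\<integral>\<^sup>+s. (2 * ennreal (exp (2 * \<mu> * s) - 1)) * E 0 s \<partial>R)"
    proof (intro nn_integral_cong)
      fix s assume "s \<in> space R"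
      then have s: "s \<in> {0..T}" by (simp add: spR)
      have [measurable]: "(\<lambda>t. I t s) \<in> borel_measurable R" unfolding I_def by (simp add: indicator_def)
      have "c t * (I t s * E t s) = (I t s * ennreal (2 * \<mu> * exp (2 * \<mu> * t))) * (2 * E 0 s)" for t
      proof -
        have "c t * ennreal (exp (2 * \<mu> * (s - t))) = ennreal (4 * \<mu> * exp (4 * \<mu> * t) * exp (2 * \<mu> * (s - t)))"
          unfolding c_def using \<mu> by (subst ennreal_mult) auto
        also have "4 * \<mu> * exp (4 * \<mu> * t) * exp (2 * \<mu> * (s - t)) = (2 * \<mu> * exp (2 * \<mu> * t)) * (2 * exp (2 * \<mu> * s))"
        proof -
          have "exp (4 * \<mu> * t) * exp (2 * \<mu> * (s - t)) = exp (2 * \<mu> * t) * exp (2 * \<mu> * s)"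
            unfolding exp_add[symmetric] by (simp add: algebra_simps)
          then show ?thesis by simp
        qed
        also have "ennreal \<dots> = ennreal (2 * \<mu> * exp (2 * \<mu> * t)) * (2 * ennreal (exp (2 * \<mu> * s)))"
          using \<mu> by (subst ennreal_mult) (auto simp: ennreal_mult)
        finally have e: "c t * ennreal (exp (2 * \<mu> * (s - t))) = ennreal (2 * \<mu> * exp (2 * \<mu> * t)) * (2 * ennreal (exp (2 * \<mu> * s)))" .
        have "c t * (I t s * E t s) = (c t * ennreal (exp (2 * \<mu> * (s - t)))) * (I t s * \<phi> s)"
          unfolding E_def by (simp only: ac_simps)
        then show ?thesis unfolding e E_def by (simp add: ac_simps)
      qed
      then have "(\<integral>\<^sup>+t. c t * (I t s * E t s) \<partial>R) = (\<integral>\<^sup>+t. (I t s * ennreal (2 * \<mu> * exp (2 * \<mu> * t))) * (2 * E 0 s) \<partial>R)" by simp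
      also have "\<dots> = (\<integral>\<^sup>+t. I t s * ennreal (2 * \<mu> * exp (2 * \<mu> * t)) \<partial>R) * (2 * E 0 s)" by (rule nn_integral_multc) measurable
      also have "(\<integral>\<^sup>+t. I t s * ennreal (2 * \<mu> * exp (2 * \<mu> * t)) \<partial>R) = ennreal (exp (2 * \<mu> * s) - 1)"
        using expint[OF s, of "2 * \<mu>"] \<mu> by simp
      finally show "(\<integral>\<^sup>+t. c t * (I t s * E t s) \<partial>R) = (2 * ennreal (exp (2 * \<mu> * s) - 1)) * E 0 s" by (simp add: ac_simps)
    qed
    finally have "(\<integral>\<^sup>+t. c t * (\<integral>\<^sup>+s. I t s * E t s \<partial>R) \<partial>R) + (\<integral>\<^sup>+s. E 0 s \<partial>R) =
      (\<integral>\<^sup>+s. (2 * ennreal (exp (2 * \<mu> * s) - 1)) * E 0 s + E 0 s \<partial>R)"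
      by (simp add: nn_integral_add)
    also have "\<dots> \<le> (\<integral>\<^sup>+s. 2 * (ennreal (exp (4 * \<mu> * s)) * \<phi> s) \<partial>R)"
    proof (intro nn_integral_mono)
      fix s assume "s \<in> space R"
      then have e1: "1 \<le> exp (2 * \<mu> * s)" using \<mu> by (simp add: spR)
      have "(2 * ennreal (exp (2 * \<mu> * s) - 1)) * E 0 s + E 0 s = (2 * ennreal (exp (2 * \<mu> * s) - 1) + 1) * E 0 s"
        by (simp add: distrib_right)
      also have "2 * ennreal (exp (2 * \<mu> * s) - 1) + 1 \<le> 2 * ennreal (exp (2 * \<mu> * s))"
      proof -
        have "ennreal (exp (2 * \<mu> * s)) = ennreal (exp (2 * \<mu> * s) - 1) + ennreal 1"
          using e1 by (subst ennreal_plus[symmetric]) auto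
        then have "2 * ennreal (exp (2 * \<mu> * s)) = 2 * ennreal (exp (2 * \<mu> * s) - 1) + 2" by (simp add: distrib_left)
        moreover have "(1::ennreal) \<le> 2" by simp
        ultimately show ?thesis by (simp add: add_left_mono)
      qed
      also have "2 * ennreal (exp (2 * \<mu> * s)) * E 0 s = 2 * (ennreal (exp (2 * \<mu> * s)) * ennreal (exp (2 * \<mu> * s)) * \<phi> s)"
        unfolding E_def by (simp add: ac_simps)
      also have "ennreal (exp (2 * \<mu> * s)) * ennreal (exp (2 * \<mu> * s)) = ennreal (exp (4 * \<mu> * s))"
        by (subst ennreal_mult[symmetric]) (auto simp: exp_add[symmetric])
      finally show "(2 * ennreal (exp (2 * \<mu> * s) - 1)) * E 0 s + E 0 s \<le> 2 * (ennreal (exp (4 * \<mu> * s)) * \<phi> s)"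
        by (simp add: mult_right_mono)
    qed
    also have "\<dots> = 2 * (\<integral>\<^sup>+s. ennreal (exp (4 * \<mu> * s)) * \<phi> s \<partial>R)" by (rule nn_integral_cmult) measurable
    finally show ?thesis .
  qed
  have Ib: "(\<lambda>t. \<integral>\<^sup>+s. I t s * b s \<partial>R) \<in> borel_measurable R"
    using R.borel_measurable_nn_integral_fst[of "\<lambda>x. I (fst x) (snd x) * b (snd x)" R] Im by simp
  have IE: "(\<lambda>t. \<integral>\<^sup>+s. I t s * E t s \<partial>R) \<in> borel_measurable R"
    using R.borel_measurable_nn_integral_fst[of "\<lambda>x. I (fst x) (snd x) * E (fst x) (snd x)" R] Im Em by simp
  have ineq': "a t + (\<integral>\<^sup>+s. I t s * b s \<partial>R) \<le> ennreal (1 / (2 * \<mu>)) * (\<integral>\<^sup>+s. I t s * E t s \<partial>R)" if "t \<in> {0..T}" for t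
    using ineq[of t] that unfolding I_def E_def by simp
  have zero: "(\<integral>\<^sup>+s. I 0 s * h s \<partial>R) = (\<integral>\<^sup>+s. h s \<partial>R)" for h
    by (intro nn_integral_cong) (simp add: I_def spR)
  have "ennreal (4 * \<mu>) * (\<integral>\<^sup>+t. ennreal (exp (4 * \<mu> * t)) * a t \<partial>R) + (\<integral>\<^sup>+s. ennreal (exp (4 * \<mu> * s)) * b s \<partial>R)
    = (\<integral>\<^sup>+t. c t * a t \<partial>R) + ((\<integral>\<^sup>+t. c t * (\<integral>\<^sup>+s. I t s * b s \<partial>R) \<partial>R) + (\<integral>\<^sup>+s. b s \<partial>R))"
  proof -
    have "ennreal (4 * \<mu>) * (\<integral>\<^sup>+t. ennreal (exp (4 * \<mu> * t)) * a t \<partial>R) = (\<integral>\<^sup>+t. ennreal (4 * \<mu>) * (ennreal (exp (4 * \<mu> * t)) * a t) \<partial>R)"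
      by (rule nn_integral_cmult[symmetric]) measurable
    also have "\<dots> = (\<integral>\<^sup>+t. c t * a t \<partial>R)"
      unfolding c_def using \<mu> by (simp add: ennreal_mult mult.assoc)
    finally show ?thesis by (simp only: L)
  qed
  also have "\<dots> = (\<integral>\<^sup>+t. c t * (a t + (\<integral>\<^sup>+s. I t s * b s \<partial>R)) \<partial>R) + (\<integral>\<^sup>+s. b s \<partial>R)"
    using Ib by (simp add: distrib_left nn_integral_add add.assoc)
  also have "\<dots> \<le> (\<integral>\<^sup>+t. c t * (ennreal (1 / (2 * \<mu>)) * (\<integral>\<^sup>+s. I t s * E t s \<partial>R)) \<partial>R) + ennreal (1 / (2 * \<mu>)) * (\<integral>\<^sup>+s. E 0 s \<partial>R)"
  proof (intro add_mono nn_integral_mono mult_left_mono)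
    show "a t + (\<integral>\<^sup>+s. I t s * b s \<partial>R) \<le> ennreal (1 / (2 * \<mu>)) * (\<integral>\<^sup>+s. I t s * E t s \<partial>R)" if "t \<in> space R" for t
      using that by (intro ineq') (simp add: spR)
    \<comment> \<open>The inequality at time 0, with the nonnegative \<open>a 0\<close>
      dropped.\<close>
    have "(\<integral>\<^sup>+s. b s \<partial>R) \<le> a 0 + (\<integral>\<^sup>+s. I 0 s * b s \<partial>R)" unfolding zero by (rule add_increasing) auto
    also have "\<dots> \<le> ennreal (1 / (2 * \<mu>)) * (\<integral>\<^sup>+s. I 0 s * E 0 s \<partial>R)" using T by (intro ineq') auto
    finally show "(\<integral>\<^sup>+s. b s \<partial>R) \<le> ennreal (1 / (2 * \<mu>)) * (\<integral>\<^sup>+s. E 0 s \<partial>R)" unfolding zero .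
  qed simp
  also have "\<dots> = ennreal (1 / (2 * \<mu>)) * ((\<integral>\<^sup>+t. c t * (\<integral>\<^sup>+s. I t s * E t s \<partial>R) \<partial>R) + (\<integral>\<^sup>+s. E 0 s \<partial>R))"
    using IE by (simp add: nn_integral_cmult[symmetric] distrib_left mult.left_commute)
  also have "\<dots> \<le> ennreal (1 / (2 * \<mu>)) * (2 * (\<integral>\<^sup>+s. ennreal (exp (4 * \<mu> * s)) * \<phi> s \<partial>R))"
    by (intro mult_left_mono U) simp
  also have "\<dots> = ennreal (1 / \<mu>) * (\<integral>\<^sup>+s. ennreal (exp (4 * \<mu> * s)) * \<phi> s \<partial>R)"
  proof -
    have "ennreal (1 / (2 * \<mu>)) * 2 = ennreal (1 / \<mu>)"
      using \<mu> ennreal_mult[of "1 / (2 * \<mu>)" 2] by simp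
    then show ?thesis by (simp only: mult.assoc[symmetric])
  qed
  finally show ?thesis .
qed

section \<open>Time integrals and the equation with prescribed drift\<close>

context wiener_pair
begin

lemma proc_time_section:
  assumes u: "joint u" and w: "\<omega> \<in> space M"
  shows "(\<lambda>s. u s \<omega>) \<in> borel_measurable Tm"
proof -
  have "(\<lambda>s. (s, \<omega>)) \<in> Tm \<rightarrow>\<^sub>M proc_space T M"
    unfolding proc_space_def using w by (rule measurable_Pair2')
  from measurable_compose[OF this u] show ?thesis by simp
qed

lemma proc_set_measurable:
  fixes u :: "real \<Rightarrow> 'w \<Rightarrow> 'b::euclidean_space"
  assumes u: "joint u" and w: "\<omega> \<in> space M" and ab: "0 \<le> a" "b \<le> T"
  shows "set_borel_measurable lborel {a..b} (\<lambda>s. u s \<omega>)"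
proof -
  have "(\<lambda>s. indicator {0..T} s *\<^sub>R u s \<omega>) \<in> borel_measurable lborel"
    using proc_time_section[OF u w] by (subst (asm) borel_measurable_restrict_space_iff) auto
  then have [measurable]: "(\<lambda>s. indicator {0..T} s *\<^sub>R u s \<omega>) \<in> borel_measurable borel" by simp
  have "(\<lambda>s. indicator {a..b} s *\<^sub>R (indicator {0..T} s *\<^sub>R u s \<omega>)) \<in> borel_measurable lborel" by measurable
  also have "(\<lambda>s. indicator {a..b} s *\<^sub>R (indicator {0..T} s *\<^sub>R u s \<omega>)) = (\<lambda>s. indicator {a..b} s *\<^sub>R u s \<omega>)"
    using ab by (auto simp: indicator_def fun_eq_iff)
  finally show ?thesis by (simp add: set_borel_measurable_def)
qed

lemma proc_norm_AE_finite:
  fixes u :: "real \<Rightarrow> 'w \<Rightarrow> 'b::euclidean_space"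
  assumes u: "joint u" and f: "proc_norm M 0 T u < \<infinity>"
  shows "AE \<omega> in M. (\<integral>\<^sup>+s\<in>{0..T}. ennreal ((norm (u s \<omega>))\<^sup>2) \<partial>lborel) < \<infinity> \<and> set_integrable lborel {0..T} (\<lambda>s. u s \<omega>)"
proof -
  interpret R: finite_measure Tm by (rule finite_lborel_restrict)
  interpret P: pair_sigma_finite Tm M ..
  have "(\<lambda>x. ennreal ((norm ((\<lambda>(s, \<omega>). u s \<omega>) x))\<^sup>2)) \<in> borel_measurable (Tm \<Otimes>\<^sub>M M)"
    using u unfolding proc_space_def by measurable
  from measurable_compose[OF measurable_pair_swap' this]
  have sw: "(\<lambda>x. ennreal ((norm (u (snd x) (fst x)))\<^sup>2)) \<in> borel_measurable (M \<Otimes>\<^sub>M Tm)"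
    by (simp add: case_prod_unfold)
  have e: "(\<integral>\<^sup>+s\<in>{0..T}. ennreal ((norm (u s \<omega>))\<^sup>2) \<partial>lborel) = (\<integral>\<^sup>+s. ennreal ((norm (u s \<omega>))\<^sup>2) \<partial>Tm)" for \<omega>
    by (simp add: nn_integral_restrict_space)
  have m: "(\<lambda>\<omega>. \<integral>\<^sup>+s\<in>{0..T}. ennreal ((norm (u s \<omega>))\<^sup>2) \<partial>lborel) \<in> borel_measurable M"
    unfolding e using R.borel_measurable_nn_integral_fst[OF sw] by simp
  have "AE \<omega> in M. (\<integral>\<^sup>+s\<in>{0..T}. ennreal ((norm (u s \<omega>))\<^sup>2) \<partial>lborel) \<noteq> \<infinity>"
    using f m unfolding proc_norm_def by (intro nn_integral_noteq_infinite) auto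
  then show ?thesis using AE_space
  proof eventually_elim
    case (elim \<omega>)
    then have "sq_int Tm (\<lambda>s. u s \<omega>)"
      using proc_time_section[OF u elim(2)] unfolding sq_int_def nn2_def e[symmetric] by (auto simp: less_top)
    from R.sq_int_integrable[OF this] have "set_integrable lborel {0..T} (\<lambda>s. u s \<omega>)"
      unfolding set_integrable_def by (subst (asm) integrable_restrict_space) auto
    then show ?case using elim by (auto simp: less_top)
  qed
qed

lemma set_integrable_subinterval:
  fixes f :: "real \<Rightarrow> 'b::euclidean_space"
  shows "set_integrable lborel {0..T} f \<Longrightarrow> 0 \<le> a \<Longrightarrow> b \<le> T \<Longrightarrow> set_integrable lborel {a..b} f"
  by (rule set_integrable_subset) auto

text \<open>Adaptedness comes from Fubini over [0,t] for a progressive integrand; the weighted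
  Cauchy-Schwarz bound, with parameter 1, controls all times at once.\<close>

lemma integral_process:
  fixes f :: "real \<Rightarrow> 'w \<Rightarrow> real^'n"
  assumes f: "f \<in> L2_proc M Fl T"
  obtains A where "A \<in> S2_proc M Fl T" "AE \<omega> in M. \<forall>t\<in>{0..T}. A t \<omega> = (LINT s:{0..t}|lborel. f s \<omega>)"
proof -
  have fp: "progressive Fl T f" and ff: "proc_norm M 0 T f < \<infinity>" using f by (auto simp: L2_proc_iff)
  note fj = progressive_joint[OF fp]
  define V where "V \<omega> = (\<integral>\<^sup>+s\<in>{0..T}. ennreal ((norm (f s \<omega>))\<^sup>2) \<partial>lborel)" for \<omega>
  from proc_norm_AE_finite[OF fj ff] obtain N where N: "N \<in> null_sets M"
    "{\<omega>\<in>space M. \<not> (V \<omega> < \<infinity> \<and> set_integrable lborel {0..T} (\<lambda>s. f s \<omega>))} \<subseteq> N"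
    unfolding eventually_ae_filter V_def by auto
  have good: "set_integrable lborel {0..T} (\<lambda>s. f s \<omega>)" if "\<omega> \<in> space M" "\<omega> \<notin> N" for \<omega>
    using N(2) that by auto
  \<comment> \<open>The value 0 on \<open>N\<close>, where a path of \<open>f\<close> may fail to be
    integrable, makes every path continuous; \<open>N\<close> belongs to each
    \<open>Fl t\<close>.\<close>
  define A where "A t \<omega> = (if \<omega> \<in> N then 0 else LINT s:{0..t}|lborel. f s \<omega>)" for t \<omega>
  have adapted: "A t \<in> borel_measurable (Fl t)" if t: "t \<in> {0..T}" for t
  proof -
    interpret Rt: finite_measure "restrict_space lborel {0..t}"
      using t by (intro finite_measureI) (simp add: emeasure_restrict_space space_restrict_space)
    have "(\<lambda>(s, \<omega>). f s \<omega>) \<in> borel_measurable (restrict_space borel {0..t} \<Otimes>\<^sub>M Fl t)"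
      using progressive_measurable[OF fp] t by simp
    moreover have "sets (restrict_space borel {0..t} \<Otimes>\<^sub>M Fl t) = sets (restrict_space lborel {0..t} \<Otimes>\<^sub>M Fl t)"
      by (intro sets_pair_measure_cong sets_restrict_space_cong) auto
    ultimately have "(\<lambda>(s, \<omega>). f s \<omega>) \<in> borel_measurable (restrict_space lborel {0..t} \<Otimes>\<^sub>M Fl t)"
      by (simp cong: measurable_cong_sets)
    from measurable_compose[OF measurable_pair_swap' this]
    have sw: "(\<lambda>(\<omega>, s). f s \<omega>) \<in> borel_measurable (Fl t \<Otimes>\<^sub>M restrict_space lborel {0..t})"
      by (simp add: case_prod_unfold)
    have [measurable]: "(\<lambda>\<omega>. LINT s:{0..t}|lborel. f s \<omega>) \<in> borel_measurable (Fl t)"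
      using Rt.borel_measurable_lebesgue_integral[OF sw]
      by (simp add: set_lebesgue_integral_def integral_restrict_space)
    have [measurable]: "N \<in> sets (Fl t)" using N(1) by (rule null_sets_aug_filt)
    show ?thesis unfolding A_def by measurable
  qed
  have cont: "continuous_on {0..T} (\<lambda>t. A t \<omega>)" if w: "\<omega> \<in> space M" for \<omega>
  proof (cases "\<omega> \<in> N")
    case False
    note i = good[OF w False]
    have "continuous_on {0..T} (\<lambda>t. integral {0..t} (\<lambda>s. f s \<omega>))"
      using set_borel_integral_eq_integral(1)[OF i] by (rule indefinite_integral_continuous_1)
    moreover have "A t \<omega> = integral {0..t} (\<lambda>s. f s \<omega>)" if "t \<in> {0..T}" for t
      using set_borel_integral_eq_integral(2)[OF set_integrable_subinterval[OF i]] that False by (simp add: A_def)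
    ultimately show ?thesis
      using continuous_on_eq[of "{0..T}" "\<lambda>t. integral {0..t} (\<lambda>s. f s \<omega>)" "\<lambda>t. A t \<omega>"] by simp
  qed (simp add: A_def)
  have AEN: "AE \<omega> in M. \<omega> \<notin> N" using N(1) by (rule AE_not_in)
  have "(\<integral>\<^sup>+\<omega>. (SUP t\<in>{0..T}. ennreal ((norm (A t \<omega>))\<^sup>2)) \<partial>M) \<le> (\<integral>\<^sup>+\<omega>. ennreal (exp (2 * T)) * V \<omega> \<partial>M)"
  proof (intro nn_integral_mono SUP_least)
    fix \<omega> t assume w: "\<omega> \<in> space M" and t: "t \<in> {0..T}"
    have "ennreal ((norm (A t \<omega>))\<^sup>2) \<le> ennreal ((norm (LINT s:{0..t}|lborel. f s \<omega>))\<^sup>2)" by (simp add: A_def)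
    also have "\<dots> \<le> ennreal (1 / (2 * 1)) * (\<integral>\<^sup>+s\<in>{0..t}. ennreal (exp (2 * 1 * (s - 0)) * (norm (f s \<omega>))\<^sup>2) \<partial>lborel)"
      using proc_set_measurable[OF fj w] t by (intro norm_integral_weighted) auto
    also have "\<dots> \<le> 1 * (\<integral>\<^sup>+s\<in>{0..T}. ennreal (exp (2 * T)) * ennreal ((norm (f s \<omega>))\<^sup>2) \<partial>lborel)"
    proof (rule mult_mono)
      show "ennreal (1 / (2 * 1)) \<le> 1" by (subst ennreal_1[symmetric], rule ennreal_leI) simp
      show "(\<integral>\<^sup>+s\<in>{0..t}. ennreal (exp (2 * 1 * (s - 0)) * (norm (f s \<omega>))\<^sup>2) \<partial>lborel)
        \<le> (\<integral>\<^sup>+s\<in>{0..T}. ennreal (exp (2 * T)) * ennreal ((norm (f s \<omega>))\<^sup>2) \<partial>lborel)"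
      proof (rule nn_integral_mono)
        fix s
        show "ennreal (exp (2 * 1 * (s - 0)) * (norm (f s \<omega>))\<^sup>2) * indicator {0..t} s
          \<le> ennreal (exp (2 * T)) * ennreal ((norm (f s \<omega>))\<^sup>2) * indicator {0..T} s"
        proof (cases "s \<in> {0..t}")
          case True
          then have "exp (2 * s) * (norm (f s \<omega>))\<^sup>2 \<le> exp (2 * T) * (norm (f s \<omega>))\<^sup>2"
            using t by (intro mult_right_mono) auto
          then show ?thesis using True t by (simp add: ennreal_mult[symmetric] ennreal_leI)
        qed simp
      qed
    qed auto
    also have "\<dots> = ennreal (exp (2 * T)) * V \<omega>"
    proof -
      have "(\<lambda>s. indicator {0..T} s *\<^sub>R f s \<omega>) \<in> borel_measurable lborel"
        using proc_set_measurable[OF fj w, of 0 T] by (simp add: set_borel_measurable_def)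
      then have "(\<lambda>s. ennreal ((norm (indicator {0..T} s *\<^sub>R f s \<omega>))\<^sup>2)) \<in> borel_measurable lborel" by measurable
      also have "(\<lambda>s. ennreal ((norm (indicator {0..T} s *\<^sub>R f s \<omega>))\<^sup>2)) = (\<lambda>s. ennreal ((norm (f s \<omega>))\<^sup>2) * indicator {0..T} s)"
        by (auto simp: indicator_def fun_eq_iff)
      finally show ?thesis unfolding V_def by (simp add: mult.assoc nn_integral_cmult)
    qed
    finally show "ennreal ((norm (A t \<omega>))\<^sup>2) \<le> ennreal (exp (2 * T)) * V \<omega>" .
  qed
  also have "\<dots> \<le> ennreal (exp (2 * T)) * proc_norm M 0 T f"
  proof -
    have "(\<integral>\<^sup>+\<omega>. ennreal (exp (2 * T)) * V \<omega> \<partial>M) = nn2 (proc_space T M) (\<lambda>(s, \<omega>). exp T *\<^sub>R f s \<omega>)"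
    proof -
      have m: "joint (\<lambda>s \<omega>. exp T *\<^sub>R f s \<omega>)"
        using borel_measurable_scaleR[OF borel_measurable_const fj, of "exp T"] by (simp add: case_prod_unfold)
      show ?thesis
        unfolding nn2_proc_space[OF m] proc_norm_def V_def
      proof (intro nn_integral_cong)
        fix \<omega> assume w: "\<omega> \<in> space M"
        have "(\<lambda>s. indicator {0..T} s *\<^sub>R f s \<omega>) \<in> borel_measurable lborel"
          using proc_set_measurable[OF fj w, of 0 T] by (simp add: set_borel_measurable_def)
        then have "(\<lambda>s. ennreal ((norm (indicator {0..T} s *\<^sub>R f s \<omega>))\<^sup>2)) \<in> borel_measurable lborel" by measurable
        also have "(\<lambda>s. ennreal ((norm (indicator {0..T} s *\<^sub>R f s \<omega>))\<^sup>2)) = (\<lambda>s. ennreal ((norm (f s \<omega>))\<^sup>2) * indicator {0..T} s)"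
          by (auto simp: indicator_def fun_eq_iff)
        finally have "ennreal (exp (2 * T)) * (\<integral>\<^sup>+s\<in>{0..T}. ennreal ((norm (f s \<omega>))\<^sup>2) \<partial>lborel)
          = (\<integral>\<^sup>+s. ennreal (exp (2 * T)) * (ennreal ((norm (f s \<omega>))\<^sup>2) * indicator {0..T} s) \<partial>lborel)"
          by (simp add: nn_integral_cmult)
        then show "ennreal (exp (2 * T)) * (\<integral>\<^sup>+s\<in>{0..T}. ennreal ((norm (f s \<omega>))\<^sup>2) \<partial>lborel)
          = (\<integral>\<^sup>+s\<in>{0..T}. ennreal ((norm (exp T *\<^sub>R f s \<omega>))\<^sup>2) \<partial>lborel)"
          by (simp add: power_mult_distrib ennreal_mult exp_double mult.assoc)
      qed
    qed
    also have "\<dots> = ennreal (exp (2 * T)) * nn2 (proc_space T M) (\<lambda>(s, \<omega>). f s \<omega>)"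
      using nn2_scale[OF fj, of "exp T"] by (simp add: case_prod_unfold exp_double)
    finally show ?thesis by (simp add: nn2_proc_space[OF fj])
  qed
  also have "\<dots> < \<infinity>" using ff by (simp add: ennreal_mult_less_top)
  finally have "A \<in> S2_proc M Fl T" using adapted cont by (auto simp: S2_proc_def adapted_def)
  moreover have "AE \<omega> in M. \<forall>t\<in>{0..T}. A t \<omega> = (LINT s:{0..t}|lborel. f s \<omega>)"
    using AEN by eventually_elim (simp add: A_def)
  ultimately show thesis by (rule that)
qed

text \<open>Suprema over [0,T] are bounded by suprema over a dense sequence before the integral is
  split, because additivity of the integral requires measurable functions.\<close>

lemma S2_add:
  fixes X Y :: "real \<Rightarrow> 'w \<Rightarrow> real^'n"
  assumes X: "X \<in> S2_proc M Fl T" and Y: "Y \<in> S2_proc M Fl T"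
  shows "(\<lambda>t \<omega>. X t \<omega> + Y t \<omega>) \<in> S2_proc M Fl T"
  unfolding S2_proc_def
proof (intro CollectI conjI ballI)
  show "adapted Fl T (\<lambda>t \<omega>. X t \<omega> + Y t \<omega>)"
    using S2_proc_at(1)[OF X] S2_proc_at(1)[OF Y] by (auto simp: adapted_def intro: borel_measurable_add)
  show "continuous_on {0..T} (\<lambda>t. X t \<omega> + Y t \<omega>)" if "\<omega> \<in> space M" for \<omega>
    using X Y that by (intro continuous_on_add) (auto simp: S2_proc_def)
  obtain q :: "nat \<Rightarrow> real" where q: "\<And>n. q n \<in> {0..T}" "{0..T} \<subseteq> closure (range q)" using dense_sequence by blast
  let ?S = "\<lambda>X \<omega>. SUP n. ennreal ((norm (X (q n) \<omega>))\<^sup>2)"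
  have Sm: "?S X \<in> borel_measurable M" if "X \<in> S2_proc M Fl T" for X :: "real \<Rightarrow> 'w \<Rightarrow> real^'n"
  proof -
    have [measurable]: "X (q n) \<in> borel_measurable M" for n using S2_proc_at(2)[OF that q(1)] by (simp add: sq_int_def)
    show ?thesis by measurable
  qed
  have le: "ennreal ((norm (X t \<omega>))\<^sup>2) \<le> ?S X \<omega>" if "X \<in> S2_proc M Fl T" "t \<in> {0..T}" "\<omega> \<in> space M" for X :: "real \<Rightarrow> 'w \<Rightarrow> real^'n" and t \<omega>
  proof (rule continuous_le_dense[OF _ q(2) _ _ that(2)])
    show "continuous_on {0..T} (\<lambda>t. (norm (X t \<omega>))\<^sup>2)"
      using that by (intro continuous_intros) (auto simp: S2_proc_def)
    show "ennreal ((norm (X t \<omega>))\<^sup>2) \<le> ?S X \<omega>" if "t \<in> range q" for t using that by (auto intro: SUP_upper2)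
  qed (use q in auto)
  have fin: "(\<integral>\<^sup>+\<omega>. ?S X \<omega> \<partial>M) < \<infinity>" if "X \<in> S2_proc M Fl T" for X :: "real \<Rightarrow> 'w \<Rightarrow> real^'n"
  proof -
    have "(\<integral>\<^sup>+\<omega>. ?S X \<omega> \<partial>M) \<le> (\<integral>\<^sup>+\<omega>. (SUP t\<in>{0..T}. ennreal ((norm (X t \<omega>))\<^sup>2)) \<partial>M)"
      using q(1) by (intro nn_integral_mono SUP_least SUP_upper)
    also have "\<dots> < \<infinity>" using that by (simp add: S2_proc_def)
    finally show ?thesis .
  qed
  have "(\<integral>\<^sup>+\<omega>. (SUP t\<in>{0..T}. ennreal ((norm (X t \<omega> + Y t \<omega>))\<^sup>2)) \<partial>M) \<le> (\<integral>\<^sup>+\<omega>. 2 * ?S X \<omega> + 2 * ?S Y \<omega> \<partial>M)"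
  proof (intro nn_integral_mono SUP_least)
    fix \<omega> t assume w: "\<omega> \<in> space M" and t: "t \<in> {0..T}"
    have "ennreal ((norm (X t \<omega> + Y t \<omega>))\<^sup>2) \<le> ennreal (2 * (norm (X t \<omega>))\<^sup>2 + 2 * (norm (Y t \<omega>))\<^sup>2)"
      using norm_add_power2_le[of 1 "X t \<omega>" "Y t \<omega>"] by (intro ennreal_leI) simp
    also have "\<dots> = 2 * ennreal ((norm (X t \<omega>))\<^sup>2) + 2 * ennreal ((norm (Y t \<omega>))\<^sup>2)" by (simp add: ennreal_mult)
    also have "\<dots> \<le> 2 * ?S X \<omega> + 2 * ?S Y \<omega>" by (intro add_mono mult_left_mono le X Y t w) auto
    finally show "ennreal ((norm (X t \<omega> + Y t \<omega>))\<^sup>2) \<le> 2 * ?S X \<omega> + 2 * ?S Y \<omega>" .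
  qed
  also have "\<dots> = 2 * (\<integral>\<^sup>+\<omega>. ?S X \<omega> \<partial>M) + 2 * (\<integral>\<^sup>+\<omega>. ?S Y \<omega> \<partial>M)"
    using Sm[OF X] Sm[OF Y] by (simp add: nn_integral_add nn_integral_cmult)
  also have "\<dots> < \<infinity>" using fin[OF X] fin[OF Y] by (simp add: ennreal_mult_less_top)
  finally show "(\<integral>\<^sup>+\<omega>. (SUP t\<in>{0..T}. ennreal ((norm (X t \<omega> + Y t \<omega>))\<^sup>2)) \<partial>M) < \<infinity>" .
qed

lemma S2_const: "(\<lambda>t \<omega>. c :: real^'n) \<in> S2_proc M Fl T"
proof -
  have "(\<integral>\<^sup>+\<omega>. (SUP t\<in>{0..T}. ennreal ((norm c)\<^sup>2)) \<partial>M) = ennreal ((norm c)\<^sup>2)"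
    using T_pos by (simp add: emeasure_space_1)
  then show ?thesis by (simp add: S2_proc_def adapted_def)
qed

text \<open>The terminal value is kept out of the notion, so that two solutions can be compared
  through mere agreement at \<open>T\<close>.\<close>

definition frozen :: "(real \<Rightarrow> 'w \<Rightarrow> real^'n) \<Rightarrow> (real \<Rightarrow> 'w \<Rightarrow> real^'n) \<Rightarrow> (real \<Rightarrow> 'w \<Rightarrow> real^'n) \<Rightarrow> (real \<Rightarrow> 'w \<Rightarrow> real^'n) \<Rightarrow> bool" where
  "frozen f P Q1 Q2 \<longleftrightarrow> P \<in> S2_proc M Fl T \<and> Q1 \<in> L2_proc M Fl T \<and> Q2 \<in> L2_proc M Fl T \<and>
     (\<exists>I1 I2. ito_integral M Fl T W1 Q1 I1 \<and> ito_integral M Fl T W2 Q2 I2 \<and>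
       (AE \<omega> in M. set_integrable lborel {0..T} (\<lambda>s. f s \<omega>)) \<and>
       (AE \<omega> in M. \<forall>t\<in>{0..T}. P t \<omega> = P 0 \<omega> + (LINT s:{0..t}|lborel. f s \<omega>) + I1 t \<omega> + I2 t \<omega>))"

text \<open>All approximating elementary integrals vanish at time 0, and so does their square-mean
  limit.\<close>

lemma ito_integral_zero:
  assumes I: "ito_integral M Fl T W H (X :: real \<Rightarrow> 'w \<Rightarrow> real^'n)"
  shows "AE \<omega> in M. X 0 \<omega> = 0"
proof -
  obtain h I where E: "\<And>k::nat. elementary_integral M Fl T W (h k) (I k)"
    and l': "\<forall>t\<in>{0..T}. (\<lambda>k. nn2 M (\<lambda>\<omega>. X t \<omega> - I k t \<omega>)) \<longlonglongrightarrow> 0"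
    using I unfolding ito_integral_iff by blast
  have l: "(\<lambda>k. nn2 M (\<lambda>\<omega>. X 0 \<omega> - I k 0 \<omega>)) \<longlonglongrightarrow> 0" using bspec[OF l', of 0] T_pos by simp
  have I0: "I k 0 \<omega> = 0" for k \<omega>
  proof -
    obtain m \<tau> \<xi> where P: "part T m \<tau>" and e: "I k = el_int W m \<tau> \<xi>"
      by (rule common_partition[OF E[of k] E[of k], of "{}"]) (simp, simp, rule that, assumption+)
    have "\<tau> 0 = 0" using P by (simp add: part_def)
    then show ?thesis using el_int_part[OF P, of 0 W \<xi>] by (simp add: e)
  qed
  have "adapted Fl T X" using I unfolding ito_integral_iff by blast
  moreover have "0 \<in> {0..T}" using T_pos by simp
  ultimately have "X 0 \<in> borel_measurable (Fl 0)" unfolding adapted_def by blast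
  then have m[measurable]: "X 0 \<in> borel_measurable M" by (rule measurable_Fl_M) (rule less_imp_le[OF T_pos])
  have "nn2 M (X 0) = 0" using l by (simp add: I0 LIMSEQ_const_iff)
  then have "AE \<omega> in M. ennreal ((norm (X 0 \<omega>))\<^sup>2) = 0"
    unfolding nn2_def by (subst (asm) nn_integral_0_iff_AE) auto
  then show ?thesis by eventually_elim (simp add: ennreal_eq_0_iff)
qed

text \<open>The drift integral is subtracted from the terminal value before representation and added
  back afterwards: \<open>c + A + X1 + X2\<close> has the required drift and the required end
  value.\<close>

lemma frozen_exists:
  fixes f :: "real \<Rightarrow> 'w \<Rightarrow> real^'n"
  assumes f: "f \<in> L2_proc M Fl T" and z: "\<zeta> \<in> borel_measurable (Fl T)" "sq_int M \<zeta>"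
  shows "\<exists>P Q1 Q2. frozen f P Q1 Q2 \<and> (AE \<omega> in M. P T \<omega> = \<zeta> \<omega>)"
proof -
  have TT: "T \<in> {0..T}" and T0: "0 \<in> {0..T}" using T_pos by auto
  obtain A where A: "A \<in> S2_proc M Fl T" "AE \<omega> in M. \<forall>t\<in>{0..T}. A t \<omega> = (LINT s:{0..t}|lborel. f s \<omega>)"
    by (rule integral_process[OF f])
  have "(\<lambda>\<omega>. \<zeta> \<omega> - A T \<omega>) \<in> borel_measurable (Fl T)" "sq_int M (\<lambda>\<omega>. \<zeta> \<omega> - A T \<omega>)"
    using z S2_proc_at[OF A(1) TT] by (auto intro: sq_int_diff borel_measurable_diff)
  from martingale_representation[OF this] obtain c Q1 Q2 X1 X2 where
    Q: "Q1 \<in> L2_proc M Fl T" "Q2 \<in> L2_proc M Fl T" and X: "X1 \<in> S2_proc M Fl T" "X2 \<in> S2_proc M Fl T"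
    and I: "ito_integral M Fl T W1 Q1 X1" "ito_integral M Fl T W2 Q2 X2"
    and eq: "AE \<omega> in M. \<zeta> \<omega> - A T \<omega> = c + X1 T \<omega> + X2 T \<omega>" by blast
  define P where "P t \<omega> = (c + A t \<omega>) + (X1 t \<omega> + X2 t \<omega>)" for t \<omega>
  have P: "P \<in> S2_proc M Fl T"
    unfolding P_def[abs_def] by (rule S2_add[OF S2_add[OF S2_const A(1)] S2_add[OF X]])
  have fp: "progressive Fl T f" "proc_norm M 0 T f < \<infinity>" using f by (auto simp: L2_proc_iff)
  from proc_norm_AE_finite[OF progressive_joint[OF fp(1)] fp(2)]
  have "AE \<omega> in M. set_integrable lborel {0..T} (\<lambda>s. f s \<omega>)" by eventually_elim simp
  moreover have "AE \<omega> in M. \<forall>t\<in>{0..T}. P t \<omega> = P 0 \<omega> + (LINT s:{0..t}|lborel. f s \<omega>) + X1 t \<omega> + X2 t \<omega>"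
    using A(2) ito_integral_zero[OF I(1)] ito_integral_zero[OF I(2)]
  proof eventually_elim
    case (elim \<omega>)
    have "AE s in lborel. indicator {0} s *\<^sub>R f s \<omega> = 0"
      using AE_lborel_singleton[of "0::real"] by eventually_elim simp
    then have "(LINT s:{0..0}|lborel. f s \<omega>) = 0"
      unfolding set_lebesgue_integral_def by (intro integral_eq_zero_AE) simp
    then have "A 0 \<omega> = 0" using elim(1) T0 by simp
    then show ?case using elim by (simp add: P_def)
  qed
  ultimately have "frozen f P Q1 Q2" unfolding frozen_def using P Q I by blast
  moreover have "AE \<omega> in M. P T \<omega> = \<zeta> \<omega>"
    using eq by eventually_elim (simp add: P_def algebra_simps)
  ultimately show ?thesis by blast
qed

end

lemma nn2_tendsto_add:
  fixes f g :: "nat \<Rightarrow> 'a \<Rightarrow> 'b::{real_normed_vector, second_countable_topology}"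
  assumes m: "\<And>k. f k \<in> borel_measurable M" "\<And>k. g k \<in> borel_measurable M"
    and l: "(\<lambda>k. nn2 M (f k)) \<longlonglongrightarrow> 0" "(\<lambda>k. nn2 M (g k)) \<longlonglongrightarrow> 0"
  shows "(\<lambda>k. nn2 M (\<lambda>x. f k x + g k x)) \<longlonglongrightarrow> 0"
proof (rule tendsto_sandwich[OF _ _ tendsto_const])
  show "\<forall>\<^sub>F k in sequentially. nn2 M (\<lambda>x. f k x + g k x) \<le> 2 * nn2 M (f k) + 2 * nn2 M (g k)"
    by (intro always_eventually allI nn2_add_le m)
  have "(\<lambda>k. 2 * nn2 M (f k) + 2 * nn2 M (g k)) \<longlonglongrightarrow> 2 * 0 + 2 * 0"
    by (intro tendsto_add ennreal_tendsto_cmult l) auto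
  then show "(\<lambda>k. 2 * nn2 M (f k) + 2 * nn2 M (g k)) \<longlonglongrightarrow> 0" by simp
qed simp

lemma nn2_tendsto_diff:
  fixes f g :: "nat \<Rightarrow> 'a \<Rightarrow> 'b::{real_normed_vector, second_countable_topology}"
  assumes m: "\<And>k. f k \<in> borel_measurable M" "\<And>k. g k \<in> borel_measurable M"
    and l: "(\<lambda>k. nn2 M (f k)) \<longlonglongrightarrow> 0" "(\<lambda>k. nn2 M (g k)) \<longlonglongrightarrow> 0"
  shows "(\<lambda>k. nn2 M (\<lambda>x. f k x - g k x)) \<longlonglongrightarrow> 0"
  using nn2_tendsto_add[of f M "\<lambda>k x. - g k x"] m l by simp

lemma nn2_zero_AE:
  fixes f :: "'a \<Rightarrow> 'b::{real_normed_vector, second_countable_topology}"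
  assumes [measurable]: "f \<in> borel_measurable M" and "nn2 M f = 0"
  shows "AE x in M. f x = 0"
proof -
  have "AE x in M. ennreal ((norm (f x))\<^sup>2) = 0"
    using assms(2) unfolding nn2_def by (subst (asm) nn_integral_0_iff_AE) auto
  then show ?thesis by eventually_elim (simp add: ennreal_eq_0_iff)
qed

section \<open>Comparison of two equations with prescribed drifts\<close>

context wiener_pair
begin

lemma space_Tm: "space Tm = {0..T}" by (simp add: space_restrict_space)

lemma Tm_borel[measurable]: "(\<lambda>x. x) \<in> Tm \<rightarrow>\<^sub>M (borel :: real measure)"
  by (rule measurable_restrict_space1) simp

lemma fst_proc_space: "fst \<in> proc_space T M \<rightarrow>\<^sub>M (borel :: real measure)"
  unfolding proc_space_def by (rule measurable_compose[OF measurable_fst Tm_borel])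

lemma joint_scale:
  fixes u :: "real \<Rightarrow> 'w \<Rightarrow> 'b::euclidean_space" and w :: "real \<Rightarrow> real"
  assumes u: "joint u" and w: "w \<in> borel_measurable borel"
  shows "joint (\<lambda>s \<omega>. w s *\<^sub>R u s \<omega>)"
proof -
  have "(\<lambda>x. w (fst x) *\<^sub>R (\<lambda>(s, \<omega>). u s \<omega>) x) \<in> borel_measurable (proc_space T M)"
    by (intro borel_measurable_scaleR u measurable_compose[OF fst_proc_space w])
  then show ?thesis by (simp add: case_prod_unfold)
qed

lemma joint_diff:
  fixes u v :: "real \<Rightarrow> 'w \<Rightarrow> 'b::euclidean_space"
  assumes "joint u" "joint v"
  shows "joint (\<lambda>s \<omega>. u s \<omega> - v s \<omega>)"
  using borel_measurable_diff[OF assms] by (simp add: case_prod_unfold)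

lemma nn2_joint_scale:
  fixes u :: "real \<Rightarrow> 'w \<Rightarrow> 'b::euclidean_space" and w :: "real \<Rightarrow> real"
  assumes u: "joint u" and w: "w \<in> borel_measurable borel"
  shows "nn2 (proc_space T M) (\<lambda>(s, \<omega>). w s *\<^sub>R u s \<omega>) = (\<integral>\<^sup>+s. ennreal ((w s)\<^sup>2) * nn2 M (u s) \<partial>Tm)"
  unfolding nn2_proc_time[OF joint_scale[OF u w]]
  by (intro nn_integral_cong nn2_scale proc_section[OF u]) (simp add: space_Tm)

lemma proc_norm_from:
  fixes u :: "real \<Rightarrow> 'w \<Rightarrow> 'b::euclidean_space"
  assumes u: "joint u" and t: "0 \<le> t"
  shows "nn2 (proc_space T M) (\<lambda>(s, \<omega>). indicator {t..T} s *\<^sub>R u s \<omega>) = proc_norm M t T u"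
    and "proc_norm M t T u = (\<integral>\<^sup>+s. indicator {t..} s * nn2 M (u s) \<partial>Tm)"
proof -
  have w: "indicator {t..T} \<in> borel_measurable (borel :: real measure)" by simp
  show 1: "nn2 (proc_space T M) (\<lambda>(s, \<omega>). indicator {t..T} s *\<^sub>R u s \<omega>) = proc_norm M t T u"
    unfolding nn2_proc_space[OF joint_scale[OF u w]] proc_norm_def
    using t by (intro nn_integral_cong) (auto simp: indicator_def)
  have "ennreal ((indicator {t..T} s)\<^sup>2) * nn2 M (u s) = indicator {t..} s * nn2 M (u s)" if "s \<in> {0..T}" for s
    using that by (auto simp: indicator_def)
  then show "proc_norm M t T u = (\<integral>\<^sup>+s. indicator {t..} s * nn2 M (u s) \<partial>Tm)"
    unfolding 1[symmetric] nn2_joint_scale[OF u w] by (intro nn_integral_cong) (simp add: space_Tm)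
qed

text \<open>The two integrands are paired into one function on the product space, since the limit
  lemma compares the norms of a single function on either side.\<close>

lemma proc_norm_pair:
  fixes u v :: "real \<Rightarrow> 'w \<Rightarrow> 'b::euclidean_space"
  assumes u: "joint u"
    and v: "joint v" and t: "0 \<le> t"
  shows "joint (\<lambda>s \<omega>. indicator {t..T} s *\<^sub>R (u s \<omega>, v s \<omega>))"
    and "nn2 (proc_space T M) (\<lambda>(s, \<omega>). indicator {t..T} s *\<^sub>R (u s \<omega>, v s \<omega>)) = proc_norm M t T u + proc_norm M t T v"
proof -
  have w: "indicator {t..T} \<in> borel_measurable (borel :: real measure)" by simp
  have "(\<lambda>x. ((\<lambda>(s, \<omega>). u s \<omega>) x, (\<lambda>(s, \<omega>). v s \<omega>) x)) \<in> borel_measurable (proc_space T M)"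
    by (intro borel_measurable_Pair u v)
  then have uv: "joint (\<lambda>s \<omega>. (u s \<omega>, v s \<omega>))" by (simp add: case_prod_unfold)
  show "joint (\<lambda>s \<omega>. indicator {t..T} s *\<^sub>R (u s \<omega>, v s \<omega>))"
    by (rule joint_scale[OF uv w])
  note mu = joint_scale[OF u w] and mv = joint_scale[OF v w]
  let ?U = "\<lambda>x. (\<lambda>(s, \<omega>). indicator {t..T} s *\<^sub>R u s \<omega>) x" and ?V = "\<lambda>x. (\<lambda>(s, \<omega>). indicator {t..T} s *\<^sub>R v s \<omega>) x"
  have "nn2 (proc_space T M) (\<lambda>(s, \<omega>). indicator {t..T} s *\<^sub>R (u s \<omega>, v s \<omega>))
     = (\<integral>\<^sup>+x. ennreal ((norm (?U x))\<^sup>2) + ennreal ((norm (?V x))\<^sup>2) \<partial>proc_space T M)"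
    unfolding nn2_def by (intro nn_integral_cong) (auto simp: norm_prod_def case_prod_unfold power_mult_distrib algebra_simps ennreal_plus[symmetric] simp del: ennreal_plus)
  also have "\<dots> = nn2 (proc_space T M) ?U + nn2 (proc_space T M) ?V"
    unfolding nn2_def by (intro nn_integral_add measurable_compose[OF mu] measurable_compose[OF mv]) auto
  finally show "nn2 (proc_space T M) (\<lambda>(s, \<omega>). indicator {t..T} s *\<^sub>R (u s \<omega>, v s \<omega>)) = proc_norm M t T u + proc_norm M t T v"
    by (simp only: proc_norm_from(1)[OF u t] proc_norm_from(1)[OF v t] eta_contract_eq)
qed

lemma proc_norm_mono_from: "0 \<le> t \<Longrightarrow> proc_norm M t T u \<le> proc_norm M 0 T u"
  unfolding proc_norm_def by (intro nn_integral_mono mult_left_mono) (auto simp: indicator_def)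

lemma elementary_at_measurable:
  fixes h :: "real \<Rightarrow> 'w \<Rightarrow> real^'n"
  assumes "elementary_integral M Fl T W h I" "W = W1 \<or> W = W2" "t \<in> {0..T}"
  shows "I t \<in> borel_measurable M"
proof -
  have "sq_int M (I t)"
    using assms elementary_at(2)[of h I "\<lambda>t \<omega>. 0" "\<lambda>t \<omega>. 0" t] elementary_at(2)[of "\<lambda>t \<omega>. 0" "\<lambda>t \<omega>. 0" h I t]
      elementary_zero[OF T_pos] by auto
  then show ?thesis by (rule sq_int_measurable)
qed

lemma L2_proc_joint: "u \<in> L2_proc M Fl T \<Longrightarrow> joint u"
  by (rule sq_int_measurable[OF L2_proc_sq_int])

text \<open>Approximants are subtracted termwise, so that a difference of two stochastic integrals
  is again a limit of elementary ones.\<close>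

lemma ito_diff_sequence:
  fixes Q Q' :: "real \<Rightarrow> 'w \<Rightarrow> real^'n"
  assumes I: "ito_integral M Fl T W Q X" "ito_integral M Fl T W Q' X'" and W: "W = W1 \<or> W = W2"
    and Q: "Q \<in> L2_proc M Fl T" "Q' \<in> L2_proc M Fl T"
  shows "\<exists>h J. (\<forall>k::nat. elementary_integral M Fl T W (h k) (J k)) \<and>
    (\<lambda>k. proc_norm M 0 T (\<lambda>s \<omega>. (Q s \<omega> - Q' s \<omega>) - h k s \<omega>)) \<longlonglongrightarrow> 0 \<and>
    (\<forall>t\<in>{0..T}. (\<lambda>k. nn2 M (\<lambda>\<omega>. (X t \<omega> - X' t \<omega>) - J k t \<omega>)) \<longlonglongrightarrow> 0)"
proof -
  obtain h J where E: "\<forall>k::nat. elementary_integral M Fl T W (h k) (J k)" "(\<lambda>k. proc_norm M 0 T (\<lambda>s \<omega>. Q s \<omega> - h k s \<omega>)) \<longlonglongrightarrow> 0"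
    "\<forall>t\<in>{0..T}. (\<lambda>k. nn2 M (\<lambda>\<omega>. X t \<omega> - J k t \<omega>)) \<longlonglongrightarrow> 0" and Xa: "adapted Fl T X"
    using I(1) unfolding ito_integral_iff by blast
  obtain h' J' where E': "\<forall>k::nat. elementary_integral M Fl T W (h' k) (J' k)" "(\<lambda>k. proc_norm M 0 T (\<lambda>s \<omega>. Q' s \<omega> - h' k s \<omega>)) \<longlonglongrightarrow> 0"
    "\<forall>t\<in>{0..T}. (\<lambda>k. nn2 M (\<lambda>\<omega>. X' t \<omega> - J' k t \<omega>)) \<longlonglongrightarrow> 0" and Xa': "adapted Fl T X'"
    using I(2) unfolding ito_integral_iff by blast
  have meas: "X t \<in> borel_measurable M" "X' t \<in> borel_measurable M" if "t \<in> {0..T}" for t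
    using measurable_Fl_M[of _ t] bspec[OF Xa[unfolded adapted_def] that] bspec[OF Xa'[unfolded adapted_def] that] that by simp_all
  have hL: "h k \<in> L2_proc M Fl T" "h' k \<in> L2_proc M Fl T" for k
    using elementary_L2_proc E(1) E'(1) by blast+
  show ?thesis
  proof (rule exI[of _ "\<lambda>k s \<omega>. h k s \<omega> - h' k s \<omega>"], rule exI[of _ "\<lambda>k s \<omega>. J k s \<omega> - J' k s \<omega>"], intro conjI allI ballI)
    fix k show "elementary_integral M Fl T W (\<lambda>s \<omega>. h k s \<omega> - h' k s \<omega>) (\<lambda>s \<omega>. J k s \<omega> - J' k s \<omega>)"
      using E(1) E'(1) by (intro elementary_diff) auto
  next
    note j = joint_diff[OF L2_proc_joint[OF Q(1)] L2_proc_joint[OF hL(1)]] and j' = joint_diff[OF L2_proc_joint[OF Q(2)] L2_proc_joint[OF hL(2)]]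
    have "(\<lambda>k. nn2 (proc_space T M) (\<lambda>x. (\<lambda>(s, \<omega>). Q s \<omega> - h k s \<omega>) x - (\<lambda>(s, \<omega>). Q' s \<omega> - h' k s \<omega>) x)) \<longlonglongrightarrow> 0"
      using E(2) E'(2) by (intro nn2_tendsto_diff j j') (simp_all only: nn2_proc_space[OF j] nn2_proc_space[OF j'])
    moreover have "nn2 (proc_space T M) (\<lambda>x. (\<lambda>(s, \<omega>). Q s \<omega> - h k s \<omega>) x - (\<lambda>(s, \<omega>). Q' s \<omega> - h' k s \<omega>) x)
      = proc_norm M 0 T (\<lambda>s \<omega>. (Q s \<omega> - Q' s \<omega>) - (h k s \<omega> - h' k s \<omega>))" for k
      using nn2_proc_space[OF joint_diff[OF j[of k] j'[of k]]] by (simp add: case_prod_unfold algebra_simps)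
    ultimately show "(\<lambda>k. proc_norm M 0 T (\<lambda>s \<omega>. (Q s \<omega> - Q' s \<omega>) - (h k s \<omega> - h' k s \<omega>))) \<longlonglongrightarrow> 0"
      by (simp only:)
  next
    fix t assume t: "t \<in> {0..T}"
    have Jm: "J k t \<in> borel_measurable M" "J' k t \<in> borel_measurable M" for k
      using elementary_at_measurable[OF E(1)[rule_format] W t] elementary_at_measurable[OF E'(1)[rule_format] W t] by blast+
    have "(\<lambda>k. nn2 M (\<lambda>\<omega>. (X t \<omega> - J k t \<omega>) - (X' t \<omega> - J' k t \<omega>))) \<longlonglongrightarrow> 0"
      by (rule nn2_tendsto_diff[OF borel_measurable_diff[OF meas(1)[OF t] Jm(1)] borel_measurable_diff[OF meas(2)[OF t] Jm(2)] bspec[OF E(3) t] bspec[OF E'(3) t]])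
    then show "(\<lambda>k. nn2 M (\<lambda>\<omega>. (X t \<omega> - X' t \<omega>) - (J k t \<omega> - J' k t \<omega>))) \<longlonglongrightarrow> 0" by (simp add: algebra_simps)
  qed
qed

lemma LINT_split:
  fixes f f' :: "real \<Rightarrow> real^'n"
  assumes f: "set_integrable lborel {0..T} f" and f': "set_integrable lborel {0..T} f'" and t: "t \<in> {0..T}"
  shows "(LINT s:{t..T}|lborel. f s - f' s) = ((LINT s:{0..T}|lborel. f s) - (LINT s:{0..T}|lborel. f' s)) - ((LINT s:{0..t}|lborel. f s) - (LINT s:{0..t}|lborel. f' s))"
proof -
  have *: "(LINT s:{t..T}|lborel. f s) = (LINT s:{0..T}|lborel. f s) - (LINT s:{0..t}|lborel. f s)"
    if i: "set_integrable lborel {0..T} f" for f :: "real \<Rightarrow> real^'n"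
  proof -
    have e: "(LINT s:{a..b}|lborel. f s) = integral {a..b} f" if "0 \<le> a" "b \<le> T" for a b
      using set_borel_integral_eq_integral(2)[OF set_integrable_subinterval[OF i that]] .
    have "integral {0..t} f + integral {t..T} f = integral {0..T} f"
      using t set_borel_integral_eq_integral(1)[OF i] by (intro Henstock_Kurzweil_Integration.integral_combine) auto
    then show ?thesis using e[of t T] e[of 0 T] e[of 0 t] t by (simp add: algebra_simps)
  qed
  have "(LINT s:{t..T}|lborel. f s - f' s) = (LINT s:{t..T}|lborel. f s) - (LINT s:{t..T}|lborel. f' s)"
    using set_integrable_subinterval[OF f, of t T] set_integrable_subinterval[OF f', of t T] t by (intro set_integral_diff) auto
  then show ?thesis using *[OF f] *[OF f'] by simp
qed

text \<open>
  The increment of the stochastic integrals over [t,T] is orthogonal to the past, so the norm of the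
  time integral splits; this replaces Ito's formula.
\<close>

lemma frozen_estimate:
  fixes f f' :: "real \<Rightarrow> 'w \<Rightarrow> real^'n"
  assumes F: "frozen f P Q1 Q2" and F': "frozen f' P' Q1' Q2'" and end_eq: "AE \<omega> in M. P T \<omega> = P' T \<omega>" and t: "t \<in> {0..T}"
  shows "nn2 M (\<lambda>\<omega>. P t \<omega> - P' t \<omega>) + (proc_norm M t T (\<lambda>s \<omega>. Q1 s \<omega> - Q1' s \<omega>) + proc_norm M t T (\<lambda>s \<omega>. Q2 s \<omega> - Q2' s \<omega>))
    \<le> nn2 M (\<lambda>\<omega>. LINT s:{t..T}|lborel. f s \<omega> - f' s \<omega>)"
proof -
  have t0: "0 \<le> t" "t \<le> T" and TT: "T \<in> {0..T}" using t T_pos by auto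
  obtain I1 I2 where S: "P \<in> S2_proc M Fl T" "Q1 \<in> L2_proc M Fl T" "Q2 \<in> L2_proc M Fl T"
    and I: "ito_integral M Fl T W1 Q1 I1" "ito_integral M Fl T W2 Q2 I2"
    and fi: "AE \<omega> in M. set_integrable lborel {0..T} (\<lambda>s. f s \<omega>)"
    and eq: "AE \<omega> in M. \<forall>t\<in>{0..T}. P t \<omega> = P 0 \<omega> + (LINT s:{0..t}|lborel. f s \<omega>) + I1 t \<omega> + I2 t \<omega>"
    using F unfolding frozen_def by blast
  obtain I1' I2' where S': "P' \<in> S2_proc M Fl T" "Q1' \<in> L2_proc M Fl T" "Q2' \<in> L2_proc M Fl T"
    and I': "ito_integral M Fl T W1 Q1' I1'" "ito_integral M Fl T W2 Q2' I2'"
    and fi': "AE \<omega> in M. set_integrable lborel {0..T} (\<lambda>s. f' s \<omega>)"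
    and eq': "AE \<omega> in M. \<forall>t\<in>{0..T}. P' t \<omega> = P' 0 \<omega> + (LINT s:{0..t}|lborel. f' s \<omega>) + I1' t \<omega> + I2' t \<omega>"
    using F' unfolding frozen_def by blast
  obtain h1 J1 where E1: "\<And>k::nat. elementary_integral M Fl T W1 (h1 k) (J1 k)"
    "(\<lambda>k. proc_norm M 0 T (\<lambda>s \<omega>. (Q1 s \<omega> - Q1' s \<omega>) - h1 k s \<omega>)) \<longlonglongrightarrow> 0"
    "\<And>t. t\<in>{0..T} \<Longrightarrow> (\<lambda>k. nn2 M (\<lambda>\<omega>. (I1 t \<omega> - I1' t \<omega>) - J1 k t \<omega>)) \<longlonglongrightarrow> 0"
    using ito_diff_sequence[OF I(1) I'(1) disjI1[OF refl] S(2) S'(2)] by blast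
  obtain h2 J2 where E2: "\<And>k::nat. elementary_integral M Fl T W2 (h2 k) (J2 k)"
    "(\<lambda>k. proc_norm M 0 T (\<lambda>s \<omega>. (Q2 s \<omega> - Q2' s \<omega>) - h2 k s \<omega>)) \<longlonglongrightarrow> 0"
    "\<And>t. t\<in>{0..T} \<Longrightarrow> (\<lambda>k. nn2 M (\<lambda>\<omega>. (I2 t \<omega> - I2' t \<omega>) - J2 k t \<omega>)) \<longlonglongrightarrow> 0"
    using ito_diff_sequence[OF I(2) I'(2) disjI2[OF refl] S(3) S'(3)] by blast
  define Y where "Y \<omega> = P t \<omega> - P' t \<omega>" for \<omega>
  have Y: "Y \<in> borel_measurable (Fl t)" "sq_int M Y"
    unfolding Y_def[abs_def] using S2_proc_at[OF S(1) t] S2_proc_at[OF S'(1) t] by (auto intro: sq_int_diff borel_measurable_diff)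
  \<comment> \<open>\<open>Y\<close> plus the stochastic increments over [t,T]. As both solutions
    agree at \<open>T\<close>, this is minus the difference of the drift integrals.\<close>
  define v where "v \<omega> = Y \<omega> + (((I1 T \<omega> - I1' T \<omega>) - (I1 t \<omega> - I1' t \<omega>)) + ((I2 T \<omega> - I2' T \<omega>) - (I2 t \<omega> - I2' t \<omega>)))" for \<omega>
  define vk where "vk k \<omega> = Y \<omega> + ((J1 k T \<omega> - J1 k t \<omega>) + (J2 k T \<omega> - J2 k t \<omega>))" for k \<omega>
  have Im: "I1 s \<in> borel_measurable M" "I2 s \<in> borel_measurable M" "I1' s \<in> borel_measurable M" "I2' s \<in> borel_measurable M"
    if s: "s \<in> {0..T}" for s
  proof -
    have a: "adapted Fl T I1" "adapted Fl T I2" "adapted Fl T I1'" "adapted Fl T I2'"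
      using I I' unfolding ito_integral_iff by blast+
    have "s \<le> T" using s by simp
    then show "I1 s \<in> borel_measurable M" "I2 s \<in> borel_measurable M" "I1' s \<in> borel_measurable M" "I2' s \<in> borel_measurable M"
      using bspec[OF a(1)[unfolded adapted_def] s] bspec[OF a(2)[unfolded adapted_def] s] bspec[OF a(3)[unfolded adapted_def] s] bspec[OF a(4)[unfolded adapted_def] s]
      by (blast intro: measurable_Fl_M)+
  qed
  have Jm: "J1 k s \<in> borel_measurable M" "J2 k s \<in> borel_measurable M" if s: "s \<in> {0..T}" for s k
    using elementary_at_measurable[OF E1(1) _ s] elementary_at_measurable[OF E2(1) _ s] by auto
  have vm: "v \<in> borel_measurable M"
    unfolding v_def[abs_def] by (intro borel_measurable_add borel_measurable_diff Im t TT sq_int_measurable[OF Y(2)])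
  have vkm: "vk k \<in> borel_measurable M" for k
    unfolding vk_def[abs_def] by (intro borel_measurable_add borel_measurable_diff Jm t TT sq_int_measurable[OF Y(2)])
  have v_lim: "(\<lambda>k. nn2 M (\<lambda>\<omega>. v \<omega> - vk k \<omega>)) \<longlonglongrightarrow> 0"
  proof -
    have "(\<lambda>k. nn2 M (\<lambda>\<omega>. (((I1 T \<omega> - I1' T \<omega>) - J1 k T \<omega>) - ((I1 t \<omega> - I1' t \<omega>) - J1 k t \<omega>)) + (((I2 T \<omega> - I2' T \<omega>) - J2 k T \<omega>) - ((I2 t \<omega> - I2' t \<omega>) - J2 k t \<omega>)))) \<longlonglongrightarrow> 0"
      by (intro nn2_tendsto_add nn2_tendsto_diff borel_measurable_diff Im Jm E1(3) E2(3) t TT)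
    then show ?thesis by (simp add: v_def vk_def algebra_simps)
  qed
  let ?u = "\<lambda>(s, \<omega>). indicator {t..T} s *\<^sub>R (Q1 s \<omega> - Q1' s \<omega>, Q2 s \<omega> - Q2' s \<omega>)"
  let ?uk = "\<lambda>k (s, \<omega>). indicator {t..T} s *\<^sub>R (h1 k s \<omega>, h2 k s \<omega>)"
  note jQ1 = joint_diff[OF L2_proc_joint[OF S(2)] L2_proc_joint[OF S'(2)]]
  note jQ2 = joint_diff[OF L2_proc_joint[OF S(3)] L2_proc_joint[OF S'(3)]]
  have jh1: "joint (\<lambda>s \<omega>. h1 k s \<omega>)" for k by (rule L2_proc_joint[OF elementary_L2_proc[OF E1(1)]])
  have jh2: "joint (\<lambda>s \<omega>. h2 k s \<omega>)" for k by (rule L2_proc_joint[OF elementary_L2_proc[OF E2(1)]])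
  have u_lim: "(\<lambda>k. nn2 (proc_space T M) (\<lambda>x. ?u x - ?uk k x)) \<longlonglongrightarrow> 0"
  proof -
    have "nn2 (proc_space T M) (\<lambda>x. ?u x - ?uk k x) =
      proc_norm M t T (\<lambda>s \<omega>. (Q1 s \<omega> - Q1' s \<omega>) - h1 k s \<omega>) + proc_norm M t T (\<lambda>s \<omega>. (Q2 s \<omega> - Q2' s \<omega>) - h2 k s \<omega>)" for k
      using proc_norm_pair(2)[OF joint_diff[OF jQ1 jh1[of k]] joint_diff[OF jQ2 jh2[of k]] t0(1)]
      by (simp add: case_prod_unfold scaleR_diff_right)
    moreover have "(\<lambda>k. proc_norm M t T (\<lambda>s \<omega>. (Q1 s \<omega> - Q1' s \<omega>) - h1 k s \<omega>)) \<longlonglongrightarrow> 0"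
      by (rule tendsto_sandwich[OF _ _ tendsto_const E1(2)]) (simp, rule always_eventually, rule allI, rule proc_norm_mono_from[OF t0(1)])
    moreover have "(\<lambda>k. proc_norm M t T (\<lambda>s \<omega>. (Q2 s \<omega> - Q2' s \<omega>) - h2 k s \<omega>)) \<longlonglongrightarrow> 0"
      by (rule tendsto_sandwich[OF _ _ tendsto_const E2(2)]) (simp, rule always_eventually, rule allI, rule proc_norm_mono_from[OF t0(1)])
    ultimately show ?thesis using tendsto_add[of _ 0 sequentially _ 0] by simp
  qed
  \<comment> \<open>The isometry is an equality for the approximants; an inequality is what is
    carried to the limit.\<close>
  have "nn2 M Y + nn2 (proc_space T M) ?u \<le> nn2 M v"
  proof (rule nn2_limit_le[OF _ _ vm vkm u_lim v_lim])
    show "?u \<in> borel_measurable (proc_space T M)" by (rule proc_norm_pair(1)[OF jQ1 jQ2 t0(1)])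
    show "?uk k \<in> borel_measurable (proc_space T M)" for k by (rule proc_norm_pair(1)[OF jh1 jh2 t0(1)])
    show "nn2 M Y + nn2 (proc_space T M) (?uk k) \<le> nn2 M (vk k)" for k
      unfolding proc_norm_pair(2)[OF jh1 jh2 t0(1)] vk_def[abs_def] elementary_isometry[OF E1(1) E2(1) t0 Y] by simp
  qed
  moreover have "nn2 M v = nn2 M (\<lambda>\<omega>. - (LINT s:{t..T}|lborel. f s \<omega> - f' s \<omega>))"
  proof (rule nn2_cong_AE)
    show "AE \<omega> in M. v \<omega> = - (LINT s:{t..T}|lborel. f s \<omega> - f' s \<omega>)"
      using fi fi' eq eq' end_eq
    proof eventually_elim
      case (elim \<omega>)
      from elim(5) bspec[OF elim(3) TT] bspec[OF elim(4) TT] bspec[OF elim(3) t] bspec[OF elim(4) t]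
      show ?case unfolding v_def Y_def LINT_split[OF elim(1,2) t] by (simp add: algebra_simps)
    qed
  qed
  ultimately show ?thesis unfolding proc_norm_pair(2)[OF jQ1 jQ2 t0(1)] Y_def by simp
qed

text \<open>A squared norm. Its weight is the one produced by \<open>weighted_estimate\<close>,
  hence the factor 4 in the exponent.\<close>

definition wnorm :: "real \<Rightarrow> (real \<Rightarrow> 'w \<Rightarrow> 'b::euclidean_space) \<Rightarrow> ennreal" where
  "wnorm \<mu> u = (\<integral>\<^sup>+s. ennreal (exp (4 * \<mu> * s)) * nn2 M (u s) \<partial>Tm)"

text \<open>On [0,T] the weight lies between 1 and its value at \<open>T\<close>, so weighted and
  plain norms define the same convergence.\<close>

lemma wnorm_bounds:
  fixes u :: "real \<Rightarrow> 'w \<Rightarrow> 'b::euclidean_space"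
  assumes u: "joint u" and \<mu>: "\<mu> > 0"
  shows "proc_norm M 0 T u \<le> wnorm \<mu> u" "wnorm \<mu> u \<le> ennreal (exp (4 * \<mu> * T)) * proc_norm M 0 T u"
proof -
  have e: "proc_norm M 0 T u = (\<integral>\<^sup>+s. nn2 M (u s) \<partial>Tm)"
    using nn2_proc_time[OF u] nn2_proc_space[OF u] by simp
  show "proc_norm M 0 T u \<le> wnorm \<mu> u"
    unfolding e wnorm_def
  proof (rule nn_integral_mono)
    fix s assume "s \<in> space Tm"
    then have "1 \<le> ennreal (exp (4 * \<mu> * s))" using \<mu> by (simp add: space_Tm)
    from mult_right_mono[OF this, of "nn2 M (u s)"] show "nn2 M (u s) \<le> ennreal (exp (4 * \<mu> * s)) * nn2 M (u s)" by simp
  qed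
  have "wnorm \<mu> u \<le> (\<integral>\<^sup>+s. ennreal (exp (4 * \<mu> * T)) * nn2 M (u s) \<partial>Tm)"
    unfolding wnorm_def using \<mu> by (intro nn_integral_mono mult_right_mono) (auto simp: space_Tm intro!: ennreal_leI)
  also have "\<dots> = ennreal (exp (4 * \<mu> * T)) * proc_norm M 0 T u"
    unfolding e by (rule nn_integral_cmult[OF nn2_time_measurable[OF u]])
  finally show "wnorm \<mu> u \<le> ennreal (exp (4 * \<mu> * T)) * proc_norm M 0 T u" .
qed

text \<open>The pathwise bound is integrated over the sample space, and the time and sample
  integrals are exchanged.\<close>

lemma time_integral_estimate:
  fixes u :: "real \<Rightarrow> 'w \<Rightarrow> 'b::euclidean_space"
  assumes u: "joint u" and t: "t \<in> {0..T}" and \<mu>: "\<mu> > 0"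
  shows "nn2 M (\<lambda>\<omega>. LINT s:{t..T}|lborel. u s \<omega>)
    \<le> ennreal (1 / (2 * \<mu>)) * (\<integral>\<^sup>+s. indicator {t..} s * (ennreal (exp (2 * \<mu> * (s - t))) * nn2 M (u s)) \<partial>Tm)"
proof -
  define w where "w s = indicator {t..T} s * exp (\<mu> * (s - t))" for s
  have w: "w \<in> borel_measurable borel" unfolding w_def[abs_def] by measurable
  have w2: "(w s)\<^sup>2 = indicator {t..T} s * exp (2 * \<mu> * (s - t))" for s
  proof -
    have "(exp (\<mu> * (s - t)))\<^sup>2 = exp (2 * \<mu> * (s - t))" by (simp add: exp_double[symmetric] algebra_simps)
    then show ?thesis by (simp add: w_def power_mult_distrib indicator_def)
  qed
  have jw: "joint (\<lambda>s \<omega>. w s *\<^sub>R u s \<omega>)" by (rule joint_scale[OF u w])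
  interpret R: finite_measure Tm by (rule finite_lborel_restrict)
  have "nn2 M (\<lambda>\<omega>. LINT s:{t..T}|lborel. u s \<omega>)
     \<le> (\<integral>\<^sup>+\<omega>. ennreal (1 / (2 * \<mu>)) * (\<integral>\<^sup>+s. ennreal ((norm (w s *\<^sub>R u s \<omega>))\<^sup>2) \<partial>Tm) \<partial>M)"
    unfolding nn2_def
  proof (rule nn_integral_mono)
    fix \<omega> assume om: "\<omega> \<in> space M"
    have "ennreal ((norm (LINT s:{t..T}|lborel. u s \<omega>))\<^sup>2) \<le> ennreal (1 / (2 * \<mu>)) *
      (\<integral>\<^sup>+s\<in>{t..T}. ennreal (exp (2 * \<mu> * (s - t)) * (norm (u s \<omega>))\<^sup>2) \<partial>lborel)"
      using proc_set_measurable[OF u om] t \<mu> by (intro norm_integral_weighted) auto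
    also have "(\<integral>\<^sup>+s\<in>{t..T}. ennreal (exp (2 * \<mu> * (s - t)) * (norm (u s \<omega>))\<^sup>2) \<partial>lborel) = (\<integral>\<^sup>+s. ennreal ((norm (w s *\<^sub>R u s \<omega>))\<^sup>2) \<partial>Tm)"
      using t by (subst nn_integral_restrict_space) (auto simp: power_mult_distrib w2 indicator_def intro!: nn_integral_cong)
    finally show "ennreal ((norm (LINT s:{t..T}|lborel. u s \<omega>))\<^sup>2) \<le> ennreal (1 / (2 * \<mu>)) * (\<integral>\<^sup>+s. ennreal ((norm (w s *\<^sub>R u s \<omega>))\<^sup>2) \<partial>Tm)" .
  qed
  also have "\<dots> = ennreal (1 / (2 * \<mu>)) * (\<integral>\<^sup>+\<omega>. (\<integral>\<^sup>+s. ennreal ((norm (w s *\<^sub>R u s \<omega>))\<^sup>2) \<partial>Tm) \<partial>M)"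
  proof (rule nn_integral_cmult)
    have "(\<lambda>x. ennreal ((norm ((\<lambda>(s, \<omega>). w s *\<^sub>R u s \<omega>) x))\<^sup>2)) \<in> borel_measurable (Tm \<Otimes>\<^sub>M M)"
      using jw unfolding proc_space_def by measurable
    from measurable_compose[OF measurable_pair_swap' this]
    have "(\<lambda>x. ennreal ((norm (w (snd x) *\<^sub>R u (snd x) (fst x)))\<^sup>2)) \<in> borel_measurable (M \<Otimes>\<^sub>M Tm)"
      by (simp add: case_prod_unfold)
    from R.borel_measurable_nn_integral_fst[OF this]
    show "(\<lambda>\<omega>. \<integral>\<^sup>+s. ennreal ((norm (w s *\<^sub>R u s \<omega>))\<^sup>2) \<partial>Tm) \<in> borel_measurable M" by simp
  qed
  also have "(\<integral>\<^sup>+\<omega>. (\<integral>\<^sup>+s. ennreal ((norm (w s *\<^sub>R u s \<omega>))\<^sup>2) \<partial>Tm) \<partial>M) = nn2 (proc_space T M) (\<lambda>(s, \<omega>). w s *\<^sub>R u s \<omega>)"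
    unfolding nn2_proc_space[OF jw] proc_norm_def by (simp add: nn_integral_restrict_space)
  also have "\<dots> = (\<integral>\<^sup>+s. ennreal ((w s)\<^sup>2) * nn2 M (u s) \<partial>Tm)" by (rule nn2_joint_scale[OF u w])
  also have "\<dots> = (\<integral>\<^sup>+s. indicator {t..} s * (ennreal (exp (2 * \<mu> * (s - t))) * nn2 M (u s)) \<partial>Tm)"
    unfolding w2 by (intro nn_integral_cong) (auto simp: space_Tm indicator_def)
  finally show ?thesis .
qed

text \<open>The weighted estimate is applied with the difference of \<open>P\<close> as
  \<open>a\<close> and those of \<open>Q1\<close>, \<open>Q2\<close> as \<open>b\<close>. The factor
  \<open>4 * \<mu>\<close> in front of \<open>P\<close> is lowered to 1; the gain
  \<open>1 / \<mu>\<close> remains.\<close>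

lemma frozen_contraction:
  fixes f f' :: "real \<Rightarrow> 'w \<Rightarrow> real^'n"
  assumes F: "frozen f P Q1 Q2" and F': "frozen f' P' Q1' Q2'" and end_eq: "AE \<omega> in M. P T \<omega> = P' T \<omega>"
    and f: "joint f" and f': "joint f'"
    and \<mu>: "\<mu> \<ge> 1"
  shows "wnorm \<mu> (\<lambda>s \<omega>. P s \<omega> - P' s \<omega>) + (wnorm \<mu> (\<lambda>s \<omega>. Q1 s \<omega> - Q1' s \<omega>) + wnorm \<mu> (\<lambda>s \<omega>. Q2 s \<omega> - Q2' s \<omega>))
    \<le> ennreal (1 / \<mu>) * wnorm \<mu> (\<lambda>s \<omega>. f s \<omega> - f' s \<omega>)"
proof -
  have S: "P \<in> S2_proc M Fl T" "Q1 \<in> L2_proc M Fl T" "Q2 \<in> L2_proc M Fl T"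
    and S': "P' \<in> S2_proc M Fl T" "Q1' \<in> L2_proc M Fl T" "Q2' \<in> L2_proc M Fl T"
    using F F' unfolding frozen_def by blast+
  note jP = joint_diff[OF L2_proc_joint[OF S2_L2_proc[OF S(1)]] L2_proc_joint[OF S2_L2_proc[OF S'(1)]]]
  note jQ1 = joint_diff[OF L2_proc_joint[OF S(2)] L2_proc_joint[OF S'(2)]]
  note jQ2 = joint_diff[OF L2_proc_joint[OF S(3)] L2_proc_joint[OF S'(3)]]
  note jf = joint_diff[OF f f']
  note [measurable] = nn2_time_measurable[OF jP] nn2_time_measurable[OF jQ1] nn2_time_measurable[OF jQ2] nn2_time_measurable[OF jf]
  let ?a = "\<lambda>t. nn2 M (\<lambda>\<omega>. P t \<omega> - P' t \<omega>)" and ?b1 = "\<lambda>t. nn2 M (\<lambda>\<omega>. Q1 t \<omega> - Q1' t \<omega>)"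
    and ?b2 = "\<lambda>t. nn2 M (\<lambda>\<omega>. Q2 t \<omega> - Q2' t \<omega>)" and ?\<phi> = "\<lambda>t. nn2 M (\<lambda>\<omega>. f t \<omega> - f' t \<omega>)"
  have \<mu>0: "\<mu> > 0" using \<mu> by simp
  have est: "ennreal (4 * \<mu>) * (\<integral>\<^sup>+t. ennreal (exp (4 * \<mu> * t)) * ?a t \<partial>Tm) + (\<integral>\<^sup>+s. ennreal (exp (4 * \<mu> * s)) * (?b1 s + ?b2 s) \<partial>Tm)
    \<le> ennreal (1 / \<mu>) * (\<integral>\<^sup>+s. ennreal (exp (4 * \<mu> * s)) * ?\<phi> s \<partial>Tm)"
  proof (rule weighted_estimate[OF T_pos \<mu>0])
    fix t assume "0 \<le> t" "t \<le> T"
    then have t: "t \<in> {0..T}" and t0: "0 \<le> t" by auto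
    have "(\<integral>\<^sup>+s. indicator {t..} s * (?b1 s + ?b2 s) \<partial>Tm) = proc_norm M t T (\<lambda>s \<omega>. Q1 s \<omega> - Q1' s \<omega>) + proc_norm M t T (\<lambda>s \<omega>. Q2 s \<omega> - Q2' s \<omega>)"
      unfolding proc_norm_from(2)[OF jQ1 t0] proc_norm_from(2)[OF jQ2 t0] distrib_left
      by (rule nn_integral_add) measurable
    then have "?a t + (\<integral>\<^sup>+s. indicator {t..} s * (?b1 s + ?b2 s) \<partial>Tm) \<le> nn2 M (\<lambda>\<omega>. LINT s:{t..T}|lborel. f s \<omega> - f' s \<omega>)"
      using frozen_estimate[OF F F' end_eq t] by simp
    also have "\<dots> \<le> ennreal (1 / (2 * \<mu>)) * (\<integral>\<^sup>+s. indicator {t..} s * (ennreal (exp (2 * \<mu> * (s - t))) * ?\<phi> s) \<partial>Tm)"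
      by (rule time_integral_estimate[OF jf t \<mu>0])
    finally show "?a t + (\<integral>\<^sup>+s. indicator {t..} s * (?b1 s + ?b2 s) \<partial>Tm)
      \<le> ennreal (1 / (2 * \<mu>)) * (\<integral>\<^sup>+s. indicator {t..} s * (ennreal (exp (2 * \<mu> * (s - t))) * ?\<phi> s) \<partial>Tm)" .
  qed measurable
  have bb: "(\<integral>\<^sup>+s. ennreal (exp (4 * \<mu> * s)) * (?b1 s + ?b2 s) \<partial>Tm) = wnorm \<mu> (\<lambda>s \<omega>. Q1 s \<omega> - Q1' s \<omega>) + wnorm \<mu> (\<lambda>s \<omega>. Q2 s \<omega> - Q2' s \<omega>)"
    unfolding wnorm_def distrib_left by (rule nn_integral_add) measurable
  have "1 * wnorm \<mu> (\<lambda>s \<omega>. P s \<omega> - P' s \<omega>) \<le> ennreal (4 * \<mu>) * wnorm \<mu> (\<lambda>s \<omega>. P s \<omega> - P' s \<omega>)"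
    using \<mu> by (intro mult_right_mono) auto
  then have aa: "wnorm \<mu> (\<lambda>s \<omega>. P s \<omega> - P' s \<omega>) \<le> ennreal (4 * \<mu>) * wnorm \<mu> (\<lambda>s \<omega>. P s \<omega> - P' s \<omega>)"
    by simp
  show ?thesis
    by (rule order_trans[OF add_right_mono[OF aa] est[unfolded bb wnorm_def[symmetric]]])
qed

end

section \<open>The fixed point\<close>

lemma sum6_power2_le: "(a + b + c + d + e + f)\<^sup>2 \<le> 6 * (a\<^sup>2 + b\<^sup>2 + c\<^sup>2 + d\<^sup>2 + e\<^sup>2 + f\<^sup>2)" for a b c d e f :: real
proof -
  have "0 \<le> (a - b)\<^sup>2 + (a - c)\<^sup>2 + (a - d)\<^sup>2 + (a - e)\<^sup>2 + (a - f)\<^sup>2 + (b - c)\<^sup>2 + (b - d)\<^sup>2 + (b - e)\<^sup>2 + (b - f)\<^sup>2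
    + (c - d)\<^sup>2 + (c - e)\<^sup>2 + (c - f)\<^sup>2 + (d - e)\<^sup>2 + (d - f)\<^sup>2 + (e - f)\<^sup>2"
    by (intro add_nonneg_nonneg zero_le_power2)
  then show ?thesis by (simp add: power2_eq_square algebra_simps)
qed

section \<open>Null sets and filtering in the weighted norm\<close>

context wiener_pair
begin

lemma AE_joint_swap:
  fixes u :: "real \<Rightarrow> 'w \<Rightarrow> 'b::euclidean_space"
  assumes u: "joint u" and z: "AE x in proc_space T M. (\<lambda>(s, \<omega>). u s \<omega>) x = 0"
  shows "AE \<omega> in M. AE s in lborel. s \<in> {0..T} \<longrightarrow> u s \<omega> = 0"
proof -
  interpret R: finite_measure Tm by (rule finite_lborel_restrict)
  interpret P: pair_sigma_finite Tm M ..
  have "AE s in Tm. AE \<omega> in M. u s \<omega> = 0"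
    using P.AE_pair[OF z[unfolded proc_space_def]] by simp
  moreover have "{x \<in> space (Tm \<Otimes>\<^sub>M M). u (fst x) (snd x) = 0} \<in> sets (Tm \<Otimes>\<^sub>M M)"
  proof -
    have "{x \<in> space (Tm \<Otimes>\<^sub>M M). u (fst x) (snd x) = 0} = (\<lambda>(s, \<omega>). u s \<omega>) -` {0} \<inter> space (proc_space T M)"
      by (auto simp: proc_space_def)
    also have "\<dots> \<in> sets (proc_space T M)" using u by (rule measurable_sets) simp
    finally show ?thesis by (simp add: proc_space_def)
  qed
  ultimately have "AE \<omega> in M. AE s in Tm. u s \<omega> = 0" by (subst (asm) P.AE_commute)
  then show ?thesis unfolding AE_proc_time .
qed

lemma wnorm_zero_AE:
  fixes u :: "real \<Rightarrow> 'w \<Rightarrow> 'b::euclidean_space"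
  assumes u: "joint u" and z: "wnorm \<mu> u = 0" and \<mu>: "\<mu> > 0"
  shows "AE x in proc_space T M. (\<lambda>(s, \<omega>). u s \<omega>) x = 0"
proof (rule nn2_zero_AE[OF u])
  show "nn2 (proc_space T M) (\<lambda>(s, \<omega>). u s \<omega>) = 0"
    using wnorm_bounds(1)[OF u \<mu>] z by (simp add: nn2_proc_space[OF u])
qed

lemma wnorm_finite:
  fixes u :: "real \<Rightarrow> 'w \<Rightarrow> 'b::euclidean_space"
  assumes u: "joint u" and \<mu>: "\<mu> > 0"
  shows "wnorm \<mu> u < \<infinity> \<longleftrightarrow> sq_int (proc_space T M) (\<lambda>(s, \<omega>). u s \<omega>)"
  using wnorm_bounds[OF u \<mu>] u unfolding sq_int_def nn2_proc_space[OF u]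
  by (auto intro: le_less_trans simp: ennreal_mult_less_top)

lemma wnorm_filtered:
  fixes u v :: "real \<Rightarrow> 'w \<Rightarrow> real^'n"
  assumes "u \<in> L2_proc M Fl T" "v \<in> L2_proc M Fl T" "is_filtered_version M T W1 u uh" "is_filtered_version M T W1 v vh"
  shows "wnorm \<mu> (\<lambda>s \<omega>. uh s \<omega> - vh s \<omega>) \<le> wnorm \<mu> (\<lambda>s \<omega>. u s \<omega> - v s \<omega>)"
  unfolding wnorm_def
proof (rule nn_integral_mono_AE)
  show "AE s in Tm. ennreal (exp (4 * \<mu> * s)) * nn2 M (\<lambda>\<omega>. uh s \<omega> - vh s \<omega>) \<le> ennreal (exp (4 * \<mu> * s)) * nn2 M (\<lambda>\<omega>. u s \<omega> - v s \<omega>)"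
    using filtered_contraction[OF assms] by eventually_elim (rule mult_left_mono, auto)
qed

end

text \<open>The exceptional event of the Lipschitz condition is fixed as a null set
  \<open>N0\<close>, so that the bound can be used at every remaining sample point.\<close>

locale filtered_bsde = wiener_pair M T W1 W2 for M :: "'w measure" and T :: real and W1 W2 :: "real \<Rightarrow> 'w \<Rightarrow> real" +
  fixes g :: "'w \<Rightarrow> real \<Rightarrow> real^'n \<Rightarrow> real^'n \<Rightarrow> real^'n \<Rightarrow> real^'n \<Rightarrow> real^'n \<Rightarrow> real^'n \<Rightarrow> real^'n"
    and L :: real and N0 :: "'w set" and \<zeta> :: "'w \<Rightarrow> real^'n"
  assumes L0: "0 \<le> L" and N0: "N0 \<in> null_sets M"
    and lip: "\<And>\<omega> t p q1 q2 pb q1b q2b p' q1' q2' pb' q1b' q2b'. \<omega> \<in> space M \<Longrightarrow> \<omega> \<notin> N0 \<Longrightarrow> t \<in> {0..T} \<Longrightarrow>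
            norm (g \<omega> t p q1 q2 pb q1b q2b - g \<omega> t p' q1' q2' pb' q1b' q2b')
            \<le> L * (norm (p - p') + norm (q1 - q1') + norm (q2 - q2')
                   + norm (pb - pb') + norm (q1b - q1b') + norm (q2b - q2b'))"
    and g_meas: "\<And>p q1 q2 pb q1b q2b. progressive (wiener_filt M W1 W2) T (\<lambda>t \<omega>. g \<omega> t p q1 q2 pb q1b q2b)"
    and g_zero: "(\<lambda>t \<omega>. g \<omega> t 0 0 0 0 0 0) \<in> L2_proc M (wiener_filt M W1 W2) T"
    and zeta: "\<zeta> \<in> borel_measurable (Fl T)" "sq_int M \<zeta>"
begin

text \<open>The value 0 on \<open>N0\<close> makes the generator Lipschitz in the state at every
  sample point, as the measurability argument asks for continuity everywhere.\<close>

definition gen where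
  "gen P Q1 Q2 P' Q1' Q2' s \<omega> = (if \<omega> \<in> N0 then 0 else g \<omega> s (P s \<omega>) (Q1 s \<omega>) (Q2 s \<omega>) (P' s \<omega>) (Q1' s \<omega>) (Q2' s \<omega>))"

text \<open>The measurable space \<open>N\<close> is left abstract: \<open>proc_space\<close> gives
  joint measurability, and the spaces over [0,t] give progressiveness. The state processes are
  inserted into a function continuous in the state.\<close>

lemma gen_measurable:
  assumes sp: "space N \<subseteq> {0..T} \<times> space M" and N0N: "{x\<in>space N. snd x \<in> N0} \<in> sets N"
    and gm: "\<And>p q1 q2 pb q1b q2b. (\<lambda>(s, \<omega>). g \<omega> s p q1 q2 pb q1b q2b) \<in> borel_measurable N"
    and c: "(\<lambda>(s, \<omega>). P s \<omega>) \<in> borel_measurable N" "(\<lambda>(s, \<omega>). Q1 s \<omega>) \<in> borel_measurable N" "(\<lambda>(s, \<omega>). Q2 s \<omega>) \<in> borel_measurable N"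
      "(\<lambda>(s, \<omega>). P' s \<omega>) \<in> borel_measurable N" "(\<lambda>(s, \<omega>). Q1' s \<omega>) \<in> borel_measurable N" "(\<lambda>(s, \<omega>). Q2' s \<omega>) \<in> borel_measurable N"
  shows "(\<lambda>(s, \<omega>). gen P Q1 Q2 P' Q1' Q2' s \<omega>) \<in> borel_measurable N"
proof -
  define G where "G x e = (if snd x \<in> N0 then 0 else g (snd x) (fst x) (fst e) (fst (snd e)) (fst (snd (snd e)))
     (fst (snd (snd (snd e)))) (fst (snd (snd (snd (snd e))))) (snd (snd (snd (snd (snd e))))))"
    for x :: "real \<times> 'w" and e :: "(real^'n) \<times> (real^'n) \<times> (real^'n) \<times> (real^'n) \<times> (real^'n) \<times> (real^'n)"
  define U where "U x = ((\<lambda>(s, \<omega>). P s \<omega>) x, (\<lambda>(s, \<omega>). Q1 s \<omega>) x, (\<lambda>(s, \<omega>). Q2 s \<omega>) x, (\<lambda>(s, \<omega>). P' s \<omega>) x, (\<lambda>(s, \<omega>). Q1' s \<omega>) x, (\<lambda>(s, \<omega>). Q2' s \<omega>) x)" for x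
  have "(\<lambda>x. G x (U x)) \<in> borel_measurable N"
  proof (rule caratheodory_measurable[where g = G and u = U])
    show "(\<lambda>x. G x e) \<in> borel_measurable N" for e
    proof -
      have "(\<lambda>x. g (snd x) (fst x) p q1 q2 a b c) \<in> borel_measurable N" for p q1 q2 a b c
        using gm[of p q1 q2 a b c] by (simp add: case_prod_unfold)
      then show ?thesis unfolding G_def[abs_def] by (rule measurable_If[OF borel_measurable_const _ N0N])
    qed
    show "U \<in> borel_measurable N"
      unfolding U_def[abs_def] by (intro borel_measurable_Pair c)
    fix x assume x: "x \<in> space N"
    show "continuous_on UNIV (G x)"
    proof (cases "snd x \<in> N0")
      case True
      then show ?thesis by (simp add: G_def[abs_def])
    next
      case False
      have xs: "snd x \<in> space M" "fst x \<in> {0..T}" using x sp by auto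
      \<comment> \<open>Each of the six component distances is at most the distance of the
        tuples.\<close>
      have "(6 * L)-lipschitz_on UNIV (G x)"
      proof (rule lipschitz_onI)
        fix e e' :: "(real^'n) \<times> (real^'n) \<times> (real^'n) \<times> (real^'n) \<times> (real^'n) \<times> (real^'n)"
        have f: "dist (fst a) (fst b) \<le> r" "dist (snd a) (snd b) \<le> r" if "dist a b \<le> r"
          for a b :: "'x::metric_space \<times> 'y::metric_space" and r
          using dist_fst_le[of a b] dist_snd_le[of a b] that by linarith+
        have "dist e e' \<le> dist e e'" by simp
        note d1 = f[OF this]
        note d2 = f[OF d1(2)]
        note d3 = f[OF d2(2)]
        note d4 = f[OF d3(2)]
        note d5 = f[OF d4(2)]
        have "dist (G x e) (G x e') \<le> L * (norm (fst e - fst e') + norm (fst (snd e) - fst (snd e')) + norm (fst (snd (snd e)) - fst (snd (snd e')))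
          + norm (fst (snd (snd (snd e))) - fst (snd (snd (snd e')))) + norm (fst (snd (snd (snd (snd e)))) - fst (snd (snd (snd (snd e')))))
          + norm (snd (snd (snd (snd (snd e)))) - snd (snd (snd (snd (snd e'))))))"
          unfolding G_def dist_norm using lip[OF xs(1) False xs(2)] False by simp
        also have "\<dots> \<le> L * (dist e e' + dist e e' + dist e e' + dist e e' + dist e e' + dist e e')"
          by (intro mult_left_mono add_mono) (simp_all only: dist_norm[symmetric] d1 d2 d3 d4 d5 L0)
        finally show "dist (G x e) (G x e') \<le> 6 * L * dist e e'" by simp
      qed (use L0 in simp)
      then show ?thesis by (rule lipschitz_on_continuous_on)
    qed
  qed
  then show ?thesis by (simp add: G_def U_def gen_def case_prod_unfold cong: if_cong)
qed

lemma N0_meas: "N0 \<in> sets M" using N0 by auto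

lemma gen_joint:
  assumes "joint P" "joint Q1"
    "joint Q2" "joint P'"
    "joint Q1'" "joint Q2'"
  shows "joint (\<lambda>s \<omega>. gen P Q1 Q2 P' Q1' Q2' s \<omega>)"
proof (rule gen_measurable[OF _ _ _ assms])
  show "space (proc_space T M) \<subseteq> {0..T} \<times> space M" by (simp add: space_proc_space)
  have "{x\<in>space (proc_space T M). snd x \<in> N0} = space Tm \<times> N0"
    using sets.sets_into_space[OF N0_meas] by (auto simp: space_proc_space space_Tm)
  moreover have "space Tm \<times> N0 \<in> sets (Tm \<Otimes>\<^sub>M M)" by (intro pair_measureI sets.top N0_meas)
  ultimately show "{x\<in>space (proc_space T M). snd x \<in> N0} \<in> sets (proc_space T M)"
    by (simp only: proc_space_def)
  show "joint (\<lambda>s \<omega>. g \<omega> s p q1 q2 pb q1b q2b)" for p q1 q2 pb q1b q2b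
    by (rule progressive_joint[OF g_meas])
qed

lemma gen_progressive:
  assumes "progressive Fl T P" "progressive Fl T Q1" "progressive Fl T Q2" "progressive Fl T P'" "progressive Fl T Q1'" "progressive Fl T Q2'"
  shows "progressive Fl T (gen P Q1 Q2 P' Q1' Q2')"
  unfolding progressive_def
proof
  fix t assume t: "t \<in> {0..T}"
  then have t': "0 \<le> t" "t \<le> T" by auto
  let ?N = "restrict_space borel {0..t} \<Otimes>\<^sub>M Fl t"
  have N0F: "N0 \<in> sets (Fl t)" using N0 by (rule null_sets_aug_filt)
  show "(\<lambda>(s, \<omega>). gen P Q1 Q2 P' Q1' Q2' s \<omega>) \<in> borel_measurable ?N"
  proof (rule gen_measurable)
    show "space ?N \<subseteq> {0..T} \<times> space M" using t' by (auto simp: space_pair_measure space_restrict_space)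
    have "{x\<in>space ?N. snd x \<in> N0} = space (restrict_space borel {0..t}) \<times> N0"
      using sets.sets_into_space[OF N0_meas] by (auto simp: space_pair_measure)
    moreover have "space (restrict_space borel {0..t}) \<times> N0 \<in> sets ?N" by (intro pair_measureI sets.top N0F)
    ultimately show "{x\<in>space ?N. snd x \<in> N0} \<in> sets ?N" by (simp only:)
    show "(\<lambda>(s, \<omega>). g \<omega> s p q1 q2 pb q1b q2b) \<in> borel_measurable ?N" for p q1 q2 pb q1b q2b
      using g_meas t' by (rule progressive_measurable)
  qed (rule progressive_measurable[OF _ t'], rule assms)+
qed

text \<open>The Lipschitz bound has six summands, and the square of their sum is at most six times
  the sum of their squares.\<close>

lemma gen_diff:
  assumes s: "s \<in> {0..T}"
    and m: "(\<lambda>\<omega>. P s \<omega> - X s \<omega>) \<in> borel_measurable M" "(\<lambda>\<omega>. Q1 s \<omega> - Y1 s \<omega>) \<in> borel_measurable M"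
      "(\<lambda>\<omega>. Q2 s \<omega> - Y2 s \<omega>) \<in> borel_measurable M" "(\<lambda>\<omega>. P' s \<omega> - X' s \<omega>) \<in> borel_measurable M"
      "(\<lambda>\<omega>. Q1' s \<omega> - Y1' s \<omega>) \<in> borel_measurable M" "(\<lambda>\<omega>. Q2' s \<omega> - Y2' s \<omega>) \<in> borel_measurable M"
  shows "nn2 M (\<lambda>\<omega>. gen P Q1 Q2 P' Q1' Q2' s \<omega> - gen X Y1 Y2 X' Y1' Y2' s \<omega>) \<le> ennreal (6 * L\<^sup>2) *
    (nn2 M (\<lambda>\<omega>. P s \<omega> - X s \<omega>) + nn2 M (\<lambda>\<omega>. Q1 s \<omega> - Y1 s \<omega>) + nn2 M (\<lambda>\<omega>. Q2 s \<omega> - Y2 s \<omega>)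
     + nn2 M (\<lambda>\<omega>. P' s \<omega> - X' s \<omega>) + nn2 M (\<lambda>\<omega>. Q1' s \<omega> - Y1' s \<omega>) + nn2 M (\<lambda>\<omega>. Q2' s \<omega> - Y2' s \<omega>))"
proof -
  note [measurable] = m
  let ?n = "\<lambda>v. ennreal ((norm (v::real^'n))\<^sup>2)"
  have "nn2 M (\<lambda>\<omega>. gen P Q1 Q2 P' Q1' Q2' s \<omega> - gen X Y1 Y2 X' Y1' Y2' s \<omega>) \<le>
    (\<integral>\<^sup>+\<omega>. ennreal (6 * L\<^sup>2) * (?n (P s \<omega> - X s \<omega>) + ?n (Q1 s \<omega> - Y1 s \<omega>) + ?n (Q2 s \<omega> - Y2 s \<omega>)
      + ?n (P' s \<omega> - X' s \<omega>) + ?n (Q1' s \<omega> - Y1' s \<omega>) + ?n (Q2' s \<omega> - Y2' s \<omega>)) \<partial>M)"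
    unfolding nn2_def
  proof (rule nn_integral_mono)
    fix \<omega> assume w: "\<omega> \<in> space M"
    show "?n (gen P Q1 Q2 P' Q1' Q2' s \<omega> - gen X Y1 Y2 X' Y1' Y2' s \<omega>) \<le> ennreal (6 * L\<^sup>2) * (?n (P s \<omega> - X s \<omega>) + ?n (Q1 s \<omega> - Y1 s \<omega>) + ?n (Q2 s \<omega> - Y2 s \<omega>)
      + ?n (P' s \<omega> - X' s \<omega>) + ?n (Q1' s \<omega> - Y1' s \<omega>) + ?n (Q2' s \<omega> - Y2' s \<omega>))"
    proof (cases "\<omega> \<in> N0")
      case False
      define a where "a = norm (P s \<omega> - X s \<omega>)"
      define b where "b = norm (Q1 s \<omega> - Y1 s \<omega>)"
      define c where "c = norm (Q2 s \<omega> - Y2 s \<omega>)"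
      define d where "d = norm (P' s \<omega> - X' s \<omega>)"
      define e where "e = norm (Q1' s \<omega> - Y1' s \<omega>)"
      define f where "f = norm (Q2' s \<omega> - Y2' s \<omega>)"
      have "norm (gen P Q1 Q2 P' Q1' Q2' s \<omega> - gen X Y1 Y2 X' Y1' Y2' s \<omega>) \<le> L * (a + b + c + d + e + f)"
        unfolding gen_def a_def b_def c_def d_def e_def f_def using lip[OF w False s] False by simp
      then have "(norm (gen P Q1 Q2 P' Q1' Q2' s \<omega> - gen X Y1 Y2 X' Y1' Y2' s \<omega>))\<^sup>2 \<le> (L * (a + b + c + d + e + f))\<^sup>2"
        by (rule power_mono) simp
      also have "\<dots> \<le> L\<^sup>2 * (6 * (a\<^sup>2 + b\<^sup>2 + c\<^sup>2 + d\<^sup>2 + e\<^sup>2 + f\<^sup>2))"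
        unfolding power_mult_distrib by (intro mult_left_mono sum6_power2_le) simp
      finally have "?n (gen P Q1 Q2 P' Q1' Q2' s \<omega> - gen X Y1 Y2 X' Y1' Y2' s \<omega>) \<le> ennreal (6 * L\<^sup>2 * (a\<^sup>2 + b\<^sup>2 + c\<^sup>2 + d\<^sup>2 + e\<^sup>2 + f\<^sup>2))"
        by (intro ennreal_leI) (simp add: algebra_simps)
      also have "\<dots> = ennreal (6 * L\<^sup>2) * ennreal (a\<^sup>2 + b\<^sup>2 + c\<^sup>2 + d\<^sup>2 + e\<^sup>2 + f\<^sup>2)" by (rule ennreal_mult) auto
      also have "ennreal (a\<^sup>2 + b\<^sup>2 + c\<^sup>2 + d\<^sup>2 + e\<^sup>2 + f\<^sup>2) = ennreal (a\<^sup>2) + ennreal (b\<^sup>2) + ennreal (c\<^sup>2) + ennreal (d\<^sup>2) + ennreal (e\<^sup>2) + ennreal (f\<^sup>2)"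
        by (simp add: ennreal_plus)
      finally show ?thesis unfolding a_def b_def c_def d_def e_def f_def .
    qed (simp add: gen_def)
  qed
  also have "\<dots> = ennreal (6 * L\<^sup>2) * (\<integral>\<^sup>+\<omega>. ?n (P s \<omega> - X s \<omega>) + ?n (Q1 s \<omega> - Y1 s \<omega>) + ?n (Q2 s \<omega> - Y2 s \<omega>)
      + ?n (P' s \<omega> - X' s \<omega>) + ?n (Q1' s \<omega> - Y1' s \<omega>) + ?n (Q2' s \<omega> - Y2' s \<omega>) \<partial>M)"
    by (rule nn_integral_cmult) measurable
  also have "\<dots> = ennreal (6 * L\<^sup>2) *
    (nn2 M (\<lambda>\<omega>. P s \<omega> - X s \<omega>) + nn2 M (\<lambda>\<omega>. Q1 s \<omega> - Y1 s \<omega>) + nn2 M (\<lambda>\<omega>. Q2 s \<omega> - Y2 s \<omega>)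
     + nn2 M (\<lambda>\<omega>. P' s \<omega> - X' s \<omega>) + nn2 M (\<lambda>\<omega>. Q1' s \<omega> - Y1' s \<omega>) + nn2 M (\<lambda>\<omega>. Q2' s \<omega> - Y2' s \<omega>))"
    unfolding nn2_def by (simp add: nn_integral_add)
  finally show ?thesis .
qed

text \<open>The three filtered differences are bounded by the three plain ones, which doubles the
  constant from 6 to 12.\<close>

lemma gen_wnorm:
  assumes u: "P \<in> L2_proc M Fl T" "Q1 \<in> L2_proc M Fl T" "Q2 \<in> L2_proc M Fl T"
      "X \<in> L2_proc M Fl T" "Y1 \<in> L2_proc M Fl T" "Y2 \<in> L2_proc M Fl T"
    and h: "is_filtered_version M T W1 P P'" "is_filtered_version M T W1 Q1 Q1'" "is_filtered_version M T W1 Q2 Q2'"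
      "is_filtered_version M T W1 X X'" "is_filtered_version M T W1 Y1 Y1'" "is_filtered_version M T W1 Y2 Y2'"
  shows "wnorm \<mu> (\<lambda>s \<omega>. gen P Q1 Q2 P' Q1' Q2' s \<omega> - gen X Y1 Y2 X' Y1' Y2' s \<omega>) \<le> ennreal (12 * L\<^sup>2) *
    (wnorm \<mu> (\<lambda>s \<omega>. P s \<omega> - X s \<omega>) + (wnorm \<mu> (\<lambda>s \<omega>. Q1 s \<omega> - Y1 s \<omega>) + wnorm \<mu> (\<lambda>s \<omega>. Q2 s \<omega> - Y2 s \<omega>)))"
proof -
  note uj = u[THEN L2_proc_joint]
  have hj: "joint P'" "joint Q1'"
     "joint Q2'" "joint X'"
     "joint Y1'" "joint Y2'"
    using h unfolding is_filtered_version_iff by blast+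
  note j1 = joint_diff[OF uj(1) uj(4)] and j2 = joint_diff[OF uj(2) uj(5)] and j3 = joint_diff[OF uj(3) uj(6)]
    and j4 = joint_diff[OF hj(1) hj(4)] and j5 = joint_diff[OF hj(2) hj(5)] and j6 = joint_diff[OF hj(3) hj(6)]
  let ?w = "\<lambda>s. ennreal (exp (4 * \<mu> * s))"
  let ?n1 = "\<lambda>s. nn2 M (\<lambda>\<omega>. P s \<omega> - X s \<omega>)" and ?n2 = "\<lambda>s. nn2 M (\<lambda>\<omega>. Q1 s \<omega> - Y1 s \<omega>)" and ?n3 = "\<lambda>s. nn2 M (\<lambda>\<omega>. Q2 s \<omega> - Y2 s \<omega>)"
    and ?n4 = "\<lambda>s. nn2 M (\<lambda>\<omega>. P' s \<omega> - X' s \<omega>)" and ?n5 = "\<lambda>s. nn2 M (\<lambda>\<omega>. Q1' s \<omega> - Y1' s \<omega>)" and ?n6 = "\<lambda>s. nn2 M (\<lambda>\<omega>. Q2' s \<omega> - Y2' s \<omega>)"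
  note [measurable] = nn2_time_measurable[OF j1] nn2_time_measurable[OF j2] nn2_time_measurable[OF j3]
    nn2_time_measurable[OF j4] nn2_time_measurable[OF j5] nn2_time_measurable[OF j6]
  have "wnorm \<mu> (\<lambda>s \<omega>. gen P Q1 Q2 P' Q1' Q2' s \<omega> - gen X Y1 Y2 X' Y1' Y2' s \<omega>)
    \<le> (\<integral>\<^sup>+s. ennreal (6 * L\<^sup>2) * (?w s * ?n1 s + ?w s * ?n2 s + ?w s * ?n3 s + ?w s * ?n4 s + ?w s * ?n5 s + ?w s * ?n6 s) \<partial>Tm)"
    unfolding wnorm_def
  proof (rule nn_integral_mono)
    fix s assume "s \<in> space Tm"
    then have s: "s \<in> {0..T}" by (simp add: space_Tm)
    have "?w s * nn2 M (\<lambda>\<omega>. gen P Q1 Q2 P' Q1' Q2' s \<omega> - gen X Y1 Y2 X' Y1' Y2' s \<omega>)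
      \<le> ?w s * (ennreal (6 * L\<^sup>2) * (?n1 s + ?n2 s + ?n3 s + ?n4 s + ?n5 s + ?n6 s))"
      by (intro mult_left_mono gen_diff s proc_section[OF j1] proc_section[OF j2] proc_section[OF j3] proc_section[OF j4] proc_section[OF j5] proc_section[OF j6]) simp
    also have "\<dots> = ennreal (6 * L\<^sup>2) * (?w s * ?n1 s + ?w s * ?n2 s + ?w s * ?n3 s + ?w s * ?n4 s + ?w s * ?n5 s + ?w s * ?n6 s)"
      by (simp only: distrib_left mult.left_commute)
    finally show "?w s * nn2 M (\<lambda>\<omega>. gen P Q1 Q2 P' Q1' Q2' s \<omega> - gen X Y1 Y2 X' Y1' Y2' s \<omega>)
      \<le> ennreal (6 * L\<^sup>2) * (?w s * ?n1 s + ?w s * ?n2 s + ?w s * ?n3 s + ?w s * ?n4 s + ?w s * ?n5 s + ?w s * ?n6 s)" .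
  qed
  also have "\<dots> = ennreal (6 * L\<^sup>2) * (\<integral>\<^sup>+s. ?w s * ?n1 s + ?w s * ?n2 s + ?w s * ?n3 s + ?w s * ?n4 s + ?w s * ?n5 s + ?w s * ?n6 s \<partial>Tm)"
    by (rule nn_integral_cmult) measurable
  also have "(\<integral>\<^sup>+s. ?w s * ?n1 s + ?w s * ?n2 s + ?w s * ?n3 s + ?w s * ?n4 s + ?w s * ?n5 s + ?w s * ?n6 s \<partial>Tm)
    = wnorm \<mu> (\<lambda>s \<omega>. P s \<omega> - X s \<omega>) + wnorm \<mu> (\<lambda>s \<omega>. Q1 s \<omega> - Y1 s \<omega>) + wnorm \<mu> (\<lambda>s \<omega>. Q2 s \<omega> - Y2 s \<omega>)
      + wnorm \<mu> (\<lambda>s \<omega>. P' s \<omega> - X' s \<omega>) + wnorm \<mu> (\<lambda>s \<omega>. Q1' s \<omega> - Y1' s \<omega>) + wnorm \<mu> (\<lambda>s \<omega>. Q2' s \<omega> - Y2' s \<omega>)"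
    unfolding wnorm_def by (simp add: nn_integral_add)
  also have "\<dots> \<le> wnorm \<mu> (\<lambda>s \<omega>. P s \<omega> - X s \<omega>) + wnorm \<mu> (\<lambda>s \<omega>. Q1 s \<omega> - Y1 s \<omega>) + wnorm \<mu> (\<lambda>s \<omega>. Q2 s \<omega> - Y2 s \<omega>)
      + wnorm \<mu> (\<lambda>s \<omega>. P s \<omega> - X s \<omega>) + wnorm \<mu> (\<lambda>s \<omega>. Q1 s \<omega> - Y1 s \<omega>) + wnorm \<mu> (\<lambda>s \<omega>. Q2 s \<omega> - Y2 s \<omega>)"
    by (intro add_mono order_refl wnorm_filtered u h)
  also have "\<dots> = 2 * (wnorm \<mu> (\<lambda>s \<omega>. P s \<omega> - X s \<omega>) + (wnorm \<mu> (\<lambda>s \<omega>. Q1 s \<omega> - Y1 s \<omega>) + wnorm \<mu> (\<lambda>s \<omega>. Q2 s \<omega> - Y2 s \<omega>)))"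
    by (simp only: mult_2 ac_simps)
  finally have "wnorm \<mu> (\<lambda>s \<omega>. gen P Q1 Q2 P' Q1' Q2' s \<omega> - gen X Y1 Y2 X' Y1' Y2' s \<omega>) \<le> ennreal (6 * L\<^sup>2) *
    (2 * (wnorm \<mu> (\<lambda>s \<omega>. P s \<omega> - X s \<omega>) + (wnorm \<mu> (\<lambda>s \<omega>. Q1 s \<omega> - Y1 s \<omega>) + wnorm \<mu> (\<lambda>s \<omega>. Q2 s \<omega> - Y2 s \<omega>))))"
    by (simp add: mult_left_mono)
  moreover have "ennreal (6 * L\<^sup>2) * 2 = ennreal (12 * L\<^sup>2)"
    using ennreal_mult[of "6 * L\<^sup>2" 2] by simp
  ultimately show ?thesis by (simp only: mult.assoc[symmetric])
qed

text \<open>A relation, not a function, since \<open>F\<close> depends on the chosen solution and on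
  the chosen filtered versions. The estimates hold for all choices, which lets the same relation
  serve existence and uniqueness.\<close>

definition picard_step where
  "picard_step f P Q1 Q2 F \<longleftrightarrow> frozen f P Q1 Q2 \<and> (AE \<omega> in M. P T \<omega> = \<zeta> \<omega>) \<and>
     (\<exists>Ph Q1h Q2h. is_filtered_version M T W1 P Ph \<and> is_filtered_version M T W1 Q1 Q1h \<and> is_filtered_version M T W1 Q2 Q2h \<and>
        F = gen P Q1 Q2 Ph Q1h Q2h)"

lemma picard_step_L2:
  assumes "picard_step f P Q1 Q2 F"
  shows "P \<in> S2_proc M Fl T" "P \<in> L2_proc M Fl T" "Q1 \<in> L2_proc M Fl T" "Q2 \<in> L2_proc M Fl T"
  using assms S2_L2_proc unfolding picard_step_def frozen_def by blast+

lemma picard_step_joint: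
  assumes p: "picard_step f P Q1 Q2 F"
  shows "joint F"
proof -
  obtain Ph Q1h Q2h where h: "is_filtered_version M T W1 P Ph" "is_filtered_version M T W1 Q1 Q1h" "is_filtered_version M T W1 Q2 Q2h"
    and F: "F = gen P Q1 Q2 Ph Q1h Q2h"
    using p unfolding picard_step_def by blast
  have hj: "joint Ph" "joint Q1h"
     "joint Q2h"
    using h unfolding is_filtered_version_iff by blast+
  show ?thesis
    unfolding F by (rule gen_joint[OF picard_step_L2(2-4)[OF p, THEN L2_proc_joint] hj])
qed

lemma picard_step_wnorm:
  assumes p: "picard_step f P Q1 Q2 F" "picard_step f' P' Q1' Q2' F'"
  shows "wnorm \<mu> (\<lambda>s \<omega>. F s \<omega> - F' s \<omega>) \<le> ennreal (12 * L\<^sup>2) *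
    (wnorm \<mu> (\<lambda>s \<omega>. P s \<omega> - P' s \<omega>) + (wnorm \<mu> (\<lambda>s \<omega>. Q1 s \<omega> - Q1' s \<omega>) + wnorm \<mu> (\<lambda>s \<omega>. Q2 s \<omega> - Q2' s \<omega>)))"
proof -
  obtain Ph Q1h Q2h where h: "is_filtered_version M T W1 P Ph" "is_filtered_version M T W1 Q1 Q1h" "is_filtered_version M T W1 Q2 Q2h"
    and F: "F = gen P Q1 Q2 Ph Q1h Q2h"
    using p(1) unfolding picard_step_def by blast
  obtain Ph' Q1h' Q2h' where h': "is_filtered_version M T W1 P' Ph'" "is_filtered_version M T W1 Q1' Q1h'" "is_filtered_version M T W1 Q2' Q2h'"
    and F': "F' = gen P' Q1' Q2' Ph' Q1h' Q2h'"
    using p(2) unfolding picard_step_def by blast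
  show ?thesis unfolding F F'
    by (rule gen_wnorm[OF picard_step_L2(2-4)[OF p(1)] picard_step_L2(2-4)[OF p(2)] h h'])
qed

text \<open>With \<open>48 = 4 * 12\<close>, the Lipschitz factor \<open>12 * L^2\<close> times the
  gain \<open>1 / rate\<close> is at most 1/4; the summand 1 ensures \<open>rate \<ge> 1\<close>,
  also for \<open>L = 0\<close>.\<close>

definition rate :: real where "rate = 48 * L\<^sup>2 + 1"

lemma rate: "1 \<le> rate" "0 < rate" "12 * L\<^sup>2 * (1 / rate) \<le> 1 / 4"
proof -
  show r: "1 \<le> rate" by (simp add: rate_def)
  then show r': "0 < rate" by simp
  have "12 * L\<^sup>2 \<le> 1 / 4 * rate" by (simp add: rate_def)
  then show "12 * L\<^sup>2 * (1 / rate) \<le> 1 / 4"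
    using r' by (simp add: field_simps)
qed

lemma picard_step_end:
  assumes p: "picard_step f P Q1 Q2 F" "picard_step f' P' Q1' Q2' F'"
  shows "AE \<omega> in M. P T \<omega> = P' T \<omega>"
proof -
  have "AE \<omega> in M. P T \<omega> = \<zeta> \<omega>" "AE \<omega> in M. P' T \<omega> = \<zeta> \<omega>" using p unfolding picard_step_def by blast+
  then show ?thesis by eventually_elim simp
qed

lemma picard_step_contraction:
  assumes p: "picard_step f P Q1 Q2 F" "picard_step f' P' Q1' Q2' F'"
    and f: "joint f" and f': "joint f'"
  shows "wnorm rate (\<lambda>s \<omega>. F s \<omega> - F' s \<omega>) \<le> ennreal (1 / 4) * wnorm rate (\<lambda>s \<omega>. f s \<omega> - f' s \<omega>)"
proof -
  have fr: "frozen f P Q1 Q2" "frozen f' P' Q1' Q2'" using p unfolding picard_step_def by blast+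
  have "wnorm rate (\<lambda>s \<omega>. F s \<omega> - F' s \<omega>) \<le> ennreal (12 * L\<^sup>2) * (ennreal (1 / rate) * wnorm rate (\<lambda>s \<omega>. f s \<omega> - f' s \<omega>))"
    using picard_step_wnorm[OF p] frozen_contraction[OF fr picard_step_end[OF p] f f' rate(1)]
    by (rule order_trans[OF _ mult_left_mono]) simp
  also have "\<dots> = ennreal (12 * L\<^sup>2 * (1 / rate)) * wnorm rate (\<lambda>s \<omega>. f s \<omega> - f' s \<omega>)"
    using rate(2) by (simp only: mult.assoc[symmetric]) (subst ennreal_mult, auto)
  also have "\<dots> \<le> ennreal (1 / 4) * wnorm rate (\<lambda>s \<omega>. f s \<omega> - f' s \<omega>)"
    by (intro mult_right_mono ennreal_leI rate(3)) simp
  finally show ?thesis .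
qed

lemma L2_diff_sq_int:
  fixes u v :: "real \<Rightarrow> 'w \<Rightarrow> real^'n"
  assumes "u \<in> L2_proc M Fl T" "v \<in> L2_proc M Fl T"
  shows "sq_int (proc_space T M) (\<lambda>(s, \<omega>). u s \<omega> - v s \<omega>)"
  using sq_int_diff[OF assms[THEN L2_proc_sq_int]] by (simp add: case_prod_unfold)

lemma L2_diff_wnorm:
  fixes u v :: "real \<Rightarrow> 'w \<Rightarrow> real^'n"
  assumes "u \<in> L2_proc M Fl T" "v \<in> L2_proc M Fl T"
  shows "wnorm rate (\<lambda>s \<omega>. u s \<omega> - v s \<omega>) < \<infinity>"
  using L2_diff_sq_int[OF assms] wnorm_finite[OF joint_diff[OF assms[THEN L2_proc_joint]] rate(2)] by blast

text \<open>Square-integrability of the output follows from comparison with \<open>G\<close>, the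
  generator along zero processes, through the Lipschitz estimate; progressive filtered versions make
  the output progressive.\<close>

lemma picard_step_exists:
  assumes f: "f \<in> L2_proc M Fl T"
  shows "\<exists>P Q1 Q2 F. picard_step f P Q1 Q2 F \<and> F \<in> L2_proc M Fl T"
proof -
  obtain P Q1 Q2 where fr: "frozen f P Q1 Q2" "AE \<omega> in M. P T \<omega> = \<zeta> \<omega>"
    using frozen_exists[OF f zeta] by blast
  have S: "P \<in> L2_proc M Fl T" "Q1 \<in> L2_proc M Fl T" "Q2 \<in> L2_proc M Fl T"
    using fr(1) S2_L2_proc unfolding frozen_def by blast+
  obtain Ph where Ph: "progressive Fl T Ph" "is_filtered_version M T W1 P Ph" using filtered_version_exists[OF S(1)] by blast
  obtain Q1h where Q1h: "progressive Fl T Q1h" "is_filtered_version M T W1 Q1 Q1h" using filtered_version_exists[OF S(2)] by blast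
  obtain Q2h where Q2h: "progressive Fl T Q2h" "is_filtered_version M T W1 Q2 Q2h" using filtered_version_exists[OF S(3)] by blast
  define F where "F = gen P Q1 Q2 Ph Q1h Q2h"
  let ?z = "\<lambda>(t::real) (\<omega>::'w). 0 :: real^'n"
  define G where "G = gen ?z ?z ?z ?z ?z ?z"
  have p: "picard_step f P Q1 Q2 F"
    unfolding picard_step_def F_def using fr Ph(2) Q1h(2) Q2h(2) by blast
  have Fp: "progressive Fl T F"
    unfolding F_def using S Ph(1) Q1h(1) Q2h(1) by (intro gen_progressive) (auto simp: L2_proc_iff)
  note z = L2_proc_joint[OF zero_L2_proc]
  have Gj: "joint G"
    unfolding G_def by (rule gen_joint[OF z z z z z z])
  have "AE x in proc_space T M. norm ((\<lambda>(s, \<omega>). G s \<omega>) x) \<le> norm ((\<lambda>(s, \<omega>). g \<omega> s 0 0 0 0 0 0) x)"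
    by (rule AE_I2) (auto simp: G_def gen_def)
  then have Gs: "sq_int (proc_space T M) (\<lambda>(s, \<omega>). G s \<omega>)"
    by (rule sq_int_bound[OF L2_proc_sq_int[OF g_zero] Gj])
  have "wnorm rate (\<lambda>s \<omega>. F s \<omega> - G s \<omega>) \<le> ennreal (12 * L\<^sup>2) *
    (wnorm rate (\<lambda>s \<omega>. P s \<omega> - 0) + (wnorm rate (\<lambda>s \<omega>. Q1 s \<omega> - 0) + wnorm rate (\<lambda>s \<omega>. Q2 s \<omega> - 0)))"
    unfolding F_def G_def
    by (rule gen_wnorm[OF S zero_L2_proc zero_L2_proc zero_L2_proc Ph(2) Q1h(2) Q2h(2) filtered_zero filtered_zero filtered_zero])
  also have "\<dots> < \<infinity>"
    using S[THEN L2_diff_wnorm[OF _ zero_L2_proc]] by (simp add: ennreal_mult_less_top)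
  finally have "sq_int (proc_space T M) (\<lambda>(s, \<omega>). F s \<omega> - G s \<omega>)"
    using wnorm_finite[OF joint_diff[OF picard_step_joint[OF p] Gj] rate(2)] by blast
  from sq_int_add[OF this Gs] have "sq_int (proc_space T M) (\<lambda>(s, \<omega>). F s \<omega>)"
    by (simp add: case_prod_unfold)
  then have "F \<in> L2_proc M Fl T"
    using Fp sq_int_finite by (auto simp: L2_proc_iff proc_norm_nn2)
  with p show ?thesis by blast
qed

text \<open>One output is chosen for each drift, and the contraction holds for any choice. The
  iterates from 0 have weighted increments at most \<open>C / 4 ^ k\<close>; their limit is a fixed
  point up to a null set of the product space.\<close>

lemma picard_fixed_point:
  "\<exists>f P Q1 Q2 F. f \<in> L2_proc M Fl T \<and> picard_step f P Q1 Q2 F \<and> (AE x in proc_space T M. (\<lambda>(s, \<omega>). F s \<omega> - f s \<omega>) x = 0)"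
proof -
  have "\<forall>f. \<exists>F. f \<in> L2_proc M Fl T \<longrightarrow> F \<in> L2_proc M Fl T \<and> (\<exists>P Q1 Q2. picard_step f P Q1 Q2 F)"
    using picard_step_exists by blast
  from choice[OF this] obtain \<Phi> where \<Phi>: "\<forall>f. f \<in> L2_proc M Fl T \<longrightarrow> \<Phi> f \<in> L2_proc M Fl T \<and> (\<exists>P Q1 Q2. picard_step f P Q1 Q2 (\<Phi> f))"
    by blast
  have con: "wnorm rate (\<lambda>s \<omega>. \<Phi> f s \<omega> - \<Phi> f' s \<omega>) \<le> ennreal (1 / 4) * wnorm rate (\<lambda>s \<omega>. f s \<omega> - f' s \<omega>)"
    if ff: "f \<in> L2_proc M Fl T" "f' \<in> L2_proc M Fl T" for f f'
  proof -
    obtain P Q1 Q2 P' Q1' Q2' where "picard_step f P Q1 Q2 (\<Phi> f)" "picard_step f' P' Q1' Q2' (\<Phi> f')"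
      using \<Phi> ff by blast
    from picard_step_contraction[OF this ff[THEN L2_proc_joint]] show ?thesis .
  qed
  define x where "x k = (\<Phi> ^^ k) (\<lambda>t \<omega>. 0)" for k
  have xS: "x (Suc k) = \<Phi> (x k)" for k by (simp add: x_def)
  have xL: "x k \<in> L2_proc M Fl T" for k
  proof (induction k)
    case 0
    show ?case unfolding x_def funpow_0 by (rule zero_L2_proc)
  next
    case (Suc k)
    then show ?case unfolding xS using \<Phi> by blast
  qed
  define C where "C = enn2real (wnorm rate (\<lambda>s \<omega>. x 1 s \<omega> - x 0 s \<omega>))"
  have C0: "C \<ge> 0" by (simp add: C_def)
  have st: "wnorm rate (\<lambda>s \<omega>. x (Suc k) s \<omega> - x k s \<omega>) \<le> ennreal (C / 4 ^ k)" for k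
  proof (induction k)
    case 0
    show ?case using L2_diff_wnorm[OF xL xL, of 1 0] by (simp add: C_def)
  next
    case (Suc k)
    have "wnorm rate (\<lambda>s \<omega>. x (Suc (Suc k)) s \<omega> - x (Suc k) s \<omega>) \<le> ennreal (1 / 4) * wnorm rate (\<lambda>s \<omega>. x (Suc k) s \<omega> - x k s \<omega>)"
      using con[OF xL xL, of "Suc k" k] unfolding xS[symmetric] .
    also have "\<dots> \<le> ennreal (1 / 4) * ennreal (C / 4 ^ k)" by (intro mult_left_mono Suc) simp
    also have "\<dots> = ennreal (C / 4 ^ Suc k)" using C0 by (subst ennreal_mult[symmetric]) auto
    finally show ?case .
  qed
  have "proc_norm M 0 T (\<lambda>s \<omega>. x (Suc k) s \<omega> - x k s \<omega>) \<le> ennreal (C / 4 ^ k)" for k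
    using wnorm_bounds(1)[OF joint_diff[OF xL[THEN L2_proc_joint] xL[THEN L2_proc_joint]] rate(2)] st by (rule order_trans)
  then obtain H where H: "H \<in> L2_proc M Fl T" "(\<lambda>k. proc_norm M 0 T (\<lambda>t \<omega>. H t \<omega> - x k t \<omega>)) \<longlonglongrightarrow> 0"
    using L2_proc_limit[of x C, OF xL _ C0] by blast
  have \<Phi>H: "\<Phi> H \<in> L2_proc M Fl T" using \<Phi> H(1) by blast
  let ?m = "\<lambda>u (s, \<omega>). (u :: real \<Rightarrow> 'w \<Rightarrow> real^'n) s \<omega>"
  let ?N = "proc_space T M"
  have jd: "?m (\<lambda>s \<omega>. u s \<omega> - v s \<omega>) \<in> borel_measurable ?N" if "u \<in> L2_proc M Fl T" "v \<in> L2_proc M Fl T" for u v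
    using that by (intro joint_diff L2_proc_joint)
  have l1: "(\<lambda>k. nn2 ?N (?m (\<lambda>s \<omega>. H s \<omega> - x k s \<omega>))) \<longlonglongrightarrow> 0"
    using H(2) unfolding nn2_proc_space[OF jd[OF H(1) xL]] .
  \<comment> \<open>As \<open>x (Suc k)\<close> is \<open>\<Phi> (x k)\<close>, the contraction
    compares it with \<open>\<Phi> H\<close>; equivalence of the weighted and plain norms does the
    rest.\<close>
  have le: "nn2 ?N (?m (\<lambda>s \<omega>. \<Phi> H s \<omega> - x (Suc k) s \<omega>)) \<le> ennreal (1 / 4) * (ennreal (exp (4 * rate * T)) * proc_norm M 0 T (\<lambda>s \<omega>. H s \<omega> - x k s \<omega>))" for k
  proof -
    have "nn2 ?N (?m (\<lambda>s \<omega>. \<Phi> H s \<omega> - x (Suc k) s \<omega>)) \<le> wnorm rate (\<lambda>s \<omega>. \<Phi> H s \<omega> - x (Suc k) s \<omega>)"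
      unfolding nn2_proc_space[OF jd[OF \<Phi>H xL]] by (rule wnorm_bounds(1)[OF jd[OF \<Phi>H xL] rate(2)])
    also have "\<dots> \<le> ennreal (1 / 4) * wnorm rate (\<lambda>s \<omega>. H s \<omega> - x k s \<omega>)"
      unfolding xS by (rule con[OF H(1) xL])
    also have "\<dots> \<le> ennreal (1 / 4) * (ennreal (exp (4 * rate * T)) * proc_norm M 0 T (\<lambda>s \<omega>. H s \<omega> - x k s \<omega>))"
      by (intro mult_left_mono wnorm_bounds(2)[OF jd[OF H(1) xL] rate(2)]) simp
    finally show ?thesis .
  qed
  have "(\<lambda>k. ennreal (1 / 4) * (ennreal (exp (4 * rate * T)) * proc_norm M 0 T (\<lambda>s \<omega>. H s \<omega> - x k s \<omega>)))
    \<longlonglongrightarrow> ennreal (1 / 4) * (ennreal (exp (4 * rate * T)) * 0)"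
    by (intro ennreal_tendsto_cmult H(2)) auto
  then have l2: "(\<lambda>k. nn2 ?N (?m (\<lambda>s \<omega>. \<Phi> H s \<omega> - x (Suc k) s \<omega>))) \<longlonglongrightarrow> 0"
    by (intro tendsto_sandwich[OF _ always_eventually[OF allI[OF le]] tendsto_const]) auto
  from nn2_tendsto_diff[OF jd[OF \<Phi>H xL] jd[OF H(1) xL] l2 LIMSEQ_Suc[OF l1]]
  have "(\<lambda>k. nn2 ?N (?m (\<lambda>s \<omega>. \<Phi> H s \<omega> - H s \<omega>))) \<longlonglongrightarrow> 0"
    by (simp add: case_prod_unfold)
  then have "nn2 ?N (?m (\<lambda>s \<omega>. \<Phi> H s \<omega> - H s \<omega>)) = 0" by (simp only: LIMSEQ_const_iff)
  from nn2_zero_AE[OF jd[OF \<Phi>H H(1)] this]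
  show ?thesis using H(1) \<Phi> by blast
qed

text \<open>Drifts that agree almost everywhere on the product have, for almost every path, the same
  integral up to every \<open>t\<close>. This upgrades the fixed point to an exact one, with
  \<open>F\<close> itself as the drift.\<close>

lemma frozen_cong:
  fixes f F :: "real \<Rightarrow> 'w \<Rightarrow> real^'n"
  assumes fr: "frozen f P Q1 Q2" and f: "joint f"
    and F: "joint F" and e: "AE x in proc_space T M. (\<lambda>(s, \<omega>). F s \<omega> - f s \<omega>) x = 0"
  shows "frozen F P Q1 Q2"
proof -
  obtain I1 I2 where I: "P \<in> S2_proc M Fl T" "Q1 \<in> L2_proc M Fl T" "Q2 \<in> L2_proc M Fl T"
      "ito_integral M Fl T W1 Q1 I1" "ito_integral M Fl T W2 Q2 I2"
    and i: "AE \<omega> in M. set_integrable lborel {0..T} (\<lambda>s. f s \<omega>)"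
    and eq: "AE \<omega> in M. \<forall>t\<in>{0..T}. P t \<omega> = P 0 \<omega> + (LINT s:{0..t}|lborel. f s \<omega>) + I1 t \<omega> + I2 t \<omega>"
    using fr unfolding frozen_def by blast
  have AEe: "AE \<omega> in M. AE s in lborel. s \<in> {0..T} \<longrightarrow> F s \<omega> - f s \<omega> = 0"
    by (rule AE_joint_swap[OF joint_diff[OF F f] e])
  have c: "integrable lborel (\<lambda>s. indicator {0..t} s *\<^sub>R f s \<omega>) = integrable lborel (\<lambda>s. indicator {0..t} s *\<^sub>R F s \<omega>) \<and>
      integral\<^sup>L lborel (\<lambda>s. indicator {0..t} s *\<^sub>R f s \<omega>) = integral\<^sup>L lborel (\<lambda>s. indicator {0..t} s *\<^sub>R F s \<omega>)"
    if w: "\<omega> \<in> space M" and t: "t \<in> {0..T}" and ae: "AE s in lborel. s \<in> {0..T} \<longrightarrow> F s \<omega> - f s \<omega> = 0" for \<omega> t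
  proof -
    have "t \<le> T" using t by simp
    note m = proc_set_measurable[OF f w order_refl this, unfolded set_borel_measurable_def] proc_set_measurable[OF F w order_refl this, unfolded set_borel_measurable_def]
    have "AE s in lborel. indicator {0..t} s *\<^sub>R f s \<omega> = indicator {0..t} s *\<^sub>R F s \<omega>"
      using ae by eventually_elim (use t in \<open>auto simp: indicator_def\<close>)
    then show ?thesis by (intro conjI integrable_cong_AE integral_cong_AE m)
  qed
  have "AE \<omega> in M. set_integrable lborel {0..T} (\<lambda>s. F s \<omega>)"
    using i AEe AE_space
  proof eventually_elim
    case (elim \<omega>)
    have "T \<in> {0..T}" using T_pos by simp
    from c[OF elim(3) this elim(2)] elim(1) show ?case unfolding set_integrable_def by blast
  qed
  moreover have "AE \<omega> in M. \<forall>t\<in>{0..T}. P t \<omega> = P 0 \<omega> + (LINT s:{0..t}|lborel. F s \<omega>) + I1 t \<omega> + I2 t \<omega>"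
    using eq AEe AE_space
  proof eventually_elim
    case (elim \<omega>)
    show ?case
    proof
      fix t assume t: "t \<in> {0..T}"
      have "(LINT s:{0..t}|lborel. F s \<omega>) = (LINT s:{0..t}|lborel. f s \<omega>)"
        unfolding set_lebesgue_integral_def using conjunct2[OF c[OF elim(3) t elim(2)]] by (rule sym)
      then show "P t \<omega> = P 0 \<omega> + (LINT s:{0..t}|lborel. F s \<omega>) + I1 t \<omega> + I2 t \<omega>"
        using bspec[OF elim(1) t] by (simp only:)
    qed
  qed
  ultimately show ?thesis unfolding frozen_def using I by blast
qed

text \<open>Off \<open>N0\<close> the processes \<open>gen\<close> and \<open>g\<close> coincide. A
  solution carries its own filtered versions, and the generator along them is both the drift and the
  output of the step.\<close>

lemma solution_iff_picard_step:
  "bsde_filtering_solution M T W1 W2 g \<zeta> P Q1 Q2 \<longleftrightarrow> (\<exists>F. picard_step F P Q1 Q2 F)"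
proof -
  let ?g = "\<lambda>Ph Q1h Q2h s \<omega>. g \<omega> s (P s \<omega>) (Q1 s \<omega>) (Q2 s \<omega>) (Ph s \<omega>) (Q1h s \<omega>) (Q2h s \<omega>)"
  have e: "AE \<omega> in M. \<forall>s. gen P Q1 Q2 Ph Q1h Q2h s \<omega> = ?g Ph Q1h Q2h s \<omega>" for Ph Q1h Q2h
    using AE_not_in[OF N0] by eventually_elim (simp add: gen_def)
  have "(AE \<omega> in M. set_integrable lborel {0..T} (\<lambda>s. gen P Q1 Q2 Ph Q1h Q2h s \<omega>)) \<longleftrightarrow>
      (AE \<omega> in M. set_integrable lborel {0..T} (\<lambda>s. ?g Ph Q1h Q2h s \<omega>))" for Ph Q1h Q2h
    by (rule eventually_subst) (use e[of Ph Q1h Q2h] in eventually_elim, simp)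
  moreover have "(AE \<omega> in M. \<forall>t\<in>{0..T}. P t \<omega> = P 0 \<omega> + (LINT s:{0..t}|lborel. gen P Q1 Q2 Ph Q1h Q2h s \<omega>) + I1 t \<omega> + I2 t \<omega>) \<longleftrightarrow>
      (AE \<omega> in M. \<forall>t\<in>{0..T}. P t \<omega> = P 0 \<omega> + (LINT s:{0..t}|lborel. ?g Ph Q1h Q2h s \<omega>) + I1 t \<omega> + I2 t \<omega>)" for Ph Q1h Q2h I1 I2
    by (rule eventually_subst) (use e[of Ph Q1h Q2h] in eventually_elim, simp)
  ultimately show ?thesis
    unfolding bsde_filtering_solution_def picard_step_def frozen_def by (simp only: ex_simps[symmetric]) blast
qed

lemma solution_exists: "\<exists>P Q1 Q2. bsde_filtering_solution M T W1 W2 g \<zeta> P Q1 Q2"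
proof -
  obtain f P Q1 Q2 F where f: "f \<in> L2_proc M Fl T" and p: "picard_step f P Q1 Q2 F"
    and e: "AE x in proc_space T M. (\<lambda>(s, \<omega>). F s \<omega> - f s \<omega>) x = 0"
    using picard_fixed_point by blast
  have "frozen f P Q1 Q2" using p unfolding picard_step_def by blast
  from frozen_cong[OF this L2_proc_joint[OF f] picard_step_joint[OF p] e]
  have "picard_step F P Q1 Q2 F" using p unfolding picard_step_def by blast
  then show ?thesis unfolding solution_iff_picard_step by blast
qed

text \<open>Each drift reproduces itself, so the contraction bounds the weighted norm of their
  difference by a quarter of itself.\<close>

lemma solution_unique:
  assumes "bsde_filtering_solution M T W1 W2 g \<zeta> P Q1 Q2" "bsde_filtering_solution M T W1 W2 g \<zeta> P' Q1' Q2'"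
  shows "indistinguishable M T P P' \<and> ae_equal_proc M T Q1 Q1' \<and> ae_equal_proc M T Q2 Q2'"
proof -
  obtain F F' where p: "picard_step F P Q1 Q2 F" "picard_step F' P' Q1' Q2' F'"
    using assms unfolding solution_iff_picard_step by blast
  have fr: "frozen F P Q1 Q2" "frozen F' P' Q1' Q2'" using p unfolding picard_step_def by blast+
  note S = picard_step_L2[OF p(1)] and S' = picard_step_L2[OF p(2)]
  note Fj = picard_step_joint[OF p(1)] and Fj' = picard_step_joint[OF p(2)]
  let ?x = "wnorm rate (\<lambda>s \<omega>. F s \<omega> - F' s \<omega>)"
  have "?x \<le> ennreal (1 / 4) * ?x" by (rule picard_step_contraction[OF p Fj Fj'])
  \<comment> \<open>Finiteness is not built into the relation; the Lipschitz estimate bounds the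
    difference of drifts by differences of square-integrable processes.\<close>
  moreover have "?x < \<infinity>"
    using picard_step_wnorm[OF p, of rate] L2_diff_wnorm[OF S(2) S'(2)] L2_diff_wnorm[OF S(3) S'(3)] L2_diff_wnorm[OF S(4) S'(4)]
    by (elim le_less_trans) (simp add: ennreal_mult_less_top)
  ultimately have x0: "?x = 0"
    by (cases ?x rule: ennreal_cases) (auto simp: ennreal_mult[symmetric] simp del: ennreal_mult)
  have Q: "wnorm rate (\<lambda>s \<omega>. Q1 s \<omega> - Q1' s \<omega>) = 0" "wnorm rate (\<lambda>s \<omega>. Q2 s \<omega> - Q2' s \<omega>) = 0"
    using frozen_contraction[OF fr picard_step_end[OF p] Fj Fj' rate(1)] unfolding x0 by simp_all
  have ae: "ae_equal_proc M T u v" if "u \<in> L2_proc M Fl T" "v \<in> L2_proc M Fl T" "wnorm rate (\<lambda>s \<omega>. u s \<omega> - v s \<omega>) = 0" for u v :: "real \<Rightarrow> 'w \<Rightarrow> real^'n"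
    using wnorm_zero_AE[OF joint_diff[OF that(1,2)[THEN L2_proc_joint]] that(3) rate(2)]
    unfolding ae_equal_proc_def proc_space_def by (simp add: case_prod_unfold)
  \<comment> \<open>The backward estimate gives equality at every single time, where the weighted
    norm alone would give it at almost every time. A dense sequence and continuity then provide one
    null set for all times.\<close>
  have "AE \<omega> in M. P t \<omega> - P' t \<omega> = 0" if t: "t \<in> {0..T}" for t
  proof (rule nn2_zero_AE)
    show "(\<lambda>\<omega>. P t \<omega> - P' t \<omega>) \<in> borel_measurable M"
      using S2_proc_at(2)[OF S(1) t] S2_proc_at(2)[OF S'(1) t] by (intro borel_measurable_diff sq_int_measurable)
    have "nn2 M (\<lambda>\<omega>. P t \<omega> - P' t \<omega>) \<le> nn2 M (\<lambda>\<omega>. LINT s:{t..T}|lborel. F s \<omega> - F' s \<omega>)"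
      using frozen_estimate[OF fr picard_step_end[OF p] t] by (rule order_trans[rotated]) simp
    also have "\<dots> \<le> ennreal (1 / (2 * rate)) * (\<integral>\<^sup>+s. indicator {t..} s * (ennreal (exp (2 * rate * (s - t))) * nn2 M (\<lambda>\<omega>. F s \<omega> - F' s \<omega>)) \<partial>Tm)"
      by (rule time_integral_estimate[OF joint_diff[OF Fj Fj'] t rate(2)])
    also have "\<dots> \<le> ennreal (1 / (2 * rate)) * ?x"
      unfolding wnorm_def
    proof (intro mult_left_mono nn_integral_mono)
      fix s assume "s \<in> space Tm"
      then have "2 * rate * (s - t) \<le> 4 * rate * s" using t rate(2) by (simp add: space_Tm algebra_simps)
      then show "indicator {t..} s * (ennreal (exp (2 * rate * (s - t))) * nn2 M (\<lambda>\<omega>. F s \<omega> - F' s \<omega>)) \<le> ennreal (exp (4 * rate * s)) * nn2 M (\<lambda>\<omega>. F s \<omega> - F' s \<omega>)"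
        by (cases "s \<in> {t..}") (simp_all add: mult_right_mono ennreal_leI)
    qed simp
    finally show "nn2 M (\<lambda>\<omega>. P t \<omega> - P' t \<omega>) = 0" unfolding x0 by simp
  qed
  note at = this
  obtain q :: "nat \<Rightarrow> real" where q: "\<And>n. q n \<in> {0..T}" "{0..T} \<subseteq> closure (range q)" by (rule dense_sequence) blast
  have cl: "closure (range q) = {0..T}"
    using q by (intro antisym closure_minimal) auto
  have "AE \<omega> in M. \<forall>n. P (q n) \<omega> - P' (q n) \<omega> = 0"
    using at q(1) by (subst AE_all_countable) blast
  then have "AE \<omega> in M. \<forall>t\<in>{0..T}. P t \<omega> = P' t \<omega>"
    using AE_space
  proof eventually_elim
    case (elim \<omega>)
    have "continuous_on (closure (range q)) (\<lambda>t. P t \<omega> - P' t \<omega>)"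
      unfolding cl using S(1) S'(1) elim(2) unfolding S2_proc_def by (intro continuous_on_diff) auto
    then have "P t \<omega> - P' t \<omega> = 0" if "t \<in> closure (range q)" for t
      using elim(1) that by (intro continuous_constant_on_closure[of "range q" "\<lambda>t. P t \<omega> - P' t \<omega>" 0 t]) auto
    then show ?case unfolding cl by simp
  qed
  then show ?thesis
    unfolding indistinguishable_def using ae[OF S(3) S'(3) Q(1)] ae[OF S(4) S'(4) Q(2)] by blast
qed

end

lemma AE_null_set: "AE x in M. Q x \<Longrightarrow> \<exists>N\<in>null_sets M. \<forall>x\<in>space M. x \<notin> N \<longrightarrow> Q x"
  unfolding eventually_ae_filter by blast

theorem lemma4p1:
  fixes M :: "'w measure" and T :: real
    and W1 W2 :: "real \<Rightarrow> 'w \<Rightarrow> real"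
    and g :: "'w \<Rightarrow> real \<Rightarrow> real^'n \<Rightarrow> real^'n \<Rightarrow> real^'n \<Rightarrow> real^'n \<Rightarrow> real^'n \<Rightarrow> real^'n \<Rightarrow> real^'n"
    and \<zeta> :: "'w \<Rightarrow> real^'n"
  assumes T: "T > 0"
    and prob: "prob_space M" and complete: "complete_measure M"
    and wiener: "wiener2 M T W1 W2"
    and g_meas: "\<And>p q1 q2 pb q1b q2b.
          progressive (wiener_filt M W1 W2) T (\<lambda>t \<omega>. g \<omega> t p q1 q2 pb q1b q2b)"
    and g_lipschitz: "\<exists>L::real. AE \<omega> in M. \<forall>t\<in>{0..T}.
          \<forall>p q1 q2 pb q1b q2b p' q1' q2' pb' q1b' q2b'.
            norm (g \<omega> t p q1 q2 pb q1b q2b - g \<omega> t p' q1' q2' pb' q1b' q2b')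
            \<le> L * (norm (p - p') + norm (q1 - q1') + norm (q2 - q2')
                   + norm (pb - pb') + norm (q1b - q1b') + norm (q2b - q2b'))"
    and g_zero: "(\<lambda>t \<omega>. g \<omega> t 0 0 0 0 0 0) \<in> L2_proc M (wiener_filt M W1 W2) T"
    and zeta: "\<zeta> \<in> L2_var M (wiener_filt M W1 W2 T)"
  shows "\<exists>P Q1 Q2.
           bsde_filtering_solution M T W1 W2 g \<zeta> P Q1 Q2 \<and>
           (\<forall>P' Q1' Q2'. bsde_filtering_solution M T W1 W2 g \<zeta> P' Q1' Q2' \<longrightarrow>
              indistinguishable M T P P' \<and> ae_equal_proc M T Q1 Q1' \<and> ae_equal_proc M T Q2 Q2')"
proof -
  interpret prob_space M by (rule prob)
  interpret complete_measure M by (rule complete)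
  interpret wiener_pair M T W1 W2 by unfold_locales (rule T, rule wiener)
  obtain L :: real where L: "AE \<omega> in M. \<forall>t\<in>{0..T}.
          \<forall>p q1 q2 pb q1b q2b p' q1' q2' pb' q1b' q2b'.
            norm (g \<omega> t p q1 q2 pb q1b q2b - g \<omega> t p' q1' q2' pb' q1b' q2b')
            \<le> L * (norm (p - p') + norm (q1 - q1') + norm (q2 - q2')
                   + norm (pb - pb') + norm (q1b - q1b') + norm (q2b - q2b'))"
    using g_lipschitz by blast
  from AE_null_set[OF this] obtain N0 where N0: "N0 \<in> null_sets M"
    and lip: "\<forall>\<omega>\<in>space M. \<omega> \<notin> N0 \<longrightarrow> (\<forall>t\<in>{0..T}.
          \<forall>p q1 q2 pb q1b q2b p' q1' q2' pb' q1b' q2b'.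
            norm (g \<omega> t p q1 q2 pb q1b q2b - g \<omega> t p' q1' q2' pb' q1b' q2b')
            \<le> L * (norm (p - p') + norm (q1 - q1') + norm (q2 - q2')
                   + norm (pb - pb') + norm (q1b - q1b') + norm (q2b - q2b')))"
    by (rule bexE)
  \<comment> \<open>The assumed constant carries no sign; enlarging it to \<open>max L 0\<close>
    keeps the bound, whose other factor is nonnegative.\<close>
  interpret filtered_bsde M T W1 W2 g "max L 0" N0 \<zeta>
  proof
    show "0 \<le> max L 0" by simp
    show "N0 \<in> null_sets M" by (rule N0)
    show "progressive Fl T (\<lambda>t \<omega>. g \<omega> t p q1 q2 pb q1b q2b)" for p q1 q2 pb q1b q2b by (rule g_meas)
    show "(\<lambda>t \<omega>. g \<omega> t 0 0 0 0 0 0) \<in> L2_proc M Fl T" by (rule g_zero)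
    show "\<zeta> \<in> borel_measurable (Fl T)" using zeta by (simp add: L2_var_def)
    with measurable_Fl_M[OF this order_refl] zeta show "sq_int M \<zeta>" by (simp add: L2_var_def sq_int_def nn2_def)
    fix \<omega> t and p q1 q2 pb q1b q2b p' q1' q2' pb' q1b' q2b' :: "real^'n"
    assume w: "\<omega> \<in> space M" "\<omega> \<notin> N0" and t: "t \<in> {0..T}"
    have "norm (g \<omega> t p q1 q2 pb q1b q2b - g \<omega> t p' q1' q2' pb' q1b' q2b')
            \<le> L * (norm (p - p') + norm (q1 - q1') + norm (q2 - q2')
                   + norm (pb - pb') + norm (q1b - q1b') + norm (q2b - q2b'))"
      using bspec[OF mp[OF bspec[OF lip w(1)] w(2)] t] by blast
    also have "\<dots> \<le> max L 0 * (norm (p - p') + norm (q1 - q1') + norm (q2 - q2')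
                   + norm (pb - pb') + norm (q1b - q1b') + norm (q2b - q2b'))"
      by (rule mult_right_mono) simp_all
    finally show "norm (g \<omega> t p q1 q2 pb q1b q2b - g \<omega> t p' q1' q2' pb' q1b' q2b')
            \<le> max L 0 * (norm (p - p') + norm (q1 - q1') + norm (q2 - q2')
                   + norm (pb - pb') + norm (q1b - q1b') + norm (q2b - q2b'))" .
  qed
  show ?thesis using solution_exists solution_unique by blast
qed

end
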